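(* The $\mathfrak{gl}_{\ell+1}$-Whittaker function satisfies $$\widehat{\mathcal{Q}}^{\mathfrak{gl}_{\ell+1}}(z)\cdot\Psi^{\mathfrak{gl}_{\ell+1}}_{\underline{\gamma}_{\ell+1}}(\underline{x}_{\ell+1})=\exp\big(-e^{\,x_{\ell+1,\ell+1}-z}\big)\;\Psi^{\mathfrak{gl}_{\ell+1}}_{\underline{\gamma}_{\ell+1}}(\underline{x}_{\ell+1}),$$ where $\underline{x}_{\ell+1}=(x_{\ell+1,1},\ldots,x_{\ell+1,\ell+1})\in\mathbb{R}^{\ell+1}$, $z\in\mathbb{R}$, and the dual Baxter operator $\widehat{\mathcal{Q}}^{\mathfrak{gl}_{\ell+1}}(z)$ acts on $\Psi^{\mathfrak{gl}_{\ell+1}}_{\underline\gamma_{\ell+1}}(\underline{x}_{\ell+1})$ as a function of $\underline{\gamma}_{\ell+1}$.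
   Context: Here $\imath=\sqrt{-1}$ and $$\mu^{(n)}(\underline{\gamma})=\frac{1}{(2\pi)^n n!}\prod_{j\ne k}\frac{1}{\Gamma(\imath\gamma_k-\imath\gamma_j)},\qquad \underline\gamma=(\gamma_1,\ldots,\gamma_n).$$ Dual Baxter operator: $\widehat{\mathcal{Q}}^{\mathfrak{gl}_{\ell+1}}(z)$ acts on functions of $\underline\gamma=(\gamma_1,\ldots,\gamma_{\ell+1})$ by $$\widehat{\mathcal{Q}}^{\mathfrak{gl}_{\ell+1}}(z)\cdot F(\underline\gamma)=\int_{\mathcal{S}_{\ell+1}}\widehat{\mathcal{Q}}^{\mathfrak{gl}_{\ell+1}}(\underline\gamma,\underline\beta|z)\,F(\underline\beta)\,\mu^{(\ell+1)}(\underline\beta)\prod_{j=1}^{\ell+1}d\beta_j,$$ $$\widehat{\mathcal{Q}}^{\mathfrak{gl}_{\ell+1}}(\underline\gamma,\underline\beta|z)=e^{-\imath z\left(\sum_{i=1}^{\ell+1}\gamma_i-\sum_{j=1}^{\ell+1}\beta_j\right)}\prod_{i=1}^{\ell+1}\prod_{j=1}^{\ell+1}\Gamma(\imath\beta_j-\imath\gamma_i).$$ In $\mathcal{S}_{\ell+1}$ each $\beta_j$ runs over a line parallel to the real axis, with $\max_j\mathrm{Im}\,\beta_j<\min_i\mathrm{Im}\,\gamma_i$. Whittaker functions: they are given by the Mellin–Barnes recursion $\Psi^{\mathfrak{gl}_1}_{\gamma_{1,1}}(x_1)=e^{-\imath\gamma_{1,1}x_1}$, $$\Psi^{\mathfrak{gl}_{n+1}}_{\underline{\gamma}_{n+1}}(x_1,\ldots,x_{n+1})=\int_{\mathcal{S}_{n}}e^{-\imath\left(\sum_{j=1}^{n+1}\gamma_{n+1,j}-\sum_{k=1}^{n}\gamma_{n,k}\right)x_{n+1}}\prod_{k=1}^{n}\prod_{m=1}^{n+1}\Gamma(\imath\gamma_{n,k}-\imath\gamma_{n+1,m})\,\Psi^{\mathfrak{gl}_{n}}_{\underline{\gamma}_{n}}(x_1,\ldots,x_{n})\,\mu^{(n)}(\underline{\gamma}_{n})\prod_{j=1}^{n}d\gamma_{n,j}.$$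 In $\mathcal{S}_n$ each $\gamma_{n,j}$ runs over a line parallel to the real axis, with $\max_j\mathrm{Im}\,\gamma_{n,j}<\min_m\mathrm{Im}\,\gamma_{n+1,m}$; $\underline\gamma_n=(\gamma_{n,1},\ldots,\gamma_{n,n})$. *)

theory Defs
  imports "HOL-Analysis.Analysis"
begin

text \<open>
  Vectors of length \<open>n\<close> are functions on \<open>nat\<close> of which only the values at \<open>1, ..., n\<close> matter,
  because the rank varies inside the Mellin--Barnes recursion.

  An integral over \<open>n\<close> lines parallel to the real axis is parametrised by the real parts
  \<open>t \<in> \<real>\<^sup>n\<close>; the heights (imaginary parts) of the lines are kept as parameters \<open>c 1, ..., c n\<close>.
\<close>

definition on_lines :: "(nat \<Rightarrow> real) \<Rightarrow> (nat \<Rightarrow> real) \<Rightarrow> nat \<Rightarrow> complex" where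
  "on_lines c t = (\<lambda>j. Complex (t j) (c j))"

definition lines_integral :: "nat \<Rightarrow> (nat \<Rightarrow> real) \<Rightarrow> ((nat \<Rightarrow> complex) \<Rightarrow> complex) \<Rightarrow> complex" where
  "lines_integral n c f = (\<integral>t. f (on_lines c t) \<partial>(\<Pi>\<^sub>M j\<in>{1..n}. lborel))"

text \<open>
  A contour rule \<open>c\<close> assigns to the outer variables \<open>\<gamma>\<^sub>1, ..., \<gamma>\<^sub>m\<close> the heights of the \<open>n\<close> lines
  of integration. It is admissible if these lines always lie below all the \<open>\<gamma>\<^sub>i\<close>.
\<close>

definition admissible :: "nat \<Rightarrow> nat \<Rightarrow> ((nat \<Rightarrow> complex) \<Rightarrow> nat \<Rightarrow> real) \<Rightarrow> bool" where
  "admissible n m c \<longleftrightarrow> (\<forall>\<gamma>. \<forall>j\<in>{1..n}. \<forall>i\<in>{1..m}. c \<gamma> j < Im (\<gamma> i))"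

text \<open>At a pole \<open>Gamma\<close> is \<open>0\<close> and \<open>1 / 0 = 0\<close>, so \<open>1 / Gamma\<close> is the entire function \<open>1 / \<Gamma>\<close>.\<close>

definition mu :: "nat \<Rightarrow> (nat \<Rightarrow> complex) \<Rightarrow> complex" where
  "mu n \<gamma> = 1 / ((2 * of_real pi) ^ n * fact n) *
     (\<Prod>j\<in>{1..n}. \<Prod>k\<in>{1..n} - {j}. 1 / Gamma (\<i> * \<gamma> k - \<i> * \<gamma> j))"

text \<open>
  \<open>whittaker h l \<gamma> x\<close> is the Whittaker function of rank \<open>l + 1\<close>; the contour rule \<open>h n\<close> is used
  for the integral over \<open>\<gamma>\<^sub>n = (\<gamma>\<^sub>n\<^sub>,\<^sub>1, ..., \<gamma>\<^sub>n\<^sub>,\<^sub>n)\<close>, with outer variables \<open>\<gamma>\<^sub>n\<^sub>+\<^sub>1\<close>.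
\<close>

primrec whittaker ::
  "(nat \<Rightarrow> (nat \<Rightarrow> complex) \<Rightarrow> nat \<Rightarrow> real) \<Rightarrow> nat \<Rightarrow> (nat \<Rightarrow> complex) \<Rightarrow> (nat \<Rightarrow> real) \<Rightarrow> complex"
where
  "whittaker h 0 = (\<lambda>\<gamma> x. exp (- \<i> * \<gamma> 1 * of_real (x 1)))"
| "whittaker h (Suc l) = (\<lambda>\<gamma> x. let n = Suc l in
     lines_integral n (h n \<gamma>) (\<lambda>\<delta>.
       exp (- \<i> * ((\<Sum>j\<in>{1..n+1}. \<gamma> j) - (\<Sum>k\<in>{1..n}. \<delta> k)) * of_real (x (n+1))) *
       (\<Prod>k\<in>{1..n}. \<Prod>m\<in>{1..n+1}. Gamma (\<i> * \<delta> k - \<i> * \<gamma> m)) *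
       whittaker h l \<delta> x * mu n \<delta>))"

definition dual_baxter_kernel ::
  "nat \<Rightarrow> real \<Rightarrow> (nat \<Rightarrow> complex) \<Rightarrow> (nat \<Rightarrow> complex) \<Rightarrow> complex" where
  "dual_baxter_kernel l z \<gamma> \<beta> =
     exp (- \<i> * of_real z * ((\<Sum>i\<in>{1..l+1}. \<gamma> i) - (\<Sum>j\<in>{1..l+1}. \<beta> j))) *
     (\<Prod>i\<in>{1..l+1}. \<Prod>j\<in>{1..l+1}. Gamma (\<i> * \<beta> j - \<i> * \<gamma> i))"

definition dual_baxter ::
  "((nat \<Rightarrow> complex) \<Rightarrow> nat \<Rightarrow> real) \<Rightarrow> nat \<Rightarrow> real \<Rightarrow>
   ((nat \<Rightarrow> complex) \<Rightarrow> complex) \<Rightarrow> (nat \<Rightarrow> complex) \<Rightarrow> complex" where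
  "dual_baxter c l z F = (\<lambda>\<gamma>. lines_integral (l+1) (c \<gamma>)
     (\<lambda>\<beta>. dual_baxter_kernel l z \<gamma> \<beta> * F \<beta> * mu (l+1) \<beta>))"

end

theory Submission
  imports Defs "HOL-Complex_Analysis.Complex_Analysis"
begin

text \<open>
  The Whittaker function of rank \<open>l + 1\<close> is an integral of the recursion kernel \<open>\<Lambda>(\<beta>, \<delta>)\<close> against the
  Whittaker function of rank \<open>l\<close> in \<open>\<delta>\<close>. Hence the dual Baxter operator acts on it through the
  composed kernel \<open>\<integral> Q(\<gamma>, \<beta>) \<mu>(\<beta>) \<Lambda>(\<beta>, \<delta>) d\<beta>\<close>, and the theorem is the statement that this composition is
  \<open>exp (- exp (x\<^sub>l\<^sub>+\<^sub>1 - z)) \<Lambda>(\<gamma>, \<delta>)\<close>. Up to factors that do not depend on \<open>\<beta>\<close>, the composed integral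
  is the function of \<open>y = z - x\<^sub>l\<^sub>+\<^sub>1\<close>

  \<open>I(y) = \<integral> (\<Prod>\<^sub>j\<^sub>\<noteq>\<^sub>k 1 / \<Gamma>(s\<^sub>k - s\<^sub>j)) \<Prod>\<^sub>j (\<Prod>\<^sub>i \<Gamma>(s\<^sub>j - \<i> \<gamma>\<^sub>i) \<Prod>\<^sub>k \<Gamma>(\<i> \<delta>\<^sub>k - s\<^sub>j)) exp (y (\<Sum>\<^sub>j s\<^sub>j - \<Sum>\<^sub>i \<i> \<gamma>\<^sub>i)) d\<beta>\<close>

  with \<open>s\<^sub>j = \<i> \<beta>\<^sub>j\<close>, a confluent form of Gustafson's multiple Barnes integral; for \<open>l = 0\<close> it is the
  Cahen--Mellin integral of \<open>exp (- exp (- y))\<close>.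

  The integral is evaluated in two steps. The shifts \<open>s\<^sub>j \<mapsto> s\<^sub>j + 1\<close> do not change the integral of
  a suitable multiple of the integrand; summing the resulting relations over \<open>j\<close> with the
  help of two of Lagrange's identities gives \<open>I'(y) = exp (- y) I(y)\<close>, so that
  \<open>I(y) = K exp (- exp (- y))\<close> (\<open>telescoping_sum\<close>, \<open>kern_integral_constant\<close>). The
  constant \<open>K\<close> is the limit of \<open>I(y)\<close> as \<open>y \<rightarrow> \<infinity>\<close>, where the contours can be moved upwards and only
  the residues at \<open>\<beta>\<^sub>j = \<gamma>\<^sub>i\<close> survive. To reduce this to integrals in one variable, \<open>\<Prod> 1 / \<Gamma>(s\<^sub>k - s\<^sub>j)\<close> is
  written as a Vandermonde product in the \<open>s\<^sub>j\<close> times one in \<open>sin \<pi>(s\<^sub>j - s\<^sub>k)\<close>, and both are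
  interpolated at the points \<open>\<i> \<gamma>\<^sub>i\<close>, one variable at a time. The interpolation functions
  have the effect that only permutations contribute, each with the same value
  (\<open>kern_integral_limit\<close>). This needs distinct \<open>Re \<gamma>\<^sub>i\<close>; the other parameters are limits of
  such ones (\<open>kern_integral\<close>).

  The remaining point is to exchange the integrations over \<open>\<beta>\<close> and \<open>\<delta>\<close>. Absolute convergence is delicate,
  because the measure grows like \<open>exp (\<pi>/2 \<Sum>\<^sub>j\<^sub>,\<^sub>k \<bar>Re \<beta>\<^sub>j - Re \<beta>\<^sub>k\<bar>)\<close>. The sharp decay of the Gamma
  function in vertical strips together with the interlacing inequality \<open>re_spread_interlace\<close> yields by induction
  the bound \<open>exp (- \<pi>/4 \<Sum>\<^sub>j\<^sub>,\<^sub>k \<bar>Re \<beta>\<^sub>j - Re \<beta>\<^sub>k\<bar> + \<epsilon> \<Sum>\<^sub>j \<bar>Re \<beta>\<^sub>j\<bar>)\<close> for the Whittaker function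
  (\<open>level_whittaker_bound\<close>), and with it all integrals converge absolutely.

  Finally the heights of the contours in the recursion may depend on the outer variables in an
  arbitrary, even non-measurable, way. For this reason the Whittaker function is compared with one
  whose contours have a fixed height on every level
  (\<open>whittaker_eq_level_whittaker\<close>); the exchange and the bounds are proved for the latter.
\<close>

section \<open>The Gamma function in vertical strips\<close>

text \<open>
  Polynomial factors are absorbed into an arbitrarily small exponential throughout; this keeps
  all bounds in the form of pure exponentials.
\<close>
lemma one_plus_power_le_exp:
  fixes e :: real and M :: nat
  assumes "e > 0"
  obtains C where "C > 0" "\<And>t. t \<ge> 0 \<Longrightarrow> (1 + t) ^ M \<le> C * exp (e * t)"
proof -
  define d where "d = e / (M + 1)"
  have d: "d > 0" using assms by (simp add: d_def)
  have "(1 + t) ^ M \<le> (1 + 1/d) ^ M * exp (e * t)" if t: "t \<ge> 0" for t :: real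
  proof -
    have "1 + t \<le> (1 + 1/d) * (1 + d * t)"
      using d t by (simp add: field_simps)
    also have "\<dots> \<le> (1 + 1/d) * exp (d * t)"
      using d by (intro mult_left_mono exp_ge_add_one_self) (auto simp: add_nonneg_nonneg)
    finally have "(1 + t) ^ M \<le> ((1 + 1/d) * exp (d * t)) ^ M"
      using t by (intro power_mono) auto
    also have "\<dots> = (1 + 1/d) ^ M * exp (M * (d * t))"
      by (simp add: power_mult_distrib exp_of_nat_mult)
    also have "\<dots> \<le> (1 + 1/d) ^ M * exp (e * t)"
      using d t assms by (intro mult_left_mono) (auto simp: d_def field_simps)
    finally show ?thesis .
  qed
  moreover have "(1 + 1/d) ^ M > 0" using d by (simp add: add_pos_pos)
  ultimately show ?thesis using that by blast
qed

lemma norm_Gamma_series: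
  assumes "a > 0"
  shows "norm (Gamma_series (Complex a t) n) =
    Gamma_series a n * (\<Prod>k\<in>{0..n}. (a + real k) / sqrt ((a + real k)\<^sup>2 + t\<^sup>2))"
proof -
  have eq: "norm (pochhammer (Complex a t) (n+1)) = (\<Prod>k\<in>{0..n}. sqrt ((a + k)\<^sup>2 + t\<^sup>2))"
  proof -
    have "Complex a t + of_nat k = Complex (a + k) t" for k
      by (simp add: complex_eq_iff)
    then show ?thesis
      by (simp add: pochhammer_prod prod_norm atLeast0AtMost atLeast0LessThan lessThan_Suc_atMost
          complex_norm flip: prod_norm)
  qed
  have "norm (Gamma_series (Complex a t) n) =
      fact n * exp (a * ln n) / (\<Prod>k\<in>{0..n}. sqrt ((a + k)\<^sup>2 + t\<^sup>2))"
    unfolding Gamma_series_def norm_divide norm_mult eq by (simp add: norm_fact)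
  also have "\<dots> = Gamma_series a n * (\<Prod>k\<in>{0..n}. (a + real k) / sqrt ((a + real k)\<^sup>2 + t\<^sup>2))"
  proof -
    have "pochhammer a (n+1) = (\<Prod>k\<in>{0..n}. a + k)"
      by (simp add: pochhammer_prod atLeast0AtMost atLeast0LessThan lessThan_Suc_atMost)
    moreover have "(\<Prod>k\<in>{0..n}. a + real k) \<noteq> 0" using assms by (simp add: add_pos_nonneg less_imp_neq[symmetric])
    ultimately show ?thesis
      by (simp add: Gamma_series_def prod_dividef)
  qed
  finally show ?thesis .
qed

text \<open>
  Each factor \<open>(a + k) / \<bar>a + k + \<i> t\<bar>\<close> of Euler's product for \<open>\<bar>\<Gamma>(a + \<i> t)\<bar> / \<Gamma>(a)\<close> increases with \<open>a\<close>. This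
  monotonicity replaces Stirling's formula: it transfers the exact decay on one line to all lines to the left of it.
\<close>
lemma norm_Gamma_mono:
  assumes "0 < a" "a \<le> b"
  shows "norm (Gamma (Complex a t)) * Gamma b \<le> norm (Gamma (Complex b t)) * Gamma a"
proof (rule LIMSEQ_le)
  show "(\<lambda>n. norm (Gamma_series (Complex a t) n) * Gamma_series b n) \<longlonglongrightarrow> norm (Gamma (Complex a t)) * Gamma b"
    and "(\<lambda>n. norm (Gamma_series (Complex b t) n) * Gamma_series a n) \<longlonglongrightarrow> norm (Gamma (Complex b t)) * Gamma a"
    by (intro tendsto_intros)+
  have le: "(a + real k) / sqrt ((a + k)\<^sup>2 + t\<^sup>2) \<le> (b + real k) / sqrt ((b + k)\<^sup>2 + t\<^sup>2)" for k
  proof -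
    have "(a + k) * sqrt ((b + k)\<^sup>2 + t\<^sup>2) = sqrt ((a + k)\<^sup>2 * ((b + k)\<^sup>2 + t\<^sup>2))"
      using assms by (simp add: real_sqrt_mult)
    also have "\<dots> \<le> sqrt ((b + k)\<^sup>2 * ((a + k)\<^sup>2 + t\<^sup>2))"
    proof (rule real_sqrt_le_mono)
      have "t\<^sup>2 * (a + real k)\<^sup>2 \<le> t\<^sup>2 * (b + real k)\<^sup>2"
        using assms by (intro mult_left_mono power_mono) auto
      then show "(a + real k)\<^sup>2 * ((b + k)\<^sup>2 + t\<^sup>2) \<le> (b + real k)\<^sup>2 * ((a + k)\<^sup>2 + t\<^sup>2)"
        by (simp add: algebra_simps)
    qed
    also have "\<dots> = (b + k) * sqrt ((a + k)\<^sup>2 + t\<^sup>2)"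
      using assms by (simp add: real_sqrt_mult)
    finally have "(a + k) * sqrt ((b + k)\<^sup>2 + t\<^sup>2) \<le> (b + k) * sqrt ((a + k)\<^sup>2 + t\<^sup>2)" .
    moreover have "sqrt ((a + k)\<^sup>2 + t\<^sup>2) > 0" "sqrt ((b + k)\<^sup>2 + t\<^sup>2) > 0"
      using assms by (auto simp: sum_power2_gt_zero_iff)
    ultimately show ?thesis by (simp only: divide_le_eq le_divide_eq times_divide_eq_left if_True split: if_splits)
  qed
  have nonneg: "Gamma_series a n \<ge> 0" "Gamma_series b n \<ge> 0" for n
    using assms by (auto simp: Gamma_series_def intro!: divide_nonneg_nonneg pochhammer_nonneg)
  have "norm (Gamma_series (Complex a t) n) * Gamma_series b n
      \<le> norm (Gamma_series (Complex b t) n) * Gamma_series a n" for n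
  proof -
    have "(\<Prod>k\<in>{0..n}. (a + real k) / sqrt ((a + k)\<^sup>2 + t\<^sup>2)) \<le> (\<Prod>k\<in>{0..n}. (b + real k) / sqrt ((b + k)\<^sup>2 + t\<^sup>2))"
      using assms le by (intro prod_mono conjI divide_nonneg_nonneg) auto
    then have "(Gamma_series a n * Gamma_series b n) * (\<Prod>k\<in>{0..n}. (a + real k) / sqrt ((a + k)\<^sup>2 + t\<^sup>2))
      \<le> (Gamma_series a n * Gamma_series b n) * (\<Prod>k\<in>{0..n}. (b + real k) / sqrt ((b + k)\<^sup>2 + t\<^sup>2))"
      using nonneg by (intro mult_left_mono mult_nonneg_nonneg)
    then show ?thesis using assms by (simp add: norm_Gamma_series mult_ac)
  qed
  then show "\<exists>N. \<forall>n\<ge>N. norm (Gamma_series (Complex a t) n) * Gamma_series b n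
      \<le> norm (Gamma_series (Complex b t) n) * Gamma_series a n" by blast
qed

lemma norm_Gamma_uminus_Im:
  assumes "a > 0"
  shows "norm (Gamma (Complex a (-t))) = norm (Gamma (Complex a t))"
proof (rule LIMSEQ_unique)
  show "(\<lambda>n. norm (Gamma_series (Complex a (-t)) n)) \<longlonglongrightarrow> norm (Gamma (Complex a (-t)))"
    by (intro tendsto_intros)
  have "(\<lambda>n. norm (Gamma_series (Complex a t) n)) \<longlonglongrightarrow> norm (Gamma (Complex a t))"
    by (intro tendsto_intros)
  then show "(\<lambda>n. norm (Gamma_series (Complex a (-t)) n)) \<longlonglongrightarrow> norm (Gamma (Complex a t))"
    using assms by (simp add: norm_Gamma_series)
qed

text \<open>By the reflection formula \<open>\<bar>\<Gamma>(1 + \<i> t)\<bar>\<^sup>2 = \<pi> t / sinh (\<pi> t)\<close>.\<close>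
lemma norm_Gamma_line_1:
  "(norm (Gamma (Complex 1 t)))\<^sup>2 \<le> (1 + 2 * pi * \<bar>t\<bar>) * exp (- pi * \<bar>t\<bar>)"
proof (cases "t = 0")
  case True
  then have "Complex 1 t = 1" by (simp add: complex_eq_iff)
  then show ?thesis using True by simp
next
  case False
  define u where "u = pi * \<bar>t\<bar>"
  have u: "u > 0" using False by (simp add: u_def)
  have eq: "Complex 1 t = \<i> * t + 1" "Complex 1 (-t) = 1 - \<i> * t" by (auto simp: complex_eq_iff)
  have nz: "\<i> * complex_of_real t \<notin> \<int>\<^sub>\<le>\<^sub>0"
    using False by (auto elim!: nonpos_Ints_cases simp: complex_eq_iff)
  have "Gamma (Complex 1 t) * Gamma (Complex 1 (-t)) = \<i> * t * (Gamma (\<i> * t) * Gamma (1 - \<i> * t))"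
    unfolding eq Gamma_plus1[OF nz] by simp
  also have "\<dots> = \<i> * t * (of_real pi / sin (\<i> * of_real (pi * t)))"
    by (subst Gamma_reflection_complex) (simp add: mult_ac)
  finally have "norm (Gamma (Complex 1 t)) * norm (Gamma (Complex 1 (-t))) =
      \<bar>t\<bar> * (pi / norm (sin (\<i> * complex_of_real (pi * t))))"
    unfolding norm_mult[symmetric] by (simp add: norm_mult norm_divide)
  also have "norm (sin (\<i> * complex_of_real (pi * t))) = (exp u - exp (-u)) / 2"
  proof -
    have "norm (sin (\<i> * complex_of_real (pi * t))) = norm (complex_of_real ((exp (pi * t) - exp (- (pi * t))) / 2))"
      by (simp add: sin_i_times norm_mult exp_of_real exp_minus norm_divide del: of_real_mult)
    also have "\<dots> = (exp u - exp (-u)) / 2"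
      unfolding norm_of_real u_def by (cases "t \<ge> 0") (auto simp: abs_if mult_less_0_iff zero_less_mult_iff not_le field_simps)
    finally show ?thesis .
  qed
  finally have "(norm (Gamma (Complex 1 t)))\<^sup>2 = 2 * u / (exp u - exp (-u))"
    by (simp add: norm_Gamma_uminus_Im power2_eq_square u_def)
  also have "\<dots> \<le> (1 + 2 * u) * exp (-u)"
  proof -
    have "1 + 2 * u \<le> exp (2 * u)" by (rule exp_ge_add_one_self)
    then have "2 * u \<le> (1 + 2 * u) * (1 - exp (- (2 * u)))"
      using u by (simp add: field_simps exp_minus)
    also have "\<dots> = (1 + 2 * u) * exp (-u) * (exp u - exp (-u))"
      by (simp add: algebra_simps flip: exp_add)
    finally show ?thesis using u by (simp add: divide_le_eq)
  qed
  finally show ?thesis by (simp add: u_def mult_ac)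
qed

text \<open>
  The functional equation carries the decay from the line \<open>Re s = 1\<close> to lines \<open>Re s = M\<close> with \<open>M\<close> a natural
  number, and monotonicity from \<open>Re s = M\<close> to the strip. The loss \<open>e\<close> absorbs the powers of \<open>\<bar>Im s\<bar>\<close>.
\<close>
lemma Gamma_strip_bound:
  assumes r: "0 < r" and e: "e > 0"
  obtains C where "C > 0"
    "\<And>s. r \<le> Re s \<Longrightarrow> Re s \<le> R \<Longrightarrow> norm (Gamma s) \<le> C * exp (- (pi/2 - e) * \<bar>Im s\<bar>)"
proof -
  \<comment> \<open>an integer line to the right of the strip\<close>
  define M where "M = nat \<lceil>max 1 R\<rceil>"
  have M: "real M \<ge> R" "M \<ge> 1" unfolding M_def by linarith+
  have cont: "continuous_on {r..max r R} (Gamma :: real \<Rightarrow> real)"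
    using r by (intro continuous_on_Gamma) (auto elim!: nonpos_Ints_cases)
  obtain B where B: "\<And>a. a \<in> {r..max r R} \<Longrightarrow> norm (Gamma a :: real) \<le> B"
    using compact_imp_bounded[OF compact_continuous_image[OF cont compact_Icc]]
    unfolding bounded_iff ball_simps by blast
  obtain C1 where C1: "C1 > 0" "\<And>t. t \<ge> 0 \<Longrightarrow> (1 + t) ^ M \<le> C1 * exp ((e/2) * t)"
    using one_plus_power_le_exp[of "e/2" M] e by auto
  obtain C2 where C2: "C2 > 0" "\<And>t. t \<ge> 0 \<Longrightarrow> (1 + t) ^ 1 \<le> C2 * exp ((e/(2*pi)) * t)"
    using one_plus_power_le_exp[of "e/(2*pi)" 1] e by auto
  have line1: "norm (Gamma (Complex 1 t)) \<le> (1 + C2) * exp (- (pi/2 - e/2) * \<bar>t\<bar>)" for t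
  proof (rule power2_le_imp_le)
    have "(norm (Gamma (Complex 1 t)))\<^sup>2 \<le> (1 + 2 * pi * \<bar>t\<bar>) * exp (- pi * \<bar>t\<bar>)"
      by (rule norm_Gamma_line_1)
    also have "\<dots> \<le> (C2 * exp (e * \<bar>t\<bar>)) * exp (- pi * \<bar>t\<bar>)"
      using C2(2)[of "2 * pi * \<bar>t\<bar>"] by (intro mult_right_mono) auto
    also have "\<dots> = C2 * exp (2 * (- (pi/2 - e/2) * \<bar>t\<bar>))"
      by (simp add: algebra_simps flip: exp_add)
    also have "\<dots> \<le> (1 + C2)\<^sup>2 * exp (2 * (- (pi/2 - e/2) * \<bar>t\<bar>))"
      using C2 by (intro mult_right_mono) (auto simp: power2_eq_square algebra_simps add_nonneg_nonneg)
    also have "\<dots> = ((1 + C2) * exp (- (pi/2 - e/2) * \<bar>t\<bar>))\<^sup>2"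
      by (simp add: power_mult_distrib exp_double)
    finally show "(norm (Gamma (Complex 1 t)))\<^sup>2 \<le> ((1 + C2) * exp (- (pi/2 - e/2) * \<bar>t\<bar>))\<^sup>2" .
  qed (use C2 in auto)
  have lineM: "norm (Gamma (Complex (Suc m) t)) \<le> real (fact m) * (1 + \<bar>t\<bar>) ^ m * norm (Gamma (Complex 1 t))" for m t
  proof (induction m)
    case (Suc m)
    have "Complex (Suc (Suc m)) t = Complex (Suc m) t + 1" by (simp add: complex_eq_iff)
    moreover have "Complex (Suc m) t \<notin> \<int>\<^sub>\<le>\<^sub>0" by (auto elim!: nonpos_Ints_cases simp: complex_eq_iff)
    ultimately have "norm (Gamma (Complex (Suc (Suc m)) t)) = norm (Complex (Suc m) t) * norm (Gamma (Complex (Suc m) t))"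
      by (simp add: Gamma_plus1 norm_mult)
    also have "\<dots> \<le> (Suc m * (1 + \<bar>t\<bar>)) * (real (fact m) * (1 + \<bar>t\<bar>) ^ m * norm (Gamma (Complex 1 t)))"
    proof (rule mult_mono[OF _ Suc])
      have "norm (Complex (Suc m) t) \<le> \<bar>real (Suc m)\<bar> + \<bar>t\<bar>"
        using cmod_le[of "Complex (Suc m) t"] by simp
      also have "\<dots> \<le> Suc m * (1 + \<bar>t\<bar>)" by (simp add: algebra_simps)
      finally show "norm (Complex (Suc m) t) \<le> Suc m * (1 + \<bar>t\<bar>)" .
    qed auto
    finally show ?case by (simp add: algebra_simps)
  qed auto
  define C where "C = (B + 1) / Gamma (real M) * (fact (M-1) * C1 * (1 + C2))"
  have "C > 0" unfolding C_def using C1 C2 M B[of r]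
    by (intro mult_pos_pos divide_pos_pos Gamma_real_pos) (auto simp: less_le_trans[of 0 1] add_pos_pos intro: add_nonneg_pos order_trans[OF abs_ge_zero])
  moreover have "norm (Gamma s) \<le> C * exp (- (pi/2 - e) * \<bar>Im s\<bar>)" if s: "r \<le> Re s" "Re s \<le> R" for s
  proof -
    define t where "t = Im s"
    have GM: "Gamma (real M) > 0" using M by (intro Gamma_real_pos) auto
    have "norm (Gamma (Complex (Re s) t)) * Gamma (real M) \<le> norm (Gamma (Complex M t)) * Gamma (Re s)"
      using s r M by (intro norm_Gamma_mono) auto
    then have "norm (Gamma s) \<le> Gamma (Re s) / Gamma (real M) * norm (Gamma (Complex M t))"
      using GM by (simp add: t_def field_simps)
    also have "\<dots> \<le> (B + 1) / Gamma (real M) * (fact (M-1) * (1 + \<bar>t\<bar>) ^ (M-1) * norm (Gamma (Complex 1 t)))"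
      using B[of "Re s"] s GM lineM[of "M-1" t] M
      by (intro mult_mono divide_right_mono) (auto simp: of_nat_diff intro: order_trans[OF abs_ge_zero])
    also have "\<dots> \<le> (B + 1) / Gamma (real M) * (fact (M-1) * (C1 * exp ((e/2) * \<bar>t\<bar>)) * ((1 + C2) * exp (- (pi/2 - e/2) * \<bar>t\<bar>)))"
    proof (intro mult_left_mono mult_mono line1)
      have "(1 + \<bar>t\<bar>) ^ (M-1) \<le> (1 + \<bar>t\<bar>) ^ M" by (intro power_increasing) auto
      then show "(1 + \<bar>t\<bar>) ^ (M-1) \<le> C1 * exp ((e/2) * \<bar>t\<bar>)" using C1(2)[of "\<bar>t\<bar>"] by simp
      show "0 \<le> (B + 1) / Gamma (real M)" using B[of r] GM by (intro divide_nonneg_pos) (auto intro: order_trans[OF abs_ge_zero])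
    qed (use C1 C2 in auto)
    also have "\<dots> = C * (exp ((e/2) * \<bar>t\<bar>) * exp (- (pi/2 - e/2) * \<bar>t\<bar>))"
      by (simp add: C_def mult_ac)
    also have "exp ((e/2) * \<bar>t\<bar>) * exp (- (pi/2 - e/2) * \<bar>t\<bar>) = exp (- (pi/2 - e) * \<bar>t\<bar>)"
      by (simp add: field_simps flip: exp_add)
    finally show ?thesis by (simp add: t_def)
  qed
  ultimately show ?thesis using that by blast
qed

text \<open>
  Away from the real axis the strip may reach to the left of the poles: \<open>\<Gamma>(s) = \<Gamma>(s + m) / (s)\<^sub>m\<close>, and every
  factor of the Pochhammer symbol \<open>(s)\<^sub>m\<close> has modulus at least \<open>\<bar>Im s\<bar> \<ge> 1\<close>.
\<close>
lemma Gamma_strip_bound_far: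
  assumes e: "e > 0"
  obtains C where "C > 0"
    "\<And>s. r \<le> Re s \<Longrightarrow> Re s \<le> R \<Longrightarrow> 1 \<le> \<bar>Im s\<bar> \<Longrightarrow>
       norm (Gamma s) \<le> C * exp (- (pi/2 - e) * \<bar>Im s\<bar>)"
proof -
  \<comment> \<open>\<open>m\<close> steps move the strip to the right of \<open>Re s = 1\<close>\<close>
  define m where "m = nat \<lceil>1 + \<bar>r\<bar>\<rceil>"
  have m: "real m \<ge> 1 + \<bar>r\<bar>" unfolding m_def by linarith
  obtain C where C: "C > 0" "\<And>s. 1 \<le> Re s \<Longrightarrow> Re s \<le> R + m \<Longrightarrow>
      norm (Gamma s) \<le> C * exp (- (pi/2 - e) * \<bar>Im s\<bar>)"
    using Gamma_strip_bound[of 1 e "R + m"] e by auto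
  have "norm (Gamma s) \<le> C * exp (- (pi/2 - e) * \<bar>Im s\<bar>)"
    if s: "r \<le> Re s" "Re s \<le> R" "1 \<le> \<bar>Im s\<bar>" for s
  proof -
    have nz: "s \<notin> \<int>\<^sub>\<le>\<^sub>0" using s by (auto elim!: nonpos_Ints_cases)
    then have poch: "pochhammer s m = Gamma (s + of_nat m) / Gamma s" by (rule pochhammer_Gamma)
    have "norm (s + of_nat k) \<ge> 1" for k
      using abs_Im_le_cmod[of "s + of_nat k"] s by simp
    then have "norm (pochhammer s m) \<ge> 1"
      unfolding pochhammer_prod prod_norm[symmetric] by (intro prod_ge_1) auto
    then have "norm (Gamma s) \<le> norm (pochhammer s m) * norm (Gamma s)"
      by (simp add: mult_le_cancel_right1)
    also have "\<dots> = norm (Gamma (s + of_nat m))"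
      using nz by (simp add: poch norm_divide Gamma_eq_zero_iff)
    also have "\<dots> \<le> C * exp (- (pi/2 - e) * \<bar>Im s\<bar>)"
      using C(2)[of "s + of_nat m"] s m by auto
    finally show ?thesis .
  qed
  with C(1) show ?thesis using that by blast
qed

lemma norm_sin_pi_le: "norm (sin (of_real pi * w :: complex)) \<le> exp (pi * \<bar>Im w\<bar>)"
  using cmod_sin_le_exp[of 1 "of_real pi * w"] by (simp add: abs_mult)

lemma rGamma_mult_uminus: "rGamma w * rGamma (- w) = - w * sin (of_real pi * w) / of_real pi" for w :: complex
proof -
  have "rGamma (- w) = - w * rGamma (1 - w)"
    using rGamma_plus1[of "- w"] by (simp add: algebra_simps)
  then have "rGamma w * rGamma (- w) = - w * (rGamma w * rGamma (1 - w))" by simp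
  then show ?thesis by (simp add: rGamma_reflection_complex)
qed

text \<open>
  The factors \<open>1 / \<Gamma>\<close> of the measure come in pairs with opposite arguments, and the product over such a pair is
  elementary. This gives upper bounds for \<open>1 / \<Gamma>\<close> without a lower bound for \<open>\<Gamma>\<close>.
\<close>
lemma rGamma_pair_bound:
  assumes e: "e > 0" and R: "R \<ge> 0"
  obtains C where "C > 0"
    "\<And>w. \<bar>Re w\<bar> \<le> R \<Longrightarrow> norm (rGamma w * rGamma (- w) :: complex) \<le> C * exp ((pi + e) * \<bar>Im w\<bar>)"
proof -
  obtain C where C: "C > 0" "\<And>t. t \<ge> 0 \<Longrightarrow> (1 + t) ^ 1 \<le> C * exp (e * t)"
    using one_plus_power_le_exp[OF e, of 1] by auto
  have "norm (rGamma w * rGamma (- w)) \<le> (1 + R) * C * exp ((pi + e) * \<bar>Im w\<bar>)" if w: "\<bar>Re w\<bar> \<le> R" for w :: complex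
  proof -
    have "norm w \<le> \<bar>Re w\<bar> + \<bar>Im w\<bar>" by (rule cmod_le)
    also have "\<dots> \<le> R + \<bar>Im w\<bar>" using w by simp
    also have "\<dots> \<le> (1 + R) * (1 + \<bar>Im w\<bar>)" using R by (simp add: algebra_simps)
    also have "\<dots> \<le> (1 + R) * (C * exp (e * \<bar>Im w\<bar>))" using C(2)[of "\<bar>Im w\<bar>"] R by (intro mult_left_mono) auto
    finally have nw: "norm w \<le> (1 + R) * (C * exp (e * \<bar>Im w\<bar>))" .
    have "norm (rGamma w * rGamma (- w)) = norm w * norm (sin (of_real pi * w)) / pi"
      by (simp add: rGamma_mult_uminus norm_mult norm_divide)
    also have "\<dots> \<le> norm w * norm (sin (of_real pi * w)) / 1"
      using pi_ge_two by (intro divide_left_mono) auto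
    also have "\<dots> \<le> ((1 + R) * (C * exp (e * \<bar>Im w\<bar>))) * exp (pi * \<bar>Im w\<bar>)"
      unfolding div_by_1 using nw norm_sin_pi_le by (intro mult_mono) (use R C in auto)
    also have "\<dots> = (1 + R) * C * exp ((pi + e) * \<bar>Im w\<bar>)"
      by (simp add: algebra_simps flip: exp_add)
    finally show ?thesis .
  qed
  moreover have "(1 + R) * C > 0" using R C by simp
  ultimately show ?thesis using that by blast
qed

section \<open>Growth of the measure and the interlacing inequality\<close>

text \<open>
  The three quantities in which all bounds are expressed. Only real parts enter, because the imaginary parts
  stay in a bounded strip.
\<close>
definition re_size :: "nat \<Rightarrow> (nat \<Rightarrow> complex) \<Rightarrow> real" where
  "re_size n \<beta> = (\<Sum>j\<in>{1..n}. \<bar>Re (\<beta> j)\<bar>)"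

definition re_spread :: "nat \<Rightarrow> (nat \<Rightarrow> complex) \<Rightarrow> real" where
  "re_spread n \<beta> = (\<Sum>j\<in>{1..n}. \<Sum>k\<in>{1..n}. \<bar>Re (\<beta> j) - Re (\<beta> k)\<bar>)"

definition re_cross :: "nat \<Rightarrow> nat \<Rightarrow> (nat \<Rightarrow> complex) \<Rightarrow> (nat \<Rightarrow> complex) \<Rightarrow> real" where
  "re_cross n m \<beta> \<delta> = (\<Sum>j\<in>{1..n}. \<Sum>k\<in>{1..m}. \<bar>Re (\<beta> j) - Re (\<delta> k)\<bar>)"

text \<open>The measure without its normalisation, written with the entire function \<open>1 / \<Gamma>\<close>.\<close>
definition rGamma_prod :: "nat \<Rightarrow> (nat \<Rightarrow> complex) \<Rightarrow> complex" where
  "rGamma_prod n \<beta> = (\<Prod>j\<in>{1..n}. \<Prod>k\<in>{1..n} - {j}. rGamma (\<i> * \<beta> k - \<i> * \<beta> j))"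

lemma mu_eq: "mu n \<beta> = 1 / ((2 * of_real pi) ^ n * fact n) * rGamma_prod n \<beta>"
  by (simp add: mu_def rGamma_prod_def rGamma_inverse_Gamma inverse_eq_divide)

lemma prod_offdiag_swap:
  "(\<Prod>j\<in>A. \<Prod>k\<in>A - {j}. f j k) = (\<Prod>j\<in>A. \<Prod>k\<in>A - {j}. (f k j :: 'a :: comm_monoid_mult))" if "finite A"
proof -
  have *: "(\<Prod>j\<in>A. \<Prod>k\<in>A - {j}. g j k) = (\<Prod>j\<in>A. \<Prod>k\<in>A. if k = j then 1 else g j k)" for g :: "'b \<Rightarrow> 'b \<Rightarrow> 'a"
    using that by (intro prod.cong refl prod.mono_neutral_cong_left) auto
  show ?thesis unfolding * by (subst prod.swap) (auto intro!: prod.cong)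
qed

lemma re_spread_le: "re_spread n \<beta> \<le> 2 * (real n - 1) * re_size n \<beta>" if "n \<ge> 1"
proof -
  have "re_spread n \<beta> = (\<Sum>j\<in>{1..n}. \<Sum>k\<in>{1..n} - {j}. \<bar>Re (\<beta> j) - Re (\<beta> k)\<bar>)"
    unfolding re_spread_def by (intro sum.cong refl sum.mono_neutral_right) auto
  also have "\<dots> \<le> (\<Sum>j\<in>{1..n}. \<Sum>k\<in>{1..n} - {j}. \<bar>Re (\<beta> j)\<bar> + \<bar>Re (\<beta> k)\<bar>)"
    by (intro sum_mono) auto
  also have "\<dots> = (\<Sum>j\<in>{1..n}. (real n - 1) * \<bar>Re (\<beta> j)\<bar> + (re_size n \<beta> - \<bar>Re (\<beta> j)\<bar>))"
    using that by (intro sum.cong refl) (auto simp: sum.distrib sum_diff1 re_size_def of_nat_diff)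
  also have "\<dots> = 2 * (real n - 1) * re_size n \<beta>"
    by (simp add: sum.distrib sum_subtractf re_size_def algebra_simps flip: sum_distrib_left)
  finally show ?thesis .
qed

lemma re_size_nonneg: "re_size n \<beta> \<ge> 0" by (simp add: re_size_def sum_nonneg)
lemma abs_Re_le_re_size: "k \<in> {1..n} \<Longrightarrow> \<bar>Re (\<beta> k)\<bar> \<le> re_size n \<beta>"
  unfolding re_size_def by (rule member_le_sum) auto

lemma re_cross_ge: "re_cross n m \<beta> \<delta> \<ge> real m * re_size n \<beta> - real n * re_size m \<delta>"
proof -
  have "(\<Sum>j\<in>{1..n}. \<Sum>k\<in>{1..m}. \<bar>Re (\<beta> j)\<bar> - \<bar>Re (\<delta> k)\<bar>) \<le> re_cross n m \<beta> \<delta>"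
    unfolding re_cross_def by (intro sum_mono) auto
  then show ?thesis
    by (simp add: sum_subtractf re_size_def sum_distrib_left)
qed

lemma re_cross_le: "re_cross n m \<beta> \<delta> \<le> real m * re_size n \<beta> + real n * re_size m \<delta>"
proof -
  have "(\<Sum>j\<in>{1..n}. \<Sum>k\<in>{1..m}. \<bar>Re (\<beta> j)\<bar> + \<bar>Re (\<delta> k)\<bar>) \<ge> re_cross n m \<beta> \<delta>"
    unfolding re_cross_def by (intro sum_mono) auto
  then show ?thesis
    by (simp add: sum.distrib re_size_def sum_distrib_left)
qed

lemma re_cross_commute: "re_cross n m \<beta> \<delta> = re_cross m n \<delta> \<beta>"
  unfolding re_cross_def by (subst sum.swap) (simp add: abs_minus_commute)

text \<open>
  In the square of the product the factors \<open>(j, k)\<close> and \<open>(k, j)\<close> meet, and each pair is bounded by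
  \<open>exp ((\<pi> + e') \<bar>Re \<beta>\<^sub>j - Re \<beta>\<^sub>k\<bar>)\<close>.
\<close>
lemma rGamma_prod_bound:
  assumes e: "e > 0"
  obtains C where "C > 0" "\<And>\<beta>. (\<forall>j\<in>{1..n}. \<bar>Im (\<beta> j)\<bar> \<le> R) \<Longrightarrow>
     norm (rGamma_prod n \<beta>) \<le> C * exp (pi/2 * re_spread n \<beta> + e * re_size n \<beta>)"
proof -
  \<comment> \<open>the spread is at most \<open>2 (n - 1)\<close> times the size, so \<open>e'\<close> times the spread is at most \<open>2 e\<close> times the size\<close>
  define e' where "e' = e / (real n + 1)"
  have e': "e' > 0" using e by (simp add: e'_def)
  obtain K where K: "K > 0" "\<And>w. \<bar>Re w\<bar> \<le> 2 * \<bar>R\<bar> \<Longrightarrow> norm (rGamma w * rGamma (- w) :: complex) \<le> K * exp ((pi + e') * \<bar>Im w\<bar>)"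
    using rGamma_pair_bound[OF e', of "2 * \<bar>R\<bar>"] by auto
  define C where "C = sqrt ((\<Prod>j\<in>{1..n}. \<Prod>k\<in>{1..n} - {j}. K))"
  have "norm (rGamma_prod n \<beta>) \<le> C * exp (pi/2 * re_spread n \<beta> + e * re_size n \<beta>)"
    if b: "\<forall>j\<in>{1..n}. \<bar>Im (\<beta> j)\<bar> \<le> R" for \<beta>
  proof (rule power2_le_imp_le)
    define w where "w j k = \<i> * \<beta> k - \<i> * \<beta> j" for j k
    have "(rGamma_prod n \<beta>)\<^sup>2 = rGamma_prod n \<beta> * (\<Prod>j\<in>{1..n}. \<Prod>k\<in>{1..n} - {j}. rGamma (w k j))"
      unfolding power2_eq_square by (subst (2) rGamma_prod_def, subst prod_offdiag_swap) (auto simp: w_def)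
    also have "\<dots> = (\<Prod>j\<in>{1..n}. \<Prod>k\<in>{1..n} - {j}. rGamma (w j k) * rGamma (- w j k))"
      unfolding rGamma_prod_def w_def by (simp add: prod.distrib)
    finally have "(norm (rGamma_prod n \<beta>))\<^sup>2 = (\<Prod>j\<in>{1..n}. \<Prod>k\<in>{1..n} - {j}. norm (rGamma (w j k) * rGamma (- w j k)))"
      by (simp flip: norm_power prod_norm)
    also have "\<dots> \<le> (\<Prod>j\<in>{1..n}. \<Prod>k\<in>{1..n} - {j}. K * exp ((pi + e') * \<bar>Re (\<beta> j) - Re (\<beta> k)\<bar>))"
    proof (intro prod_mono conjI prod_nonneg norm_ge_zero ballI)
      fix j k assume jk: "j \<in> {1..n}" "k \<in> {1..n} - {j}"
      then have "\<bar>Im (\<beta> j)\<bar> \<le> R" "\<bar>Im (\<beta> k)\<bar> \<le> R" using b by auto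
      then have "\<bar>Re (w j k)\<bar> \<le> 2 * \<bar>R\<bar>" unfolding w_def by simp
      from K(2)[OF this] show "norm (rGamma (w j k) * rGamma (- w j k)) \<le> K * exp ((pi + e') * \<bar>Re (\<beta> j) - Re (\<beta> k)\<bar>)"
        by (simp add: w_def abs_minus_commute)
    qed
    also have "\<dots> = C\<^sup>2 * exp ((pi + e') * re_spread n \<beta>)"
    proof -
      have "re_spread n \<beta> = (\<Sum>j\<in>{1..n}. \<Sum>k\<in>{1..n} - {j}. \<bar>Re (\<beta> j) - Re (\<beta> k)\<bar>)"
        unfolding re_spread_def by (intro sum.cong refl sum.mono_neutral_right) auto
      moreover have "C\<^sup>2 = (\<Prod>j\<in>{1..n}. \<Prod>k\<in>{1..n} - {j}. K)"
        unfolding C_def using K by (intro real_sqrt_pow2 prod_nonneg) auto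
      ultimately show ?thesis
        by (simp add: prod.distrib sum_distrib_left exp_sum)
    qed
    also have "\<dots> \<le> C\<^sup>2 * exp (2 * (pi/2 * re_spread n \<beta> + e * re_size n \<beta>))"
    proof (cases "n = 0")
      case False
      have "e' * re_spread n \<beta> \<le> e' * (2 * (real n - 1) * re_size n \<beta>)"
        using False e' re_spread_le[of n \<beta>] by (intro mult_left_mono) auto
      also have "\<dots> \<le> 2 * e * re_size n \<beta>"
        using e re_size_nonneg[of n \<beta>] by (simp add: e'_def field_simps mult_left_mono)
      finally show ?thesis by (intro mult_left_mono) (auto simp: algebra_simps)
    qed (simp add: re_spread_def re_size_def)
    also have "\<dots> = (C * exp (pi/2 * re_spread n \<beta> + e * re_size n \<beta>))\<^sup>2"
      by (simp only: power_mult_distrib exp_double)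
    finally show "(norm (rGamma_prod n \<beta>))\<^sup>2 \<le> (C * exp (pi/2 * re_spread n \<beta> + e * re_size n \<beta>))\<^sup>2" .
    have "C \<ge> 0" unfolding C_def using K by (intro real_sqrt_ge_zero prod_nonneg) auto
    then show "0 \<le> C * exp (pi/2 * re_spread n \<beta> + e * re_size n \<beta>)" by simp
  qed
  moreover have "C > 0" unfolding C_def using K by (simp add: prod_pos)
  ultimately show ?thesis using that by blast
qed

text \<open>This reduces inequalities between sums of absolute differences to the case that all points are \<open>0\<close> or \<open>1\<close>.\<close>
lemma abs_diff_as_integral:
  fixes u v :: real
  shows "integrable lborel (\<lambda>t. \<bar>of_bool (u \<le> t) - of_bool (v \<le> t)\<bar> :: real)"
    "\<bar>u - v\<bar> = (\<integral>t. \<bar>of_bool (u \<le> t) - of_bool (v \<le> t)\<bar> \<partial>lborel)"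
proof -
  have eq: "(\<lambda>t. \<bar>of_bool (u \<le> t) - of_bool (v \<le> t)\<bar> :: real) = indicator {min u v..<max u v}"
    by (auto simp: fun_eq_iff indicator_def min_def max_def)
  show "integrable lborel (\<lambda>t. \<bar>of_bool (u \<le> t) - of_bool (v \<le> t)\<bar> :: real)"
    unfolding eq by (intro integrable_real_indicator) auto
  show "\<bar>u - v\<bar> = (\<integral>t. \<bar>of_bool (u \<le> t) - of_bool (v \<le> t)\<bar> \<partial>lborel)"
    unfolding eq by (simp add: min_def max_def)
qed

text \<open>
  After writing the absolute differences as integrals over \<open>t\<close>, let \<open>p\<close> and \<open>q\<close> be the numbers of the
  \<open>Re \<delta>\<^sub>k\<close> and of the \<open>Re \<gamma>\<^sub>k\<close> that are at most \<open>t\<close>. The right-hand integrand minus the left-hand one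
  is \<open>2 (q - p) (q - p - 1)\<close>, which is nonnegative because \<open>q - p\<close> is an integer. Equality holds
  exactly if the points interlace, so the constant \<open>2\<close> cannot be improved.
\<close>
lemma re_spread_interlace:
  "re_spread n \<delta> + re_spread (Suc n) \<gamma> \<le> 2 * re_cross n (Suc n) \<delta> \<gamma>"
proof -
  define P where "P t k = (of_bool (Re (\<delta> k) \<le> t) :: real)" for t k
  define Q where "Q t k = (of_bool (Re (\<gamma> k) \<le> t) :: real)" for t k
  have int: "integrable lborel (\<lambda>t. \<Sum>j\<in>A. \<Sum>k\<in>B. \<bar>of_bool (Re (f j) \<le> t) - of_bool (Re (g k) \<le> t)\<bar> :: real)"
    "(\<Sum>j\<in>A. \<Sum>k\<in>B. \<bar>Re (f j) - Re (g k)\<bar>) = (\<integral>t. (\<Sum>j\<in>A. \<Sum>k\<in>B. \<bar>of_bool (Re (f j) \<le> t) - of_bool (Re (g k) \<le> t)\<bar>) \<partial>lborel)"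
    for A B :: "nat set" and f g :: "nat \<Rightarrow> complex"
  proof -
    show "integrable lborel (\<lambda>t. \<Sum>j\<in>A. \<Sum>k\<in>B. \<bar>of_bool (Re (f j) \<le> t) - of_bool (Re (g k) \<le> t)\<bar> :: real)"
      by (intro Bochner_Integration.integrable_sum abs_diff_as_integral)
    show "(\<Sum>j\<in>A. \<Sum>k\<in>B. \<bar>Re (f j) - Re (g k)\<bar>) = (\<integral>t. (\<Sum>j\<in>A. \<Sum>k\<in>B. \<bar>of_bool (Re (f j) \<le> t) - of_bool (Re (g k) \<le> t)\<bar>) \<partial>lborel)"
      by (simp add: Bochner_Integration.integral_sum abs_diff_as_integral(1) abs_diff_as_integral(2)[symmetric])
  qed
  note D = int[where f = "\<delta>" and g = "\<delta>" and A = "{1..n}" and B = "{1..n}", folded re_spread_def]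
  note G = int[where f = "\<gamma>" and g = "\<gamma>" and A = "{1..Suc n}" and B = "{1..Suc n}", folded re_spread_def]
  note X = int[where f = "\<delta>" and g = "\<gamma>" and A = "{1..n}" and B = "{1..Suc n}", folded re_cross_def]
  have pt: "(\<Sum>j\<in>{1..n}. \<Sum>k\<in>{1..n}. \<bar>P t j - P t k\<bar>) + (\<Sum>j\<in>{1..Suc n}. \<Sum>k\<in>{1..Suc n}. \<bar>Q t j - Q t k\<bar>)
     \<le> 2 * (\<Sum>j\<in>{1..n}. \<Sum>k\<in>{1..Suc n}. \<bar>P t j - Q t k\<bar>)" for t
  proof -
    have b: "\<bar>of_bool x - of_bool y\<bar> = of_bool x + of_bool y - 2 * of_bool x * (of_bool y :: real)" for x y
      by auto
    define p where "p = (\<Sum>j\<in>{1..n}. P t j)"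
    define q where "q = (\<Sum>j\<in>{1..Suc n}. Q t j)"
    have PP: "(\<Sum>j\<in>{1..n}. \<Sum>k\<in>{1..n}. \<bar>P t j - P t k\<bar>) = 2 * n * p - 2 * p * p"
      unfolding P_def b p_def
      by (simp add: sum.distrib sum_subtractf flip: sum_distrib_left sum_distrib_right) (simp add: algebra_simps)?
    have QQ: "(\<Sum>j\<in>{1..Suc n}. \<Sum>k\<in>{1..Suc n}. \<bar>Q t j - Q t k\<bar>) = 2 * (n+1) * q - 2 * q * q"
      unfolding Q_def b q_def
      by (simp add: sum.distrib sum_subtractf del: sum.cl_ivl_Suc flip: sum_distrib_left sum_distrib_right) (simp add: algebra_simps)?
    have PQ: "(\<Sum>j\<in>{1..n}. \<Sum>k\<in>{1..Suc n}. \<bar>P t j - Q t k\<bar>) = (n+1) * p + n * q - 2 * p * q"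
      unfolding P_def Q_def b p_def q_def
      by (simp add: sum.distrib sum_subtractf del: sum.cl_ivl_Suc flip: sum_distrib_left sum_distrib_right) (simp add: algebra_simps)?
    \<comment> \<open>consecutive integers have a nonnegative product\<close>
    have "(q - p) * (q - p - 1) \<ge> 0"
    proof -
      have "p \<in> \<int>" "q \<in> \<int>" unfolding p_def q_def P_def Q_def by (auto intro!: Ints_sum)
      then have "q - p \<in> \<int>" by simp
      then obtain i :: int where i: "q - p = of_int i" by (elim Ints_cases)
      have "i * (i - 1) \<ge> 0" by (cases "i \<le> 0") (auto intro: mult_nonpos_nonpos)
      then have "real_of_int (i * (i - 1)) \<ge> 0" by (simp only: of_int_0_le_iff)
      then show ?thesis unfolding i by simp
    qed
    then show ?thesis
      unfolding PP QQ PQ by (simp add: algebra_simps)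
  qed
  have "re_spread n \<delta> + re_spread (Suc n) \<gamma> = (\<integral>t. (\<Sum>j\<in>{1..n}. \<Sum>k\<in>{1..n}. \<bar>P t j - P t k\<bar>) +
       (\<Sum>j\<in>{1..Suc n}. \<Sum>k\<in>{1..Suc n}. \<bar>Q t j - Q t k\<bar>) \<partial>lborel)"
    unfolding P_def Q_def
    by (rule trans[OF arg_cong2[where f = "(+)", OF D(2) G(2)] Bochner_Integration.integral_add[OF D(1) G(1), symmetric]])
  also have "\<dots> \<le> (\<integral>t. 2 * (\<Sum>j\<in>{1..n}. \<Sum>k\<in>{1..Suc n}. \<bar>P t j - Q t k\<bar>) \<partial>lborel)"
    using D(1) G(1) X(1) unfolding P_def Q_def
    by (intro integral_mono pt[unfolded P_def Q_def] Bochner_Integration.integrable_add integrable_mult_right)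
  also have "\<dots> = 2 * re_cross n (Suc n) \<delta> \<gamma>" unfolding P_def Q_def integral_mult_right_zero
    by (rule arg_cong[where f = "\<lambda>x. 2 * x", OF X(2), symmetric])
  finally show ?thesis .
qed

section \<open>Shifting lines of integration\<close>

lemma neg_mult_at_bot: "\<eta> > 0 \<Longrightarrow> filterlim (\<lambda>x::real. - \<eta> * x) at_bot at_top"
  by (rule filterlim_tendsto_neg_mult_at_bot[OF tendsto_const _ filterlim_ident]) simp

lemma integrable_exp_neg_abs:
  assumes "\<eta> > 0"
  shows "integrable lborel (\<lambda>t::real. exp (- \<eta> * \<bar>t\<bar>))"
proof -
  have "((\<lambda>t::real. - exp (- \<eta> * t) / \<eta>) \<longlongrightarrow> - 0 / \<eta>) at_top"
    using assms by (intro tendsto_intros filterlim_compose[OF exp_at_bot] neg_mult_at_bot) auto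
  then have "(\<integral>\<^sup>+x. ennreal (exp (- \<eta> * x)) * indicator {0..} x \<partial>lborel) = ennreal (- 0 / \<eta> - (- exp (- \<eta> * 0) / \<eta>))"
    using assms by (intro nn_integral_FTC_atLeast) (auto intro!: derivative_eq_intros)
  then have "(\<integral>\<^sup>+x. ennreal (norm (exp (- \<eta> * x) * indicator {0..} x)) \<partial>lborel) < \<infinity>"
    by (simp add: ennreal_mult'' abs_mult ennreal_indicator flip: ennreal_indicator)
  then have 1: "integrable lborel (\<lambda>x. exp (- \<eta> * x) * indicator {0..} x :: real)"
    by (intro integrableI_bounded) auto
  then have 2: "integrable lborel (\<lambda>x. exp (- \<eta> * (0 + (-1) * x)) * indicator {0..} (0 + (-1) * x) :: real)"
    by (rule lborel_integrable_real_affine) auto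
  show ?thesis
  proof (rule Bochner_Integration.integrable_bound[OF Bochner_Integration.integrable_add[OF 1 2]])
    show "AE t in lborel. norm (exp (- \<eta> * \<bar>t\<bar>))
      \<le> norm (exp (- \<eta> * t) * indicator {0..} t + exp (- \<eta> * (0 + (-1) * t)) * indicator {0..} (0 + (-1) * t) :: real)"
      by (intro AE_I2) (auto simp: indicator_def abs_if)
  qed auto
qed

interpretation lborel_prod: product_sigma_finite "\<lambda>_::nat. lborel :: real measure"
  by standard

lemma re_size_on_lines: "re_size n (on_lines c t) = (\<Sum>j\<in>{1..n}. \<bar>t j\<bar>)"
  by (simp add: re_size_def on_lines_def)

lemma integrable_exp_re_size:
  assumes "\<eta> > 0"
  shows "integrable (\<Pi>\<^sub>M j\<in>{1..n}. lborel) (\<lambda>t. exp (- \<eta> * re_size n (on_lines c t)))"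
proof -
  have "integrable (\<Pi>\<^sub>M j\<in>{1..n}. lborel) (\<lambda>t. \<Prod>j\<in>{1..n}. exp (- \<eta> * \<bar>t j :: real\<bar>))"
    using assms by (intro lborel_prod.product_integrable_prod integrable_exp_neg_abs) auto
  then show ?thesis by (simp add: re_size_on_lines sum_distrib_left exp_sum flip: sum_negf)
qed

lemma lines_integrable:
  fixes f :: "(nat \<Rightarrow> complex) \<Rightarrow> complex"
  assumes "\<eta> > 0" "(\<lambda>t. f (on_lines c t)) \<in> borel_measurable (\<Pi>\<^sub>M j\<in>{1..n}. lborel)"
    and "\<And>t. norm (f (on_lines c t)) \<le> C * exp (- \<eta> * re_size n (on_lines c t))"
  shows "integrable (\<Pi>\<^sub>M j\<in>{1..n}. lborel) (\<lambda>t. f (on_lines c t))"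
  by (rule Bochner_Integration.integrable_bound[OF integrable_mult_right[OF integrable_exp_re_size[OF assms(1), of n c], of C] assms(2)])
     (intro AE_I2 order_trans[OF assms(3)], simp)

text \<open>
  The residue at a pole appears for integrals over \<open>[-n, n]\<close>, where no integrability is needed; this passes
  to the whole line.
\<close>
lemma integral_indicator_Icc_limit:
  fixes f :: "real \<Rightarrow> complex"
  assumes "integrable lborel f"
  shows "(\<lambda>n. \<integral>t. indicator {- real n..real n} t *\<^sub>R f t \<partial>lborel) \<longlonglongrightarrow> (\<integral>t. f t \<partial>lborel)"
proof (rule integral_dominated_convergence[where w = "\<lambda>t. norm (f t)"])
  show "AE t in lborel. (\<lambda>n. indicator {- real n..real n} t *\<^sub>R f t) \<longlonglongrightarrow> f t"
  proof (intro AE_I2 tendsto_eventually)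
    fix t
    show "\<forall>\<^sub>F n in sequentially. indicator {- real n..real n} t *\<^sub>R f t = f t"
      using eventually_ge_at_top[of "nat \<lceil>\<bar>t\<bar>\<rceil>"]
    proof eventually_elim
      case (elim n)
      then have "\<bar>t\<bar> \<le> real n" by linarith
      then show ?case by (auto simp: indicator_def)
    qed
  qed
qed (use assms in \<open>auto split: split_indicator\<close>)

definition truncated_line :: "(complex \<Rightarrow> complex) \<Rightarrow> real \<Rightarrow> nat \<Rightarrow> complex" where
  "truncated_line g c n = (\<integral>t. indicator {- real n..real n} t *\<^sub>R g (Complex t c) \<partial>lborel)"

lemma Complex_line_derivative: "((\<lambda>t. Complex t c) has_vector_derivative 1) (at t within A)"
proof -
  have "((\<lambda>t. complex_of_real t + \<i> * c) has_vector_derivative 1) (at t within A)"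
    by (auto intro!: derivative_eq_intros simp: has_vector_derivative_def scaleR_conv_of_real fun_eq_iff)
  then show ?thesis by (simp add: Complex_eq)
qed

lemma convex_strip: "convex {z. lo < Im z \<and> Im z < hi}"
proof -
  have "{z. lo < Im z \<and> Im z < hi} = {z. Im z > lo} \<inter> {z. Im z < hi}" by auto
  then show ?thesis by (simp add: convex_Int convex_halfspace_Im_gt convex_halfspace_Im_lt)
qed

lemma open_strip: "open {z. lo < Im z \<and> Im z < hi}"
proof -
  have "{z. lo < Im z \<and> Im z < hi} = {z. Im z > lo} \<inter> {z. Im z < hi}" by auto
  then show ?thesis by (simp add: open_Int open_halfspace_Im_gt open_halfspace_Im_lt)
qed

text \<open>
  On a convex strip the function has a primitive \<open>G\<close>, so the difference of the two truncated integrals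
  is a difference of increments of \<open>G\<close> along the two short vertical sides, which are small by the decay. Finitely many
  exceptional points are allowed for the sake of removable singularities.
\<close>
lemma truncated_lines_merge:
  assumes c: "lo < c" "c \<le> c'" "c' < hi"
    and cont: "continuous_on {z. lo < Im z \<and> Im z < hi} g" and K: "finite K"
    and diff: "\<And>z. lo < Im z \<Longrightarrow> Im z < hi \<Longrightarrow> z \<notin> K \<Longrightarrow> g field_differentiable at z"
    and decay: "\<And>e. e > 0 \<Longrightarrow> \<exists>X. \<forall>z. c \<le> Im z \<longrightarrow> Im z \<le> c' \<longrightarrow> X \<le> \<bar>Re z\<bar> \<longrightarrow> norm (g z) \<le> e"
  shows "(\<lambda>n. truncated_line g c n - truncated_line g c' n) \<longlonglongrightarrow> 0"
proof -
  let ?S = "{z. lo < Im z \<and> Im z < hi}"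
  obtain G where G: "\<And>z. z \<in> ?S \<Longrightarrow> (G has_field_derivative g z) (at z within ?S)"
  proof (rule holomorphic_convex_primitive[OF convex_strip K cont])
    show "g field_differentiable at z" if "z \<in> interior ?S - K" for z
      using that diff by (simp add: interior_open open_strip)
  qed (rule that, blast)
  have J: "truncated_line g b n = G (Complex n b) - G (Complex (- real n) b)" if b: "lo < b" "b < hi" for b n
    unfolding truncated_line_def
  proof (rule integral_FTC_Icc)
    show "((\<lambda>t. G (Complex t b)) has_vector_derivative g (Complex t b)) (at t within {- real n..real n})" for t
    proof -
      have *: "(G has_field_derivative g (Complex t b)) (at (Complex t b) within (\<lambda>t. Complex t b) ` {- real n..real n})"
        by (rule DERIV_subset[OF G]) (use b in auto)
      show ?thesis
        using field_vector_diff_chain_within[OF Complex_line_derivative *] by (simp add: o_def)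
    qed
    show "continuous_on {- real n..real n} (\<lambda>t. g (Complex t b))"
      by (rule continuous_on_compose2[OF cont]) (use b in \<open>auto simp: Complex_eq intro!: continuous_intros\<close>)
  qed auto
  show ?thesis
  proof (rule LIMSEQ_I)
    fix r :: real assume r: "r > 0"
    define e where "e = r / (2 * (c' - c + 1))"
    have e: "e > 0" using r c by (simp add: e_def)
    obtain X where X: "\<And>z. c \<le> Im z \<Longrightarrow> Im z \<le> c' \<Longrightarrow> X \<le> \<bar>Re z\<bar> \<Longrightarrow> norm (g z) \<le> e"
      using decay[OF e] by blast
    have side: "norm (G (Complex x c) - G (Complex x c')) \<le> e * (c' - c)" if x: "X \<le> \<bar>x\<bar>" for x
    proof -
      have sub: "z \<in> ?S \<and> c \<le> Im z \<and> Im z \<le> c' \<and> Re z = x" if z: "z \<in> closed_segment (Complex x c) (Complex x c')" for z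
      proof -
        have "Re z = x" "Im z \<in> closed_segment c c'"
          using z by (auto simp: closed_segment_same_Re)
        then show ?thesis using c by (auto simp: closed_segment_eq_real_ivl)
      qed
      have "norm (G (Complex x c) - G (Complex x c')) \<le> e * norm (Complex x c - Complex x c')"
      proof (rule field_differentiable_bound[of "closed_segment (Complex x c) (Complex x c')"])
        show "(G has_field_derivative g z) (at z within closed_segment (Complex x c) (Complex x c'))"
          if "z \<in> closed_segment (Complex x c) (Complex x c')" for z
          by (rule DERIV_subset[OF G]) (use sub that in blast)+
        show "norm (g z) \<le> e" if "z \<in> closed_segment (Complex x c) (Complex x c')" for z
          using X sub[OF that] x by auto
      qed auto
      also have "norm (Complex x c - Complex x c') = c' - c"
        using c by (simp add: complex_diff cmod_def)
      finally show ?thesis .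
    qed
    show "\<exists>N. \<forall>n\<ge>N. norm (truncated_line g c n - truncated_line g c' n - 0) < r"
    proof (intro exI[of _ "nat \<lceil>X\<rceil>"] allI impI)
      fix n assume n: "nat \<lceil>X\<rceil> \<le> n"
      then have n': "X \<le> \<bar>real n\<bar>" "X \<le> \<bar>- real n\<bar>" by linarith+
      have "truncated_line g c n - truncated_line g c' n =
        (G (Complex n c) - G (Complex n c')) - (G (Complex (- real n) c) - G (Complex (- real n) c'))"
        using c by (simp add: J)
      also have "norm \<dots> \<le> e * (c' - c) + e * (c' - c)"
        using side[OF n'(1)] side[OF n'(2)] by (rule order_trans[OF norm_triangle_ineq4 add_mono])
      also have "\<dots> < e * (2 * (c' - c + 1))" using e by (simp add: algebra_simps)
      also have "\<dots> = r" using c by (simp add: e_def)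
      finally show "norm (truncated_line g c n - truncated_line g c' n - 0) < r" by simp
    qed
  qed
qed

lemma exp_decay_small:
  assumes "\<eta> > 0" "e > 0"
  shows "\<exists>X. \<forall>t\<ge>X. C * exp (- \<eta> * t) \<le> (e::real)"
proof -
  have "((\<lambda>t. C * exp (- \<eta> * t)) \<longlongrightarrow> C * 0) at_top"
    using assms by (intro tendsto_intros filterlim_compose[OF exp_at_bot] neg_mult_at_bot)
  then have "\<forall>\<^sub>F t in at_top. C * exp (- \<eta> * t) < e"
    using assms by (intro order_tendstoD) auto
  then show ?thesis unfolding eventually_at_top_linorder by (meson less_imp_le)
qed

lemma integrable_line:
  fixes f :: "complex \<Rightarrow> complex"
  assumes "continuous_on {z. lo < Im z \<and> Im z < hi} f" "lo < b" "b < hi" "\<eta> > 0"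
    and "\<And>t. X \<le> \<bar>t\<bar> \<Longrightarrow> norm (f (Complex t b)) \<le> C * exp (- \<eta> * \<bar>t\<bar>)"
  shows "integrable lborel (\<lambda>t. f (Complex t b))"
proof -
  have cont: "continuous_on UNIV (\<lambda>t. f (Complex t b))"
    by (rule continuous_on_compose2[OF assms(1)]) (use assms in \<open>auto simp: Complex_eq intro!: continuous_intros\<close>)
  then have meas: "(\<lambda>t. f (Complex t b)) \<in> borel_measurable lborel"
    by (simp add: borel_measurable_continuous_onI)
  have "compact ((\<lambda>t. f (Complex t b)) ` {-\<bar>X\<bar>..\<bar>X\<bar>})"
    by (intro compact_continuous_image compact_Icc continuous_on_subset[OF cont]) auto
  then have "bounded ((\<lambda>t. f (Complex t b)) ` {-\<bar>X\<bar>..\<bar>X\<bar>})"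
    by (rule compact_imp_bounded)
  then obtain B where "\<forall>z\<in>(\<lambda>t. f (Complex t b)) ` {-\<bar>X\<bar>..\<bar>X\<bar>}. norm z \<le> B"
    unfolding bounded_iff ..
  then have B: "\<And>t. t \<in> {-\<bar>X\<bar>..\<bar>X\<bar>} \<Longrightarrow> norm (f (Complex t b)) \<le> B"
    by (simp only: ball_simps)
  have 1: "integrable lborel (\<lambda>t. B * indicator {-\<bar>X\<bar>..\<bar>X\<bar>} t :: real)" by simp
  have 2: "integrable lborel (\<lambda>t. \<bar>C\<bar> * exp (- \<eta> * \<bar>t\<bar>))"
    using integrable_exp_neg_abs[OF assms(4)] by simp
  show ?thesis
  proof (rule Bochner_Integration.integrable_bound[OF Bochner_Integration.integrable_add[OF 1 2] meas], intro AE_I2)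
    fix t
    have "norm (f (Complex t b)) \<le> B * indicator {-\<bar>X\<bar>..\<bar>X\<bar>} t + \<bar>C\<bar> * exp (- \<eta> * \<bar>t\<bar>)"
    proof (cases "t \<in> {-\<bar>X\<bar>..\<bar>X\<bar>}")
      case False
      then have "X \<le> \<bar>t\<bar>" by auto
      from assms(5)[OF this] have "norm (f (Complex t b)) \<le> C * exp (- \<eta> * \<bar>t\<bar>)" .
      also have "\<dots> \<le> \<bar>C\<bar> * exp (- \<eta> * \<bar>t\<bar>)" by (intro mult_right_mono) auto
      finally show ?thesis using False by simp
    next
      case True
      then have "norm (f (Complex t b)) \<le> B" by (rule B)
      also have "\<dots> \<le> B + \<bar>C\<bar> * exp (- \<eta> * \<bar>t\<bar>)" by simp
      finally show ?thesis using True by simp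
    qed
    also have "\<dots> \<le> norm (B * indicator {-\<bar>X\<bar>..\<bar>X\<bar>} t + \<bar>C\<bar> * exp (- \<eta> * \<bar>t\<bar>))" by simp
    finally show "norm (f (Complex t b)) \<le> norm (B * indicator {-\<bar>X\<bar>..\<bar>X\<bar>} t + \<bar>C\<bar> * exp (- \<eta> * \<bar>t\<bar>))" .
  qed
qed

lemma line_shift:
  assumes c: "lo < c" "c < hi" "lo < c'" "c' < hi" and \<eta>: "\<eta> > 0"
    and hol: "f holomorphic_on {z. lo < Im z \<and> Im z < hi}"
    and bound: "\<And>z. min c c' \<le> Im z \<Longrightarrow> Im z \<le> max c c' \<Longrightarrow> X \<le> \<bar>Re z\<bar> \<Longrightarrow> norm (f z) \<le> C * exp (- \<eta> * \<bar>Re z\<bar>)"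
  shows "(\<integral>t. f (Complex t c) \<partial>lborel) = (\<integral>t. f (Complex t c') \<partial>lborel)"
proof -
  have main: "(\<integral>t. f (Complex t a) \<partial>lborel) = (\<integral>t. f (Complex t b) \<partial>lborel)"
    if ab: "lo < a" "a \<le> b" "b < hi" "min c c' = a" "max c c' = b" for a b
  proof -
    note cont = holomorphic_on_imp_continuous_on[OF hol]
    have int: "integrable lborel (\<lambda>t. f (Complex t d))" if "d = a \<or> d = b" for d
      by (rule integrable_line[OF cont _ _ \<eta>, where X = X and C = C]) (use that ab bound[of "Complex _ d"] in auto)
    have "(\<lambda>n. truncated_line f a n - truncated_line f b n) \<longlonglongrightarrow> 0"
    proof (rule truncated_lines_merge[OF ab(1-3) cont finite.emptyI])
      show "f field_differentiable at z" if "lo < Im z" "Im z < hi" for z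
        using holomorphic_on_imp_differentiable_at[OF hol open_strip] that by auto
      fix e :: real assume e: "e > 0"
      obtain Y where Y: "\<And>t. t \<ge> Y \<Longrightarrow> C * exp (- \<eta> * t) \<le> e"
        using exp_decay_small[OF \<eta> e] by blast
      show "\<exists>X. \<forall>z. a \<le> Im z \<longrightarrow> Im z \<le> b \<longrightarrow> X \<le> \<bar>Re z\<bar> \<longrightarrow> norm (f z) \<le> e"
      proof (intro exI[of _ "max X Y"] allI impI)
        fix z assume "a \<le> Im z" "Im z \<le> b" "max X Y \<le> \<bar>Re z\<bar>"
        then show "norm (f z) \<le> e"
          using bound[of z] Y[of "\<bar>Re z\<bar>"] ab by simp
      qed
    qed
    moreover have "(\<lambda>n. truncated_line f a n - truncated_line f b n) \<longlonglongrightarrow>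
        (\<integral>t. f (Complex t a) \<partial>lborel) - (\<integral>t. f (Complex t b) \<partial>lborel)"
      unfolding truncated_line_def using int by (intro tendsto_diff integral_indicator_Icc_limit) auto
    ultimately show ?thesis using LIMSEQ_unique by fastforce
  qed
  show ?thesis
  proof (cases "c \<le> c'")
    case True
    then show ?thesis using c by (intro main) auto
  next
    case False
    then show ?thesis using c by (intro main[symmetric]) auto
  qed
qed

text \<open>The difference of the two integrands is \<open>2 \<i> d / ((t - Re p)\<^sup>2 + d\<^sup>2)\<close>, whose primitive is an \<open>arctan\<close>.\<close>
lemma truncated_line_inverse_diff:
  assumes d: "d > 0"
  shows "(\<lambda>n. truncated_line (\<lambda>z. 1 / (z - p)) (Im p - d) n - truncated_line (\<lambda>z. 1 / (z - p)) (Im p + d) n)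
     \<longlonglongrightarrow> 2 * of_real pi * \<i>"
proof -
  define a where "a = Re p"
  have int: "integrable lborel (\<lambda>t. indicator {- real n..real n} t *\<^sub>R (1 / (Complex t b - p)))" if "b \<noteq> Im p" for b n
  proof (rule borel_integrable_compact)
    have "Complex t b - p \<noteq> 0" for t using that by (auto simp: complex_eq_iff)
    then show "continuous_on {- real n..real n} (\<lambda>t. 1 / (Complex t b - p))"
      by (auto simp: Complex_eq intro!: continuous_intros)
  qed auto
  have "truncated_line (\<lambda>z. 1 / (z - p)) (Im p - d) n - truncated_line (\<lambda>z. 1 / (z - p)) (Im p + d) n
      = 2 * \<i> * of_real (arctan ((real n - a) / d) - arctan ((- real n - a) / d))" for n :: nat
  proof -
    have pt: "1 / (Complex t (Im p - d) - p) - 1 / (Complex t (Im p + d) - p)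
        = 2 * \<i> * of_real (inverse (1 + ((t - a) / d)\<^sup>2) * (1 / d))" for t
    proof -
      define u where "u = t - a"
      have nz: "u\<^sup>2 + d\<^sup>2 \<noteq> 0" using d by (simp add: sum_power2_eq_zero_iff)
      have e: "Complex t (Im p - d) - p = Complex u (- d)" "Complex t (Im p + d) - p = Complex u d"
        by (auto simp: complex_eq_iff u_def a_def)
      have f: "inverse (1 + (u / d)\<^sup>2) * (1 / d) = d / (u\<^sup>2 + d\<^sup>2)"
        using d nz by (simp add: field_simps power2_eq_square)
      have m: "Complex u (- d) * Complex u d = of_real (u\<^sup>2 + d\<^sup>2)" "Complex u d - Complex u (- d) = 2 * \<i> * of_real d"
        by (auto simp: complex_eq_iff power2_eq_square)
      have "Complex u (- d) \<noteq> 0" "Complex u d \<noteq> 0" using d by (auto simp: complex_eq_iff)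
      then have "1 / Complex u (- d) - 1 / Complex u d = (Complex u d - Complex u (- d)) / (Complex u (- d) * Complex u d)"
        by (simp add: diff_frac_eq)
      then show ?thesis unfolding e u_def[symmetric] f m by simp
    qed
    have "truncated_line (\<lambda>z. 1 / (z - p)) (Im p - d) n - truncated_line (\<lambda>z. 1 / (z - p)) (Im p + d) n
       = (\<integral>t. indicator {- real n..real n} t *\<^sub>R (1 / (Complex t (Im p - d) - p)) -
             indicator {- real n..real n} t *\<^sub>R (1 / (Complex t (Im p + d) - p)) \<partial>lborel)"
      unfolding truncated_line_def using d by (subst Bochner_Integration.integral_diff) (auto intro!: int)
    also have "\<dots> = (\<integral>t. indicator {- real n..real n} t *\<^sub>R (2 * \<i> * of_real (inverse (1 + ((t - a) / d)\<^sup>2) * (1 / d))) \<partial>lborel)"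
      unfolding pt[symmetric] scaleR_diff_right ..
    also have "\<dots> = 2 * \<i> * of_real (arctan ((real n - a) / d)) - 2 * \<i> * of_real (arctan ((- real n - a) / d))"
    proof (rule integral_FTC_Icc)
      fix t
      have "((\<lambda>t. (t - a) / d) has_real_derivative 1 / d) (at t within {- real n..real n})"
        using d by (auto intro!: derivative_eq_intros)
      from DERIV_chain2[OF DERIV_arctan this]
      have "((\<lambda>t. arctan ((t - a) / d)) has_real_derivative inverse (1 + ((t - a) / d)\<^sup>2) * (1 / d)) (at t within {- real n..real n})" .
      then show "((\<lambda>t. 2 * \<i> * of_real (arctan ((t - a) / d))) has_vector_derivative 2 * \<i> * of_real (inverse (1 + ((t - a) / d)\<^sup>2) * (1 / d))) (at t within {- real n..real n})"
        by (intro has_vector_derivative_mult_right has_vector_derivative_of_real)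
           (simp add: has_real_derivative_iff_has_vector_derivative)
    next
      have "1 + ((t - a) / d)\<^sup>2 \<noteq> 0" for t using sum_power2_eq_zero_iff[of 1 "(t - a) / d"] by (auto simp: power_divide)
      then show "continuous_on {- real n..real n} (\<lambda>t. 2 * \<i> * complex_of_real (inverse (1 + ((t - a) / d)\<^sup>2) * (1 / d)))"
        using d by (intro continuous_intros) auto
    qed auto
    finally show ?thesis by (simp add: algebra_simps)
  qed
  moreover have "(\<lambda>n. 2 * \<i> * complex_of_real (arctan ((real n - a) / d) - arctan ((- real n - a) / d)))
      \<longlonglongrightarrow> 2 * \<i> * of_real (pi / 2 - (- (pi / 2)))"
  proof (intro tendsto_intros)
    have lin: "filterlim (\<lambda>n. b + (1 / d) * real n) at_top sequentially" for b
      by (rule filterlim_tendsto_add_at_top[OF tendsto_const filterlim_tendsto_pos_mult_at_top[OF tendsto_const _ filterlim_real_sequentially]])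
        (use d in simp)
    have "filterlim (\<lambda>n. (real n - a) / d) at_top sequentially"
      using lin[of "- a / d"] by (simp add: diff_divide_distrib)
    then show "(\<lambda>n. arctan ((real n - a) / d)) \<longlonglongrightarrow> pi / 2"
      by (rule filterlim_compose[OF tendsto_arctan_at_top])
    have "filterlim (\<lambda>n. (- real n - a) / d) at_bot sequentially"
      using lin[of "a / d"] unfolding filterlim_uminus_at_bot by (simp add: diff_divide_distrib add_divide_distrib)
    then show "(\<lambda>n. arctan ((- real n - a) / d)) \<longlonglongrightarrow> - (pi / 2)"
      by (rule filterlim_compose[OF tendsto_arctan_at_bot])
  qed
  ultimately show ?thesis by (simp add: mult_ac)
qed

text \<open>
  The difference quotient \<open>(h z - h p) / (z - p)\<close> extends continuously over \<open>p\<close>, so it contributes nothing;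
  the rest is the elementary pole \<open>h p / (z - p)\<close>.
\<close>
lemma truncated_line_residue:
  assumes d: "d > 0" "lo < Im p - d" "Im p + d < hi"
    and hol: "h holomorphic_on {z. lo < Im z \<and> Im z < hi}"
    and bound: "\<And>z. Im p - d \<le> Im z \<Longrightarrow> Im z \<le> Im p + d \<Longrightarrow> X \<le> \<bar>Re z\<bar> \<Longrightarrow> norm (h z) \<le> C"
  shows "(\<lambda>n. truncated_line (\<lambda>z. h z / (z - p)) (Im p - d) n - truncated_line (\<lambda>z. h z / (z - p)) (Im p + d) n)
     \<longlonglongrightarrow> 2 * of_real pi * \<i> * h p"
proof -
  let ?S = "{z. lo < Im z \<and> Im z < hi}"
  have pS: "p \<in> ?S" using d by auto
  define H where "H z = (if z = p then deriv h p else (h z - h p) / (z - p))" for z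
  have diffh: "h field_differentiable at z" if "z \<in> ?S" for z
    using holomorphic_on_imp_differentiable_at[OF hol open_strip] that by auto
  have diffH: "H field_differentiable at z" if z: "z \<in> ?S" "z \<noteq> p" for z
  proof -
    have "(\<lambda>z. (h z - h p) / (z - p)) field_differentiable at z"
      using z diffh[OF z(1)] by (intro derivative_intros) auto
    then obtain D where "((\<lambda>z. (h z - h p) / (z - p)) has_field_derivative D) (at z)"
      unfolding field_differentiable_def by blast
    then have "(H has_field_derivative D) (at z)"
      by (rule has_field_derivative_transform_within_open[where S = "- {p}"]) (use z in \<open>auto simp: H_def\<close>)
    then show ?thesis unfolding field_differentiable_def by blast
  qed
  have contH: "continuous_on ?S H"
  proof (intro continuous_at_imp_continuous_on ballI)
    fix z assume z: "z \<in> ?S"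
    show "isCont H z"
    proof (cases "z = p")
      case True
      have "(h has_field_derivative deriv h p) (at p)"
        using diffh[OF pS] by (simp add: DERIV_deriv_iff_field_differentiable)
      then have "((\<lambda>w. (h w - h p) / (w - p)) \<longlongrightarrow> deriv h p) (at p)"
        by (simp add: has_field_derivative_iff)
      moreover have "(H \<longlongrightarrow> deriv h p) (at p) \<longleftrightarrow> ((\<lambda>w. (h w - h p) / (w - p)) \<longlongrightarrow> deriv h p) (at p)"
        by (intro tendsto_cong eventually_at_filter[THEN iffD2] always_eventually) (auto simp: H_def)
      ultimately show ?thesis using True by (simp add: isCont_def H_def)
    qed (use diffH[OF z] field_differentiable_imp_continuous_at in blast)
  qed
  have merge: "(\<lambda>n. truncated_line H (Im p - d) n - truncated_line H (Im p + d) n) \<longlonglongrightarrow> 0"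
  proof (rule truncated_lines_merge[OF _ _ _ contH, where K = "{p}"])
    fix e :: real assume e: "e > 0"
    define B where "B = \<bar>C\<bar> + norm (h p)"
    have B: "B \<ge> 0" by (simp add: B_def)
    show "\<exists>X. \<forall>z. Im p - d \<le> Im z \<longrightarrow> Im z \<le> Im p + d \<longrightarrow> X \<le> \<bar>Re z\<bar> \<longrightarrow> norm (H z) \<le> e"
    proof (intro exI[of _ "max X (\<bar>Re p\<bar> + B / e + 1)"] allI impI)
      fix z assume z: "Im p - d \<le> Im z" "Im z \<le> Im p + d" "max X (\<bar>Re p\<bar> + B / e + 1) \<le> \<bar>Re z\<bar>"
      have far: "B / e + 1 \<le> norm (z - p)"
      proof -
        have "\<bar>Re z - Re p\<bar> \<le> norm (z - p)" using abs_Re_le_cmod[of "z - p"] by simp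
        moreover have "\<bar>Re p\<bar> + B / e + 1 \<le> \<bar>Re z\<bar>" using z by simp
        ultimately show ?thesis by linarith
      qed
      have "B / e \<ge> 0" using B e by simp
      with far have pos: "norm (z - p) > 0" by linarith
      have "norm (H z) = norm (h z - h p) / norm (z - p)" using pos by (simp add: H_def norm_divide)
      also have "\<dots> \<le> B / norm (z - p)"
        using bound[of z] z pos unfolding B_def
        by (intro divide_right_mono order_trans[OF norm_triangle_ineq4]) auto
      also have "\<dots> \<le> e"
      proof -
        have "B / e \<le> norm (z - p)" using far by simp
        then have "B \<le> norm (z - p) * e" using e by (simp add: divide_le_eq)
        then show ?thesis using pos by (simp add: divide_le_eq mult.commute)
      qed
      finally show "norm (H z) \<le> e" .
    qed
  qed (use d diffH in auto)
  have split: "truncated_line (\<lambda>z. h z / (z - p)) b n = truncated_line H b n + h p * truncated_line (\<lambda>z. 1 / (z - p)) b n"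
    if b: "b \<noteq> Im p" "lo < b" "b < hi" for b n
  proof -
    have nz: "Complex t b - p \<noteq> 0" "Complex t b \<noteq> p" for t using b by (auto simp: complex_eq_iff)
    have "continuous_on {- real n..real n} (\<lambda>t. H (Complex t b))"
      by (rule continuous_on_compose2[OF contH]) (use b in \<open>auto simp: Complex_eq intro!: continuous_intros\<close>)
    then have 1: "integrable lborel (\<lambda>t. indicator {- real n..real n} t *\<^sub>R H (Complex t b))"
      by (intro borel_integrable_compact) auto
    have "continuous_on {- real n..real n} (\<lambda>t. 1 / (Complex t b - p))"
      using nz by (auto simp: Complex_eq intro!: continuous_intros)
    then have 2: "integrable lborel (\<lambda>t. indicator {- real n..real n} t *\<^sub>R (1 / (Complex t b - p)))"
      by (intro borel_integrable_compact) auto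
    have "truncated_line (\<lambda>z. h z / (z - p)) b n = (\<integral>t. indicator {- real n..real n} t *\<^sub>R H (Complex t b) +
       h p * (indicator {- real n..real n} t *\<^sub>R (1 / (Complex t b - p))) \<partial>lborel)"
      unfolding truncated_line_def
    proof (intro Bochner_Integration.integral_cong refl)
      fix t
      have "h (Complex t b) / (Complex t b - p) = H (Complex t b) + h p * (1 / (Complex t b - p))"
        using nz[of t] by (simp add: H_def diff_divide_distrib)
      then show "indicator {- real n..real n} t *\<^sub>R (h (Complex t b) / (Complex t b - p)) =
          indicator {- real n..real n} t *\<^sub>R H (Complex t b) + h p * (indicator {- real n..real n} t *\<^sub>R (1 / (Complex t b - p)))"
        by (simp add: scaleR_add_right)
    qed
    also have "\<dots> = truncated_line H b n + h p * truncated_line (\<lambda>z. 1 / (z - p)) b n"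
      unfolding truncated_line_def
      unfolding Bochner_Integration.integral_add[OF 1 integrable_mult_right[OF 2]] integral_mult_right_zero ..
    finally show ?thesis .
  qed
  have "(\<lambda>n. (truncated_line H (Im p - d) n - truncated_line H (Im p + d) n) +
      h p * (truncated_line (\<lambda>z. 1 / (z - p)) (Im p - d) n - truncated_line (\<lambda>z. 1 / (z - p)) (Im p + d) n))
      \<longlonglongrightarrow> 0 + h p * (2 * of_real pi * \<i>)"
    by (intro tendsto_intros merge truncated_line_inverse_diff d)
  then show ?thesis using d by (simp add: split algebra_simps)
qed

lemma residue_shift:
  assumes d: "d > 0" "lo < Im p - d" "Im p + d < hi" and \<eta>: "\<eta> > 0"
    and hol: "h holomorphic_on {z. lo < Im z \<and> Im z < hi}"
    and bound: "\<And>z. Im p - d \<le> Im z \<Longrightarrow> Im z \<le> Im p + d \<Longrightarrow> X \<le> \<bar>Re z\<bar> \<Longrightarrow>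
       norm (h z / (z - p)) \<le> C * exp (- \<eta> * \<bar>Re z\<bar>)"
  shows "(\<integral>t. h (Complex t (Im p - d)) / (Complex t (Im p - d) - p) \<partial>lborel)
    = (\<integral>t. h (Complex t (Im p + d)) / (Complex t (Im p + d) - p) \<partial>lborel) + 2 * of_real pi * \<i> * h p"
    "integrable lborel (\<lambda>t. h (Complex t (Im p + d)) / (Complex t (Im p + d) - p))"
proof -
  have int: "integrable lborel (\<lambda>t. h (Complex t b) / (Complex t b - p))" if b: "b = Im p - d \<and> hi' = Im p \<and> lo' = lo \<or> b = Im p + d \<and> lo' = Im p \<and> hi' = hi" for b lo' hi'
  proof (rule integrable_line[where lo = lo' and hi = hi' and X = X and C = C and f = "\<lambda>z. h z / (z - p)", OF _ _ _ \<eta>])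
    show "continuous_on {z. lo' < Im z \<and> Im z < hi'} (\<lambda>z. h z / (z - p))"
      using b d by (intro continuous_intros continuous_on_subset[OF holomorphic_on_imp_continuous_on[OF hol]]) auto
  qed (use b d bound[of "Complex _ b"] in auto)
  show int2: "integrable lborel (\<lambda>t. h (Complex t (Im p + d)) / (Complex t (Im p + d) - p))"
    by (rule int[where lo' = "Im p" and hi' = hi]) auto
  have int1: "integrable lborel (\<lambda>t. h (Complex t (Im p - d)) / (Complex t (Im p - d) - p))"
    by (rule int[where lo' = lo and hi' = "Im p"]) auto
    obtain K where K: "K > 0" "\<And>t. t \<ge> 0 \<Longrightarrow> (1 + t) ^ 1 \<le> K * exp (\<eta> * t)"
      using one_plus_power_le_exp[OF \<eta>, of 1] by auto
  have lim1: "(\<lambda>n. truncated_line (\<lambda>z. h z / (z - p)) (Im p - d) n - truncated_line (\<lambda>z. h z / (z - p)) (Im p + d) n)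
     \<longlonglongrightarrow> 2 * of_real pi * \<i> * h p"
  proof (rule truncated_line_residue[OF d hol])
    fix z assume z: "Im p - d \<le> Im z" "Im z \<le> Im p + d" "max X (\<bar>Re p\<bar> + 1) \<le> \<bar>Re z\<bar>"
    have "\<bar>Re z - Re p\<bar> \<ge> 1" using z by linarith
    then have nz: "z \<noteq> p" by auto
    have "norm (z - p) \<le> \<bar>Re (z - p)\<bar> + \<bar>Im (z - p)\<bar>" by (rule cmod_le)
    also have "\<dots> \<le> (\<bar>Re z\<bar> + \<bar>Re p\<bar>) + d" using z by (intro add_mono) auto
    also have "\<dots> \<le> (1 + \<bar>Re p\<bar> + d) * (1 + \<bar>Re z\<bar>)" using d by (simp add: algebra_simps)
    also have "\<dots> \<le> (1 + \<bar>Re p\<bar> + d) * (K * exp (\<eta> * \<bar>Re z\<bar>))"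
      using K(2)[of "\<bar>Re z\<bar>"] d by (intro mult_left_mono) auto
    finally have 1: "norm (z - p) \<le> (1 + \<bar>Re p\<bar> + d) * (K * exp (\<eta> * \<bar>Re z\<bar>))" .
    have "norm (h z / (z - p)) \<le> C * exp (- \<eta> * \<bar>Re z\<bar>)" using bound z by simp
    also have "\<dots> \<le> \<bar>C\<bar> * exp (- \<eta> * \<bar>Re z\<bar>)" by (intro mult_right_mono) auto
    finally have 2: "norm (h z / (z - p)) \<le> \<bar>C\<bar> * exp (- \<eta> * \<bar>Re z\<bar>)" .
    have "norm (h z) = norm (h z / (z - p)) * norm (z - p)" using nz by (simp add: norm_divide)
    also have "\<dots> \<le> (\<bar>C\<bar> * exp (- \<eta> * \<bar>Re z\<bar>)) * ((1 + \<bar>Re p\<bar> + d) * (K * exp (\<eta> * \<bar>Re z\<bar>)))"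
      using 1 2 by (intro mult_mono) auto
    also have "\<dots> = \<bar>C\<bar> * (1 + \<bar>Re p\<bar> + d) * K" by (simp add: exp_minus field_simps)
    finally show "norm (h z) \<le> \<bar>C\<bar> * (1 + \<bar>Re p\<bar> + d) * K" .
  qed
  have "(\<lambda>n. truncated_line (\<lambda>z. h z / (z - p)) (Im p - d) n - truncated_line (\<lambda>z. h z / (z - p)) (Im p + d) n)
     \<longlonglongrightarrow> (\<integral>t. h (Complex t (Im p - d)) / (Complex t (Im p - d) - p) \<partial>lborel) -
        (\<integral>t. h (Complex t (Im p + d)) / (Complex t (Im p + d) - p) \<partial>lborel)"
    unfolding truncated_line_def by (intro tendsto_diff integral_indicator_Icc_limit int1 int2)
  from LIMSEQ_unique[OF this lim1] show "(\<integral>t. h (Complex t (Im p - d)) / (Complex t (Im p - d) - p) \<partial>lborel)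
    = (\<integral>t. h (Complex t (Im p + d)) / (Complex t (Im p + d) - p) \<partial>lborel) + 2 * of_real pi * \<i> * h p"
    by (simp add: diff_eq_eq add.commute)
qed

lemma lines_integral_fold_coordinate:
  assumes j: "j \<in> {1..n}" and int: "integrable (\<Pi>\<^sub>M j\<in>{1..n}. lborel) (\<lambda>t. f (on_lines c t))"
  shows "lines_integral n c f =
    (\<integral>x. (\<integral>y. f ((on_lines c x)(j := Complex y (c j))) \<partial>lborel) \<partial>(\<Pi>\<^sub>M j\<in>{1..n} - {j}. lborel))"
proof -
  have I: "{1..n} = insert j ({1..n} - {j})" using j by auto
  have upd: "on_lines c (x(j := y)) = (on_lines c x)(j := Complex y (c j))" for x y
    by (auto simp: on_lines_def)
  show ?thesis
    unfolding lines_integral_def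
    by (subst (1) I, subst lborel_prod.product_integral_insert) (use int I[symmetric] in \<open>auto simp: upd\<close>)
qed

text \<open>Fubini isolates the coordinate \<open>j\<close>, in which the line is moved.\<close>
lemma lines_integral_shift_coordinate:
  assumes j: "j \<in> {1..n}" and \<eta>: "\<eta> > 0"
    and v: "lo < c j" "c j < hi" "lo < v" "v < hi"
    and meas: "(\<lambda>t. f (on_lines c t)) \<in> borel_measurable (\<Pi>\<^sub>M j\<in>{1..n}. lborel)"
      "(\<lambda>t. f (on_lines (c(j := v)) t)) \<in> borel_measurable (\<Pi>\<^sub>M j\<in>{1..n}. lborel)"
    and hol: "\<And>\<beta>. (\<And>k. k \<in> {1..n} - {j} \<Longrightarrow> Im (\<beta> k) = c k) \<Longrightarrow>
       (\<lambda>z. f (\<beta>(j := z))) holomorphic_on {z. lo < Im z \<and> Im z < hi}"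
    and bound: "\<And>\<beta>. (\<And>k. k \<in> {1..n} - {j} \<Longrightarrow> Im (\<beta> k) = c k) \<Longrightarrow> min (c j) v \<le> Im (\<beta> j) \<Longrightarrow>
       Im (\<beta> j) \<le> max (c j) v \<Longrightarrow> norm (f \<beta>) \<le> C * exp (- \<eta> * re_size n \<beta>)"
  shows "lines_integral n c f = lines_integral n (c(j := v)) f"
proof -
  have int: "integrable (\<Pi>\<^sub>M j\<in>{1..n}. lborel) (\<lambda>t. f (on_lines c t))"
    "integrable (\<Pi>\<^sub>M j\<in>{1..n}. lborel) (\<lambda>t. f (on_lines (c(j := v)) t))"
    by (intro lines_integrable[OF \<eta> meas(1), of C] lines_integrable[OF \<eta> meas(2), of C] bound; simp add: on_lines_def)+
  have C: "C \<ge> 0"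
  proof (rule ccontr)
    assume "\<not> C \<ge> 0"
    then have "C * exp (- \<eta> * re_size n (on_lines c (\<lambda>_. 0))) < 0" by (simp add: mult_neg_pos)
    moreover have "norm (f (on_lines c (\<lambda>_. 0))) \<le> C * exp (- \<eta> * re_size n (on_lines c (\<lambda>_. 0)))"
      by (rule bound) (auto simp: on_lines_def)
    ultimately show False using norm_ge_zero[of "f (on_lines c (\<lambda>_. 0))"] by linarith
  qed
  have "(\<integral>y. f ((on_lines c x)(j := Complex y (c j))) \<partial>lborel) = (\<integral>y. f ((on_lines c x)(j := Complex y v)) \<partial>lborel)" for x
  proof (rule line_shift[OF v \<eta>, where f = "\<lambda>z. f ((on_lines c x)(j := z))" and X = 0 and C = C])
    show "(\<lambda>z. f ((on_lines c x)(j := z))) holomorphic_on {z. lo < Im z \<and> Im z < hi}"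
      by (rule hol) (auto simp: on_lines_def)
    fix z assume z: "min (c j) v \<le> Im z" "Im z \<le> max (c j) v"
    have "norm (f ((on_lines c x)(j := z))) \<le> C * exp (- \<eta> * re_size n ((on_lines c x)(j := z)))"
      by (rule bound) (use z in \<open>auto simp: on_lines_def\<close>)
    also have "\<dots> \<le> C * exp (- \<eta> * \<bar>Re z\<bar>)"
      using abs_Re_le_re_size[OF j, of "(on_lines c x)(j := z)"] \<eta> C by (intro mult_left_mono) auto
    finally show "norm (f ((on_lines c x)(j := z))) \<le> C * exp (- \<eta> * \<bar>Re z\<bar>)" .
  qed
  moreover have "(on_lines (c(j := v)) x)(j := w) = (on_lines c x)(j := w)" for x w
    by (auto simp: on_lines_def)
  ultimately show ?thesis
    unfolding lines_integral_fold_coordinate[of j n f, OF j int(1)] lines_integral_fold_coordinate[of j n f, OF j int(2)]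
    by simp
qed

text \<open>The coordinates are moved one after the other; at every stage the heights stay between \<open>p\<close> and \<open>q\<close>.\<close>
lemma lines_integral_shift:
  assumes \<eta>: "\<eta> > 0" and pq: "lo < p" "q < hi"
    and c: "\<And>j. j \<in> {1..n} \<Longrightarrow> p \<le> c j \<and> c j \<le> q" "\<And>j. j \<in> {1..n} \<Longrightarrow> p \<le> c' j \<and> c' j \<le> q"
    and meas: "\<And>c. (\<lambda>t. f (on_lines c t)) \<in> borel_measurable (\<Pi>\<^sub>M j\<in>{1..n}. lborel)"
    and hol: "\<And>\<beta> j. (\<And>k. k \<in> {1..n} \<Longrightarrow> p \<le> Im (\<beta> k) \<and> Im (\<beta> k) \<le> q) \<Longrightarrow> j \<in> {1..n} \<Longrightarrow>
       (\<lambda>z. f (\<beta>(j := z))) holomorphic_on {z. lo < Im z \<and> Im z < hi}"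
    and bound: "\<And>\<beta>. (\<And>k. k \<in> {1..n} \<Longrightarrow> p \<le> Im (\<beta> k) \<and> Im (\<beta> k) \<le> q) \<Longrightarrow>
       norm (f \<beta>) \<le> C * exp (- \<eta> * re_size n \<beta>)"
    and cong: "\<And>\<beta> \<beta>'. (\<And>k. k \<in> {1..n} \<Longrightarrow> \<beta> k = \<beta>' k) \<Longrightarrow> f \<beta> = f \<beta>'"
  shows "lines_integral n c f = lines_integral n c' f"
proof -
  define cc where "cc m j = (if 1 \<le> j \<and> j \<le> m then c' j else c j)" for m j :: nat
  have "lines_integral n c f = lines_integral n (cc m) f" if "m \<le> n" for m
    using that
  proof (induction m)
    case 0
    have "cc 0 = c" by (auto simp: cc_def)
    then show ?case by simp
  next
    case (Suc m)
    have eq: "cc (Suc m) = (cc m)(Suc m := c' (Suc m))" by (auto simp: cc_def fun_eq_iff)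
    have range: "p \<le> cc m j \<and> cc m j \<le> q" if "j \<in> {1..n}" for j using c that by (auto simp: cc_def)
    have S: "Suc m \<in> {1..n}" using Suc by auto
    have "lines_integral n c f = lines_integral n (cc m) f" using Suc by simp
    also have "lines_integral n (cc m) f = lines_integral n ((cc m)(Suc m := c' (Suc m))) f"
    proof (rule lines_integral_shift_coordinate[OF S \<eta>, where lo = lo and hi = hi and C = C])
      fix \<beta> assume b: "\<And>k. k \<in> {1..n} - {Suc m} \<Longrightarrow> Im (\<beta> k) = cc m k"
      \<comment> \<open>the moving coordinate is unconstrained in the goal and is first put into the strip\<close>
      have "(\<lambda>z. f ((\<beta>(Suc m := Complex 0 p))(Suc m := z))) holomorphic_on {z. lo < Im z \<and> Im z < hi}"
        by (rule hol[OF _ S]) (use b range c[OF S] in \<open>auto intro: order_trans\<close>)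
      then show "(\<lambda>z. f (\<beta>(Suc m := z))) holomorphic_on {z. lo < Im z \<and> Im z < hi}" by simp
      assume z: "min (cc m (Suc m)) (c' (Suc m)) \<le> Im (\<beta> (Suc m))" "Im (\<beta> (Suc m)) \<le> max (cc m (Suc m)) (c' (Suc m))"
      show "norm (f \<beta>) \<le> C * exp (- \<eta> * re_size n \<beta>)"
      proof (rule bound)
        fix k assume k: "k \<in> {1..n}"
        show "p \<le> Im (\<beta> k) \<and> Im (\<beta> k) \<le> q"
          using b[of k] range[OF k] range[OF S] c[OF S] z k by (cases "k = Suc m") auto
      qed
    qed (use meas range[OF S] c[OF S] pq in auto)
    finally show ?case unfolding eq .
  qed
  from this[of n] have "lines_integral n c f = lines_integral n (cc n) f" by simp
  also have "\<dots> = lines_integral n c' f"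
    unfolding lines_integral_def
    by (intro Bochner_Integration.integral_cong refl cong) (auto simp: on_lines_def cc_def)
  finally show ?thesis .
qed

section \<open>Lagrange interpolation and Vandermonde products\<close>

lemma degree_prod_linear: "finite A \<Longrightarrow> degree (\<Prod>k\<in>A. [:- x k, 1:]) = card A" for x :: "'a \<Rightarrow> complex"
  by (subst degree_prod_eq_sum_degree) auto

lemma coeff_prod_linear_card: "finite A \<Longrightarrow> coeff (\<Prod>k\<in>A. [:- x k, 1:]) (card A) = 1" for x :: "'a \<Rightarrow> complex"
  using lead_coeff_prod[of "\<lambda>k. [:- x k, 1:]" A] by (simp add: degree_prod_linear)

lemma lagrange_poly:
  fixes x :: "'a \<Rightarrow> complex"
  assumes A: "finite A" "inj_on x A" and deg: "degree P < card A"
  shows "P = (\<Sum>i\<in>A. smult (poly P (x i) / (\<Prod>k\<in>A-{i}. x i - x k)) (\<Prod>k\<in>A-{i}. [:- x k, 1:]))"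
proof (rule poly_eqI_degree[of "x ` A"])
  let ?Q = "\<Sum>i\<in>A. smult (poly P (x i) / (\<Prod>k\<in>A-{i}. x i - x k)) (\<Prod>k\<in>A-{i}. [:- x k, 1:])"
  have cA: "card (x ` A) = card A" by (simp add: card_image A)
  show "degree P < card (x ` A)" using deg cA by simp
  have "degree ?Q \<le> card A - 1"
  proof (intro degree_sum_le A order_trans[OF degree_smult_le])
    fix i assume "i \<in> A"
    then show "degree (\<Prod>k\<in>A-{i}. [:- x k, 1:]) \<le> card A - 1"
      using A by (simp add: degree_prod_linear)
  qed
  then show "degree ?Q < card (x ` A)" using deg cA by simp
  fix z assume "z \<in> x ` A"
  then obtain j where j: "j \<in> A" "z = x j" by auto
  have nz: "(\<Prod>k\<in>A-{j}. x j - x k) \<noteq> 0" using A j by (auto simp: inj_on_def)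
  have "poly ?Q z = (\<Sum>i\<in>A. if i = j then poly P (x j) else 0)"
    unfolding poly_sum
  proof (intro sum.cong refl)
    fix i assume i: "i \<in> A"
    show "poly (smult (poly P (x i) / (\<Prod>k\<in>A-{i}. x i - x k)) (\<Prod>k\<in>A-{i}. [:- x k, 1:])) z =
       (if i = j then poly P (x j) else 0)"
    proof (cases "i = j")
      case False
      then have "(\<Prod>k\<in>A-{i}. poly [:- x k, 1:] z) = 0"
        using A j i by (intro prod_zero) auto
      then show ?thesis using False by (simp add: poly_prod)
    qed (use nz j in \<open>simp add: poly_prod\<close>)
  qed
  then show "poly P z = poly ?Q z" using A j by simp
qed

text \<open>Comparison of the top coefficients in Lagrange's interpolation formula.\<close>
lemma lagrange_leading_coeff:
  fixes x :: "'a \<Rightarrow> complex"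
  assumes A: "finite A" "inj_on x A" and deg: "degree P < card A"
  shows "(\<Sum>i\<in>A. poly P (x i) / (\<Prod>k\<in>A-{i}. x i - x k)) = coeff P (card A - 1)"
proof -
  have "coeff P (card A - 1) = (\<Sum>i\<in>A. poly P (x i) / (\<Prod>k\<in>A-{i}. x i - x k) * coeff (\<Prod>k\<in>A-{i}. [:- x k, 1:]) (card A - 1))"
    by (subst lagrange_poly[OF assms]) (simp add: coeff_sum)
  also have "\<dots> = (\<Sum>i\<in>A. poly P (x i) / (\<Prod>k\<in>A-{i}. x i - x k))"
  proof (intro sum.cong refl)
    fix i assume "i \<in> A"
    then have "card A - 1 = card (A - {i})" using A by simp
    then show "poly P (x i) / (\<Prod>k\<in>A-{i}. x i - x k) * coeff (\<Prod>k\<in>A-{i}. [:- x k, 1:]) (card A - 1)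
      = poly P (x i) / (\<Prod>k\<in>A-{i}. x i - x k)"
      using A coeff_prod_linear_card[of "A - {i}" x] by simp
  qed
  finally show ?thesis ..
qed

lemma coeff_prod_linear_second: "finite A \<Longrightarrow> A \<noteq> {} \<Longrightarrow> coeff (\<Prod>k\<in>A. [:- x k, 1:]) (card A - 1) = - (\<Sum>k\<in>A. x k)" for x :: "'a \<Rightarrow> complex"
proof (induction A rule: finite_ne_induct)
  case (insert a A)
  then have "card A \<noteq> 0" by auto
  then obtain m where m: "card A = Suc m" using not0_implies_Suc by blast
  then show ?case using insert coeff_prod_linear_card[of A x]
    by (simp add: algebra_simps)
qed auto

text \<open>
  The numerator has degree \<open>card A\<close>, one too many for the interpolation formula. Subtracting \<open>\<Prod> (z - s\<^sub>i)\<close>, which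
  vanishes at all nodes, lowers the degree.
\<close>
lemma lagrange_sum_top:
  fixes s a :: "'a \<Rightarrow> complex"
  assumes A: "finite A" "A \<noteq> {}" "inj_on s A"
  shows "(\<Sum>j\<in>A. (\<Prod>i\<in>A. s j - a i) / (\<Prod>k\<in>A-{j}. s j - s k)) = (\<Sum>j\<in>A. s j) - (\<Sum>i\<in>A. a i)"
proof -
  define P where "P = (\<Prod>i\<in>A. [:- a i, 1:]) - (\<Prod>i\<in>A. [:- s i, 1:])"
  have cA: "card A > 0" using A by (simp add: card_gt_0_iff)
  have "coeff P (card A) = 0" using A by (simp add: P_def coeff_prod_linear_card)
  moreover have "degree P \<le> card A"
    unfolding P_def using A by (intro degree_diff_le) (auto simp: degree_prod_linear)
  ultimately have deg: "degree P < card A"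
    using cA by (metis degree_0 leading_coeff_0_iff le_neq_implies_less)
  have "poly P (s j) = (\<Prod>i\<in>A. s j - a i)" if "j \<in> A" for j
    using that A unfolding P_def by (auto simp: poly_prod)
  then have "(\<Sum>j\<in>A. (\<Prod>i\<in>A. s j - a i) / (\<Prod>k\<in>A-{j}. s j - s k)) =
      (\<Sum>j\<in>A. poly P (s j) / (\<Prod>k\<in>A-{j}. s j - s k))" by simp
  also have "\<dots> = coeff P (card A - 1)"
    by (rule lagrange_leading_coeff[OF A(1) A(3) deg])
  also have "\<dots> = (\<Sum>j\<in>A. s j) - (\<Sum>i\<in>A. a i)"
    using coeff_prod_linear_second[OF A(1,2), of a] coeff_prod_linear_second[OF A(1,2), of s] by (simp add: P_def)
  finally show ?thesis .
qed

lemma lagrange_sum_below: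
  fixes s :: "'a \<Rightarrow> complex" and b :: "'b \<Rightarrow> complex"
  assumes A: "finite A" "inj_on s A" and B: "finite B" "card A = Suc (card B)"
  shows "(\<Sum>j\<in>A. (\<Prod>k\<in>B. b k - s j) / (\<Prod>k\<in>A-{j}. s j - s k)) = (-1) ^ card B"
proof -
  define P where "P = smult ((-1) ^ card B) (\<Prod>k\<in>B. [:- b k, 1:])"
  have deg: "degree P < card A" using B by (simp add: P_def degree_prod_linear)
  have "poly P z = (\<Prod>k\<in>B. b k - z)" for z
  proof -
    have "poly P z = (\<Prod>k\<in>B. -1) * (\<Prod>k\<in>B. z - b k)" by (simp add: P_def poly_prod)
    also have "\<dots> = (\<Prod>k\<in>B. b k - z)" by (subst prod.distrib[symmetric]) simp
    finally show ?thesis .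
  qed
  then have "(\<Sum>j\<in>A. (\<Prod>k\<in>B. b k - s j) / (\<Prod>k\<in>A-{j}. s j - s k)) = coeff P (card A - 1)"
    using lagrange_leading_coeff[OF A deg] by simp
  then show ?thesis using B by (simp add: P_def coeff_prod_linear_card)
qed

text \<open>
  Lagrange interpolation for products of a function \<open>d x y\<close> that is a difference \<open>h x - h y\<close> up to
  factors depending on \<open>x\<close> and \<open>y\<close> separately. This covers \<open>x - y\<close> as well as \<open>sin (\<pi> (x - y))\<close>.
\<close>
lemma lagrange_prod:
  fixes \<kappa> :: complex and g h :: "complex \<Rightarrow> complex" and p s :: "nat \<Rightarrow> complex"
  defines "d \<equiv> (\<lambda>x y. \<kappa> * g x * g y * (h x - h y))"
  assumes A: "finite A" "inj_on (\<lambda>i. h (p i)) A" and B: "finite B" "card A = Suc (card B)"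
    and nz: "\<kappa> \<noteq> 0" "\<And>x. g x \<noteq> 0"
  shows "(\<Prod>k\<in>B. d z (s k)) = (\<Sum>i\<in>A. (\<Prod>k\<in>B. d (p i) (s k)) * (\<Prod>k\<in>A-{i}. d z (p k) / d (p i) (p k)))"
proof -
  define P where "P = (\<Prod>k\<in>B. [:- h (s k), 1:])"
  have deg: "degree P < card A" using B by (simp add: P_def degree_prod_linear)
  have polyP: "poly P (h z) = (\<Prod>k\<in>B. h z - h (s k))" for z by (simp add: P_def poly_prod)
  have "poly P (h z) = (\<Sum>i\<in>A. poly P (h (p i)) / (\<Prod>k\<in>A-{i}. h (p i) - h (p k)) * (\<Prod>k\<in>A-{i}. h z - h (p k)))"
    by (subst lagrange_poly[OF A deg]) (simp add: poly_sum poly_prod)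
  also have "\<dots> = (\<Sum>i\<in>A. (\<Prod>k\<in>B. h (p i) - h (s k)) * (\<Prod>k\<in>A-{i}. (h z - h (p k)) / (h (p i) - h (p k))))"
    by (simp add: polyP prod_dividef)
  finally have L: "(\<Prod>k\<in>B. h z - h (s k)) = (\<Sum>i\<in>A. (\<Prod>k\<in>B. h (p i) - h (s k)) * (\<Prod>k\<in>A-{i}. (h z - h (p k)) / (h (p i) - h (p k))))"
    by (simp add: polyP)
  define G where "G = (\<Prod>k\<in>B. \<kappa> * g (s k))"
  have D: "(\<Prod>k\<in>B. d w (s k)) = G * g w ^ card B * (\<Prod>k\<in>B. h w - h (s k))" for w
    by (simp add: d_def G_def prod.distrib mult_ac power_mult_distrib)
  have E: "(\<Prod>k\<in>A-{i}. d z (p k) / d (p i) (p k)) = (g z / g (p i)) ^ card B * (\<Prod>k\<in>A-{i}. (h z - h (p k)) / (h (p i) - h (p k)))"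
    if "i \<in> A" for i
  proof -
    have "(\<Prod>k\<in>A-{i}. d z (p k) / d (p i) (p k)) = (\<Prod>k\<in>A-{i}. (g z / g (p i)) * ((h z - h (p k)) / (h (p i) - h (p k))))"
      using nz by (intro prod.cong refl) (simp add: d_def)
    also have "\<dots> = (g z / g (p i)) ^ card B * (\<Prod>k\<in>A-{i}. (h z - h (p k)) / (h (p i) - h (p k)))"
      unfolding prod.distrib using A B that by simp
    finally show ?thesis .
  qed
  have "(\<Prod>k\<in>B. d z (s k)) = G * g z ^ card B * (\<Sum>i\<in>A. (\<Prod>k\<in>B. h (p i) - h (s k)) * (\<Prod>k\<in>A-{i}. (h z - h (p k)) / (h (p i) - h (p k))))"
    unfolding D L ..
  also have "\<dots> = (\<Sum>i\<in>A. (\<Prod>k\<in>B. d (p i) (s k)) * (\<Prod>k\<in>A-{i}. d z (p k) / d (p i) (p k)))"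
    unfolding sum_distrib_left
  proof (intro sum.cong refl)
    fix i assume i: "i \<in> A"
    show "G * g z ^ card B * ((\<Prod>k\<in>B. h (p i) - h (s k)) * (\<Prod>k\<in>A-{i}. (h z - h (p k)) / (h (p i) - h (p k)))) =
      (\<Prod>k\<in>B. d (p i) (s k)) * (\<Prod>k\<in>A-{i}. d z (p k) / d (p i) (p k))"
      unfolding D E[OF i] using nz(2)[of "p i"] by (simp add: power_divide)
  qed
  finally show ?thesis .
qed

text \<open>
  A function that can be interpolated in each variable separately is interpolated in all of them
  at once; the nodes are indexed by maps \<open>\<sigma>\<close>.
\<close>
lemma tensor_interpolation:
  fixes T :: "(nat \<Rightarrow> 'b) \<Rightarrow> complex"
  assumes "finite J" and step: "\<And>s j. j \<in> J \<Longrightarrow> T s = (\<Sum>i\<in>I. T (s(j := p i)) * L i (s j))"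
  shows "T s = (\<Sum>\<sigma>\<in>J \<rightarrow>\<^sub>E I. T (\<lambda>j. if j \<in> J then p (\<sigma> j) else s j) * (\<Prod>j\<in>J. L (\<sigma> j) (s j)))"
  using assms
proof (induction J rule: finite_induct)
  case (insert a J)
  have "T s = (\<Sum>\<sigma>\<in>J \<rightarrow>\<^sub>E I. T (\<lambda>j. if j \<in> J then p (\<sigma> j) else s j) * (\<Prod>j\<in>J. L (\<sigma> j) (s j)))"
    using insert by blast
  also have "\<dots> = (\<Sum>\<sigma>\<in>J \<rightarrow>\<^sub>E I. \<Sum>i\<in>I. T (\<lambda>j. if j \<in> insert a J then p ((\<sigma>(a := i)) j) else s j) * (\<Prod>j\<in>insert a J. L ((\<sigma>(a := i)) j) (s j)))"
  proof (intro sum.cong refl)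
    fix \<sigma> assume "\<sigma> \<in> J \<rightarrow>\<^sub>E I"
    define u where "u = (\<lambda>j. if j \<in> J then p (\<sigma> j) else s j)"
    have "T u = (\<Sum>i\<in>I. T (u(a := p i)) * L i (u a))" by (rule insert.prems) simp
    moreover have "u(a := p i) = (\<lambda>j. if j \<in> insert a J then p ((\<sigma>(a := i)) j) else s j)" for i
      using insert.hyps by (auto simp: u_def)
    moreover have "u a = s a" using insert.hyps by (simp add: u_def)
    ultimately have Tu: "T u = (\<Sum>i\<in>I. T (\<lambda>j. if j \<in> insert a J then p ((\<sigma>(a := i)) j) else s j) * L i (s a))" by simp
    have pr: "(\<Prod>j\<in>insert a J. L ((\<sigma>(a := i)) j) (s j)) = L i (s a) * (\<Prod>j\<in>J. L (\<sigma> j) (s j))" for i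
    proof -
      have "(\<Prod>j\<in>J. L ((\<sigma>(a := i)) j) (s j)) = (\<Prod>j\<in>J. L (\<sigma> j) (s j))"
        using insert.hyps by (intro prod.cong) auto
      then show ?thesis using insert.hyps by simp
    qed
    show "T (\<lambda>j. if j \<in> J then p (\<sigma> j) else s j) * (\<Prod>j\<in>J. L (\<sigma> j) (s j)) =
      (\<Sum>i\<in>I. T (\<lambda>j. if j \<in> insert a J then p ((\<sigma>(a := i)) j) else s j) * (\<Prod>j\<in>insert a J. L ((\<sigma>(a := i)) j) (s j)))"
      unfolding pr u_def[symmetric] Tu sum_distrib_right by (simp add: mult_ac)
  qed
  also have "\<dots> = (\<Sum>(i, \<sigma>)\<in>I \<times> (J \<rightarrow>\<^sub>E I). T (\<lambda>j. if j \<in> insert a J then p ((\<sigma>(a := i)) j) else s j) * (\<Prod>j\<in>insert a J. L ((\<sigma>(a := i)) j) (s j)))"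
    by (subst sum.swap) (simp add: sum.cartesian_product)
  also have "\<dots> = (\<Sum>\<sigma>\<in>insert a J \<rightarrow>\<^sub>E I. T (\<lambda>j. if j \<in> insert a J then p (\<sigma> j) else s j) * (\<Prod>j\<in>insert a J. L (\<sigma> j) (s j)))"
    unfolding PiE_insert_eq
    by (subst sum.reindex[OF inj_combinator[OF insert.hyps(2)]]) (simp add: case_prod_unfold)
  finally show ?case .
qed simp

text \<open>Vandermonde's product with a general antisymmetric function \<open>d\<close> in place of the difference.\<close>
definition vandermonde :: "(complex \<Rightarrow> complex \<Rightarrow> complex) \<Rightarrow> nat \<Rightarrow> (nat \<Rightarrow> complex) \<Rightarrow> complex" where
  "vandermonde d n s = (\<Prod>j\<in>{1..n}. \<Prod>k\<in>{1..<j}. d (s j) (s k))"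

text \<open>
  As a function of one variable the product is, up to a constant, a product of \<open>n - 1\<close> factors, so it can be
  interpolated at \<open>n\<close> nodes.
\<close>
lemma vandermonde_split:
  assumes anti: "\<And>x y. d y x = - d x y" and j: "j \<in> {1..n}"
  obtains c where "\<And>z. vandermonde d n (s(j := z)) = c * (\<Prod>k\<in>{1..n}-{j}. d z (s k))"
proof -
  define R where "R = (\<Prod>a\<in>{1..n}-{j}. \<Prod>k\<in>{1..<a}-{j}. d (s a) (s k))"
  have "vandermonde d n (s(j := z)) = R * (\<Prod>a\<in>{j<..n}. -1) * (\<Prod>k\<in>{1..n}-{j}. d z (s k))" for z
  proof -
    let ?s = "s(j := z)"
    have "vandermonde d n ?s = (\<Prod>k\<in>{1..<j}. d z (s k)) * (\<Prod>a\<in>{1..n}-{j}. \<Prod>k\<in>{1..<a}. d (?s a) (?s k))"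
      unfolding vandermonde_def using j by (subst prod.remove[of _ j]) auto
    also have "(\<Prod>a\<in>{1..n}-{j}. \<Prod>k\<in>{1..<a}. d (?s a) (?s k)) =
       (\<Prod>a\<in>{1..n}-{j}. (if j < a then d (s a) z else 1) * (\<Prod>k\<in>{1..<a}-{j}. d (s a) (s k)))"
    proof (intro prod.cong refl)
      fix a assume a: "a \<in> {1..n}-{j}"
      show "(\<Prod>k\<in>{1..<a}. d (?s a) (?s k)) = (if j < a then d (s a) z else 1) * (\<Prod>k\<in>{1..<a}-{j}. d (s a) (s k))"
      proof (cases "j < a")
        case True
        then have "(\<Prod>k\<in>{1..<a}. d (?s a) (?s k)) = d (?s a) (?s j) * (\<Prod>k\<in>{1..<a}-{j}. d (?s a) (?s k))"
          using j by (intro prod.remove) auto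
        then show ?thesis using a True by simp
      next
        case False
        then have "{1..<a}-{j} = {1..<a}" by auto
        then show ?thesis using a False by (auto intro!: prod.cong)
      qed
    qed
    also have "\<dots> = (\<Prod>a\<in>{1..n}-{j}. if j < a then d (s a) z else 1) * R"
      by (simp add: prod.distrib R_def)
    also have "(\<Prod>a\<in>{1..n}-{j}. if j < a then d (s a) z else 1) = (\<Prod>a\<in>{j<..n}. d (s a) z)"
      using j by (intro prod.mono_neutral_cong_right) auto
    also have "\<dots> = (\<Prod>a\<in>{j<..n}. -1) * (\<Prod>a\<in>{j<..n}. d z (s a))"
      by (subst prod.distrib[symmetric], rule prod.cong[OF refl], subst anti) simp
    finally have eq: "vandermonde d n ?s = (\<Prod>k\<in>{1..<j}. d z (s k)) * ((\<Prod>a\<in>{j<..n}. -1) * (\<Prod>a\<in>{j<..n}. d z (s a)) * R)" .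
    have U: "{1..n} - {j} = {1..<j} \<union> {j<..n}" using j by auto
    have "(\<Prod>k\<in>{1..n}-{j}. d z (s k)) = (\<Prod>k\<in>{1..<j}. d z (s k)) * (\<Prod>k\<in>{j<..n}. d z (s k))"
      unfolding U by (rule prod.union_disjoint) auto
    then show ?thesis unfolding eq by (simp add: mult_ac)
  qed
  then show ?thesis using that by blast
qed

text \<open>
  The term of \<open>\<sigma>\<close> carries a Vandermonde product of the nodes, so only permutations contribute
  (\<open>vandermonde_eq_0\<close>).
\<close>
lemma vandermonde_interpolation:
  fixes \<kappa> :: complex and g h :: "complex \<Rightarrow> complex" and p s :: "nat \<Rightarrow> complex"
  defines "d \<equiv> (\<lambda>x y. \<kappa> * g x * g y * (h x - h y))"
  assumes inj: "inj_on (\<lambda>i. h (p i)) {1..n}" and nz: "\<kappa> \<noteq> 0" "\<And>x. g x \<noteq> 0"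
  shows "vandermonde d n s = (\<Sum>\<sigma>\<in>{1..n} \<rightarrow>\<^sub>E {1..n}. vandermonde d n (\<lambda>j. p (\<sigma> j)) *
     (\<Prod>j\<in>{1..n}. \<Prod>k\<in>{1..n}-{\<sigma> j}. d (s j) (p k) / d (p (\<sigma> j)) (p k)))"
proof -
  have anti: "d y x = - d x y" for x y by (simp add: d_def algebra_simps)
  have "vandermonde d n s = (\<Sum>\<sigma>\<in>{1..n} \<rightarrow>\<^sub>E {1..n}. vandermonde d n (\<lambda>j. if j \<in> {1..n} then p (\<sigma> j) else s j) *
     (\<Prod>j\<in>{1..n}. (\<lambda>i z. \<Prod>k\<in>{1..n}-{i}. d z (p k) / d (p i) (p k)) (\<sigma> j) (s j)))"
  proof (rule tensor_interpolation[OF finite_atLeastAtMost])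
    fix s :: "nat \<Rightarrow> complex" and j assume j: "j \<in> {1..n}"
    obtain c where c: "\<And>z. vandermonde d n (s(j := z)) = c * (\<Prod>k\<in>{1..n}-{j}. d z (s k))"
      by (rule vandermonde_split[where d = d and s = s, OF anti j]) (rule that)
    have "vandermonde d n s = c * (\<Prod>k\<in>{1..n}-{j}. d (s j) (s k))"
      using c[of "s j"] by simp
    also have "(\<Prod>k\<in>{1..n}-{j}. d (s j) (s k)) =
        (\<Sum>i\<in>{1..n}. (\<Prod>k\<in>{1..n}-{j}. d (p i) (s k)) * (\<Prod>k\<in>{1..n}-{i}. d (s j) (p k) / d (p i) (p k)))"
      unfolding d_def by (rule lagrange_prod[where h = h and p = p and \<kappa> = \<kappa> and g = g, OF _ inj _ _ nz]) (use j in auto)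
    finally show "vandermonde d n s = (\<Sum>i\<in>{1..n}. vandermonde d n (s(j := p i)) * (\<Prod>k\<in>{1..n}-{i}. d (s j) (p k) / d (p i) (p k)))"
      unfolding c by (simp add: sum_distrib_left mult_ac)
  qed
  also have "\<dots> = (\<Sum>\<sigma>\<in>{1..n} \<rightarrow>\<^sub>E {1..n}. vandermonde d n (\<lambda>j. p (\<sigma> j)) *
     (\<Prod>j\<in>{1..n}. \<Prod>k\<in>{1..n}-{\<sigma> j}. d (s j) (p k) / d (p (\<sigma> j)) (p k)))"
    unfolding vandermonde_def by (intro sum.cong refl arg_cong2[where f = "(*)"] prod.cong) auto
  finally show ?thesis .
qed

lemma vandermonde_eq_0:
  assumes "\<And>x. d x x = 0" "\<not> inj_on \<sigma> {1..n}"
  shows "vandermonde d n (\<lambda>j. p (\<sigma> j)) = 0"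
proof -
  obtain a b where ab: "a \<in> {1..n}" "b \<in> {1..n}" "\<sigma> a = \<sigma> b" "b < a"
    using assms(2) unfolding inj_on_def by (metis linorder_neqE_nat)
  have 0: "(\<Prod>k\<in>{1..<a}. d (p (\<sigma> a)) (p (\<sigma> k))) = 0"
    by (rule prod_zero) (use ab assms(1) in \<open>auto intro!: bexI[of _ b]\<close>)
  have "\<exists>j\<in>{1..n}. (\<Prod>k\<in>{1..<j}. d (p (\<sigma> j)) (p (\<sigma> k))) = 0"
    using 0 ab(1) by (rule bexI[where P = "\<lambda>j. (\<Prod>k\<in>{1..<j}. d (p (\<sigma> j)) (p (\<sigma> k))) = 0"])
  then show ?thesis unfolding vandermonde_def by (intro prod_zero) simp_all
qed

lemma prod_offdiag_triangle:
  "(\<Prod>j\<in>{1..n::nat}. \<Prod>k\<in>{1..n}-{j}. f j k) = (\<Prod>j\<in>{1..n}. \<Prod>k\<in>{1..<j}. f j k * f k j :: 'a :: comm_monoid_mult)"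
proof -
  have "(\<Prod>k\<in>{1..n}-{j}. f j k) = (\<Prod>k\<in>{1..<j}. f j k) * (\<Prod>k\<in>{j<..n}. f j k)" if "j \<in> {1..n}" for j
  proof -
    have U: "{1..n} - {j} = {1..<j} \<union> {j<..n}" using that by auto
    show ?thesis unfolding U by (rule prod.union_disjoint) auto
  qed
  then have "(\<Prod>j\<in>{1..n}. \<Prod>k\<in>{1..n}-{j}. f j k) = (\<Prod>j\<in>{1..n}. \<Prod>k\<in>{1..<j}. f j k) * (\<Prod>j\<in>{1..n}. \<Prod>k\<in>{j<..n}. f j k)"
    by (simp add: prod.distrib)
  also have "(\<Prod>j\<in>{1..n}. \<Prod>k\<in>{j<..n}. f j k) = (\<Prod>(j,k)\<in>Sigma {1..n} (\<lambda>j. {j<..n}). f j k)"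
    by (simp add: prod.Sigma)
  also have "\<dots> = (\<Prod>(j,k)\<in>Sigma {1..n} (\<lambda>j. {1..<j}). f k j)"
    by (rule prod.reindex_bij_witness[of _ "\<lambda>(j,k). (k,j)" "\<lambda>(j,k). (k,j)"]) auto
  also have "\<dots> = (\<Prod>j\<in>{1..n}. \<Prod>k\<in>{1..<j}. f k j)"
    by (simp add: prod.Sigma)
  finally show ?thesis by (simp add: prod.distrib)
qed

text \<open>The reflection formula turns each pair \<open>1 / (\<Gamma>(w) \<Gamma>(- w))\<close> into \<open>- w sin (\<pi> w) / \<pi>\<close>.\<close>
lemma rGamma_prod_vandermonde:
  "rGamma_prod n \<beta> = (\<Prod>j\<in>{1..n}. \<Prod>k\<in>{1..<j}. - 1 / of_real pi) *
     vandermonde (\<lambda>x y. x - y) n (\<lambda>j. \<i> * \<beta> j) * vandermonde (\<lambda>x y. sin (of_real pi * (x - y))) n (\<lambda>j. \<i> * \<beta> j)"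
proof -
  have "rGamma_prod n \<beta> = (\<Prod>j\<in>{1..n}. \<Prod>k\<in>{1..<j}. rGamma (\<i> * \<beta> k - \<i> * \<beta> j) * rGamma (\<i> * \<beta> j - \<i> * \<beta> k))"
    unfolding rGamma_prod_def by (rule prod_offdiag_triangle)
  also have "\<dots> = (\<Prod>j\<in>{1..n}. \<Prod>k\<in>{1..<j}. (- 1 / of_real pi) * (\<i> * \<beta> j - \<i> * \<beta> k) * sin (of_real pi * (\<i> * \<beta> j - \<i> * \<beta> k)))"
  proof (intro prod.cong refl)
    fix j k
    define w where "w = \<i> * \<beta> j - \<i> * \<beta> k"
    have e: "\<i> * \<beta> k - \<i> * \<beta> j = - w" by (simp add: w_def)
    show "rGamma (\<i> * \<beta> k - \<i> * \<beta> j) * rGamma (\<i> * \<beta> j - \<i> * \<beta> k) = (- 1 / of_real pi) * (\<i> * \<beta> j - \<i> * \<beta> k) * sin (of_real pi * (\<i> * \<beta> j - \<i> * \<beta> k))"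
      unfolding e w_def[symmetric] using rGamma_mult_uminus[of w] by (simp add: mult.commute)
  qed
  finally show ?thesis by (simp only: prod.distrib vandermonde_def)
qed

lemma rGamma_prod_permute:
  assumes "bij_betw \<sigma> {1..n} {1..n}"
  shows "rGamma_prod n (\<lambda>j. \<beta> (\<sigma> j)) = rGamma_prod n \<beta>"
proof -
  have "(\<Prod>k\<in>{1..n}-{j}. rGamma (\<i> * \<beta> (\<sigma> k) - \<i> * \<beta> (\<sigma> j))) = (\<Prod>k\<in>{1..n}-{\<sigma> j}. rGamma (\<i> * \<beta> k - \<i> * \<beta> (\<sigma> j)))"
    if j: "j \<in> {1..n}" for j
  proof (rule prod.reindex_bij_betw)
    show "bij_betw \<sigma> ({1..n} - {j}) ({1..n} - {\<sigma> j})"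
    proof (rule bij_betw_imageI)
      have inj: "inj_on \<sigma> {1..n}" and im: "\<sigma> ` {1..n} = {1..n}"
        using assms unfolding bij_betw_def by auto
      show "inj_on \<sigma> ({1..n} - {j})" by (rule inj_on_diff[OF inj])
      have "\<sigma> ` ({1..n} - {j}) = \<sigma> ` {1..n} - \<sigma> ` {j}"
        by (rule inj_on_image_set_diff[OF inj]) (use j in auto)
      then show "\<sigma> ` ({1..n} - {j}) = {1..n} - {\<sigma> j}" unfolding im by simp
    qed
  qed
  then show ?thesis
    unfolding rGamma_prod_def
    using prod.reindex_bij_betw[OF assms, of "\<lambda>j. \<Prod>k\<in>{1..n}-{j}. rGamma (\<i> * \<beta> k - \<i> * \<beta> j)"] by simp
qed

lemma card_bijective_selfmaps: "card {\<sigma> \<in> {1..n} \<rightarrow>\<^sub>E {1..n::nat}. inj_on \<sigma> {1..n}} = fact n"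
proof -
  have "card {\<sigma> \<in> {1..n} \<rightarrow>\<^sub>E {1..n}. inj_on \<sigma> {1..n}} = prod ((-) n) {0..<n}"
    by (subst card_inj_on_subset_funcset) auto
  also have "\<dots> = \<Prod>{1..n}"
    by (rule prod.reindex_bij_witness[of _ "\<lambda>i. n - i" "\<lambda>i. n - i"]) auto
  finally show ?thesis by (simp add: fact_prod)
qed

section \<open>Regularity and size of the factors of the integrands\<close>

lemma borel_measurable_rGamma [measurable (raw)]:
  "f \<in> borel_measurable M \<Longrightarrow> (\<lambda>x. rGamma (f x :: complex)) \<in> borel_measurable M"
  using measurable_compose[of f M borel "rGamma :: complex \<Rightarrow> complex" borel]
  by (simp add: borel_measurable_continuous_onI continuous_on_rGamma)

lemma borel_measurable_Gamma [measurable (raw)]: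
  "f \<in> borel_measurable M \<Longrightarrow> (\<lambda>x. Gamma (f x :: complex)) \<in> borel_measurable M"
  unfolding Gamma_def by measurable

lemma borel_measurable_sin_complex [measurable (raw)]:
  "f \<in> borel_measurable M \<Longrightarrow> (\<lambda>x. sin (f x :: complex)) \<in> borel_measurable M"
  using measurable_compose[of f M borel "sin :: complex \<Rightarrow> complex" borel]
  by (simp add: borel_measurable_continuous_onI continuous_on_sin)

lemma borel_measurable_exp_complex [measurable (raw)]:
  "f \<in> borel_measurable M \<Longrightarrow> (\<lambda>x. exp (f x :: complex)) \<in> borel_measurable M"
  using measurable_compose[of f M borel "exp :: complex \<Rightarrow> complex" borel]
  by (simp add: borel_measurable_continuous_onI continuous_on_exp)

lemma measurable_on_lines:
  assumes "j \<in> {1..n}"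
  shows "(\<lambda>t. on_lines c t j) \<in> borel_measurable (\<Pi>\<^sub>M j\<in>{1..n}. lborel)"
proof -
  have "(\<lambda>t. t j :: real) \<in> borel_measurable (\<Pi>\<^sub>M j\<in>{1..n}. lborel)"
    using measurable_component_singleton[OF assms, of "\<lambda>_. lborel :: real measure"] by simp
  then have "(\<lambda>t. complex_of_real (t j) + \<i> * c j) \<in> borel_measurable (\<Pi>\<^sub>M j\<in>{1..n}. lborel)"
    by measurable
  then show ?thesis by (simp add: on_lines_def Complex_eq)
qed

lemma holomorphic_coordinate: "(\<lambda>z. (\<beta>(j := z)) k) holomorphic_on S"
  by (cases "k = j") (auto intro: holomorphic_intros)

lemma Gamma_cross_bound:
  assumes r: "r > 0" and e: "e > 0"
  obtains C where "C > 0"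
    "\<And>\<beta> \<delta>. (\<And>j k. j \<in> {1..n} \<Longrightarrow> k \<in> {1..m} \<Longrightarrow> r \<le> Im (\<delta> k) - Im (\<beta> j) \<and> Im (\<delta> k) - Im (\<beta> j) \<le> R) \<Longrightarrow>
       norm (\<Prod>j\<in>{1..n}. \<Prod>k\<in>{1..m}. Gamma (\<i> * \<beta> j - \<i> * \<delta> k)) \<le> C * exp (- (pi/2 - e) * re_cross n m \<beta> \<delta>)"
proof -
  obtain K where K: "K > 0" "\<And>s. r \<le> Re s \<Longrightarrow> Re s \<le> R \<Longrightarrow> norm (Gamma s) \<le> K * exp (- (pi/2 - e) * \<bar>Im s\<bar>)"
    using Gamma_strip_bound[OF r e] by metis
  have "norm (\<Prod>j\<in>{1..n}. \<Prod>k\<in>{1..m}. Gamma (\<i> * \<beta> j - \<i> * \<delta> k)) \<le> (K ^ m) ^ n * exp (- (pi/2 - e) * re_cross n m \<beta> \<delta>)"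
    if "\<And>j k. j \<in> {1..n} \<Longrightarrow> k \<in> {1..m} \<Longrightarrow> r \<le> Im (\<delta> k) - Im (\<beta> j) \<and> Im (\<delta> k) - Im (\<beta> j) \<le> R" for \<beta> \<delta>
  proof -
    have "norm (\<Prod>j\<in>{1..n}. \<Prod>k\<in>{1..m}. Gamma (\<i> * \<beta> j - \<i> * \<delta> k)) = (\<Prod>j\<in>{1..n}. \<Prod>k\<in>{1..m}. norm (Gamma (\<i> * \<beta> j - \<i> * \<delta> k)))"
      by (simp add: prod_norm)
    also have "\<dots> \<le> (\<Prod>j\<in>{1..n}. \<Prod>k\<in>{1..m}. K * exp (- (pi/2 - e) * \<bar>Re (\<beta> j) - Re (\<delta> k)\<bar>))"
    proof (intro prod_mono conjI prod_nonneg norm_ge_zero ballI)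
      fix j k assume "j \<in> {1..n}" "k \<in> {1..m}"
      then show "norm (Gamma (\<i> * \<beta> j - \<i> * \<delta> k)) \<le> K * exp (- (pi/2 - e) * \<bar>Re (\<beta> j) - Re (\<delta> k)\<bar>)"
        using that[of j k] K(2)[of "\<i> * \<beta> j - \<i> * \<delta> k"] by simp
    qed
    also have "\<dots> = (K ^ m) ^ n * exp (- (pi/2 - e) * re_cross n m \<beta> \<delta>)"
      by (simp only: prod.distrib exp_sum[symmetric] finite_atLeastAtMost sum_distrib_left[symmetric] re_cross_def)
         simp
    finally show ?thesis .
  qed
  then show ?thesis using that[of "(K ^ m) ^ n"] K(1) by simp
qed

text \<open>
  The factor of the kernel that depends on one integration variable \<open>z\<close>. Its poles from \<open>\<gamma>\<close> lie on and above the
  heights \<open>Im \<gamma>\<^sub>i\<close>, those from \<open>\<delta>\<close> on and below the heights \<open>Im \<delta>\<^sub>k\<close>.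
\<close>
definition gam :: "nat \<Rightarrow> nat \<Rightarrow> (nat \<Rightarrow> complex) \<Rightarrow> (nat \<Rightarrow> complex) \<Rightarrow> complex \<Rightarrow> complex" where
  "gam n l \<gamma> \<delta> z = (\<Prod>i\<in>{1..n}. Gamma (\<i> * z - \<i> * \<gamma> i)) * (\<Prod>k\<in>{1..l}. Gamma (\<i> * \<delta> k - \<i> * z))"

lemma re_size_one: "re_size 1 (\<lambda>_. z) = \<bar>Re z\<bar>" by (simp add: re_size_def)

text \<open>The bound is uniform in \<open>Re \<gamma>\<^sub>i\<close> on bounded sets, because the \<open>\<gamma>\<^sub>i\<close> are perturbed later.\<close>
lemma gam_bound:
  assumes e: "0 < e" "e < pi/2"
    and below: "\<And>k. k \<in> {1..l} \<Longrightarrow> Im (\<delta> k) < P" and above: "\<And>i. i \<in> {1..n} \<Longrightarrow> Q < g i"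
  obtains C where "C > 0"
    "\<And>\<gamma> z. (\<And>i. i \<in> {1..n} \<Longrightarrow> Im (\<gamma> i) = g i \<and> \<bar>Re (\<gamma> i)\<bar> \<le> R) \<Longrightarrow> P \<le> Im z \<Longrightarrow> Im z \<le> Q \<Longrightarrow>
       norm (gam n l \<gamma> \<delta> z) \<le> C * exp (- (pi/2 - e) * (real n + real l) * \<bar>Re z\<bar>)"
proof -
  define r where "r = Min (insert 1 ((\<lambda>i. g i - Q) ` {1..n} \<union> (\<lambda>k. P - Im (\<delta> k)) ` {1..l}))"
  have r: "r > 0" unfolding r_def using below above by (subst Min_gr_iff) auto
  have r1: "r \<le> g i - Q" if "i \<in> {1..n}" for i unfolding r_def using that by (intro Min_le) auto
  have r2: "r \<le> P - Im (\<delta> k)" if "k \<in> {1..l}" for k unfolding r_def using that by (intro Min_le) auto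
  define S where "S = Max (insert 1 ((\<lambda>i. g i - P) ` {1..n} \<union> (\<lambda>k. Q - Im (\<delta> k)) ` {1..l}))"
  have S1: "g i - P \<le> S" if "i \<in> {1..n}" for i unfolding S_def using that by (intro Max_ge) auto
  have S2: "Q - Im (\<delta> k) \<le> S" if "k \<in> {1..l}" for k unfolding S_def using that by (intro Max_ge) auto
  obtain C1 where C1: "C1 > 0" "\<And>\<beta> \<delta>. (\<And>j k. j \<in> {1..1::nat} \<Longrightarrow> k \<in> {1..n} \<Longrightarrow> r \<le> Im (\<delta> k) - Im (\<beta> j) \<and> Im (\<delta> k) - Im (\<beta> j) \<le> S) \<Longrightarrow>
       norm (\<Prod>j\<in>{1..1::nat}. \<Prod>k\<in>{1..n}. Gamma (\<i> * \<beta> j - \<i> * \<delta> k)) \<le> C1 * exp (- (pi/2 - e) * re_cross 1 n \<beta> \<delta>)"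
    using Gamma_cross_bound[OF r e(1), of 1 n S] by metis
  obtain C2 where C2: "C2 > 0" "\<And>\<beta> \<delta>. (\<And>j k. j \<in> {1..l} \<Longrightarrow> k \<in> {1..1::nat} \<Longrightarrow> r \<le> Im (\<delta> k) - Im (\<beta> j) \<and> Im (\<delta> k) - Im (\<beta> j) \<le> S) \<Longrightarrow>
       norm (\<Prod>j\<in>{1..l}. \<Prod>k\<in>{1..1::nat}. Gamma (\<i> * \<beta> j - \<i> * \<delta> k)) \<le> C2 * exp (- (pi/2 - e) * re_cross l 1 \<beta> \<delta>)"
    using Gamma_cross_bound[OF r e(1), of l 1 S] by metis
  define C where "C = (C1 * exp ((pi/2 - e) * (real n * \<bar>R\<bar>))) * (C2 * exp ((pi/2 - e) * re_size l \<delta>))"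
  have "norm (gam n l \<gamma> \<delta> z) \<le> C * exp (- (pi/2 - e) * (real n + real l) * \<bar>Re z\<bar>)"
    if g: "\<And>i. i \<in> {1..n} \<Longrightarrow> Im (\<gamma> i) = g i \<and> \<bar>Re (\<gamma> i)\<bar> \<le> R" and z: "P \<le> Im z" "Im z \<le> Q" for \<gamma> z
  proof -
    have s: "re_size n \<gamma> \<le> real n * \<bar>R\<bar>"
    proof -
      have "re_size n \<gamma> \<le> (\<Sum>i\<in>{1..n}. \<bar>R\<bar>)" unfolding re_size_def using g by (intro sum_mono) fastforce
      then show ?thesis by simp
    qed
    have "norm (\<Prod>i\<in>{1..n}. Gamma (\<i> * z - \<i> * \<gamma> i)) \<le> C1 * exp (- (pi/2 - e) * re_cross 1 n (\<lambda>_. z) \<gamma>)"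
    proof -
      have "r \<le> Im (\<gamma> k) - Im z \<and> Im (\<gamma> k) - Im z \<le> S" if "k \<in> {1..n}" for k
        using g[OF that] r1[OF that] S1[OF that] z by linarith
      with C1(2)[of \<gamma> "\<lambda>_. z"] show ?thesis by simp
    qed
    also have "\<dots> \<le> C1 * exp ((pi/2 - e) * (real n * \<bar>R\<bar>) - (pi/2 - e) * (real n * \<bar>Re z\<bar>))"
    proof -
      have "(pi/2 - e) * (real n * \<bar>Re z\<bar> - real n * \<bar>R\<bar>) \<le> (pi/2 - e) * re_cross 1 n (\<lambda>_. z) \<gamma>"
        using re_cross_ge[of n 1 "\<lambda>_. z" \<gamma>] s e by (intro mult_left_mono) (auto simp: re_size_one[unfolded One_nat_def])
      then show ?thesis using C1 by (intro mult_left_mono) (auto simp: algebra_simps)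
    qed
    finally have 1: "norm (\<Prod>i\<in>{1..n}. Gamma (\<i> * z - \<i> * \<gamma> i)) \<le> C1 * exp ((pi/2 - e) * (real n * \<bar>R\<bar>) - (pi/2 - e) * (real n * \<bar>Re z\<bar>))" .
    have "norm (\<Prod>k\<in>{1..l}. Gamma (\<i> * \<delta> k - \<i> * z)) \<le> C2 * exp (- (pi/2 - e) * re_cross l 1 \<delta> (\<lambda>_. z))"
    proof -
      have "r \<le> Im z - Im (\<delta> k) \<and> Im z - Im (\<delta> k) \<le> S" if "k \<in> {1..l}" for k
        using r2[OF that] S2[OF that] z by linarith
      with C2(2)[of "\<lambda>_. z" \<delta>] show ?thesis by simp
    qed
    also have "\<dots> \<le> C2 * exp ((pi/2 - e) * re_size l \<delta> - (pi/2 - e) * (real l * \<bar>Re z\<bar>))"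
    proof -
      have "(pi/2 - e) * (real l * \<bar>Re z\<bar> - re_size l \<delta>) \<le> (pi/2 - e) * re_cross l 1 \<delta> (\<lambda>_. z)"
        using re_cross_ge[of l 1 "\<lambda>_. z" \<delta>] e by (intro mult_left_mono) (auto simp: re_size_one[unfolded One_nat_def] re_cross_commute[of l "Suc 0"])
      then show ?thesis using C2 by (intro mult_left_mono) (auto simp: algebra_simps)
    qed
    finally have 2: "norm (\<Prod>k\<in>{1..l}. Gamma (\<i> * \<delta> k - \<i> * z)) \<le> C2 * exp ((pi/2 - e) * re_size l \<delta> - (pi/2 - e) * (real l * \<bar>Re z\<bar>))" .
    have "norm (gam n l \<gamma> \<delta> z) \<le> (C1 * exp ((pi/2 - e) * (real n * \<bar>R\<bar>) - (pi/2 - e) * (real n * \<bar>Re z\<bar>))) * (C2 * exp ((pi/2 - e) * re_size l \<delta> - (pi/2 - e) * (real l * \<bar>Re z\<bar>)))"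
      unfolding gam_def norm_mult using 1 2 C1 by (intro mult_mono) auto
    also have "\<dots> = C * exp (- (pi/2 - e) * (real n + real l) * \<bar>Re z\<bar>)"
    proof -
      have eq: "(C1 * exp (a - b)) * (C2 * exp (c - d)) = (C1 * exp a) * (C2 * exp c) * exp (- (b + d))" for a b c d :: real
        by (simp add: exp_diff exp_minus exp_add divide_inverse)
      have arg: "- ((pi/2 - e) * (real n * \<bar>Re z\<bar>) + (pi/2 - e) * (real l * \<bar>Re z\<bar>)) = - (pi/2 - e) * (real n + real l) * \<bar>Re z\<bar>"
        by (simp add: algebra_simps add_divide_distrib)
      show ?thesis unfolding C_def eq arg ..
    qed
    finally show ?thesis .
  qed
  moreover have "C > 0" using C1 C2 by (simp add: C_def)
  ultimately show ?thesis using that by blast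
qed

lemma Re_pos_not_nonpos_Int: "Re z > 0 \<Longrightarrow> z \<notin> \<int>\<^sub>\<le>\<^sub>0"
  by (auto elim!: nonpos_Ints_cases)

lemma gam_holomorphic:
  assumes "\<And>k z. k \<in> {1..l} \<Longrightarrow> z \<in> S \<Longrightarrow> Im (\<delta> k) < Im z" "\<And>i z. i \<in> {1..n} \<Longrightarrow> z \<in> S \<Longrightarrow> Im z < Im (\<gamma> i)"
  shows "gam n l \<gamma> \<delta> holomorphic_on S"
proof -
  have "(\<lambda>z. (\<Prod>i\<in>{1..n}. Gamma (\<i> * z - \<i> * \<gamma> i)) * (\<Prod>k\<in>{1..l}. Gamma (\<i> * \<delta> k - \<i> * z))) holomorphic_on S"
  proof (intro holomorphic_intros holomorphic_on_prod holomorphic_Gamma')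
    fix i z assume "i \<in> {1..n}" "z \<in> S"
    then have "Re (\<i> * z - \<i> * \<gamma> i) > 0" using assms(2)[of i z] by simp
    then show "\<i> * z - \<i> * \<gamma> i \<notin> \<int>\<^sub>\<le>\<^sub>0" by (rule Re_pos_not_nonpos_Int)
  next
    fix k z assume "k \<in> {1..l}" "z \<in> S"
    then have "Re (\<i> * \<delta> k - \<i> * z) > 0" using assms(1)[of k z] by simp
    then show "\<i> * \<delta> k - \<i> * z \<notin> \<int>\<^sub>\<le>\<^sub>0" by (rule Re_pos_not_nonpos_Int)
  qed
  then show ?thesis unfolding gam_def[abs_def] .
qed

lemma gam_measurable:
  assumes [measurable]: "f \<in> borel_measurable M"
  shows "(\<lambda>\<omega>. gam n l \<gamma> \<delta> (f \<omega>)) \<in> borel_measurable M"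
  unfolding gam_def by measurable

lemma rGamma_prod_measurable:
  assumes "\<And>j. j \<in> {1..n} \<Longrightarrow> (\<lambda>\<omega>. g \<omega> j) \<in> borel_measurable M"
  shows "(\<lambda>\<omega>. rGamma_prod n (g \<omega>)) \<in> borel_measurable M"
  unfolding rGamma_prod_def
  by (intro borel_measurable_prod borel_measurable_rGamma borel_measurable_diff borel_measurable_times borel_measurable_const assms) auto

lemma rGamma_prod_holomorphic: "(\<lambda>z. rGamma_prod n (\<beta>(j := z))) holomorphic_on S"
  unfolding rGamma_prod_def by (intro holomorphic_on_prod holomorphic_intros holomorphic_coordinate)

text \<open>A cruder form of \<open>rGamma_prod_bound\<close>, sufficient where the Gamma factors of the kernel decay.\<close>
lemma rGamma_prod_size_bound:
  assumes e: "e > 0"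
  obtains C where "C > 0" "\<And>\<beta>. (\<forall>j\<in>{1..n}. \<bar>Im (\<beta> j)\<bar> \<le> R) \<Longrightarrow>
     norm (rGamma_prod n \<beta>) \<le> C * exp ((pi * (real n - 1) + e) * re_size n \<beta>)"
proof -
  obtain C where C: "C > 0" "\<And>\<beta>. (\<forall>j\<in>{1..n}. \<bar>Im (\<beta> j)\<bar> \<le> R) \<Longrightarrow>
     norm (rGamma_prod n \<beta>) \<le> C * exp (pi/2 * re_spread n \<beta> + e * re_size n \<beta>)"
    using rGamma_prod_bound[OF e] by metis
  have "norm (rGamma_prod n \<beta>) \<le> C * exp ((pi * (real n - 1) + e) * re_size n \<beta>)" if b: "\<forall>j\<in>{1..n}. \<bar>Im (\<beta> j)\<bar> \<le> R" for \<beta>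
  proof -
    have "pi/2 * re_spread n \<beta> \<le> pi/2 * (2 * (real n - 1) * re_size n \<beta>)"
    proof (cases "n = 0")
      case False
      then show ?thesis using re_spread_le[of n \<beta>] by (intro mult_left_mono) auto
    qed (simp add: re_spread_def re_size_def)
    then have "pi/2 * re_spread n \<beta> + e * re_size n \<beta> \<le> (pi * (real n - 1) + e) * re_size n \<beta>"
      by (simp add: algebra_simps)
    then have "C * exp (pi/2 * re_spread n \<beta> + e * re_size n \<beta>) \<le> C * exp ((pi * (real n - 1) + e) * re_size n \<beta>)"
      using C(1) by (intro mult_left_mono) auto
    with C(2)[OF b] show ?thesis by linarith
  qed
  with C(1) show ?thesis using that by blast
qed

text \<open>
  The product \<open>rGamma_prod\<close> divided by \<open>\<Prod>\<^sub>k (s\<^sub>j - s\<^sub>k)\<close>, where \<open>s\<^sub>j = \<i> \<beta>\<^sub>j\<close>. The quotient is written without division,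
  so that it makes sense and is entire also where some of the \<open>s\<^sub>j\<close> coincide.
\<close>
definition sin_minor :: "nat \<Rightarrow> nat \<Rightarrow> (nat \<Rightarrow> complex) \<Rightarrow> complex" where
  "sin_minor n j \<beta> = (\<Prod>a\<in>{1..n}-{j}. \<Prod>b\<in>{1..n}-{j}-{a}. rGamma (\<i> * \<beta> b - \<i> * \<beta> a)) *
     (\<Prod>k\<in>{1..n}-{j}. - sin (of_real pi * (\<i> * \<beta> j - \<i> * \<beta> k)) / of_real pi)"

lemma prod_offdiag_remove:
  assumes "finite A" "j \<in> A"
  shows "(\<Prod>a\<in>A. \<Prod>b\<in>A-{a}. f a b) = (\<Prod>k\<in>A-{j}. f j k * f k j) * (\<Prod>a\<in>A-{j}. \<Prod>b\<in>A-{j}-{a}. f a b :: 'a :: comm_monoid_mult)"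
proof -
  have "(\<Prod>b\<in>A-{a}. f a b) = f a j * (\<Prod>b\<in>A-{j}-{a}. f a b)" if "a \<in> A - {j}" for a
  proof -
    have "A - {a} - {j} = A - {j} - {a}" by auto
    then show ?thesis using assms that by (subst prod.remove[of _ j]) auto
  qed
  then show ?thesis
    using assms by (subst prod.remove[of _ j]) (auto simp: prod.distrib mult_ac)
qed

lemma rGamma_prod_sin_minor:
  assumes "j \<in> {1..n}"
  shows "rGamma_prod n \<beta> = sin_minor n j \<beta> * (\<Prod>k\<in>{1..n}-{j}. \<i> * \<beta> j - \<i> * \<beta> k)"
proof -
  have "rGamma_prod n \<beta> = (\<Prod>k\<in>{1..n}-{j}. rGamma (\<i> * \<beta> k - \<i> * \<beta> j) * rGamma (\<i> * \<beta> j - \<i> * \<beta> k)) *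
     (\<Prod>a\<in>{1..n}-{j}. \<Prod>b\<in>{1..n}-{j}-{a}. rGamma (\<i> * \<beta> b - \<i> * \<beta> a))"
    unfolding rGamma_prod_def by (rule prod_offdiag_remove) (use assms in auto)
  also have "(\<Prod>k\<in>{1..n}-{j}. rGamma (\<i> * \<beta> k - \<i> * \<beta> j) * rGamma (\<i> * \<beta> j - \<i> * \<beta> k)) =
     (\<Prod>k\<in>{1..n}-{j}. (- sin (of_real pi * (\<i> * \<beta> j - \<i> * \<beta> k)) / of_real pi) * (\<i> * \<beta> j - \<i> * \<beta> k))"
  proof (intro prod.cong refl)
    fix k
    define w where "w = \<i> * \<beta> j - \<i> * \<beta> k"
    have e: "\<i> * \<beta> k - \<i> * \<beta> j = - w" by (simp add: w_def)
    show "rGamma (\<i> * \<beta> k - \<i> * \<beta> j) * rGamma (\<i> * \<beta> j - \<i> * \<beta> k) = (- sin (of_real pi * (\<i> * \<beta> j - \<i> * \<beta> k)) / of_real pi) * (\<i> * \<beta> j - \<i> * \<beta> k)"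
      unfolding e w_def[symmetric] using rGamma_mult_uminus[of w] by (simp add: mult.commute)
  qed
  finally show ?thesis by (simp only: sin_minor_def prod.distrib mult_ac)
qed

lemma sin_minor_measurable:
  assumes "\<And>j. j \<in> {1..n} \<Longrightarrow> (\<lambda>\<omega>. g \<omega> j) \<in> borel_measurable M" "j \<in> {1..n}"
  shows "(\<lambda>\<omega>. sin_minor n j (g \<omega>)) \<in> borel_measurable M"
  unfolding sin_minor_def
  by (intro borel_measurable_prod borel_measurable_rGamma borel_measurable_diff borel_measurable_times borel_measurable_const
      borel_measurable_divide borel_measurable_uminus borel_measurable_sin_complex assms) (use assms(2) in auto)

lemma sin_minor_holomorphic: "(\<lambda>z. sin_minor n j (\<beta>(i := z))) holomorphic_on S"
  unfolding sin_minor_def by (intro holomorphic_on_prod holomorphic_intros holomorphic_coordinate) auto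

text \<open>The variable \<open>s\<^sub>j\<close> enters only through the \<open>l\<close> sines, and each of them changes sign under \<open>s\<^sub>j \<mapsto> s\<^sub>j + 1\<close>.\<close>
lemma sin_minor_shift:
  assumes "j \<in> {1..Suc l}"
  shows "sin_minor (Suc l) j (\<beta>(j := \<beta> j - \<i>)) = (-1) ^ l * sin_minor (Suc l) j \<beta>"
proof -
  have 1: "(\<Prod>a\<in>{1..Suc l}-{j}. \<Prod>b\<in>{1..Suc l}-{j}-{a}. rGamma (\<i> * (\<beta>(j := \<beta> j - \<i>)) b - \<i> * (\<beta>(j := \<beta> j - \<i>)) a)) =
    (\<Prod>a\<in>{1..Suc l}-{j}. \<Prod>b\<in>{1..Suc l}-{j}-{a}. rGamma (\<i> * \<beta> b - \<i> * \<beta> a))"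
    by (intro prod.cong refl) auto
  have "(\<Prod>k\<in>{1..Suc l}-{j}. - sin (of_real pi * (\<i> * (\<beta>(j := \<beta> j - \<i>)) j - \<i> * (\<beta>(j := \<beta> j - \<i>)) k)) / of_real pi)
     = (\<Prod>k\<in>{1..Suc l}-{j}. (-1) * (- sin (of_real pi * (\<i> * \<beta> j - \<i> * \<beta> k)) / of_real pi))"
  proof (intro prod.cong refl)
    fix k assume k: "k \<in> {1..Suc l}-{j}"
    have "of_real pi * (\<i> * (\<beta> j - \<i>) - \<i> * \<beta> k) = of_real pi * (\<i> * \<beta> j - \<i> * \<beta> k) + of_real pi"
      by (simp add: algebra_simps)
    moreover have "sin (x + of_real pi) = - sin x" for x :: complex
      by (simp add: sin_add flip: sin_of_real cos_of_real)
    ultimately show "- sin (of_real pi * (\<i> * (\<beta>(j := \<beta> j - \<i>)) j - \<i> * (\<beta>(j := \<beta> j - \<i>)) k)) / of_real pi =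
        (-1) * (- sin (of_real pi * (\<i> * \<beta> j - \<i> * \<beta> k)) / of_real pi)"
      using k by simp
  qed
  also have "\<dots> = (-1) ^ l * (\<Prod>k\<in>{1..Suc l}-{j}. - sin (of_real pi * (\<i> * \<beta> j - \<i> * \<beta> k)) / of_real pi)"
    using assms by (subst prod.distrib) simp
  finally show ?thesis unfolding sin_minor_def 1 by simp
qed

text \<open>
  The factors without index \<open>j\<close> form the product \<open>rGamma_prod\<close> for the remaining \<open>l\<close> variables, and each sine
  contributes at most \<open>exp (\<pi> (\<bar>Re \<beta>\<^sub>j\<bar> + \<bar>Re \<beta>\<^sub>k\<bar>))\<close>.
\<close>
lemma sin_minor_bound:
  assumes j: "j \<in> {1..Suc l}" and e: "e > 0"
  obtains C where "C > 0" "\<And>\<beta>. (\<forall>j\<in>{1..Suc l}. \<bar>Im (\<beta> j)\<bar> \<le> R) \<Longrightarrow>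
     norm (sin_minor (Suc l) j \<beta>) \<le> C * exp ((pi * l + e) * re_size (Suc l) \<beta>)"
proof -
  define skip where "skip m = (if m < j then m else Suc m)" for m
  have bij: "bij_betw skip {1..l} ({1..Suc l} - {j})"
    by (rule bij_betw_byWitness[where f' = "\<lambda>m. if m < j then m else m - 1"]) (use j in \<open>auto simp: skip_def\<close>)
  have injs: "skip a = skip b \<longleftrightarrow> a = b" for a b by (auto simp: skip_def)
  obtain C where C: "C > 0" "\<And>\<beta>. (\<forall>j\<in>{1..l}. \<bar>Im (\<beta> j)\<bar> \<le> R) \<Longrightarrow>
     norm (rGamma_prod l \<beta>) \<le> C * exp ((pi * (real l - 1) + e) * re_size l \<beta>)"
    using rGamma_prod_size_bound[OF e] by metis
  have "norm (sin_minor (Suc l) j \<beta>) \<le> C * exp ((pi * l + e) * re_size (Suc l) \<beta>)"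
    if b: "\<forall>j\<in>{1..Suc l}. \<bar>Im (\<beta> j)\<bar> \<le> R" for \<beta>
  proof -
    define S where "S = (\<Sum>k\<in>{1..Suc l}-{j}. \<bar>Re (\<beta> k)\<bar>)"
    have size: "re_size (Suc l) \<beta> = \<bar>Re (\<beta> j)\<bar> + S"
      unfolding re_size_def S_def using j by (intro sum.remove) auto
    have sizel: "re_size l (\<lambda>m. \<beta> (skip m)) = S"
      unfolding re_size_def S_def by (rule sum.reindex_bij_betw[OF bij])
    have inner: "(\<Prod>b\<in>{1..l}-{a}. f (skip b)) = (\<Prod>b\<in>{1..Suc l}-{j}-{skip a}. f b)" if "a \<in> {1..l}" for a and f :: "nat \<Rightarrow> complex"
    proof (rule prod.reindex_bij_betw)
      have inj: "inj_on skip {1..l}" and im: "skip ` {1..l} = {1..Suc l} - {j}"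
        using bij unfolding bij_betw_def by auto
      show "bij_betw skip ({1..l} - {a}) ({1..Suc l} - {j} - {skip a})"
      proof (rule bij_betw_imageI)
        show "inj_on skip ({1..l} - {a})" by (rule inj_on_diff[OF inj])
        have "skip ` ({1..l} - {a}) = skip ` {1..l} - skip ` {a}"
          by (rule inj_on_image_set_diff[OF inj]) (use that in auto)
        then show "skip ` ({1..l} - {a}) = {1..Suc l} - {j} - {skip a}" unfolding im by simp
      qed
    qed
    have "(\<Prod>a\<in>{1..Suc l}-{j}. \<Prod>b\<in>{1..Suc l}-{j}-{a}. rGamma (\<i> * \<beta> b - \<i> * \<beta> a)) =
      (\<Prod>a\<in>{1..l}. \<Prod>b\<in>{1..Suc l}-{j}-{skip a}. rGamma (\<i> * \<beta> b - \<i> * \<beta> (skip a)))"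
      by (rule prod.reindex_bij_betw[OF bij, symmetric])
    also have "\<dots> = rGamma_prod l (\<lambda>m. \<beta> (skip m))"
      unfolding rGamma_prod_def by (intro prod.cong refl inner[symmetric])
    finally have eq: "(\<Prod>a\<in>{1..Suc l}-{j}. \<Prod>b\<in>{1..Suc l}-{j}-{a}. rGamma (\<i> * \<beta> b - \<i> * \<beta> a)) = rGamma_prod l (\<lambda>m. \<beta> (skip m))" .
    have "\<forall>m\<in>{1..l}. \<bar>Im (\<beta> (skip m))\<bar> \<le> R" using b bij_betwE[OF bij] by auto
    from C(2)[OF this] have 1: "norm (rGamma_prod l (\<lambda>m. \<beta> (skip m))) \<le> C * exp ((pi * (real l - 1) + e) * S)"
      by (simp add: sizel)
    have "norm (\<Prod>k\<in>{1..Suc l}-{j}. - sin (of_real pi * (\<i> * \<beta> j - \<i> * \<beta> k)) / of_real pi) \<le> (\<Prod>k\<in>{1..Suc l}-{j}. exp (pi * (\<bar>Re (\<beta> j)\<bar> + \<bar>Re (\<beta> k)\<bar>)))"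
      unfolding prod_norm[symmetric]
    proof (intro prod_mono conjI norm_ge_zero)
      fix k
      have "norm (- sin (of_real pi * (\<i> * \<beta> j - \<i> * \<beta> k)) / of_real pi) = norm (sin (of_real pi * (\<i> * \<beta> j - \<i> * \<beta> k))) / pi"
        by (simp add: norm_divide)
      also have "\<dots> \<le> norm (sin (of_real pi * (\<i> * \<beta> j - \<i> * \<beta> k))) / 1"
        using pi_ge_two by (intro divide_left_mono) auto
      also have "\<dots> \<le> exp (pi * \<bar>Im (\<i> * \<beta> j - \<i> * \<beta> k)\<bar>)" unfolding div_by_1 by (rule norm_sin_pi_le)
      also have "\<dots> \<le> exp (pi * (\<bar>Re (\<beta> j)\<bar> + \<bar>Re (\<beta> k)\<bar>))" by simp
      finally show "norm (- sin (of_real pi * (\<i> * \<beta> j - \<i> * \<beta> k)) / of_real pi) \<le> exp (pi * (\<bar>Re (\<beta> j)\<bar> + \<bar>Re (\<beta> k)\<bar>))" .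
    qed
    also have "\<dots> = exp (pi * (l * \<bar>Re (\<beta> j)\<bar> + S))"
    proof -
      have "card ({1..Suc l} - {j}) = l" using j by simp
      then show ?thesis unfolding S_def by (simp add: exp_sum[symmetric] sum_distrib_left[symmetric] sum.distrib del: sum.cl_ivl_Suc)
    qed
    finally have 2: "norm (\<Prod>k\<in>{1..Suc l}-{j}. - sin (of_real pi * (\<i> * \<beta> j - \<i> * \<beta> k)) / of_real pi) \<le> exp (pi * (l * \<bar>Re (\<beta> j)\<bar> + S))" .
    have "norm (sin_minor (Suc l) j \<beta>) \<le> (C * exp ((pi * (real l - 1) + e) * S)) * exp (pi * (l * \<bar>Re (\<beta> j)\<bar> + S))"
      unfolding sin_minor_def eq norm_mult using 1 2 C by (intro mult_mono) auto
    also have "\<dots> = C * exp ((pi * l + e) * S + pi * l * \<bar>Re (\<beta> j)\<bar>)"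
      by (simp add: algebra_simps flip: exp_add)
    also have "\<dots> \<le> C * exp ((pi * l + e) * re_size (Suc l) \<beta>)"
      unfolding size using C e by (intro mult_left_mono) (auto simp: algebra_simps)
    finally show ?thesis .
  qed
  with C(1) show ?thesis using that by blast
qed

section \<open>The kernel and its telescoping identity\<close>

text \<open>The logarithmic derivative of the kernel with respect to \<open>y\<close>.\<close>
definition weight :: "nat \<Rightarrow> (nat \<Rightarrow> complex) \<Rightarrow> (nat \<Rightarrow> complex) \<Rightarrow> complex" where
  "weight l \<gamma> \<beta> = (\<Sum>j\<in>{1..Suc l}. \<i> * \<beta> j) - (\<Sum>i\<in>{1..Suc l}. \<i> * \<gamma> i)"

text \<open>
  The dual Baxter kernel times measure times recursion kernel, stripped of all factors that do not depend on \<open>\<beta>\<close>;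
  \<open>y\<close> stands for \<open>z - x\<^sub>l\<^sub>+\<^sub>1\<close>.
\<close>
definition kern :: "nat \<Rightarrow> (nat \<Rightarrow> complex) \<Rightarrow> (nat \<Rightarrow> complex) \<Rightarrow> real \<Rightarrow> (nat \<Rightarrow> complex) \<Rightarrow> complex" where
  "kern l \<gamma> \<delta> y \<beta> = rGamma_prod (Suc l) \<beta> * (\<Prod>j\<in>{1..Suc l}. gam (Suc l) l \<gamma> \<delta> (\<beta> j)) * exp (of_real y * weight l \<gamma> \<beta>)"

text \<open>
  The kernel divided by \<open>\<Prod>\<^sub>k (s\<^sub>j - s\<^sub>k)\<close>, with \<open>\<Gamma>(\<i> \<delta>\<^sub>k - s\<^sub>j)\<close> raised to \<open>\<Gamma>(\<i> \<delta>\<^sub>k + 1 - s\<^sub>j)\<close>. The raised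
  factors are the reason why \<open>\<beta>\<^sub>j\<close> can be lowered by \<open>\<i>\<close> without meeting a pole; the prefactor compensates the factor
  \<open>exp y\<close> that this shift produces.
\<close>
definition telescoper :: "nat \<Rightarrow> (nat \<Rightarrow> complex) \<Rightarrow> (nat \<Rightarrow> complex) \<Rightarrow> real \<Rightarrow> nat \<Rightarrow> (nat \<Rightarrow> complex) \<Rightarrow> complex" where
  "telescoper l \<gamma> \<delta> y j \<beta> = exp (- of_real y) * (sin_minor (Suc l) j \<beta> *
     (\<Prod>m\<in>{1..Suc l}. gam (Suc l) l \<gamma> (if m = j then (\<lambda>k. \<delta> k - \<i>) else \<delta>) (\<beta> m)) * exp (of_real y * weight l \<gamma> \<beta>))"

text \<open>
  The growing factor \<open>A\<close> costs \<open>\<pi> l + e\<close> per unit of \<open>re_size\<close>, while the \<open>2 l + 1\<close> Gamma factors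
  in each variable gain \<open>(\<pi>/2 - e) (2 l + 1)\<close>. The gain exceeds the cost by \<open>\<pi>/2\<close>, half of which pays for the losses \<open>e\<close>.
\<close>
lemma product_decay:
  fixes g :: "nat \<Rightarrow> real"
  assumes e: "e = pi / (8 * (real l + 1))"
    and A: "0 \<le> A" "A \<le> C1 * exp ((pi * l + e) * re_size (Suc l) \<beta>)"
    and g: "\<And>m. m \<in> {1..Suc l} \<Longrightarrow> 0 \<le> g m \<and> g m \<le> C2 * exp (- (pi/2 - e) * (real (Suc l) + real l) * \<bar>Re (\<beta> m)\<bar>)"
    and x: "0 \<le> x" "x \<le> X" and C: "C1 \<ge> 0" "C2 \<ge> 0"
  shows "A * (\<Prod>m\<in>{1..Suc l}. g m) * x \<le> C1 * C2 ^ Suc l * X * exp (- (pi/4) * re_size (Suc l) \<beta>)"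
proof -
  let ?S = "re_size (Suc l) \<beta>"
  have "(\<Prod>m\<in>{1..Suc l}. g m) \<le> (\<Prod>m\<in>{1..Suc l}. C2 * exp (- (pi/2 - e) * (real (Suc l) + real l) * \<bar>Re (\<beta> m)\<bar>))"
    using g by (intro prod_mono) auto
  also have "\<dots> = C2 ^ Suc l * exp (- (pi/2 - e) * (real (Suc l) + real l) * ?S)"
    unfolding re_size_def prod.distrib sum_distrib_left exp_sum[OF finite_atLeastAtMost] by simp
  finally have P: "(\<Prod>m\<in>{1..Suc l}. g m) \<le> C2 ^ Suc l * exp (- (pi/2 - e) * (real (Suc l) + real l) * ?S)" .
  have "A * (\<Prod>m\<in>{1..Suc l}. g m) * x \<le> (C1 * exp ((pi * l + e) * ?S)) * (C2 ^ Suc l * exp (- (pi/2 - e) * (real (Suc l) + real l) * ?S)) * X"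
    using A P x C g by (intro mult_mono mult_nonneg_nonneg prod_nonneg) auto
  also have "\<dots> = C1 * C2 ^ Suc l * X * exp ((pi * l + e) * ?S + - (pi/2 - e) * (real (Suc l) + real l) * ?S)"
    by (simp add: exp_add mult_ac)
  also have "(pi * l + e) * ?S + - (pi/2 - e) * (real (Suc l) + real l) * ?S = (- (pi/2) + e * (2 * (real l + 1))) * ?S"
    by (simp add: algebra_simps add_divide_distrib)
  also have "e * (2 * (real l + 1)) = pi/4" by (simp add: e field_simps)
  finally show ?thesis by simp
qed

lemma norm_exp_weight_le:
  assumes "\<And>j. j \<in> {1..Suc l} \<Longrightarrow> \<bar>Im (\<beta> j)\<bar> \<le> B" "\<And>j. j \<in> {1..Suc l} \<Longrightarrow> \<bar>Im (\<gamma> j)\<bar> \<le> B"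
  shows "\<bar>Re (weight l \<gamma> \<beta>)\<bar> \<le> 2 * (real l + 1) * B"
    "norm (exp (of_real y * weight l \<gamma> \<beta>)) \<le> exp (\<bar>y\<bar> * (2 * (real l + 1) * B))"
proof -
  have 1: "\<bar>\<Sum>j\<in>{1..Suc l}. Im (f j)\<bar> \<le> (real l + 1) * B" if "\<And>j. j \<in> {1..Suc l} \<Longrightarrow> \<bar>Im (f j)\<bar> \<le> B" for f :: "nat \<Rightarrow> complex"
  proof -
    have "\<bar>\<Sum>j\<in>{1..Suc l}. Im (f j)\<bar> \<le> (\<Sum>j\<in>{1..Suc l}. B)"
      using that by (intro order_trans[OF sum_abs] sum_mono)
    then show ?thesis by (simp add: algebra_simps)
  qed
  have "Re (weight l \<gamma> \<beta>) = (\<Sum>i\<in>{1..Suc l}. Im (\<gamma> i)) - (\<Sum>j\<in>{1..Suc l}. Im (\<beta> j))"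
    by (simp add: weight_def sum_negf del: sum.cl_ivl_Suc)
  then show R: "\<bar>Re (weight l \<gamma> \<beta>)\<bar> \<le> 2 * (real l + 1) * B"
    using 1[of \<gamma>, OF assms(2)] 1[of \<beta>, OF assms(1)] by linarith
  have "norm (exp (of_real y * weight l \<gamma> \<beta>)) = exp (y * Re (weight l \<gamma> \<beta>))" by simp
  also have "\<dots> \<le> exp (\<bar>y\<bar> * (2 * (real l + 1) * B))"
  proof -
    have "y * Re (weight l \<gamma> \<beta>) \<le> \<bar>y\<bar> * \<bar>Re (weight l \<gamma> \<beta>)\<bar>" by (metis abs_ge_self abs_mult)
    also have "\<dots> \<le> \<bar>y\<bar> * (2 * (real l + 1) * B)" using R by (intro mult_left_mono) auto
    finally show ?thesis by simp
  qed
  finally show "norm (exp (of_real y * weight l \<gamma> \<beta>)) \<le> exp (\<bar>y\<bar> * (2 * (real l + 1) * B))" .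
qed

lemma kern_bound:
  assumes below: "\<And>k. k \<in> {1..l} \<Longrightarrow> Im (\<delta> k) < P" and above: "\<And>i. i \<in> {1..Suc l} \<Longrightarrow> Q < g i"
  obtains C where "C > 0"
    "\<And>\<gamma> \<beta>. (\<And>i. i \<in> {1..Suc l} \<Longrightarrow> Im (\<gamma> i) = g i \<and> \<bar>Re (\<gamma> i)\<bar> \<le> R) \<Longrightarrow>
       (\<And>j. j \<in> {1..Suc l} \<Longrightarrow> P \<le> Im (\<beta> j) \<and> Im (\<beta> j) \<le> Q) \<Longrightarrow>
       norm (kern l \<gamma> \<delta> y \<beta>) \<le> C * exp (- (pi/4) * re_size (Suc l) \<beta>)"
proof -
  define e where "e = pi / (8 * (real l + 1))"
  have "pi < pi * (4 * (real l + 1))" by simp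
  then have e: "e > 0" "e < pi/2" by (auto simp: e_def field_simps)
  define B where "B = \<bar>P\<bar> + \<bar>Q\<bar> + (\<Sum>i\<in>{1..Suc l}. \<bar>g i\<bar>)"
  have gB: "\<bar>g i\<bar> \<le> B" if "i \<in> {1..Suc l}" for i
    using member_le_sum[OF that, of "\<lambda>i. \<bar>g i\<bar>"] unfolding B_def by (intro add_increasing) auto
  have "(\<Sum>i\<in>{1..Suc l}. \<bar>g i\<bar>) \<ge> 0" by (intro sum_nonneg) auto
  then have PB: "\<bar>P\<bar> + \<bar>Q\<bar> \<le> B" by (simp add: B_def)
  obtain C1 where C1: "C1 > 0" "\<And>\<beta>. (\<forall>j\<in>{1..Suc l}. \<bar>Im (\<beta> j)\<bar> \<le> B) \<Longrightarrow>
     norm (rGamma_prod (Suc l) \<beta>) \<le> C1 * exp ((pi * (real (Suc l) - 1) + e) * re_size (Suc l) \<beta>)"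
    using rGamma_prod_size_bound[OF e(1), of "Suc l" B] by metis
  obtain C2 where C2: "C2 > 0" "\<And>\<gamma> z. (\<And>i. i \<in> {1..Suc l} \<Longrightarrow> Im (\<gamma> i) = g i \<and> \<bar>Re (\<gamma> i)\<bar> \<le> R) \<Longrightarrow> P \<le> Im z \<Longrightarrow> Im z \<le> Q \<Longrightarrow>
       norm (gam (Suc l) l \<gamma> \<delta> z) \<le> C2 * exp (- (pi/2 - e) * (real (Suc l) + real l) * \<bar>Re z\<bar>)"
    using gam_bound[where l = l and n = "Suc l" and \<delta> = \<delta> and P = P and Q = Q and g = g and R = R, OF e below above] by metis
  define C where "C = C1 * C2 ^ Suc l * exp (\<bar>y\<bar> * (2 * (real l + 1) * B))"
  have "norm (kern l \<gamma> \<delta> y \<beta>) \<le> C * exp (- (pi/4) * re_size (Suc l) \<beta>)"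
    if \<gamma>: "\<And>i. i \<in> {1..Suc l} \<Longrightarrow> Im (\<gamma> i) = g i \<and> \<bar>Re (\<gamma> i)\<bar> \<le> R"
      and \<beta>: "\<And>j. j \<in> {1..Suc l} \<Longrightarrow> P \<le> Im (\<beta> j) \<and> Im (\<beta> j) \<le> Q" for \<gamma> \<beta>
  proof -
    have bB: "\<bar>Im (\<beta> j)\<bar> \<le> B" if "j \<in> {1..Suc l}" for j using \<beta>[OF that] PB by linarith
    have "norm (kern l \<gamma> \<delta> y \<beta>) = norm (rGamma_prod (Suc l) \<beta>) * (\<Prod>j\<in>{1..Suc l}. norm (gam (Suc l) l \<gamma> \<delta> (\<beta> j))) * norm (exp (of_real y * weight l \<gamma> \<beta>))"
      unfolding kern_def norm_mult prod_norm ..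
    also have "\<dots> \<le> C1 * C2 ^ Suc l * exp (\<bar>y\<bar> * (2 * (real l + 1) * B)) * exp (- (pi/4) * re_size (Suc l) \<beta>)"
    proof (rule product_decay[OF e_def])
      show "norm (rGamma_prod (Suc l) \<beta>) \<le> C1 * exp ((pi * real l + e) * re_size (Suc l) \<beta>)"
        using C1(2)[of \<beta>] bB by simp
      show "0 \<le> norm (gam (Suc l) l \<gamma> \<delta> (\<beta> m)) \<and> norm (gam (Suc l) l \<gamma> \<delta> (\<beta> m)) \<le> C2 * exp (- (pi/2 - e) * (real (Suc l) + real l) * \<bar>Re (\<beta> m)\<bar>)"
        if "m \<in> {1..Suc l}" for m using C2(2)[OF \<gamma>, of "\<beta> m"] \<beta>[OF that] by simp
      show "norm (exp (of_real y * weight l \<gamma> \<beta>)) \<le> exp (\<bar>y\<bar> * (2 * (real l + 1) * B))"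
        by (rule norm_exp_weight_le) (use bB gB \<gamma> in auto)
    qed (use C1 C2 in auto)
    finally show ?thesis by (simp add: C_def)
  qed
  moreover have "C > 0" using C1 C2 by (simp add: C_def)
  ultimately show ?thesis using that by blast
qed

lemma weight_measurable:
  assumes "\<And>j. j \<in> {1..Suc l} \<Longrightarrow> (\<lambda>\<omega>. g \<omega> j) \<in> borel_measurable M"
  shows "(\<lambda>\<omega>. weight l \<gamma> (g \<omega>)) \<in> borel_measurable M"
  unfolding weight_def
  by (intro borel_measurable_diff borel_measurable_sum borel_measurable_times borel_measurable_const assms)

lemma kern_measurable:
  assumes "\<And>j. j \<in> {1..Suc l} \<Longrightarrow> (\<lambda>\<omega>. g \<omega> j) \<in> borel_measurable M"
  shows "(\<lambda>\<omega>. kern l \<gamma> \<delta> y (g \<omega>)) \<in> borel_measurable M"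
  unfolding kern_def
  by (intro borel_measurable_times rGamma_prod_measurable borel_measurable_prod gam_measurable borel_measurable_exp_complex
      weight_measurable borel_measurable_const assms)

lemma telescoper_measurable:
  assumes "\<And>j. j \<in> {1..Suc l} \<Longrightarrow> (\<lambda>\<omega>. g \<omega> j) \<in> borel_measurable M" "j \<in> {1..Suc l}"
  shows "(\<lambda>\<omega>. telescoper l \<gamma> \<delta> y j (g \<omega>)) \<in> borel_measurable M"
  unfolding telescoper_def
  by (intro borel_measurable_times sin_minor_measurable borel_measurable_prod gam_measurable borel_measurable_exp_complex
      weight_measurable borel_measurable_const assms)

lemma weight_holomorphic: "(\<lambda>z. weight l \<gamma> (\<beta>(j := z))) holomorphic_on S"
  unfolding weight_def by (intro holomorphic_intros holomorphic_coordinate)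

lemma gam_coordinate_holomorphic:
  assumes "m = j \<Longrightarrow> gam n l \<gamma> \<delta> holomorphic_on S"
  shows "(\<lambda>z. gam n l \<gamma> \<delta> ((\<beta>(j := z)) m)) holomorphic_on S"
  using assms by (cases "m = j") auto

lemma gam_lower_shift:
  assumes "\<And>k. k \<in> {1..l} \<Longrightarrow> Im (\<delta> k) < Im z"
  shows "gam n l \<gamma> (\<lambda>k. \<delta> k - \<i>) z = gam n l \<gamma> \<delta> z * (\<Prod>k\<in>{1..l}. \<i> * \<delta> k - \<i> * z)"
proof -
  have "(\<Prod>k\<in>{1..l}. Gamma (\<i> * (\<delta> k - \<i>) - \<i> * z)) = (\<Prod>k\<in>{1..l}. (\<i> * \<delta> k - \<i> * z) * Gamma (\<i> * \<delta> k - \<i> * z))"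
  proof (intro prod.cong refl)
    fix k assume "k \<in> {1..l}"
    then have "\<i> * \<delta> k - \<i> * z \<notin> \<int>\<^sub>\<le>\<^sub>0" using assms by (intro Re_pos_not_nonpos_Int) auto
    from Gamma_plus1[OF this] show "Gamma (\<i> * (\<delta> k - \<i>) - \<i> * z) = (\<i> * \<delta> k - \<i> * z) * Gamma (\<i> * \<delta> k - \<i> * z)"
      by (simp add: algebra_simps)
  qed
  then show ?thesis by (simp add: gam_def prod.distrib)
qed

lemma gam_upper_shift:
  assumes "\<And>i. i \<in> {1..n} \<Longrightarrow> Im z < Im (\<gamma> i)"
  shows "gam n l \<gamma> (\<lambda>k. \<delta> k - \<i>) (z - \<i>) = gam n l \<gamma> \<delta> z * (\<Prod>i\<in>{1..n}. \<i> * z - \<i> * \<gamma> i)"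
proof -
  have "(\<Prod>i\<in>{1..n}. Gamma (\<i> * (z - \<i>) - \<i> * \<gamma> i)) = (\<Prod>i\<in>{1..n}. (\<i> * z - \<i> * \<gamma> i) * Gamma (\<i> * z - \<i> * \<gamma> i))"
  proof (intro prod.cong refl)
    fix i assume "i \<in> {1..n}"
    then have "\<i> * z - \<i> * \<gamma> i \<notin> \<int>\<^sub>\<le>\<^sub>0" using assms by (intro Re_pos_not_nonpos_Int) auto
    from Gamma_plus1[OF this] show "Gamma (\<i> * (z - \<i>) - \<i> * \<gamma> i) = (\<i> * z - \<i> * \<gamma> i) * Gamma (\<i> * z - \<i> * \<gamma> i)"
      by (simp add: algebra_simps)
  qed
  moreover have "(\<Prod>k\<in>{1..l}. Gamma (\<i> * (\<delta> k - \<i>) - \<i> * (z - \<i>))) = (\<Prod>k\<in>{1..l}. Gamma (\<i> * \<delta> k - \<i> * z))"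
    by (simp add: algebra_simps)
  ultimately show ?thesis by (simp add: gam_def prod.distrib)
qed

lemma prod_replace_factor:
  assumes "finite A" "j \<in> A" "f j = g j * (x :: 'a :: comm_monoid_mult)" "\<And>m. m \<in> A \<Longrightarrow> m \<noteq> j \<Longrightarrow> f m = g m"
  shows "(\<Prod>m\<in>A. f m) = (\<Prod>m\<in>A. g m) * x"
proof -
  have "(\<Prod>m\<in>A. f m) = f j * (\<Prod>m\<in>A-{j}. f m)" using assms by (intro prod.remove)
  also have "(\<Prod>m\<in>A-{j}. f m) = (\<Prod>m\<in>A-{j}. g m)" using assms by (intro prod.cong) auto
  also have "f j * \<dots> = (g j * (\<Prod>m\<in>A-{j}. g m)) * x" using assms by (simp add: mult_ac)
  also have "g j * (\<Prod>m\<in>A-{j}. g m) = (\<Prod>m\<in>A. g m)" using assms by (intro prod.remove[symmetric])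
  finally show ?thesis .
qed

text \<open>
  Relative to the kernel, the value at the shifted point carries \<open>\<Prod>\<^sub>i (s\<^sub>j - \<i> \<gamma>\<^sub>i) / \<Prod>\<^sub>k (s\<^sub>j - s\<^sub>k)\<close> and the value at
  the original point carries \<open>exp (- y) \<Prod>\<^sub>k (\<i> \<delta>\<^sub>k - s\<^sub>j) / \<Prod>\<^sub>k (s\<^sub>j - s\<^sub>k)\<close>. The sums over \<open>j\<close> are the two Lagrange sums,
  \<open>lagrange_sum_top\<close> and \<open>lagrange_sum_below\<close>.
\<close>
lemma telescoping_sum:
  assumes below: "\<And>j k. j \<in> {1..Suc l} \<Longrightarrow> k \<in> {1..l} \<Longrightarrow> Im (\<delta> k) < Im (\<beta> j)"
    and above: "\<And>j i. j \<in> {1..Suc l} \<Longrightarrow> i \<in> {1..Suc l} \<Longrightarrow> Im (\<beta> j) < Im (\<gamma> i)"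
  shows "(\<Sum>j\<in>{1..Suc l}. telescoper l \<gamma> \<delta> y j (\<beta>(j := \<beta> j - \<i>)) - telescoper l \<gamma> \<delta> y j \<beta>) =
     (-1) ^ l * (weight l \<gamma> \<beta> - exp (- of_real y)) * kern l \<gamma> \<delta> y \<beta>"
proof -
  define s where "s j = \<i> * \<beta> j" for j
  define G where "G = (\<Prod>m\<in>{1..Suc l}. gam (Suc l) l \<gamma> \<delta> (\<beta> m))"
  define E where "E = exp (of_real y * weight l \<gamma> \<beta>)"
  define q where "q j = sin_minor (Suc l) j \<beta> * G * E" for j
  have kern: "kern l \<gamma> \<delta> y \<beta> = q j * (\<Prod>k\<in>{1..Suc l}-{j}. s j - s k)" if "j \<in> {1..Suc l}" for j
    unfolding kern_def q_def s_def E_def G_def rGamma_prod_sin_minor[OF that] by (simp only: mult_ac)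
  have low: "telescoper l \<gamma> \<delta> y j \<beta> = exp (- of_real y) * (\<Prod>k\<in>{1..l}. \<i> * \<delta> k - s j) * q j" if j: "j \<in> {1..Suc l}" for j
  proof -
    have "(\<Prod>m\<in>{1..Suc l}. gam (Suc l) l \<gamma> (if m = j then (\<lambda>k. \<delta> k - \<i>) else \<delta>) (\<beta> m)) = G * (\<Prod>k\<in>{1..l}. \<i> * \<delta> k - s j)"
      unfolding G_def s_def
      by (rule prod_replace_factor[OF _ j]) (use gam_lower_shift[of l \<delta> "\<beta> j"] below[OF j] in auto)
    then show ?thesis by (simp only: telescoper_def q_def E_def[symmetric] mult_ac)
  qed
  have up: "telescoper l \<gamma> \<delta> y j (\<beta>(j := \<beta> j - \<i>)) = (-1) ^ l * (\<Prod>i\<in>{1..Suc l}. s j - \<i> * \<gamma> i) * q j" if j: "j \<in> {1..Suc l}" for j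
  proof -
    have 1: "(\<Prod>m\<in>{1..Suc l}. gam (Suc l) l \<gamma> (if m = j then (\<lambda>k. \<delta> k - \<i>) else \<delta>) ((\<beta>(j := \<beta> j - \<i>)) m)) = G * (\<Prod>i\<in>{1..Suc l}. s j - \<i> * \<gamma> i)"
      unfolding G_def s_def
      by (rule prod_replace_factor[OF _ j]) (use gam_upper_shift[of "Suc l" "\<beta> j" \<gamma>] above[OF j] in auto)
    have "(\<Sum>m\<in>{1..Suc l}. \<i> * (\<beta>(j := \<beta> j - \<i>)) m) = (\<Sum>m\<in>{1..Suc l}. \<i> * \<beta> m + (if m = j then 1 else 0))"
      by (intro sum.cong refl) (auto simp: algebra_simps)
    also have "\<dots> = (\<Sum>m\<in>{1..Suc l}. \<i> * \<beta> m) + 1"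
      using j by (simp only: sum.distrib sum.delta' finite_atLeastAtMost sum.delta if_True)
    finally have w: "weight l \<gamma> (\<beta>(j := \<beta> j - \<i>)) = weight l \<gamma> \<beta> + 1"
      by (simp only: weight_def algebra_simps)
    have 2: "exp (of_real y * weight l \<gamma> (\<beta>(j := \<beta> j - \<i>))) = E * exp (of_real y)"
      unfolding w E_def by (simp add: algebra_simps exp_add)
    have 3: "exp (- complex_of_real y) * exp (of_real y) = 1" by (simp flip: exp_add)
    have "telescoper l \<gamma> \<delta> y j (\<beta>(j := \<beta> j - \<i>)) = (exp (- complex_of_real y) * exp (of_real y)) * ((-1) ^ l * (\<Prod>i\<in>{1..Suc l}. s j - \<i> * \<gamma> i) * q j)"
      unfolding telescoper_def 1 2 sin_minor_shift[OF j] q_def by (simp only: mult_ac)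
    then show ?thesis unfolding 3 by simp
  qed
  have split: "(\<Sum>j\<in>{1..Suc l}. telescoper l \<gamma> \<delta> y j (\<beta>(j := \<beta> j - \<i>)) - telescoper l \<gamma> \<delta> y j \<beta>) =
     (\<Sum>j\<in>{1..Suc l}. (-1) ^ l * (\<Prod>i\<in>{1..Suc l}. s j - \<i> * \<gamma> i) * q j - exp (- of_real y) * (\<Prod>k\<in>{1..l}. \<i> * \<delta> k - s j) * q j)"
    using low up by (intro sum.cong refl) simp
  \<comment> \<open>where two of the \<open>s\<^sub>j\<close> coincide, Lagrange's identities fail but both sides vanish\<close>
  show ?thesis
  proof (cases "inj_on s {1..Suc l}")
    case True
    have q: "q j = kern l \<gamma> \<delta> y \<beta> / (\<Prod>k\<in>{1..Suc l}-{j}. s j - s k)" if j: "j \<in> {1..Suc l}" for j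
    proof -
      have "(\<Prod>k\<in>{1..Suc l}-{j}. s j - s k) \<noteq> 0" using True j by (auto simp: inj_on_def)
      then show ?thesis using kern[OF j] by simp
    qed
    have top: "(\<Sum>j\<in>{1..Suc l}. (\<Prod>i\<in>{1..Suc l}. s j - \<i> * \<gamma> i) / (\<Prod>k\<in>{1..Suc l}-{j}. s j - s k)) = weight l \<gamma> \<beta>"
      unfolding weight_def s_def[symmetric] by (rule lagrange_sum_top) (use True in auto)
    have bot: "(\<Sum>j\<in>{1..Suc l}. (\<Prod>k\<in>{1..l}. \<i> * \<delta> k - s j) / (\<Prod>k\<in>{1..Suc l}-{j}. s j - s k)) = (-1) ^ l"
      using lagrange_sum_below[of "{1..Suc l}" s "{1..l}" "\<lambda>k. \<i> * \<delta> k"] True by simp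
    have "(\<Sum>j\<in>{1..Suc l}. (-1) ^ l * (\<Prod>i\<in>{1..Suc l}. s j - \<i> * \<gamma> i) * q j - exp (- of_real y) * (\<Prod>k\<in>{1..l}. \<i> * \<delta> k - s j) * q j)
      = (\<Sum>j\<in>{1..Suc l}. (-1) ^ l * kern l \<gamma> \<delta> y \<beta> * ((\<Prod>i\<in>{1..Suc l}. s j - \<i> * \<gamma> i) / (\<Prod>k\<in>{1..Suc l}-{j}. s j - s k)) -
          exp (- of_real y) * kern l \<gamma> \<delta> y \<beta> * ((\<Prod>k\<in>{1..l}. \<i> * \<delta> k - s j) / (\<Prod>k\<in>{1..Suc l}-{j}. s j - s k)))"
      by (intro sum.cong refl) (simp only: q times_divide_eq_left times_divide_eq_right mult_ac)
    also have "\<dots> = (-1) ^ l * kern l \<gamma> \<delta> y \<beta> * weight l \<gamma> \<beta> - exp (- of_real y) * kern l \<gamma> \<delta> y \<beta> * (-1) ^ l"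
      unfolding sum_subtractf sum_distrib_left[symmetric] top bot ..
    finally show ?thesis unfolding split by (simp only: algebra_simps)
  next
    case False
    then obtain a b where ab: "a \<in> {1..Suc l}" "b \<in> {1..Suc l}" "a \<noteq> b" "s a = s b"
      unfolding inj_on_def by blast
    have "sin_minor (Suc l) j \<beta> = 0" if j: "j \<in> {1..Suc l}" for j
    proof -
      have hit: "sin_minor (Suc l) j \<beta> = 0" if "k \<in> {1..Suc l} - {j}" "s j = s k" for k
      proof -
        have "(\<Prod>k\<in>{1..Suc l}-{j}. - sin (of_real pi * (\<i> * \<beta> j - \<i> * \<beta> k)) / complex_of_real pi) = 0"
          by (rule prod_zero[OF _ bexI[of _ k]]) (use that in \<open>auto simp: s_def\<close>)
        then show ?thesis unfolding sin_minor_def by (simp only: mult_zero_right)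
      qed
      show ?thesis
      proof (cases "j = a \<or> j = b")
        case True
        then show ?thesis using hit[of a] hit[of b] ab by auto
      next
        case False
        have "(\<Prod>m\<in>{1..Suc l}-{j}-{a}. rGamma (\<i> * \<beta> m - \<i> * \<beta> a)) = 0"
          by (rule prod_zero[OF _ bexI[of _ b]]) (use ab False in \<open>auto simp: s_def\<close>)
        then have "(\<Prod>a\<in>{1..Suc l}-{j}. \<Prod>m\<in>{1..Suc l}-{j}-{a}. rGamma (\<i> * \<beta> m - \<i> * \<beta> a)) = 0"
          using ab False by (intro prod_zero) (auto intro!: bexI[of _ a] simp del: prod_zero_iff)
        then show ?thesis unfolding sin_minor_def by (simp only: mult_zero_left)
      qed
    qed
    then have q0: "q j = 0" if "j \<in> {1..Suc l}" for j using that by (simp add: q_def)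
    have "kern l \<gamma> \<delta> y \<beta> = 0" using kern[OF ab(1)] q0[OF ab(1)] by simp
    moreover have "(\<Sum>j\<in>{1..Suc l}. (-1) ^ l * (\<Prod>i\<in>{1..Suc l}. s j - \<i> * \<gamma> i) * q j - exp (- of_real y) * (\<Prod>k\<in>{1..l}. \<i> * \<delta> k - s j) * q j) = 0"
      using q0 by (intro sum.neutral) simp
    ultimately show ?thesis unfolding split by simp
  qed
qed

section \<open>The differential equation of the kernel integral\<close>

text \<open>
  Differentiation under the integral sign, with the remainder of the exponential series controlled by the second
  moment of \<open>\<omega>\<close>. Since \<open>Re \<omega>\<close> is bounded, the moments need to be finite at the point \<open>y\<close> only.
\<close>
lemma exp_integral_derivative:
  fixes w \<omega> :: "'a \<Rightarrow> complex"
  assumes B: "\<And>t. \<bar>Re (\<omega> t)\<bar> \<le> B"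
    and int0: "\<And>y. integrable M (\<lambda>t. w t * exp (of_real y * \<omega> t))"
    and int1: "integrable M (\<lambda>t. \<omega> t * (w t * exp (of_real y * \<omega> t)))"
    and int2: "integrable M (\<lambda>t. (norm (\<omega> t))\<^sup>2 * norm (w t * exp (of_real y * \<omega> t)))"
  shows "((\<lambda>y. \<integral>t. w t * exp (of_real y * \<omega> t) \<partial>M) has_vector_derivative
     (\<integral>t. \<omega> t * (w t * exp (of_real y * \<omega> t)) \<partial>M)) (at y)"
proof -
  define f where "f y = (\<integral>t. w t * exp (of_real y * \<omega> t) \<partial>M)" for y :: real
  define D where "D = (\<integral>t. \<omega> t * (w t * exp (of_real y * \<omega> t)) \<partial>M)"
  define K where "K = exp \<bar>B\<bar> * (\<integral>t. (norm (\<omega> t))\<^sup>2 * norm (w t * exp (of_real y * \<omega> t)) \<partial>M)"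
  have "(f has_derivative (\<lambda>h. h *\<^sub>R D)) (at y within UNIV)"
  proof (rule has_derivativeI_sandwich[where e = 1 and H = "\<lambda>v. K * \<bar>v - y\<bar>"])
    show "bounded_linear (\<lambda>h::real. h *\<^sub>R D)" by (rule bounded_linear_scaleR_left)
    have "((\<lambda>v. K * \<bar>v - y\<bar>) \<longlongrightarrow> K * \<bar>y - y\<bar>) (at y)" by (intro tendsto_intros)
    then show "((\<lambda>v. K * \<bar>v - y\<bar>) \<longlongrightarrow> 0) (at y within UNIV)" by simp
    fix v assume v: "v \<noteq> y" "dist v y < 1"
    define h where "h = v - y"
    have h: "h \<noteq> 0" "\<bar>h\<bar> < 1" using v by (auto simp: h_def dist_real_def)
    have pt: "norm (w t * exp (of_real v * \<omega> t) - w t * exp (of_real y * \<omega> t) - of_real h * (\<omega> t * (w t * exp (of_real y * \<omega> t))))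
        \<le> exp \<bar>B\<bar> * h\<^sup>2 * ((norm (\<omega> t))\<^sup>2 * norm (w t * exp (of_real y * \<omega> t)))" for t
    proof -
      have "norm (exp (of_real h * \<omega> t) - 1 - of_real h * \<omega> t) \<le> exp \<bar>Re (of_real h * \<omega> t)\<bar> * (norm (of_real h * \<omega> t))\<^sup>2"
        using Taylor_exp[of "of_real h * \<omega> t" 1] by (simp add: numeral_2_eq_2 algebra_simps)
      also have "\<dots> \<le> exp \<bar>B\<bar> * (h\<^sup>2 * (norm (\<omega> t))\<^sup>2)"
      proof -
        have "\<bar>h\<bar> * \<bar>Re (\<omega> t)\<bar> \<le> 1 * \<bar>B\<bar>" using h B[of t] by (intro mult_mono) auto
        then show ?thesis by (simp add: norm_mult power_mult_distrib abs_mult mult_right_mono)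
      qed
      finally have 1: "norm (exp (of_real h * \<omega> t) - 1 - of_real h * \<omega> t) \<le> exp \<bar>B\<bar> * (h\<^sup>2 * (norm (\<omega> t))\<^sup>2)" .
      have "exp (complex_of_real v * \<omega> t) = exp (of_real y * \<omega> t) * exp (of_real h * \<omega> t)"
        by (simp add: h_def algebra_simps flip: exp_add)
      then have "w t * exp (of_real v * \<omega> t) - w t * exp (of_real y * \<omega> t) - of_real h * (\<omega> t * (w t * exp (of_real y * \<omega> t)))
         = (exp (of_real h * \<omega> t) - 1 - of_real h * \<omega> t) * (w t * exp (of_real y * \<omega> t))"
        by (simp add: algebra_simps)
      then show ?thesis using mult_right_mono[OF 1, of "norm (w t * exp (of_real y * \<omega> t))"]
        by (simp add: norm_mult mult_ac)
    qed
    have "f v - f y - h *\<^sub>R D = (\<integral>t. w t * exp (of_real v * \<omega> t) - w t * exp (of_real y * \<omega> t) - of_real h * (\<omega> t * (w t * exp (of_real y * \<omega> t))) \<partial>M)"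
      using int0 int1 unfolding f_def D_def scaleR_conv_of_real by simp
    also have "norm \<dots> \<le> (\<integral>t. exp \<bar>B\<bar> * h\<^sup>2 * ((norm (\<omega> t))\<^sup>2 * norm (w t * exp (of_real y * \<omega> t))) \<partial>M)"
      by (rule order_trans[OF integral_norm_bound integral_mono]) (use int0 int1 int2 pt in auto)
    also have "\<dots> = K * \<bar>h\<bar> * \<bar>h\<bar>"
    proof -
      have "\<bar>h\<bar> * \<bar>h\<bar> = h\<^sup>2" by (simp add: power2_eq_square)
      then show ?thesis unfolding K_def integral_mult_right_zero by (simp add: mult.assoc mult.commute)
    qed
    finally have "norm (f v - f y - h *\<^sub>R D) \<le> K * \<bar>h\<bar> * \<bar>h\<bar>" .
    then show "norm (f v - f y - (v - y) *\<^sub>R D) / norm (v - y) \<le> K * \<bar>v - y\<bar>"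
      using h unfolding h_def[symmetric] by (simp add: divide_le_eq)
  qed auto
  then show ?thesis unfolding has_vector_derivative_def f_def[symmetric] D_def[symmetric] f_def[abs_def, symmetric] by simp
qed

text \<open>
  The strip \<open>P \<le> Im z \<le> Q\<close> around the lines of integration keeps a positive distance from the poles on both sides, which makes
  the bounds of the Gamma functions uniform on it.
\<close>
locale kernel_lines =
  fixes l :: nat and \<gamma> \<delta> :: "nat \<Rightarrow> complex" and c :: "nat \<Rightarrow> real" and P Q :: real
  assumes below: "\<And>k. k \<in> {1..l} \<Longrightarrow> Im (\<delta> k) < P"
    and above: "\<And>i. i \<in> {1..Suc l} \<Longrightarrow> Q < Im (\<gamma> i)"
    and heights: "\<And>j. j \<in> {1..Suc l} \<Longrightarrow> P < c j \<and> c j < Q"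
begin

lemma kern_decay:
  obtains C where "C > 0" "\<And>\<beta>. (\<And>j. j \<in> {1..Suc l} \<Longrightarrow> P \<le> Im (\<beta> j) \<and> Im (\<beta> j) \<le> Q) \<Longrightarrow>
       norm (kern l \<gamma> \<delta> y \<beta>) \<le> C * exp (- (pi/4) * re_size (Suc l) \<beta>)"
proof -
  obtain C where "C > 0" and C: "\<And>\<gamma>' \<beta>. (\<And>i. i \<in> {1..Suc l} \<Longrightarrow> Im (\<gamma>' i) = Im (\<gamma> i) \<and> \<bar>Re (\<gamma>' i)\<bar> \<le> re_size (Suc l) \<gamma>) \<Longrightarrow>
       (\<And>j. j \<in> {1..Suc l} \<Longrightarrow> P \<le> Im (\<beta> j) \<and> Im (\<beta> j) \<le> Q) \<Longrightarrow>
       norm (kern l \<gamma>' \<delta> y \<beta>) \<le> C * exp (- (pi/4) * re_size (Suc l) \<beta>)"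
    using kern_bound[where l = l and \<delta> = \<delta> and P = P and Q = Q and g = "\<lambda>i. Im (\<gamma> i)" and R = "re_size (Suc l) \<gamma>" and y = y, OF below above] by metis
  show ?thesis by (rule that[OF \<open>C > 0\<close>]) (rule C, use abs_Re_le_re_size in auto)
qed

text \<open>The strip is extended downwards by \<open>1\<close> for the variable \<open>j\<close>, which is the room needed for its shift.\<close>
lemma telescoper_decay:
  assumes j: "j \<in> {1..Suc l}"
  obtains C where "C > 0" "\<And>\<beta>. (\<And>m. m \<in> {1..Suc l} \<Longrightarrow> (if m = j then P - 1 else P) \<le> Im (\<beta> m) \<and> Im (\<beta> m) \<le> Q) \<Longrightarrow>
       norm (telescoper l \<gamma> \<delta> y j \<beta>) \<le> C * exp (- (pi/4) * re_size (Suc l) \<beta>)"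
proof -
  define e where "e = pi / (8 * (real l + 1))"
  have "pi < pi * (4 * (real l + 1))" by simp
  then have e: "e > 0" "e < pi/2" by (auto simp: e_def field_simps)
  define B where "B = \<bar>P\<bar> + 1 + \<bar>Q\<bar> + (\<Sum>i\<in>{1..Suc l}. \<bar>Im (\<gamma> i)\<bar>)"
  have gB: "\<bar>Im (\<gamma> i)\<bar> \<le> B" if "i \<in> {1..Suc l}" for i
    using member_le_sum[OF that, of "\<lambda>i. \<bar>Im (\<gamma> i)\<bar>"] unfolding B_def by (intro add_increasing) auto
  have "(\<Sum>i\<in>{1..Suc l}. \<bar>Im (\<gamma> i)\<bar>) \<ge> 0" by (intro sum_nonneg) auto
  then have PB: "\<bar>P\<bar> + 1 + \<bar>Q\<bar> \<le> B" by (simp add: B_def)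
  obtain C1 where C1: "C1 > 0" "\<And>\<beta>. (\<forall>j\<in>{1..Suc l}. \<bar>Im (\<beta> j)\<bar> \<le> B) \<Longrightarrow>
     norm (sin_minor (Suc l) j \<beta>) \<le> C1 * exp ((pi * l + e) * re_size (Suc l) \<beta>)"
    using sin_minor_bound[OF j e(1), of B] by metis
  have gamma: "Im (\<gamma> i) = Im (\<gamma> i) \<and> \<bar>Re (\<gamma> i)\<bar> \<le> re_size (Suc l) \<gamma>" if "i \<in> {1..Suc l}" for i
    using abs_Re_le_re_size[OF that] by simp
  obtain C2 where C2: "C2 > 0" "\<And>z. P \<le> Im z \<Longrightarrow> Im z \<le> Q \<Longrightarrow>
       norm (gam (Suc l) l \<gamma> \<delta> z) \<le> C2 * exp (- (pi/2 - e) * (real (Suc l) + real l) * \<bar>Re z\<bar>)"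
    by (rule gam_bound[where l = l and n = "Suc l" and \<delta> = \<delta> and P = P and Q = Q and g = "\<lambda>i. Im (\<gamma> i)" and R = "re_size (Suc l) \<gamma>", OF e below above])
       (use gamma that in blast)+
  have below': "Im (\<delta> k - \<i>) < P - 1" if "k \<in> {1..l}" for k using below[OF that] by simp
  obtain C3 where C3: "C3 > 0" "\<And>z. P - 1 \<le> Im z \<Longrightarrow> Im z \<le> Q \<Longrightarrow>
       norm (gam (Suc l) l \<gamma> (\<lambda>k. \<delta> k - \<i>) z) \<le> C3 * exp (- (pi/2 - e) * (real (Suc l) + real l) * \<bar>Re z\<bar>)"
    by (rule gam_bound[where l = l and n = "Suc l" and \<delta> = "\<lambda>k. \<delta> k - \<i>" and P = "P - 1" and Q = Q and g = "\<lambda>i. Im (\<gamma> i)" and R = "re_size (Suc l) \<gamma>", OF e below' above])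
       (use gamma that in blast)+
  define C where "C = exp (- y) * (C1 * (C2 + C3) ^ Suc l * exp (\<bar>y\<bar> * (2 * (real l + 1) * B)))"
  have "norm (telescoper l \<gamma> \<delta> y j \<beta>) \<le> C * exp (- (pi/4) * re_size (Suc l) \<beta>)"
    if \<beta>: "\<And>m. m \<in> {1..Suc l} \<Longrightarrow> (if m = j then P - 1 else P) \<le> Im (\<beta> m) \<and> Im (\<beta> m) \<le> Q" for \<beta>
  proof -
    have bB: "\<bar>Im (\<beta> j)\<bar> \<le> B" if "j \<in> {1..Suc l}" for j using \<beta>[OF that] PB by (auto split: if_splits)
    let ?g = "\<lambda>m. gam (Suc l) l \<gamma> (if m = j then (\<lambda>k. \<delta> k - \<i>) else \<delta>) (\<beta> m)"
    have "norm (telescoper l \<gamma> \<delta> y j \<beta>) = exp (- y) * (norm (sin_minor (Suc l) j \<beta>) * (\<Prod>m\<in>{1..Suc l}. norm (?g m)) * norm (exp (of_real y * weight l \<gamma> \<beta>)))"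
      unfolding telescoper_def norm_mult prod_norm by simp
    also have "\<dots> \<le> exp (- y) * (C1 * (C2 + C3) ^ Suc l * exp (\<bar>y\<bar> * (2 * (real l + 1) * B)) * exp (- (pi/4) * re_size (Suc l) \<beta>))"
    proof (rule mult_left_mono[OF product_decay[OF e_def]])
      show "norm (sin_minor (Suc l) j \<beta>) \<le> C1 * exp ((pi * real l + e) * re_size (Suc l) \<beta>)"
        using C1(2)[of \<beta>] bB by simp
      show "0 \<le> norm (?g m) \<and> norm (?g m) \<le> (C2 + C3) * exp (- (pi/2 - e) * (real (Suc l) + real l) * \<bar>Re (\<beta> m)\<bar>)"
        if m: "m \<in> {1..Suc l}" for m
      proof (cases "m = j")
        case True
        have "norm (?g m) \<le> C3 * exp (- (pi/2 - e) * (real (Suc l) + real l) * \<bar>Re (\<beta> m)\<bar>)"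
          using C3(2)[of "\<beta> m"] \<beta>[OF m] True by simp
        also have "\<dots> \<le> (C2 + C3) * exp (- (pi/2 - e) * (real (Suc l) + real l) * \<bar>Re (\<beta> m)\<bar>)"
          using C2 by (intro mult_right_mono) auto
        finally show ?thesis by simp
      next
        case False
        have "norm (?g m) \<le> C2 * exp (- (pi/2 - e) * (real (Suc l) + real l) * \<bar>Re (\<beta> m)\<bar>)"
          using C2(2)[of "\<beta> m"] \<beta>[OF m] False by simp
        also have "\<dots> \<le> (C2 + C3) * exp (- (pi/2 - e) * (real (Suc l) + real l) * \<bar>Re (\<beta> m)\<bar>)"
          using C3 by (intro mult_right_mono) auto
        finally show ?thesis by simp
      qed
      show "norm (exp (of_real y * weight l \<gamma> \<beta>)) \<le> exp (\<bar>y\<bar> * (2 * (real l + 1) * B))"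
        by (rule norm_exp_weight_le) (use bB gB in auto)
    qed (use C1 C2 C3 in auto)
    finally show ?thesis by (simp add: C_def mult_ac)
  qed
  moreover have "C > 0" using C1 C2 C3 by (simp add: C_def add_pos_pos)
  ultimately show ?thesis using that by blast
qed

lemma on_lines_range: "j \<in> {1..Suc l} \<Longrightarrow> P < Im (on_lines c t j) \<and> Im (on_lines c t j) < Q"
  using heights by (simp add: on_lines_def)

text \<open>Two powers of the weight are needed, for the second moment in \<open>exp_integral_derivative\<close>.\<close>
lemma kern_moment_decay:
  obtains C where "C > 0" "\<And>t. (1 + norm (weight l \<gamma> (on_lines c t)))\<^sup>2 * norm (kern l \<gamma> \<delta> y (on_lines c t))
     \<le> C * exp (- (pi/8) * re_size (Suc l) (on_lines c t))"
proof -
  obtain C where C: "C > 0" "\<And>\<beta>. (\<And>j. j \<in> {1..Suc l} \<Longrightarrow> P \<le> Im (\<beta> j) \<and> Im (\<beta> j) \<le> Q) \<Longrightarrow>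
       norm (kern l \<gamma> \<delta> y \<beta>) \<le> C * exp (- (pi/4) * re_size (Suc l) \<beta>)"
    using kern_decay by metis
  obtain K where K: "K > 0" "\<And>t. t \<ge> 0 \<Longrightarrow> (1 + t)\<^sup>2 \<le> K * exp (pi/8 * t)"
    using one_plus_power_le_exp[of "pi/8" 2] by auto
  define A where "A = (\<Sum>j\<in>{1..Suc l}. \<bar>c j\<bar>) + norm (\<Sum>i\<in>{1..Suc l}. \<i> * \<gamma> i)"
  have A: "A \<ge> 0" unfolding A_def by (intro add_nonneg_nonneg sum_nonneg) auto
  have "(1 + norm (weight l \<gamma> (on_lines c t)))\<^sup>2 * norm (kern l \<gamma> \<delta> y (on_lines c t))
     \<le> ((1 + A)\<^sup>2 * K * C) * exp (- (pi/8) * re_size (Suc l) (on_lines c t))" for t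
  proof -
    let ?S = "re_size (Suc l) (on_lines c t)"
    have S: "?S \<ge> 0" by (rule re_size_nonneg)
    have "norm (\<Sum>j\<in>{1..Suc l}. \<i> * on_lines c t j) \<le> (\<Sum>j\<in>{1..Suc l}. \<bar>t j\<bar> + \<bar>c j\<bar>)"
    proof (intro order_trans[OF norm_sum] sum_mono)
      fix j
      show "norm (\<i> * on_lines c t j) \<le> \<bar>t j\<bar> + \<bar>c j\<bar>"
        using cmod_le[of "on_lines c t j"] by (simp add: norm_mult on_lines_def)
    qed
    then have "norm (weight l \<gamma> (on_lines c t)) \<le> ?S + A"
      unfolding weight_def A_def re_size_on_lines
      by (intro order_trans[OF norm_triangle_ineq4]) (simp add: sum.distrib)
    then have "1 + norm (weight l \<gamma> (on_lines c t)) \<le> (1 + A) * (1 + ?S)"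
    proof -
      have "(1 + A) * (1 + ?S) = 1 + A + ?S + A * ?S" by (simp add: algebra_simps)
      with \<open>norm (weight l \<gamma> (on_lines c t)) \<le> ?S + A\<close> mult_nonneg_nonneg[OF A S] show ?thesis by linarith
    qed
    then have "(1 + norm (weight l \<gamma> (on_lines c t)))\<^sup>2 \<le> ((1 + A) * (1 + ?S))\<^sup>2"
      by (intro power_mono) auto
    also have "\<dots> \<le> (1 + A)\<^sup>2 * (K * exp (pi/8 * ?S))"
      unfolding power_mult_distrib using K(2)[OF S] by (intro mult_left_mono) auto
    finally have 1: "(1 + norm (weight l \<gamma> (on_lines c t)))\<^sup>2 \<le> (1 + A)\<^sup>2 * (K * exp (pi/8 * ?S))" .
    have 2: "norm (kern l \<gamma> \<delta> y (on_lines c t)) \<le> C * exp (- (pi/4) * ?S)"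
      by (rule C(2)) (use on_lines_range in \<open>auto intro: less_imp_le\<close>)
    have "(1 + norm (weight l \<gamma> (on_lines c t)))\<^sup>2 * norm (kern l \<gamma> \<delta> y (on_lines c t)) \<le> ((1 + A)\<^sup>2 * (K * exp (pi/8 * ?S))) * (C * exp (- (pi/4) * ?S))"
      using 1 2 K by (intro mult_mono) auto
    also have "\<dots> = ((1 + A)\<^sup>2 * K * C) * (exp (pi/8 * ?S) * exp (- (pi/4) * ?S))" by (simp add: mult_ac)
    also have "exp (pi/8 * ?S) * exp (- (pi/4) * ?S) = exp (- (pi/8) * ?S)" by (simp add: algebra_simps flip: exp_add)
    finally show ?thesis .
  qed
  moreover have "(1 + A)\<^sup>2 * K * C > 0" using A K C by simp
  ultimately show ?thesis using that by blast
qed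

lemma kern_on_lines_measurable:
  "(\<lambda>t. kern l \<gamma> \<delta> y (on_lines c t)) \<in> borel_measurable (\<Pi>\<^sub>M j\<in>{1..Suc l}. lborel)"
  "(\<lambda>t. weight l \<gamma> (on_lines c t)) \<in> borel_measurable (\<Pi>\<^sub>M j\<in>{1..Suc l}. lborel)"
  by (intro kern_measurable weight_measurable measurable_on_lines; assumption)+

lemma kern_moment_integrable:
  assumes "p \<le> 2"
  shows "integrable (\<Pi>\<^sub>M j\<in>{1..Suc l}. lborel) (\<lambda>t. weight l \<gamma> (on_lines c t) ^ p * kern l \<gamma> \<delta> y (on_lines c t))"
proof -
  obtain C where C: "C > 0" "\<And>t. (1 + norm (weight l \<gamma> (on_lines c t)))\<^sup>2 * norm (kern l \<gamma> \<delta> y (on_lines c t))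
     \<le> C * exp (- (pi/8) * re_size (Suc l) (on_lines c t))"
    using kern_moment_decay by metis
  show ?thesis
  proof (rule lines_integrable[where \<eta> = "pi/8" and C = C and f = "\<lambda>\<beta>. weight l \<gamma> \<beta> ^ p * kern l \<gamma> \<delta> y \<beta>"])
    show "(\<lambda>t. weight l \<gamma> (on_lines c t) ^ p * kern l \<gamma> \<delta> y (on_lines c t)) \<in> borel_measurable (\<Pi>\<^sub>M j\<in>{1..Suc l}. lborel)"
      by (intro borel_measurable_times borel_measurable_power kern_on_lines_measurable)
    fix t
    let ?w = "norm (weight l \<gamma> (on_lines c t))"
    have "?w ^ p \<le> (1 + ?w) ^ p" by (intro power_mono) auto
    also have "\<dots> \<le> (1 + ?w) ^ 2" using assms by (intro power_increasing) auto
    finally have "norm (weight l \<gamma> (on_lines c t) ^ p * kern l \<gamma> \<delta> y (on_lines c t)) \<le> (1 + ?w)\<^sup>2 * norm (kern l \<gamma> \<delta> y (on_lines c t))"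
      by (simp add: norm_mult norm_power mult_right_mono)
    also have "\<dots> \<le> C * exp (- (pi/8) * re_size (Suc l) (on_lines c t))" by (rule C)
    finally show "norm (weight l \<gamma> (on_lines c t) ^ p * kern l \<gamma> \<delta> y (on_lines c t)) \<le> C * exp (- (pi/8) * re_size (Suc l) (on_lines c t))" .
  qed simp
qed

lemma kern_integrable: "integrable (\<Pi>\<^sub>M j\<in>{1..Suc l}. lborel) (\<lambda>t. kern l \<gamma> \<delta> y (on_lines c t))"
  using kern_moment_integrable[of 0] by simp

text \<open>Lowering \<open>\<beta>\<^sub>j\<close> by \<open>\<i>\<close> amounts to moving the \<open>j\<close>-th line down by \<open>1\<close>.\<close>
lemma telescoper_lines_integral:
  assumes j: "j \<in> {1..Suc l}"
  shows "integrable (\<Pi>\<^sub>M j\<in>{1..Suc l}. lborel) (\<lambda>t. telescoper l \<gamma> \<delta> y j (on_lines c t))"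
    "integrable (\<Pi>\<^sub>M j\<in>{1..Suc l}. lborel) (\<lambda>t. telescoper l \<gamma> \<delta> y j ((on_lines c t)(j := on_lines c t j - \<i>)))"
    "(\<integral>t. telescoper l \<gamma> \<delta> y j ((on_lines c t)(j := on_lines c t j - \<i>)) \<partial>(\<Pi>\<^sub>M j\<in>{1..Suc l}. lborel)) =
     (\<integral>t. telescoper l \<gamma> \<delta> y j (on_lines c t) \<partial>(\<Pi>\<^sub>M j\<in>{1..Suc l}. lborel))"
proof -
  have upd: "(on_lines c t)(j := on_lines c t j - \<i>) = on_lines (c(j := c j - 1)) t" for t
    by (auto simp: on_lines_def complex_eq_iff)
  obtain C where C: "C > 0" "\<And>\<beta>. (\<And>m. m \<in> {1..Suc l} \<Longrightarrow> (if m = j then P - 1 else P) \<le> Im (\<beta> m) \<and> Im (\<beta> m) \<le> Q) \<Longrightarrow>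
       norm (telescoper l \<gamma> \<delta> y j \<beta>) \<le> C * exp (- (pi/4) * re_size (Suc l) \<beta>)"
    using telescoper_decay[OF j] by metis
  have meas: "(\<lambda>t. telescoper l \<gamma> \<delta> y j (on_lines c' t)) \<in> borel_measurable (\<Pi>\<^sub>M j\<in>{1..Suc l}. lborel)" for c'
    by (intro telescoper_measurable measurable_on_lines j)
  have bound: "norm (telescoper l \<gamma> \<delta> y j \<beta>) \<le> C * exp (- (pi/4) * re_size (Suc l) \<beta>)"
    if "\<And>k. k \<in> {1..Suc l} - {j} \<Longrightarrow> Im (\<beta> k) = c k" "min (c j) (c j - 1) \<le> Im (\<beta> j)" "Im (\<beta> j) \<le> max (c j) (c j - 1)" for \<beta>
  proof (rule C(2))
    fix m assume m: "m \<in> {1..Suc l}"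
    show "(if m = j then P - 1 else P) \<le> Im (\<beta> m) \<and> Im (\<beta> m) \<le> Q"
      using that heights[OF m] m by (cases "m = j") auto
  qed
  have "lines_integral (Suc l) c (telescoper l \<gamma> \<delta> y j) = lines_integral (Suc l) (c(j := c j - 1)) (telescoper l \<gamma> \<delta> y j)"
  proof (rule lines_integral_shift_coordinate[OF j, where \<eta> = "pi/4" and lo = "P - 1" and hi = Q and C = C])
    show "(\<lambda>z. telescoper l \<gamma> \<delta> y j (\<beta>(j := z))) holomorphic_on {z. P - 1 < Im z \<and> Im z < Q}" for \<beta>
      unfolding telescoper_def
    proof (intro holomorphic_intros sin_minor_holomorphic weight_holomorphic gam_coordinate_holomorphic holomorphic_on_prod)
      fix m assume "m = j"
      then show "gam (Suc l) l \<gamma> (if m = j then (\<lambda>k. \<delta> k - \<i>) else \<delta>) holomorphic_on {z. P - 1 < Im z \<and> Im z < Q}"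
        by (simp, intro gam_holomorphic) (use below above in \<open>fastforce+\<close>)
    qed
  qed (use heights[OF j] meas bound in auto)
  then show "(\<integral>t. telescoper l \<gamma> \<delta> y j ((on_lines c t)(j := on_lines c t j - \<i>)) \<partial>(\<Pi>\<^sub>M j\<in>{1..Suc l}. lborel)) =
     (\<integral>t. telescoper l \<gamma> \<delta> y j (on_lines c t) \<partial>(\<Pi>\<^sub>M j\<in>{1..Suc l}. lborel))"
    unfolding upd lines_integral_def by simp
  show "integrable (\<Pi>\<^sub>M j\<in>{1..Suc l}. lborel) (\<lambda>t. telescoper l \<gamma> \<delta> y j (on_lines c t))"
    by (rule lines_integrable[where \<eta> = "pi/4" and C = C, OF _ meas]) (simp, rule bound, simp_all add: on_lines_def)
  show "integrable (\<Pi>\<^sub>M j\<in>{1..Suc l}. lborel) (\<lambda>t. telescoper l \<gamma> \<delta> y j ((on_lines c t)(j := on_lines c t j - \<i>)))"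
    unfolding upd by (rule lines_integrable[where \<eta> = "pi/4" and C = C, OF _ meas]) (simp, rule bound, simp_all add: on_lines_def)
qed

text \<open>The integral of the telescoping sum vanishes.\<close>
lemma kern_first_moment:
  "(\<integral>t. weight l \<gamma> (on_lines c t) * kern l \<gamma> \<delta> y (on_lines c t) \<partial>(\<Pi>\<^sub>M j\<in>{1..Suc l}. lborel)) =
   exp (- of_real y) * lines_integral (Suc l) c (kern l \<gamma> \<delta> y)"
proof -
  let ?M = "\<Pi>\<^sub>M j\<in>{1..Suc l}. lborel :: real measure"
  have int1: "integrable ?M (\<lambda>t. weight l \<gamma> (on_lines c t) * kern l \<gamma> \<delta> y (on_lines c t))"
    using kern_moment_integrable[of 1] by simp
  have "(-1) ^ l * ((\<integral>t. weight l \<gamma> (on_lines c t) * kern l \<gamma> \<delta> y (on_lines c t) \<partial>?M) - exp (- of_real y) * lines_integral (Suc l) c (kern l \<gamma> \<delta> y))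
    = (\<integral>t. (-1) ^ l * (weight l \<gamma> (on_lines c t) * kern l \<gamma> \<delta> y (on_lines c t) - exp (- of_real y) * kern l \<gamma> \<delta> y (on_lines c t)) \<partial>?M)"
    unfolding lines_integral_def
    by (subst integral_mult_right_zero, subst Bochner_Integration.integral_diff[OF int1 integrable_mult_right[OF kern_integrable]], subst integral_mult_right_zero) (rule refl)
  also have "\<dots> = (\<integral>t. (\<Sum>j\<in>{1..Suc l}. telescoper l \<gamma> \<delta> y j ((on_lines c t)(j := on_lines c t j - \<i>)) - telescoper l \<gamma> \<delta> y j (on_lines c t)) \<partial>?M)"
  proof (intro Bochner_Integration.integral_cong refl)
    fix t
    have "(\<Sum>j\<in>{1..Suc l}. telescoper l \<gamma> \<delta> y j ((on_lines c t)(j := on_lines c t j - \<i>)) - telescoper l \<gamma> \<delta> y j (on_lines c t)) =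
      (-1) ^ l * (weight l \<gamma> (on_lines c t) - exp (- of_real y)) * kern l \<gamma> \<delta> y (on_lines c t)"
    proof (rule telescoping_sum)
      show "Im (\<delta> k) < Im (on_lines c t j)" if "j \<in> {1..Suc l}" "k \<in> {1..l}" for j k
        using on_lines_range[OF that(1), of t] below[OF that(2)] by linarith
      show "Im (on_lines c t j) < Im (\<gamma> i)" if "j \<in> {1..Suc l}" "i \<in> {1..Suc l}" for i j
        using on_lines_range[OF that(1), of t] above[OF that(2)] by linarith
    qed
    then show "(-1) ^ l * (weight l \<gamma> (on_lines c t) * kern l \<gamma> \<delta> y (on_lines c t) - exp (- of_real y) * kern l \<gamma> \<delta> y (on_lines c t)) =
      (\<Sum>j\<in>{1..Suc l}. telescoper l \<gamma> \<delta> y j ((on_lines c t)(j := on_lines c t j - \<i>)) - telescoper l \<gamma> \<delta> y j (on_lines c t))"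
      by (simp only: left_diff_distrib mult.assoc)
  qed
  also have "\<dots> = (\<Sum>j\<in>{1..Suc l}. (\<integral>t. telescoper l \<gamma> \<delta> y j ((on_lines c t)(j := on_lines c t j - \<i>)) - telescoper l \<gamma> \<delta> y j (on_lines c t) \<partial>?M))"
    by (intro Bochner_Integration.integral_sum Bochner_Integration.integrable_diff telescoper_lines_integral)
  also have "\<dots> = 0"
  proof (intro sum.neutral ballI)
    fix j assume j: "j \<in> {1..Suc l}"
    show "(\<integral>t. telescoper l \<gamma> \<delta> y j ((on_lines c t)(j := on_lines c t j - \<i>)) - telescoper l \<gamma> \<delta> y j (on_lines c t) \<partial>?M) = 0"
      unfolding Bochner_Integration.integral_diff[OF telescoper_lines_integral(2,1)[OF j]] telescoper_lines_integral(3)[OF j] by simp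
  qed
  finally show ?thesis by simp
qed

lemma kern_integral_derivative:
  "((\<lambda>y. lines_integral (Suc l) c (kern l \<gamma> \<delta> y)) has_vector_derivative
    exp (- of_real y) * lines_integral (Suc l) c (kern l \<gamma> \<delta> y)) (at y)"
proof -
  let ?M = "\<Pi>\<^sub>M j\<in>{1..Suc l}. lborel :: real measure"
  define w where "w t = rGamma_prod (Suc l) (on_lines c t) * (\<Prod>j\<in>{1..Suc l}. gam (Suc l) l \<gamma> \<delta> (on_lines c t j))" for t
  have k: "kern l \<gamma> \<delta> y (on_lines c t) = w t * exp (of_real y * weight l \<gamma> (on_lines c t))" for y t
    by (simp only: kern_def w_def)
  define B where "B = Max (insert \<bar>P\<bar> (insert \<bar>Q\<bar> ((\<lambda>i. \<bar>Im (\<gamma> i)\<bar>) ` {1..Suc l})))"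
  have B: "\<bar>P\<bar> \<le> B" "\<bar>Q\<bar> \<le> B" "\<And>i. i \<in> {1..Suc l} \<Longrightarrow> \<bar>Im (\<gamma> i)\<bar> \<le> B"
    unfolding B_def by (intro Max_ge; auto)+
  have "((\<lambda>y. \<integral>t. w t * exp (of_real y * weight l \<gamma> (on_lines c t)) \<partial>?M) has_vector_derivative
     (\<integral>t. weight l \<gamma> (on_lines c t) * (w t * exp (of_real y * weight l \<gamma> (on_lines c t))) \<partial>?M)) (at y)"
  proof (rule exp_integral_derivative)
    show "\<bar>Re (weight l \<gamma> (on_lines c t))\<bar> \<le> 2 * (real l + 1) * B" for t
    proof (rule norm_exp_weight_le(1))
      show "\<bar>Im (on_lines c t j)\<bar> \<le> B" if "j \<in> {1..Suc l}" for j
        using on_lines_range[OF that, of t] B(1,2) by linarith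
    qed (rule B(3))
    show "integrable ?M (\<lambda>t. w t * exp (of_real y * weight l \<gamma> (on_lines c t)))" for y
      unfolding k[symmetric] by (rule kern_integrable)
    show "integrable ?M (\<lambda>t. weight l \<gamma> (on_lines c t) * (w t * exp (of_real y * weight l \<gamma> (on_lines c t))))"
      unfolding k[symmetric] using kern_moment_integrable[of 1] by simp
    show "integrable ?M (\<lambda>t. (norm (weight l \<gamma> (on_lines c t)))\<^sup>2 * norm (w t * exp (of_real y * weight l \<gamma> (on_lines c t))))"
      unfolding k[symmetric] using integrable_norm[OF kern_moment_integrable[of 2]] by (simp add: norm_mult norm_power)
  qed
  then show ?thesis
    unfolding k[symmetric] kern_first_moment unfolding lines_integral_def .
qed

text \<open>By the differential equation the product of the integral with \<open>exp (exp (- y))\<close> has derivative \<open>0\<close>.\<close>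
lemma kern_integral_constant:
  obtains K where "\<And>y. lines_integral (Suc l) c (kern l \<gamma> \<delta> y) = K * of_real (exp (- exp (- y)))"
proof -
  define G where "G y = lines_integral (Suc l) c (kern l \<gamma> \<delta> y)" for y
  define E where "E y = G y * of_real (exp (exp (- y)))" for y
  have "(E has_vector_derivative 0) (at y)" for y
  proof -
    have 1: "(G has_vector_derivative exp (- of_real y) * G y) (at y)"
      using kern_integral_derivative[of y] unfolding G_def .
    have "((\<lambda>y. exp (exp (- y))) has_real_derivative exp (exp (- y)) * (exp (- y) * (-1))) (at y)"
      by (auto intro!: derivative_eq_intros)
    then have 2: "((\<lambda>y. complex_of_real (exp (exp (- y)))) has_vector_derivative of_real (exp (exp (- y)) * (exp (- y) * (-1)))) (at y)"
      by (intro has_vector_derivative_of_real) (simp add: has_real_derivative_iff_has_vector_derivative)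
    have 3: "exp (- complex_of_real y) = of_real (exp (- y))" by (simp add: exp_of_real flip: of_real_minus)
    show ?thesis
      using has_vector_derivative_mult[OF 1 2] unfolding E_def 3 by (simp add: algebra_simps)
  qed
  then have "\<exists>K. \<forall>y\<in>UNIV. E y = K"
    by (intro has_derivative_zero_constant[of UNIV E]) (auto simp: has_vector_derivative_def)
  then obtain K where K: "\<And>y. E y = K" by blast
  have "lines_integral (Suc l) c (kern l \<gamma> \<delta> y) = K * of_real (exp (- exp (- y)))" for y
    using K[of y] unfolding E_def G_def[symmetric] by (simp add: exp_minus divide_inverse[symmetric] field_simps)
  then show ?thesis using that by blast
qed

end

section \<open>Lines below a simple pole\<close>

text \<open>
  An exponential rate at both ends of a closed horizontal strip. Ignoring a bounded part of the strip permits poles there, and leaving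
  the constants implicit makes the rates of factors additive.
\<close>
definition far_bound :: "real \<Rightarrow> real \<Rightarrow> real \<Rightarrow> (complex \<Rightarrow> complex) \<Rightarrow> bool" where
  "far_bound p q a f \<longleftrightarrow> (\<exists>C X. \<forall>z. p \<le> Im z \<longrightarrow> Im z \<le> q \<longrightarrow> X \<le> \<bar>Re z\<bar> \<longrightarrow> norm (f z) \<le> C * exp (a * \<bar>Re z\<bar>))"

lemma far_bound_mult:
  assumes "far_bound p q a f" "far_bound p q b g"
  shows "far_bound p q (a + b) (\<lambda>z. f z * g z)"
proof -
  obtain C X where 1: "\<And>z. p \<le> Im z \<Longrightarrow> Im z \<le> q \<Longrightarrow> X \<le> \<bar>Re z\<bar> \<Longrightarrow> norm (f z) \<le> C * exp (a * \<bar>Re z\<bar>)"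
    using assms(1) unfolding far_bound_def by blast
  obtain D Y where 2: "\<And>z. p \<le> Im z \<Longrightarrow> Im z \<le> q \<Longrightarrow> Y \<le> \<bar>Re z\<bar> \<Longrightarrow> norm (g z) \<le> D * exp (b * \<bar>Re z\<bar>)"
    using assms(2) unfolding far_bound_def by blast
  have "norm (f z * g z) \<le> (C * D) * exp ((a + b) * \<bar>Re z\<bar>)"
    if "p \<le> Im z" "Im z \<le> q" "max X Y \<le> \<bar>Re z\<bar>" for z
  proof -
    have F: "norm (f z) \<le> C * exp (a * \<bar>Re z\<bar>)" and G: "norm (g z) \<le> D * exp (b * \<bar>Re z\<bar>)" using 1 2 that by auto
    then have "norm (f z) * norm (g z) \<le> (C * exp (a * \<bar>Re z\<bar>)) * (D * exp (b * \<bar>Re z\<bar>))"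
      by (intro mult_mono) (auto intro: order_trans[OF norm_ge_zero])
    moreover have "exp ((a + b) * \<bar>Re z\<bar>) = exp (a * \<bar>Re z\<bar>) * exp (b * \<bar>Re z\<bar>)"
      by (simp add: distrib_right exp_add)
    ultimately show ?thesis by (simp only: norm_mult mult_ac)
  qed
  then show ?thesis unfolding far_bound_def by blast
qed

lemma far_bound_const: "far_bound p q 0 (\<lambda>z. w)"
  unfolding far_bound_def by (intro exI[of _ "norm w"]) auto

lemma far_bound_mono:
  assumes "far_bound p q a f" "a \<le> b"
  shows "far_bound p q b f"
proof -
  obtain C X where 1: "\<And>z. p \<le> Im z \<Longrightarrow> Im z \<le> q \<Longrightarrow> X \<le> \<bar>Re z\<bar> \<Longrightarrow> norm (f z) \<le> C * exp (a * \<bar>Re z\<bar>)"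
    using assms(1) unfolding far_bound_def by blast
  have "norm (f z) \<le> \<bar>C\<bar> * exp (b * \<bar>Re z\<bar>)" if "p \<le> Im z" "Im z \<le> q" "X \<le> \<bar>Re z\<bar>" for z
  proof -
    have "norm (f z) \<le> C * exp (a * \<bar>Re z\<bar>)" using 1 that by blast
    also have "\<dots> \<le> \<bar>C\<bar> * exp (b * \<bar>Re z\<bar>)"
      using assms(2) by (intro mult_mono) (auto intro: mult_right_mono)
    finally show ?thesis .
  qed
  then show ?thesis unfolding far_bound_def by blast
qed

lemma far_bound_prod:
  assumes "finite A" "\<And>i. i \<in> A \<Longrightarrow> far_bound p q a (f i)"
  shows "far_bound p q (real (card A) * a) (\<lambda>z. \<Prod>i\<in>A. f i z)"
  using assms
proof (induction A rule: finite_induct)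
  case (insert x A)
  have "far_bound p q (a + real (card A) * a) (\<lambda>z. f x z * (\<Prod>i\<in>A. f i z))"
    using insert by (intro far_bound_mult) auto
  then show ?case using insert.hyps by (simp add: algebra_simps)
qed (use far_bound_const[of p q 1] in simp)

lemma far_bound_Gamma:
  assumes e: "0 < e" "e < pi/2"
    and w: "\<And>z. p \<le> Im z \<Longrightarrow> Im z \<le> q \<Longrightarrow> r \<le> Re (w z) \<and> Re (w z) \<le> R \<and> \<bar>\<bar>Im (w z)\<bar> - \<bar>Re z\<bar>\<bar> \<le> B"
  shows "far_bound p q (- (pi/2 - e)) (\<lambda>z. Gamma (w z))"
proof -
  obtain C where C: "C > 0" "\<And>s. r \<le> Re s \<Longrightarrow> Re s \<le> R \<Longrightarrow> 1 \<le> \<bar>Im s\<bar> \<Longrightarrow>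
       norm (Gamma s) \<le> C * exp (- (pi/2 - e) * \<bar>Im s\<bar>)"
    using Gamma_strip_bound_far[OF e(1)] by metis
  have "norm (Gamma (w z)) \<le> (C * exp ((pi/2 - e) * B)) * exp (- (pi/2 - e) * \<bar>Re z\<bar>)"
    if z: "p \<le> Im z" "Im z \<le> q" "B + 1 \<le> \<bar>Re z\<bar>" for z
  proof -
    have I: "\<bar>Re z\<bar> - B \<le> \<bar>Im (w z)\<bar>" using w[OF z(1,2)] by linarith
    then have "norm (Gamma (w z)) \<le> C * exp (- (pi/2 - e) * \<bar>Im (w z)\<bar>)"
      using w[OF z(1,2)] z by (intro C) auto
    also have "\<dots> \<le> C * exp (- (pi/2 - e) * (\<bar>Re z\<bar> - B))"
    proof -
      have "(pi/2 - e) * (\<bar>Re z\<bar> - B) \<le> (pi/2 - e) * \<bar>Im (w z)\<bar>" using I e by (intro mult_left_mono) auto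
      then have "- (pi/2 - e) * \<bar>Im (w z)\<bar> \<le> - (pi/2 - e) * (\<bar>Re z\<bar> - B)"
        unfolding minus_mult_left[symmetric] neg_le_iff_le .
      then have "exp (- (pi/2 - e) * \<bar>Im (w z)\<bar>) \<le> exp (- (pi/2 - e) * (\<bar>Re z\<bar> - B))"
        unfolding exp_le_cancel_iff .
      then show ?thesis using C(1) by (intro mult_left_mono) auto
    qed
    also have "\<dots> = (C * exp ((pi/2 - e) * B)) * exp (- (pi/2 - e) * \<bar>Re z\<bar>)"
    proof -
      have "C * exp (- a * (x - B)) = (C * exp (a * B)) * exp (- a * x)" for a x :: real
        by (simp add: algebra_simps flip: exp_add)
      then show ?thesis .
    qed
    finally show ?thesis .
  qed
  then show ?thesis unfolding far_bound_def by blast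
qed

lemma far_bound_sin_pi:
  assumes w: "\<And>z. p \<le> Im z \<Longrightarrow> Im z \<le> q \<Longrightarrow> \<bar>\<bar>Im (w z)\<bar> - \<bar>Re z\<bar>\<bar> \<le> B"
  shows "far_bound p q pi (\<lambda>z. sin (of_real pi * w z))"
proof -
  have "norm (sin (of_real pi * w z)) \<le> exp (pi * B) * exp (pi * \<bar>Re z\<bar>)" if z: "p \<le> Im z" "Im z \<le> q" for z
  proof -
    have "pi * \<bar>Im (w z)\<bar> \<le> pi * (B + \<bar>Re z\<bar>)" using w[OF z] by (intro mult_left_mono) auto
    then have "exp (pi * \<bar>Im (w z)\<bar>) \<le> exp (pi * B) * exp (pi * \<bar>Re z\<bar>)"
      by (simp add: algebra_simps flip: exp_add)
    with norm_sin_pi_le[of "w z"] show ?thesis by linarith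
  qed
  then show ?thesis unfolding far_bound_def by blast
qed

lemma far_bound_linear:
  assumes e: "e > 0"
  shows "far_bound p q e (\<lambda>z. a * z + b)"
proof -
  obtain K where K: "K > 0" "\<And>t. t \<ge> 0 \<Longrightarrow> (1 + t) ^ 1 \<le> K * exp (e * t)"
    using one_plus_power_le_exp[OF e, of 1] by auto
  define B where "B = norm a * (1 + \<bar>p\<bar> + \<bar>q\<bar>) + norm b"
  have "norm (a * z + b) \<le> (B * K) * exp (e * \<bar>Re z\<bar>)" if z: "p \<le> Im z" "Im z \<le> q" for z
  proof -
    have "norm z \<le> \<bar>Re z\<bar> + \<bar>Im z\<bar>" by (rule cmod_le)
    also have "\<dots> \<le> \<bar>Re z\<bar> + (\<bar>p\<bar> + \<bar>q\<bar>)" using z by linarith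
    also have "\<dots> \<le> (1 + \<bar>p\<bar> + \<bar>q\<bar>) * (1 + \<bar>Re z\<bar>)" by (simp add: algebra_simps)
    finally have nz: "norm z \<le> (1 + \<bar>p\<bar> + \<bar>q\<bar>) * (1 + \<bar>Re z\<bar>)" .
    have "norm (a * z + b) \<le> norm a * norm z + norm b * 1"
      by (metis norm_mult norm_triangle_ineq mult.right_neutral)
    also have "\<dots> \<le> norm a * ((1 + \<bar>p\<bar> + \<bar>q\<bar>) * (1 + \<bar>Re z\<bar>)) + norm b * (1 + \<bar>Re z\<bar>)"
      using nz by (intro add_mono mult_left_mono) auto
    also have "\<dots> = B * (1 + \<bar>Re z\<bar>)" by (simp add: B_def algebra_simps)
    also have "\<dots> \<le> B * (K * exp (e * \<bar>Re z\<bar>))"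
      using K(2)[of "\<bar>Re z\<bar>"] by (intro mult_left_mono) (auto simp: B_def)
    finally show ?thesis by simp
  qed
  then show ?thesis unfolding far_bound_def by blast
qed

lemma far_bound_inverse: "far_bound p q 0 (\<lambda>z. 1 / (z - b))"
proof -
  have "norm (1 / (z - b)) \<le> 1 * exp (0 * \<bar>Re z\<bar>)" if z: "\<bar>Re b\<bar> + 1 \<le> \<bar>Re z\<bar>" for z
  proof -
    have "\<bar>Re z - Re b\<bar> \<ge> 1" using z by linarith
    then have "norm (z - b) \<ge> 1" using abs_Re_le_cmod[of "z - b"] by simp
    then show ?thesis by (simp add: norm_divide divide_le_eq)
  qed
  then show ?thesis unfolding far_bound_def by blast
qed

lemma far_bound_exp: "far_bound p q 0 (\<lambda>z. exp (\<i> * of_real y * z))"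
proof -
  have "norm (exp (\<i> * of_real y * z)) \<le> exp (\<bar>y\<bar> * (\<bar>p\<bar> + \<bar>q\<bar>)) * exp (0 * \<bar>Re z\<bar>)" if z: "p \<le> Im z" "Im z \<le> q" for z
  proof -
    have "- (y * Im z) \<le> \<bar>y\<bar> * \<bar>Im z\<bar>" by (metis abs_ge_minus_self abs_mult)
    also have "\<dots> \<le> \<bar>y\<bar> * (\<bar>p\<bar> + \<bar>q\<bar>)" using z by (intro mult_left_mono) auto
    finally show ?thesis by simp
  qed
  then show ?thesis unfolding far_bound_def by blast
qed

lemma far_bound_cong:
  assumes "far_bound p q a f" "\<And>z. p \<le> Im z \<Longrightarrow> Im z \<le> q \<Longrightarrow> X \<le> \<bar>Re z\<bar> \<Longrightarrow> g z = f z"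
  shows "far_bound p q a g"
proof -
  obtain C Y where 1: "\<And>z. p \<le> Im z \<Longrightarrow> Im z \<le> q \<Longrightarrow> Y \<le> \<bar>Re z\<bar> \<Longrightarrow> norm (f z) \<le> C * exp (a * \<bar>Re z\<bar>)"
    using assms(1) unfolding far_bound_def by blast
  show ?thesis unfolding far_bound_def
    by (rule exI[of _ C], rule exI[of _ "max X Y"]) (use 1 assms(2) in auto)
qed

text \<open>
  The factor \<open>exp (\<i> y z)\<close> has modulus \<open>exp (- y Im z)\<close>. Once the line has been moved to a height above \<open>p\<close>, the remaining integral is
  of lower order than the residue at \<open>p\<close>, which is of size \<open>exp (- y Im p)\<close>.
\<close>
lemma pole_asymptotics:
  assumes c: "lo < c" "c < Im p" "Im p < hi" and \<eta>: "\<eta> > 0"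
    and hol: "h holomorphic_on {z. lo < Im z \<and> Im z < hi}"
    and far: "far_bound c hi (- \<eta>) (\<lambda>z. h z / (z - p))"
  shows "integrable lborel (\<lambda>t. h (Complex t c) / (Complex t c - p) * exp (\<i> * of_real y * Complex t c))"
    and "(\<lambda>n. exp (- \<i> * of_nat n * p) * (\<integral>t. h (Complex t c) / (Complex t c - p) * exp (\<i> * of_nat n * Complex t c) \<partial>lborel))
      \<longlonglongrightarrow> 2 * of_real pi * \<i> * h p"
proof -
  \<comment> \<open>the pole is crossed between the heights \<open>Im p - d\<close> and \<open>Im p + d\<close>, which lie in the strip\<close>
  define d where "d = min (Im p - c) ((hi - Im p) / 2)"
  have d: "d > 0" "c \<le> Im p - d" "Im p + d < hi" using c by (auto simp: d_def min_def field_simps)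
  define g where "g y z = h z / (z - p) * exp (\<i> * of_real y * z)" for y z
  have fg: "far_bound c hi (- \<eta>) (g y)" for y
    using far_bound_mult[OF far far_bound_exp[of c hi y]] by (simp add: g_def[abs_def])
  have bnd: "\<exists>C X. \<forall>z. c \<le> Im z \<longrightarrow> Im z \<le> hi \<longrightarrow> X \<le> \<bar>Re z\<bar> \<longrightarrow> norm (g y z) \<le> C * exp (- \<eta> * \<bar>Re z\<bar>)" for y
    using fg[of y] unfolding far_bound_def .
  have holg: "g y holomorphic_on {z. lo < Im z \<and> Im z < Im p}" for y
    unfolding g_def using c
    by (intro holomorphic_intros holomorphic_on_subset[OF hol]) auto
  have int: "integrable lborel (\<lambda>t. g y (Complex t c))" for y
  proof -
    obtain C X where b: "\<And>z. c \<le> Im z \<Longrightarrow> Im z \<le> hi \<Longrightarrow> X \<le> \<bar>Re z\<bar> \<Longrightarrow> norm (g y z) \<le> C * exp (- \<eta> * \<bar>Re z\<bar>)"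
      using bnd[of y] by blast
    show ?thesis
      by (rule integrable_line[OF holomorphic_on_imp_continuous_on[OF holg] _ _ \<eta>, where X = X and C = C])
         (use c b[of "Complex _ c"] in auto)
  qed
  then show "integrable lborel (\<lambda>t. h (Complex t c) / (Complex t c - p) * exp (\<i> * of_real y * Complex t c))"
    unfolding g_def .
  have moved: "(\<integral>t. g y (Complex t c) \<partial>lborel) = (\<integral>t. g y (Complex t (Im p + d)) \<partial>lborel) + 2 * of_real pi * \<i> * (h p * exp (\<i> * of_real y * p))"
    and int_up: "integrable lborel (\<lambda>t. g y (Complex t (Im p + d)))" for y
  proof -
    obtain C X where b: "\<And>z. c \<le> Im z \<Longrightarrow> Im z \<le> hi \<Longrightarrow> X \<le> \<bar>Re z\<bar> \<Longrightarrow> norm (g y z) \<le> C * exp (- \<eta> * \<bar>Re z\<bar>)"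
      using bnd[of y] by blast
    have 1: "(\<integral>t. g y (Complex t c) \<partial>lborel) = (\<integral>t. g y (Complex t (Im p - d)) \<partial>lborel)"
      by (rule line_shift[OF _ _ _ _ \<eta> holg, where X = X and C = C]) (use c d b in auto)
    let ?h = "\<lambda>z. h z * exp (\<i> * of_real y * z)"
    have eq: "g y z = ?h z / (z - p)" for z by (simp add: g_def)
    have hol': "?h holomorphic_on {z. lo < Im z \<and> Im z < hi}" by (intro holomorphic_intros hol)
    have b': "norm (?h z / (z - p)) \<le> C * exp (- \<eta> * \<bar>Re z\<bar>)"
      if "Im p - d \<le> Im z" "Im z \<le> Im p + d" "X \<le> \<bar>Re z\<bar>" for z
      unfolding eq[symmetric] using that d by (intro b) auto
    have lo: "lo < Im p - d" using c d by linarith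
    show "integrable lborel (\<lambda>t. g y (Complex t (Im p + d)))"
      unfolding eq by (rule residue_shift(2)[OF d(1) lo d(3) \<eta> hol' b'])
    show "(\<integral>t. g y (Complex t c) \<partial>lborel) = (\<integral>t. g y (Complex t (Im p + d)) \<partial>lborel) + 2 * of_real pi * \<i> * (h p * exp (\<i> * of_real y * p))"
      unfolding 1 unfolding eq by (rule residue_shift(1)[OF d(1) lo d(3) \<eta> hol' b'])
  qed
  define A where "A = (\<integral>t. norm (g 0 (Complex t (Im p + d))) \<partial>lborel)"
  have "(\<lambda>n. exp (- \<i> * of_nat n * p) * (\<integral>t. g (real n) (Complex t (Im p + d)) \<partial>lborel)) \<longlonglongrightarrow> 0"
  proof (rule Lim_null_comparison)
    have "(\<lambda>n. A * exp (- d * real n)) \<longlonglongrightarrow> A * 0"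
      using d by (intro tendsto_intros filterlim_compose[OF exp_at_bot]
        filterlim_compose[OF neg_mult_at_bot filterlim_real_sequentially])
    then show "(\<lambda>n. A * exp (- d * real n)) \<longlonglongrightarrow> 0" by simp
    show "\<forall>\<^sub>F n in sequentially. norm (exp (- \<i> * of_nat n * p) * (\<integral>t. g (real n) (Complex t (Im p + d)) \<partial>lborel)) \<le> A * exp (- d * real n)"
    proof (intro always_eventually allI)
      fix n
      have "exp (- \<i> * of_nat n * p) * (\<integral>t. g (real n) (Complex t (Im p + d)) \<partial>lborel) = (\<integral>t. exp (- \<i> * of_nat n * p) * g (real n) (Complex t (Im p + d)) \<partial>lborel)"
        by simp
      also have "norm \<dots> \<le> (\<integral>t. exp (- d * real n) * norm (g 0 (Complex t (Im p + d))) \<partial>lborel)"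
      proof (rule order_trans[OF integral_norm_bound integral_mono])
        fix t
        have "norm (exp (- \<i> * of_nat n * p)) * norm (exp (\<i> * of_real (real n) * Complex t (Im p + d))) = exp (- d * real n)"
          by (simp add: algebra_simps flip: exp_add)
        then show "norm (exp (- \<i> * of_nat n * p) * g (real n) (Complex t (Im p + d))) \<le> exp (- d * real n) * norm (g 0 (Complex t (Im p + d)))"
          unfolding g_def norm_mult by (simp add: mult_ac) (metis eq_iff mult.commute mult.left_commute)
      qed (use int_up in auto)
      also have "\<dots> = A * exp (- d * real n)" by (simp add: A_def mult.commute)
      finally show "norm (exp (- \<i> * of_nat n * p) * (\<integral>t. g (real n) (Complex t (Im p + d)) \<partial>lborel)) \<le> A * exp (- d * real n)" .
    qed
  qed
  then have "(\<lambda>n. exp (- \<i> * of_nat n * p) * (\<integral>t. g (real n) (Complex t (Im p + d)) \<partial>lborel) + 2 * of_real pi * \<i> * h p) \<longlonglongrightarrow> 0 + 2 * of_real pi * \<i> * h p"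
    by (intro tendsto_intros)
  moreover have "exp (- \<i> * of_nat n * p) * (\<integral>t. g (real n) (Complex t (Im p + d)) \<partial>lborel) + 2 * of_real pi * \<i> * h p
     = exp (- \<i> * of_nat n * p) * (\<integral>t. g (real n) (Complex t c) \<partial>lborel)" for n
  proof -
    have "exp (- \<i> * of_nat n * p) * exp (\<i> * of_real (real n) * p) = 1" by (simp flip: exp_add)
    then show ?thesis unfolding moved by (simp add: algebra_simps)
  qed
  ultimately show "(\<lambda>n. exp (- \<i> * of_nat n * p) * (\<integral>t. h (Complex t c) / (Complex t c - p) * exp (\<i> * of_nat n * Complex t c) \<partial>lborel))
      \<longlonglongrightarrow> 2 * of_real pi * \<i> * h p"
    unfolding g_def by simp
qed

section \<open>Interpolation functions at the poles\<close>

text \<open>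
  The Lagrange functions at the nodes \<open>\<i> \<gamma>\<^sub>i\<close>: algebraic ones for the difference product and trigonometric ones for the
  product of sines.
\<close>
definition poly_basis :: "nat \<Rightarrow> (nat \<Rightarrow> complex) \<Rightarrow> nat \<Rightarrow> complex \<Rightarrow> complex" where
  "poly_basis n \<gamma> m s = (\<Prod>i\<in>{1..n}-{m}. (s - \<i> * \<gamma> i) / (\<i> * \<gamma> m - \<i> * \<gamma> i))"

definition sin_basis :: "nat \<Rightarrow> (nat \<Rightarrow> complex) \<Rightarrow> nat \<Rightarrow> complex \<Rightarrow> complex" where
  "sin_basis n \<gamma> k s = (\<Prod>i\<in>{1..n}-{k}. sin (of_real pi * (s - \<i> * \<gamma> i)) / sin (of_real pi * (\<i> * \<gamma> k - \<i> * \<gamma> i)))"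

lemma Gamma_times_sin:
  fixes w :: complex
  assumes "w \<notin> \<int>\<^sub>\<le>\<^sub>0"
  shows "Gamma w * sin (of_real pi * w) = of_real pi * rGamma (1 - w)"
proof -
  have "sin (of_real pi * w) = of_real pi * (rGamma w * rGamma (1 - w))"
    by (simp add: rGamma_reflection_complex)
  then show ?thesis
    using assms by (simp add: rGamma_inverse_Gamma[of w] Gamma_eq_zero_iff)
qed

context kernel_lines
begin

text \<open>
  The sines of \<open>sin_basis k\<close> cancel all poles of \<open>\<Gamma>(\<i> z - \<i> \<gamma>\<^sub>i)\<close> for \<open>i \<noteq> k\<close>. What is left has, in a strip around \<open>\<gamma>\<^sub>k\<close>, just a simple pole
  at \<open>\<gamma>\<^sub>k\<close>, and \<open>residue_part\<close> is its numerator. By writing \<open>\<pi> / \<Gamma>(1 - w)\<close> for \<open>\<Gamma>(w) sin (\<pi> w)\<close> the cancellation is built in.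
\<close>
definition residue_part :: "nat \<Rightarrow> nat \<Rightarrow> complex \<Rightarrow> complex" where
  "residue_part m k z = - \<i> * Gamma (\<i> * z - \<i> * \<gamma> k + 1) *
     (\<Prod>i\<in>{1..Suc l}-{k}. of_real pi * rGamma (1 - (\<i> * z - \<i> * \<gamma> i)) / sin (of_real pi * (\<i> * \<gamma> k - \<i> * \<gamma> i))) *
     (\<Prod>j\<in>{1..l}. Gamma (\<i> * \<delta> j - \<i> * z)) * poly_basis (Suc l) \<gamma> m (\<i> * z)"

lemma residue_part_eq:
  assumes k: "k \<in> {1..Suc l}" and z: "\<And>i. i \<in> {1..Suc l} \<Longrightarrow> \<i> * z - \<i> * \<gamma> i \<notin> \<int>\<^sub>\<le>\<^sub>0"
  shows "poly_basis (Suc l) \<gamma> m (\<i> * z) * sin_basis (Suc l) \<gamma> k (\<i> * z) * gam (Suc l) l \<gamma> \<delta> z = residue_part m k z / (z - \<gamma> k)"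
proof -
  have "\<i> * z - \<i> * \<gamma> k \<noteq> 0" using z[OF k] by auto
  then have ne: "z - \<gamma> k \<noteq> 0" by auto
  have G: "Gamma (\<i> * z - \<i> * \<gamma> k + 1) = (\<i> * (z - \<gamma> k)) * Gamma (\<i> * z - \<i> * \<gamma> k)"
    using Gamma_plus1[OF z[OF k]] by (simp add: algebra_simps)
  have 1: "Gamma (\<i> * z - \<i> * \<gamma> k) = - \<i> * Gamma (\<i> * z - \<i> * \<gamma> k + 1) / (z - \<gamma> k)"
    unfolding G using ne by simp
  have "(\<Prod>i\<in>{1..Suc l}-{k}. Gamma (\<i> * z - \<i> * \<gamma> i)) * sin_basis (Suc l) \<gamma> k (\<i> * z) =
     (\<Prod>i\<in>{1..Suc l}-{k}. Gamma (\<i> * z - \<i> * \<gamma> i) * sin (of_real pi * (\<i> * z - \<i> * \<gamma> i)) / sin (of_real pi * (\<i> * \<gamma> k - \<i> * \<gamma> i)))"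
    unfolding sin_basis_def by (simp flip: prod.distrib)
  also have "\<dots> = (\<Prod>i\<in>{1..Suc l}-{k}. of_real pi * rGamma (1 - (\<i> * z - \<i> * \<gamma> i)) / sin (of_real pi * (\<i> * \<gamma> k - \<i> * \<gamma> i)))"
  proof (intro prod.cong refl)
    fix i assume "i \<in> {1..Suc l}-{k}"
    then show "Gamma (\<i> * z - \<i> * \<gamma> i) * sin (of_real pi * (\<i> * z - \<i> * \<gamma> i)) / sin (of_real pi * (\<i> * \<gamma> k - \<i> * \<gamma> i)) =
      of_real pi * rGamma (1 - (\<i> * z - \<i> * \<gamma> i)) / sin (of_real pi * (\<i> * \<gamma> k - \<i> * \<gamma> i))"
      using Gamma_times_sin[OF z] by simp
  qed
  finally have 2: "(\<Prod>i\<in>{1..Suc l}-{k}. Gamma (\<i> * z - \<i> * \<gamma> i)) * sin_basis (Suc l) \<gamma> k (\<i> * z) =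
    (\<Prod>i\<in>{1..Suc l}-{k}. of_real pi * rGamma (1 - (\<i> * z - \<i> * \<gamma> i)) / sin (of_real pi * (\<i> * \<gamma> k - \<i> * \<gamma> i)))" .
  have 3: "(\<Prod>i\<in>{1..Suc l}. Gamma (\<i> * z - \<i> * \<gamma> i)) = Gamma (\<i> * z - \<i> * \<gamma> k) * (\<Prod>i\<in>{1..Suc l}-{k}. Gamma (\<i> * z - \<i> * \<gamma> i))"
    by (rule prod.remove) (use k in auto)
  have "poly_basis (Suc l) \<gamma> m (\<i> * z) * sin_basis (Suc l) \<gamma> k (\<i> * z) * gam (Suc l) l \<gamma> \<delta> z
    = Gamma (\<i> * z - \<i> * \<gamma> k) * ((\<Prod>i\<in>{1..Suc l}-{k}. Gamma (\<i> * z - \<i> * \<gamma> i)) * sin_basis (Suc l) \<gamma> k (\<i> * z)) *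
      (\<Prod>j\<in>{1..l}. Gamma (\<i> * \<delta> j - \<i> * z)) * poly_basis (Suc l) \<gamma> m (\<i> * z)"
    unfolding gam_def 3 by (simp only: mult_ac)
  also have "\<dots> = residue_part m k z / (z - \<gamma> k)"
    unfolding 1 2 residue_part_def by (simp only: times_divide_eq_left times_divide_eq_right mult_ac)
  finally show ?thesis .
qed

text \<open>The next pole of \<open>\<Gamma>(\<i> z - \<i> \<gamma>\<^sub>k)\<close> above \<open>\<gamma>\<^sub>k\<close> is \<open>\<gamma>\<^sub>k + \<i>\<close>.\<close>
lemma residue_part_holomorphic:
  "residue_part m k holomorphic_on {z. P < Im z \<and> Im z < Im (\<gamma> k) + 1}"
  unfolding residue_part_def[abs_def] poly_basis_def divide_inverse
proof (intro holomorphic_intros holomorphic_on_prod holomorphic_Gamma')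
  fix z assume "z \<in> {z. P < Im z \<and> Im z < Im (\<gamma> k) + 1}"
  then show "\<i> * z - \<i> * \<gamma> k + 1 \<notin> \<int>\<^sub>\<le>\<^sub>0" by (intro Re_pos_not_nonpos_Int) auto
next
  fix j z assume "j \<in> {1..l}" "z \<in> {z. P < Im z \<and> Im z < Im (\<gamma> k) + 1}"
  then show "\<i> * \<delta> j - \<i> * z \<notin> \<int>\<^sub>\<le>\<^sub>0" using below[of j] by (intro Re_pos_not_nonpos_Int) auto
qed

text \<open>
  Each quotient \<open>\<pi> / \<Gamma>(1 - w)\<close> grows at rate \<open>\<pi>/2\<close> and is balanced by one \<open>\<Gamma>(\<i> \<delta>\<^sub>j - \<i> z)\<close>; the Gamma function of index \<open>k\<close> remains and
  gives the rate \<open>- \<pi>/2\<close>, up to losses.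
\<close>
lemma residue_part_far:
  assumes k: "k \<in> {1..Suc l}"
  shows "far_bound p q (- (pi/4)) (\<lambda>z. residue_part m k z / (z - \<gamma> k))"
proof -
  \<comment> \<open>at most \<open>2 + 3 l\<close> losses of size \<open>e\<close> occur: \<open>1 + 2 l\<close> from Gamma factors, \<open>l + 1\<close> from linear factors\<close>
  define e where "e = pi / (4 * (2 + 3 * real l))"
  have "pi < pi * (2 * (2 + 3 * real l))" by simp
  then have e: "0 < e" "e < pi/2" by (auto simp: e_def field_simps)
  have G1: "far_bound p q (- (pi/2 - e)) (\<lambda>z. Gamma (\<i> * z - \<i> * \<gamma> k + 1))"
    by (rule far_bound_Gamma[OF e, where r = "1 + Im (\<gamma> k) - q" and R = "1 + Im (\<gamma> k) - p" and B = "\<bar>Re (\<gamma> k)\<bar>"]) auto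
  have G2: "far_bound p q (- (pi/2 - e)) (\<lambda>z. Gamma (\<i> * \<delta> j - \<i> * z))" for j
    by (rule far_bound_Gamma[OF e, where r = "p - Im (\<delta> j)" and R = "q - Im (\<delta> j)" and B = "\<bar>Re (\<delta> j)\<bar>"]) auto
  have R: "far_bound p q (pi/2 + e) (\<lambda>z. of_real pi * rGamma (1 - (\<i> * z - \<i> * \<gamma> i)) / w)" for i w
  proof -
    have "far_bound p q (- (pi/2 - e)) (\<lambda>z. Gamma (\<i> * z - \<i> * \<gamma> i))"
      by (rule far_bound_Gamma[OF e, where r = "Im (\<gamma> i) - q" and R = "Im (\<gamma> i) - p" and B = "\<bar>Re (\<gamma> i)\<bar>"]) auto
    moreover have "far_bound p q pi (\<lambda>z. sin (of_real pi * (\<i> * z - \<i> * \<gamma> i)))"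
      by (rule far_bound_sin_pi[where B = "\<bar>Re (\<gamma> i)\<bar>"]) auto
    ultimately have "far_bound p q (- (pi/2 - e) + pi + 0) (\<lambda>z. Gamma (\<i> * z - \<i> * \<gamma> i) * sin (of_real pi * (\<i> * z - \<i> * \<gamma> i)) * (1 / w))"
      by (intro far_bound_mult far_bound_const)
    also have "- (pi/2 - e) + pi + 0 = pi/2 + e" by simp
    finally show ?thesis
    proof (rule far_bound_cong[where X = "\<bar>Re (\<gamma> i)\<bar> + 1"])
      fix z assume z: "\<bar>Re (\<gamma> i)\<bar> + 1 \<le> \<bar>Re z\<bar>"
      have "\<i> * z - \<i> * \<gamma> i \<notin> \<int>\<^sub>\<le>\<^sub>0"
      proof
        assume "\<i> * z - \<i> * \<gamma> i \<in> \<int>\<^sub>\<le>\<^sub>0"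
        then obtain n where "\<i> * z - \<i> * \<gamma> i = of_int n" by (elim nonpos_Ints_cases)
        then have "Im (\<i> * z - \<i> * \<gamma> i) = 0" by simp
        then show False using z by simp
      qed
      from Gamma_times_sin[OF this] show "of_real pi * rGamma (1 - (\<i> * z - \<i> * \<gamma> i)) / w = Gamma (\<i> * z - \<i> * \<gamma> i) * sin (of_real pi * (\<i> * z - \<i> * \<gamma> i)) * (1 / w)"
        by simp
    qed
  qed
  have L: "far_bound p q e (\<lambda>z. (\<i> * z - \<i> * \<gamma> i) / w)" for i w
    using far_bound_linear[OF e(1), of p q "\<i> / w" "- \<i> * \<gamma> i / w"] by (simp add: diff_divide_distrib)
  have cardk: "card ({1..Suc l} - {k}) = l" using k by simp
  have R': "far_bound p q (real l * (pi/2 + e)) (\<lambda>z. \<Prod>i\<in>{1..Suc l}-{k}. of_real pi * rGamma (1 - (\<i> * z - \<i> * \<gamma> i)) / sin (of_real pi * (\<i> * \<gamma> k - \<i> * \<gamma> i)))"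
  proof -
    have "far_bound p q (real (card ({1..Suc l}-{k})) * (pi/2 + e)) (\<lambda>z. \<Prod>i\<in>{1..Suc l}-{k}. of_real pi * rGamma (1 - (\<i> * z - \<i> * \<gamma> i)) / sin (of_real pi * (\<i> * \<gamma> k - \<i> * \<gamma> i)))"
      by (intro far_bound_prod R) auto
    then show ?thesis unfolding cardk .
  qed
  have D': "far_bound p q (real l * - (pi/2 - e)) (\<lambda>z. \<Prod>j\<in>{1..l}. Gamma (\<i> * \<delta> j - \<i> * z))"
  proof -
    have "far_bound p q (real (card {1..l}) * - (pi/2 - e)) (\<lambda>z. \<Prod>j\<in>{1..l}. Gamma (\<i> * \<delta> j - \<i> * z))"
      by (intro far_bound_prod G2) auto
    then show ?thesis by simp
  qed
  obtain n where n: "n \<le> Suc l" "far_bound p q (real n * e) (\<lambda>z. poly_basis (Suc l) \<gamma> m (\<i> * z))"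
  proof
    show "far_bound p q (real (card ({1..Suc l} - {m})) * e) (\<lambda>z. poly_basis (Suc l) \<gamma> m (\<i> * z))"
      unfolding poly_basis_def by (intro far_bound_prod L) auto
    show "card ({1..Suc l} - {m}) \<le> Suc l"
      using card_Diff1_le[of "{1..Suc l}" m] by simp
  qed
  have "far_bound p q (((((0 + - (pi/2 - e)) + real l * (pi/2 + e)) + real l * - (pi/2 - e)) + real n * e) + 0)
      (\<lambda>z. residue_part m k z * (1 / (z - \<gamma> k)))"
    unfolding residue_part_def by (intro far_bound_mult far_bound_const G1 R' D' n(2) far_bound_inverse)
  moreover have "((((0 + - (pi/2 - e)) + real l * (pi/2 + e)) + real l * - (pi/2 - e)) + real n * e) + 0 \<le> - (pi/4)"
  proof -
    have "real n * e \<le> (1 + real l) * e" using n(1) e by (intro mult_right_mono) auto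
    then have "((((0 + - (pi/2 - e)) + real l * (pi/2 + e)) + real l * - (pi/2 - e)) + real n * e) + 0 \<le> - (pi/2) + e * (2 + 3 * real l)"
      by (simp add: algebra_simps)
    also have "e * (2 + 3 * real l) = pi/4" by (simp add: e_def field_simps)
    finally show ?thesis by simp
  qed
  ultimately show ?thesis using far_bound_mono by fastforce
qed

definition residue_value :: "nat \<Rightarrow> complex" where
  "residue_value k = (\<Prod>i\<in>{1..Suc l}-{k}. Gamma (\<i> * \<gamma> k - \<i> * \<gamma> i)) * (\<Prod>j\<in>{1..l}. Gamma (\<i> * \<delta> j - \<i> * \<gamma> k))"

text \<open>The one-variable factor of the kernel after interpolation.\<close>
definition basis_integrand :: "nat \<Rightarrow> nat \<Rightarrow> real \<Rightarrow> complex \<Rightarrow> complex" where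
  "basis_integrand m k y z = poly_basis (Suc l) \<gamma> m (\<i> * z) * sin_basis (Suc l) \<gamma> k (\<i> * z) * gam (Suc l) l \<gamma> \<delta> z * exp (\<i> * of_real y * z)"

text \<open>Here the algebraic Lagrange function selects \<open>m = k\<close>.\<close>
lemma residue_part_at_pole:
  assumes k: "k \<in> {1..Suc l}" and m: "m \<in> {1..Suc l}" and inj: "inj_on (\<lambda>i. Re (\<gamma> i)) {1..Suc l}"
  shows "residue_part m k (\<gamma> k) = (if m = k then - \<i> * residue_value k else 0)"
proof -
  have Im: "Im (\<i> * \<gamma> k - \<i> * \<gamma> i) \<noteq> 0" if "i \<in> {1..Suc l}-{k}" for i
    using inj k that by (auto simp: inj_on_def)
  have np: "w \<notin> \<int>\<^sub>\<le>\<^sub>0" if "Im w \<noteq> 0" for w using that by (auto elim!: nonpos_Ints_cases)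
  have "(\<Prod>i\<in>{1..Suc l}-{k}. of_real pi * rGamma (1 - (\<i> * \<gamma> k - \<i> * \<gamma> i)) / sin (of_real pi * (\<i> * \<gamma> k - \<i> * \<gamma> i)))
    = (\<Prod>i\<in>{1..Suc l}-{k}. Gamma (\<i> * \<gamma> k - \<i> * \<gamma> i))"
  proof (intro prod.cong refl)
    fix i assume i: "i \<in> {1..Suc l}-{k}"
    define w where "w = \<i> * \<gamma> k - \<i> * \<gamma> i"
    have w: "Im w \<noteq> 0" unfolding w_def by (rule Im[OF i])
    have "sin (of_real pi * w) = of_real pi * (rGamma w * rGamma (1 - w))"
      by (simp add: rGamma_reflection_complex)
    moreover have "rGamma w \<noteq> 0" "rGamma (1 - w) \<noteq> 0"
      using np[of w] np[of "1 - w"] w by (auto simp: rGamma_eq_zero_iff)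
    ultimately have "sin (of_real pi * w) \<noteq> 0" by simp
    with Gamma_times_sin[OF np[OF w]] have "of_real pi * rGamma (1 - w) / sin (of_real pi * w) = Gamma w"
      by (simp add: divide_eq_eq)
    then show "of_real pi * rGamma (1 - (\<i> * \<gamma> k - \<i> * \<gamma> i)) / sin (of_real pi * (\<i> * \<gamma> k - \<i> * \<gamma> i)) = Gamma (\<i> * \<gamma> k - \<i> * \<gamma> i)"
      unfolding w_def .
  qed
  moreover have "poly_basis (Suc l) \<gamma> m (\<i> * \<gamma> k) = (if m = k then 1 else 0)"
  proof (cases "m = k")
    case True
    have "(\<i> * \<gamma> k - \<i> * \<gamma> i) / (\<i> * \<gamma> k - \<i> * \<gamma> i) = 1" if "i \<in> {1..Suc l}-{k}" for i
      using Im[OF that] by (metis divide_self zero_complex.simps(2))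
    then show ?thesis using True unfolding poly_basis_def by simp
  next
    case False
    have "(\<Prod>i\<in>{1..Suc l}-{m}. (\<i> * \<gamma> k - \<i> * \<gamma> i) / (\<i> * \<gamma> m - \<i> * \<gamma> i)) = 0"
      by (rule prod_zero[OF _ bexI[of _ k]]) (use False k in auto)
    then show ?thesis using False unfolding poly_basis_def by simp
  qed
  ultimately show ?thesis unfolding residue_part_def residue_value_def by simp
qed

text \<open>
  The integral is of the order of the residue at \<open>\<gamma>\<^sub>k\<close>, with \<open>k\<close> the index of the trigonometric function, and this residue vanishes
  unless the algebraic index is the same.
\<close>
lemma basis_integral:
  assumes k: "k \<in> {1..Suc l}" and m: "m \<in> {1..Suc l}" and inj: "inj_on (\<lambda>i. Re (\<gamma> i)) {1..Suc l}"
    and b: "P < b" "b < Q"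
  shows "integrable lborel (\<lambda>t. basis_integrand m k y (Complex t b))"
    and "(\<lambda>n. exp (- \<i> * of_nat n * \<gamma> k) * (\<integral>t. basis_integrand m k (real n) (Complex t b) \<partial>lborel))
      \<longlonglongrightarrow> (if m = k then 2 * of_real pi * residue_value k else 0)"
proof -
  have eq: "basis_integrand m k y (Complex t b) = residue_part m k (Complex t b) / (Complex t b - \<gamma> k) * exp (\<i> * of_real y * Complex t b)" for t y
  proof -
    have "\<i> * Complex t b - \<i> * \<gamma> i \<notin> \<int>\<^sub>\<le>\<^sub>0" if "i \<in> {1..Suc l}" for i
      using above[OF that] b by (intro Re_pos_not_nonpos_Int) simp
    then show ?thesis unfolding basis_integrand_def using residue_part_eq[OF k] by simp
  qed
  have b': "b < Im (\<gamma> k)" using above[OF k] b by simp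
  note pa = pole_asymptotics[OF b(1) b' _ _ residue_part_holomorphic residue_part_far[OF k], of m]
  show "integrable lborel (\<lambda>t. basis_integrand m k y (Complex t b))"
    unfolding eq by (rule pa(1)) auto
  have "(\<lambda>n. exp (- \<i> * of_nat n * \<gamma> k) * (\<integral>t. basis_integrand m k (real n) (Complex t b) \<partial>lborel))
      \<longlonglongrightarrow> 2 * of_real pi * \<i> * residue_part m k (\<gamma> k)"
    unfolding eq of_real_of_nat_eq by (rule pa(2)) auto
  moreover have "2 * of_real pi * \<i> * residue_part m k (\<gamma> k) = (if m = k then 2 * of_real pi * residue_value k else 0)"
    unfolding residue_part_at_pole[OF k m inj] by (simp add: complex_eq_iff)
  ultimately show "(\<lambda>n. exp (- \<i> * of_nat n * \<gamma> k) * (\<integral>t. basis_integrand m k (real n) (Complex t b) \<partial>lborel))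
      \<longlonglongrightarrow> (if m = k then 2 * of_real pi * residue_value k else 0)" by simp
qed

end

section \<open>Evaluation of the kernel integral\<close>

text \<open>The coefficient that the interpolation of both Vandermonde products produces; for \<open>\<sigma> = \<tau>\<close> the two products recombine.\<close>
definition interp_coeff :: "nat \<Rightarrow> (nat \<Rightarrow> complex) \<Rightarrow> (nat \<Rightarrow> nat) \<Rightarrow> (nat \<Rightarrow> nat) \<Rightarrow> complex" where
  "interp_coeff n \<gamma> \<sigma> \<tau> = (\<Prod>j\<in>{1..n}. \<Prod>k\<in>{1..<j}. - 1 / complex_of_real pi) *
     vandermonde (\<lambda>x y. x - y) n (\<lambda>j. \<i> * \<gamma> (\<sigma> j)) * vandermonde (\<lambda>x y. sin (of_real pi * (x - y))) n (\<lambda>j. \<i> * \<gamma> (\<tau> j))"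

lemma interp_coeff_diagonal: "interp_coeff n \<gamma> \<sigma> \<sigma> = rGamma_prod n (\<lambda>j. \<gamma> (\<sigma> j))"
  unfolding interp_coeff_def by (rule rGamma_prod_vandermonde[symmetric])

lemma interp_coeff_eq_0:
  assumes "\<not> inj_on \<tau> {1..n}"
  shows "interp_coeff n \<gamma> \<sigma> \<tau> = 0"
proof -
  have "vandermonde (\<lambda>x y. sin (of_real pi * (x - y))) n (\<lambda>j. \<i> * \<gamma> (\<tau> j)) = 0"
    by (rule vandermonde_eq_0[where p = "\<lambda>i. \<i> * \<gamma> i", OF _ assms]) simp
  then show ?thesis unfolding interp_coeff_def by (simp only: mult_zero_right)
qed

lemma difference_vandermonde_interpolation:
  assumes inj: "inj_on (\<lambda>i. Re (\<gamma> i)) {1..n}"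
  shows "vandermonde (\<lambda>x y. x - y) n s = (\<Sum>\<sigma>\<in>{1..n} \<rightarrow>\<^sub>E {1..n}. vandermonde (\<lambda>x y. x - y) n (\<lambda>j. \<i> * \<gamma> (\<sigma> j)) * (\<Prod>j\<in>{1..n}. poly_basis n \<gamma> (\<sigma> j) (s j)))"
proof -
  have "inj_on (\<lambda>i. \<i> * \<gamma> i) {1..n}"
  proof (rule inj_onI)
    fix i j assume ij: "i \<in> {1..n}" "j \<in> {1..n}" "\<i> * \<gamma> i = \<i> * \<gamma> j"
    then have "Re (\<gamma> i) = Re (\<gamma> j)" by simp
    then show "i = j" by (rule inj_onD[OF inj _ ij(1,2)])
  qed
  from vandermonde_interpolation[where \<kappa> = 1 and g = "\<lambda>_. 1" and h = "\<lambda>x. x" and p = "\<lambda>i. \<i> * \<gamma> i" and n = n and s = s, OF this]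
  show ?thesis unfolding poly_basis_def mult_1_left mult_1_right by simp
qed

text \<open>
  Here \<open>sin (\<pi> (x - y))\<close> is, up to the factors \<open>exp (- \<i> \<pi> x)\<close> and \<open>exp (- \<i> \<pi> y)\<close>, a difference of values of
  \<open>x \<mapsto> exp (2 \<i> \<pi> x)\<close>. These values are distinct at the nodes since the imaginary parts of the nodes are.
\<close>
lemma sine_vandermonde_interpolation:
  assumes inj: "inj_on (\<lambda>i. Re (\<gamma> i)) {1..n}"
  shows "vandermonde (\<lambda>x y. sin (of_real pi * (x - y))) n s = (\<Sum>\<tau>\<in>{1..n} \<rightarrow>\<^sub>E {1..n}. vandermonde (\<lambda>x y. sin (of_real pi * (x - y))) n (\<lambda>j. \<i> * \<gamma> (\<tau> j)) * (\<Prod>j\<in>{1..n}. sin_basis n \<gamma> (\<tau> j) (s j)))"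
proof -
  let ?g = "\<lambda>x. exp (- \<i> * of_real pi * x)" and ?h = "\<lambda>x. exp (2 * \<i> * of_real pi * x)"
  have d: "1 / (2 * \<i>) * ?g x * ?g y * (?h x - ?h y) = sin (of_real pi * (x - y))" for x y :: complex
  proof -
    have "- \<i> * of_real pi * x + - \<i> * of_real pi * y + 2 * \<i> * of_real pi * x = \<i> * (of_real pi * (x - y))"
      "- \<i> * of_real pi * x + - \<i> * of_real pi * y + 2 * \<i> * of_real pi * y = - (\<i> * (of_real pi * (x - y)))"
      by (simp_all add: algebra_simps)
    then have "?g x * ?g y * ?h x = exp (\<i> * (of_real pi * (x - y)))" "?g x * ?g y * ?h y = exp (- (\<i> * (of_real pi * (x - y))))"
      by (simp_all only: exp_add[symmetric])
    then have "?g x * ?g y * (?h x - ?h y) = exp (\<i> * (of_real pi * (x - y))) - exp (- (\<i> * (of_real pi * (x - y))))"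
      by (simp only: right_diff_distrib)
    then show ?thesis unfolding sin_exp_eq by (simp add: mult.assoc)
  qed
  have "inj_on (\<lambda>i. ?h (\<i> * \<gamma> i)) {1..n}"
  proof (rule inj_onI)
    fix i j assume ij: "i \<in> {1..n}" "j \<in> {1..n}" "?h (\<i> * \<gamma> i) = ?h (\<i> * \<gamma> j)"
    then obtain m :: int where "2 * \<i> * of_real pi * (\<i> * \<gamma> i) = 2 * \<i> * of_real pi * (\<i> * \<gamma> j) + of_real (2 * of_int m * pi) * \<i>"
      unfolding exp_eq by auto
    then have "Re (2 * \<i> * of_real pi * (\<i> * \<gamma> i)) = Re (2 * \<i> * of_real pi * (\<i> * \<gamma> j) + of_real (2 * of_int m * pi) * \<i>)" by simp
    then have "Re (\<gamma> i) = Re (\<gamma> j)" by simp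
    then show "i = j" by (rule inj_onD[OF inj _ ij(1,2)])
  qed
  from vandermonde_interpolation[where \<kappa> = "1 / (2 * \<i>)" and g = ?g and h = ?h and p = "\<lambda>i. \<i> * \<gamma> i" and n = n and s = s, OF this]
  show ?thesis unfolding d sin_basis_def by simp
qed

lemma rGamma_prod_interpolation:
  assumes inj: "inj_on (\<lambda>i. Re (\<gamma> i)) {1..n}"
  shows "rGamma_prod n \<beta> = (\<Sum>\<sigma>\<in>{1..n} \<rightarrow>\<^sub>E {1..n}. \<Sum>\<tau>\<in>{1..n} \<rightarrow>\<^sub>E {1..n}. interp_coeff n \<gamma> \<sigma> \<tau> *
     (\<Prod>j\<in>{1..n}. poly_basis n \<gamma> (\<sigma> j) (\<i> * \<beta> j) * sin_basis n \<gamma> (\<tau> j) (\<i> * \<beta> j)))"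
proof -
  have rearrange: "a * ((v * p) * (w * q)) = (a * v * w) * (p * q)" for a v p w q :: complex by simp
  show ?thesis
    unfolding rGamma_prod_vandermonde mult.assoc[of "\<Prod>j\<in>{1..n}. \<Prod>k\<in>{1..<j}. - 1 / of_real pi"]
    unfolding difference_vandermonde_interpolation[OF inj, of "\<lambda>j. \<i> * \<beta> j"] sine_vandermonde_interpolation[OF inj, of "\<lambda>j. \<i> * \<beta> j"]
    unfolding sum_product
    unfolding sum_distrib_left rearrange
    unfolding prod.distrib[symmetric] interp_coeff_def ..
qed

lemma inj_imp_bij: "\<tau> \<in> {1..n} \<rightarrow>\<^sub>E {1..n::nat} \<Longrightarrow> inj_on \<tau> {1..n} \<Longrightarrow> bij_betw \<tau> {1..n} {1..n}"
  unfolding bij_betw_def using endo_inj_surj[of "{1..n}" \<tau>] by (auto simp: PiE_def Pi_def image_subset_iff)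

context kernel_lines
begin

lemma exp_weight:
  "exp (of_real y * weight l \<gamma> \<beta>) = exp (- \<i> * of_real y * (\<Sum>i\<in>{1..Suc l}. \<gamma> i)) * (\<Prod>j\<in>{1..Suc l}. exp (\<i> * of_real y * \<beta> j))"
proof -
  have "of_real y * weight l \<gamma> \<beta> = - \<i> * of_real y * (\<Sum>i\<in>{1..Suc l}. \<gamma> i) + (\<Sum>j\<in>{1..Suc l}. \<i> * of_real y * \<beta> j)"
    unfolding weight_def sum_distrib_left[symmetric] by (simp add: algebra_simps del: sum.cl_ivl_Suc)
  then show ?thesis by (simp only: exp_add exp_sum finite_atLeastAtMost)
qed

text \<open>
  After interpolation the kernel is a finite sum of products of functions of one variable each. As \<open>y \<rightarrow> \<infinity>\<close> the
  terms with \<open>\<sigma> \<noteq> \<tau>\<close> tend to \<open>0\<close>, and so only permutations \<open>\<sigma> = \<tau>\<close> contribute. Their coefficient \<open>\<Prod> 1 / \<Gamma>(\<i> \<gamma>\<^sub>k - \<i> \<gamma>\<^sub>j)\<close> cancels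
  against the Gamma functions in the residues, so each of the \<open>(l + 1)!\<close> permutations gives the same value.
\<close>
lemma kern_integral_limit:
  assumes inj: "inj_on (\<lambda>i. Re (\<gamma> i)) {1..Suc l}"
  shows "(\<lambda>n. lines_integral (Suc l) c (kern l \<gamma> \<delta> (real n))) \<longlonglongrightarrow>
    (2 * of_real pi) ^ Suc l * fact (Suc l) * (\<Prod>i\<in>{1..Suc l}. \<Prod>j\<in>{1..l}. Gamma (\<i> * \<delta> j - \<i> * \<gamma> i))"
proof -
  let ?N = "{1..Suc l}" and ?S = "{1..Suc l} \<rightarrow>\<^sub>E {1..Suc l}"
  let ?A = "interp_coeff (Suc l) \<gamma>"
  note A = rGamma_prod_interpolation[OF inj] and Adiag = interp_coeff_diagonal and A0 = interp_coeff_eq_0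
  have finS: "finite ?S" by (intro finite_PiE) auto
  have expand: "kern l \<gamma> \<delta> y \<beta> = (\<Sum>\<sigma>\<in>?S. \<Sum>\<tau>\<in>?S. ?A \<sigma> \<tau> * (\<Prod>j\<in>?N. exp (- \<i> * of_real y * \<gamma> (\<tau> j))) * (\<Prod>j\<in>?N. basis_integrand (\<sigma> j) (\<tau> j) y (\<beta> j)))" for y \<beta>
  proof -
    let ?B = "\<lambda>\<sigma> \<tau>. \<Prod>j\<in>?N. poly_basis (Suc l) \<gamma> (\<sigma> j) (\<i> * \<beta> j) * sin_basis (Suc l) \<gamma> (\<tau> j) (\<i> * \<beta> j)"
    let ?E = "exp (- \<i> * of_real y * (\<Sum>i\<in>?N. \<gamma> i))"
    have "kern l \<gamma> \<delta> y \<beta> = (\<Sum>\<sigma>\<in>?S. \<Sum>\<tau>\<in>?S. ?A \<sigma> \<tau> * ?B \<sigma> \<tau>) * ((\<Prod>j\<in>?N. gam (Suc l) l \<gamma> \<delta> (\<beta> j)) * (?E * (\<Prod>j\<in>?N. exp (\<i> * of_real y * \<beta> j))))"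
      unfolding kern_def A exp_weight by (simp only: mult.assoc)
    also have "\<dots> = (\<Sum>\<sigma>\<in>?S. \<Sum>\<tau>\<in>?S. ?A \<sigma> \<tau> * ?B \<sigma> \<tau> * ((\<Prod>j\<in>?N. gam (Suc l) l \<gamma> \<delta> (\<beta> j)) * (?E * (\<Prod>j\<in>?N. exp (\<i> * of_real y * \<beta> j)))))"
      by (simp only: sum_distrib_right)
    also have "\<dots> = (\<Sum>\<sigma>\<in>?S. \<Sum>\<tau>\<in>?S. ?A \<sigma> \<tau> * (\<Prod>j\<in>?N. exp (- \<i> * of_real y * \<gamma> (\<tau> j))) * (\<Prod>j\<in>?N. basis_integrand (\<sigma> j) (\<tau> j) y (\<beta> j)))"
    proof (intro sum.cong refl)
      fix \<sigma> \<tau> assume \<tau>: "\<tau> \<in> ?S"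
      \<comment> \<open>the coefficient vanishes unless \<open>\<tau>\<close> permutes the \<open>\<gamma>\<^sub>i\<close>, so that their sum may be split according to \<open>\<tau>\<close>\<close>
      have AE: "?A \<sigma> \<tau> * ?E = ?A \<sigma> \<tau> * (\<Prod>j\<in>?N. exp (- \<i> * of_real y * \<gamma> (\<tau> j)))"
      proof (cases "inj_on \<tau> ?N")
        case True
        have "(\<Sum>i\<in>?N. \<gamma> i) = (\<Sum>j\<in>?N. \<gamma> (\<tau> j))"
          by (rule sum.reindex_bij_betw[OF inj_imp_bij[OF \<tau> True], symmetric])
        then show ?thesis by (simp only: sum_distrib_left exp_sum[OF finite_atLeastAtMost])
      qed (simp add: A0)
      have "?A \<sigma> \<tau> * ?B \<sigma> \<tau> * ((\<Prod>j\<in>?N. gam (Suc l) l \<gamma> \<delta> (\<beta> j)) * (?E * (\<Prod>j\<in>?N. exp (\<i> * of_real y * \<beta> j))))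
        = (?A \<sigma> \<tau> * ?E) * (?B \<sigma> \<tau> * (\<Prod>j\<in>?N. gam (Suc l) l \<gamma> \<delta> (\<beta> j)) * (\<Prod>j\<in>?N. exp (\<i> * of_real y * \<beta> j)))"
        by (simp only: mult_ac)
      also have "?B \<sigma> \<tau> * (\<Prod>j\<in>?N. gam (Suc l) l \<gamma> \<delta> (\<beta> j)) * (\<Prod>j\<in>?N. exp (\<i> * of_real y * \<beta> j)) = (\<Prod>j\<in>?N. basis_integrand (\<sigma> j) (\<tau> j) y (\<beta> j))"
        unfolding basis_integrand_def prod.distrib ..
      finally show "?A \<sigma> \<tau> * ?B \<sigma> \<tau> * ((\<Prod>j\<in>?N. gam (Suc l) l \<gamma> \<delta> (\<beta> j)) * (?E * (\<Prod>j\<in>?N. exp (\<i> * of_real y * \<beta> j)))) =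
        ?A \<sigma> \<tau> * (\<Prod>j\<in>?N. exp (- \<i> * of_real y * \<gamma> (\<tau> j))) * (\<Prod>j\<in>?N. basis_integrand (\<sigma> j) (\<tau> j) y (\<beta> j))"
        unfolding AE .
    qed
    finally show ?thesis .
  qed
  have mem: "\<sigma> j \<in> ?N" if "\<sigma> \<in> ?S" "j \<in> ?N" for \<sigma> j using that by (rule PiE_mem)
  have int: "integrable lborel (\<lambda>t. basis_integrand (\<sigma> j) (\<tau> j) y (Complex t (c j)))"
    if "\<sigma> \<in> ?S" "\<tau> \<in> ?S" "j \<in> ?N" for \<sigma> \<tau> j y
    by (rule basis_integral(1)[OF mem[OF that(2,3)] mem[OF that(1,3)] inj]) (use heights[OF that(3)] in auto)
  have integral: "lines_integral (Suc l) c (kern l \<gamma> \<delta> (real n)) = (\<Sum>\<sigma>\<in>?S. \<Sum>\<tau>\<in>?S. ?A \<sigma> \<tau> *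
     (\<Prod>j\<in>?N. exp (- \<i> * of_nat n * \<gamma> (\<tau> j)) * (\<integral>t. basis_integrand (\<sigma> j) (\<tau> j) (real n) (Complex t (c j)) \<partial>lborel)))" for n
  proof -
    let ?M = "\<Pi>\<^sub>M j\<in>?N. lborel :: real measure"
    let ?a = "\<lambda>\<sigma> \<tau>. ?A \<sigma> \<tau> * (\<Prod>j\<in>?N. exp (- \<i> * of_real (real n) * \<gamma> (\<tau> j)))"
    let ?f = "\<lambda>\<sigma> \<tau> t. \<Prod>j\<in>?N. basis_integrand (\<sigma> j) (\<tau> j) (real n) (Complex (t j) (c j))"
    have intp: "integrable ?M (\<lambda>t. ?a \<sigma> \<tau> * ?f \<sigma> \<tau> t)" if "\<sigma> \<in> ?S" "\<tau> \<in> ?S" for \<sigma> \<tau>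
      by (intro integrable_mult_right lborel_prod.product_integrable_prod[where f = "\<lambda>j t. basis_integrand (\<sigma> j) (\<tau> j) (real n) (Complex t (c j))"] int that) auto
    have val: "(\<integral>t. ?a \<sigma> \<tau> * ?f \<sigma> \<tau> t \<partial>?M) = ?A \<sigma> \<tau> *
     (\<Prod>j\<in>?N. exp (- \<i> * of_nat n * \<gamma> (\<tau> j)) * (\<integral>t. basis_integrand (\<sigma> j) (\<tau> j) (real n) (Complex t (c j)) \<partial>lborel))"
      if "\<sigma> \<in> ?S" "\<tau> \<in> ?S" for \<sigma> \<tau>
    proof -
      have "(\<integral>t. ?f \<sigma> \<tau> t \<partial>?M) = (\<Prod>j\<in>?N. (\<integral>t. basis_integrand (\<sigma> j) (\<tau> j) (real n) (Complex t (c j)) \<partial>lborel))"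
        by (intro lborel_prod.product_integral_prod[where f = "\<lambda>j t. basis_integrand (\<sigma> j) (\<tau> j) (real n) (Complex t (c j))"] int that) auto
      then show ?thesis unfolding integral_mult_right_zero prod.distrib by (simp only: mult.assoc of_real_of_nat_eq)
    qed
    have "lines_integral (Suc l) c (kern l \<gamma> \<delta> (real n)) = (\<integral>t. (\<Sum>\<sigma>\<in>?S. \<Sum>\<tau>\<in>?S. ?a \<sigma> \<tau> * ?f \<sigma> \<tau> t) \<partial>?M)"
      unfolding lines_integral_def expand on_lines_def ..
    also have "\<dots> = (\<Sum>\<sigma>\<in>?S. \<integral>t. (\<Sum>\<tau>\<in>?S. ?a \<sigma> \<tau> * ?f \<sigma> \<tau> t) \<partial>?M)"
      by (intro Bochner_Integration.integral_sum Bochner_Integration.integrable_sum intp)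
    also have "\<dots> = (\<Sum>\<sigma>\<in>?S. \<Sum>\<tau>\<in>?S. \<integral>t. ?a \<sigma> \<tau> * ?f \<sigma> \<tau> t \<partial>?M)"
      by (intro sum.cong refl Bochner_Integration.integral_sum intp)
    also have "\<dots> = (\<Sum>\<sigma>\<in>?S. \<Sum>\<tau>\<in>?S. ?A \<sigma> \<tau> *
     (\<Prod>j\<in>?N. exp (- \<i> * of_nat n * \<gamma> (\<tau> j)) * (\<integral>t. basis_integrand (\<sigma> j) (\<tau> j) (real n) (Complex t (c j)) \<partial>lborel)))"
      by (intro sum.cong refl val)
    finally show ?thesis .
  qed
  have "(\<lambda>n. lines_integral (Suc l) c (kern l \<gamma> \<delta> (real n))) \<longlonglongrightarrow>
    (\<Sum>\<sigma>\<in>?S. \<Sum>\<tau>\<in>?S. ?A \<sigma> \<tau> * (\<Prod>j\<in>?N. if \<sigma> j = \<tau> j then 2 * of_real pi * residue_value (\<tau> j) else 0))"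
    unfolding integral
  proof (intro tendsto_sum)
    fix \<sigma> \<tau> assume st: "\<sigma> \<in> ?S" "\<tau> \<in> ?S"
    have "(\<lambda>n. exp (- \<i> * of_nat n * \<gamma> (\<tau> j)) * (\<integral>t. basis_integrand (\<sigma> j) (\<tau> j) (real n) (Complex t (c j)) \<partial>lborel))
       \<longlonglongrightarrow> (if \<sigma> j = \<tau> j then 2 * of_real pi * residue_value (\<tau> j) else 0)" if "j \<in> ?N" for j
      by (rule basis_integral(2)[OF mem[OF st(2) that] mem[OF st(1) that] inj]) (use heights[OF that] in auto)
    then show "(\<lambda>n. ?A \<sigma> \<tau> * (\<Prod>j\<in>?N. exp (- \<i> * of_nat n * \<gamma> (\<tau> j)) * (\<integral>t. basis_integrand (\<sigma> j) (\<tau> j) (real n) (Complex t (c j)) \<partial>lborel)))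
       \<longlonglongrightarrow> ?A \<sigma> \<tau> * (\<Prod>j\<in>?N. if \<sigma> j = \<tau> j then 2 * of_real pi * residue_value (\<tau> j) else 0)"
      by (rule tendsto_mult[OF tendsto_const tendsto_prod])
  qed
  also have "(\<Sum>\<sigma>\<in>?S. \<Sum>\<tau>\<in>?S. ?A \<sigma> \<tau> * (\<Prod>j\<in>?N. if \<sigma> j = \<tau> j then 2 * of_real pi * residue_value (\<tau> j) else 0))
     = (\<Sum>\<sigma>\<in>?S. \<Sum>\<tau>\<in>?S. if \<tau> = \<sigma> then ?A \<sigma> \<sigma> * (\<Prod>j\<in>?N. 2 * of_real pi * residue_value (\<sigma> j)) else 0)"
  proof (intro sum.cong refl)
    fix \<sigma> \<tau> assume st: "\<sigma> \<in> ?S" "\<tau> \<in> ?S"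
    show "?A \<sigma> \<tau> * (\<Prod>j\<in>?N. if \<sigma> j = \<tau> j then 2 * of_real pi * residue_value (\<tau> j) else 0) =
       (if \<tau> = \<sigma> then ?A \<sigma> \<sigma> * (\<Prod>j\<in>?N. 2 * of_real pi * residue_value (\<sigma> j)) else 0)"
    proof (cases "\<tau> = \<sigma>")
      case False
      then obtain j where j: "j \<in> ?N" "\<sigma> j \<noteq> \<tau> j" using PiE_ext[OF st] by blast
      have "(\<Prod>j\<in>?N. if \<sigma> j = \<tau> j then 2 * of_real pi * residue_value (\<tau> j) else 0) = 0"
        by (rule prod_zero[OF _ bexI[of _ j]]) (use j in auto)
      then show ?thesis using False by (simp only: mult_zero_right if_False)
    qed simp
  qed
  also have "\<dots> = (\<Sum>\<sigma>\<in>?S. ?A \<sigma> \<sigma> * (\<Prod>j\<in>?N. 2 * of_real pi * residue_value (\<sigma> j)))"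
    using finS by (simp only: sum.delta if_True cong: sum.cong)
  also have "\<dots> = (\<Sum>\<sigma>\<in>{\<sigma>\<in>?S. inj_on \<sigma> ?N}. ?A \<sigma> \<sigma> * (\<Prod>j\<in>?N. 2 * of_real pi * residue_value (\<sigma> j)))"
    by (intro sum.mono_neutral_right finS) (auto simp: A0)
  also have "\<dots> = (\<Sum>\<sigma>\<in>{\<sigma>\<in>?S. inj_on \<sigma> ?N}. (2 * of_real pi) ^ Suc l * (\<Prod>i\<in>?N. \<Prod>j\<in>{1..l}. Gamma (\<i> * \<delta> j - \<i> * \<gamma> i)))"
  proof (intro sum.cong refl)
    fix \<sigma> assume \<sigma>: "\<sigma> \<in> {\<sigma>\<in>?S. inj_on \<sigma> ?N}"
    have bij: "bij_betw \<sigma> ?N ?N" using \<sigma> by (intro inj_imp_bij) auto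
    have "(\<Prod>j\<in>?N. 2 * of_real pi * residue_value (\<sigma> j)) = (2 * of_real pi) ^ Suc l * (\<Prod>j\<in>?N. residue_value j)"
      unfolding prod.distrib prod.reindex_bij_betw[OF bij, of residue_value] by simp
    then have e1: "?A \<sigma> \<sigma> * (\<Prod>j\<in>?N. 2 * of_real pi * residue_value (\<sigma> j)) = ?A \<sigma> \<sigma> * ((2 * of_real pi) ^ Suc l * (\<Prod>j\<in>?N. residue_value j))" by (simp only:)
    have e2: "?A \<sigma> \<sigma> = rGamma_prod (Suc l) \<gamma>" unfolding Adiag by (rule rGamma_prod_permute[OF bij])
    have e3: "rGamma_prod (Suc l) \<gamma> * (\<Prod>j\<in>?N. residue_value j) = (\<Prod>i\<in>?N. \<Prod>j\<in>{1..l}. Gamma (\<i> * \<delta> j - \<i> * \<gamma> i))"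
    proof -
      have "rGamma_prod (Suc l) \<gamma> = (\<Prod>j\<in>?N. \<Prod>k\<in>?N-{j}. rGamma (\<i> * \<gamma> j - \<i> * \<gamma> k))"
        unfolding rGamma_prod_def by (rule prod_offdiag_swap) simp
      then have "rGamma_prod (Suc l) \<gamma> * (\<Prod>j\<in>?N. \<Prod>k\<in>?N-{j}. Gamma (\<i> * \<gamma> j - \<i> * \<gamma> k)) =
         (\<Prod>j\<in>?N. \<Prod>k\<in>?N-{j}. rGamma (\<i> * \<gamma> j - \<i> * \<gamma> k) * Gamma (\<i> * \<gamma> j - \<i> * \<gamma> k))"
        by (simp only: prod.distrib)
      also have "\<dots> = 1"
      proof (intro prod.neutral ballI)
        fix j k assume jk: "j \<in> ?N" "k \<in> ?N-{j}"
        have "Im (\<i> * \<gamma> j - \<i> * \<gamma> k) \<noteq> 0" using inj_onD[OF inj, of j k] jk by auto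
        then have "\<i> * \<gamma> j - \<i> * \<gamma> k \<notin> \<int>\<^sub>\<le>\<^sub>0" by (auto elim!: nonpos_Ints_cases simp del: minus_complex.sel)
        then show "rGamma (\<i> * \<gamma> j - \<i> * \<gamma> k) * Gamma (\<i> * \<gamma> j - \<i> * \<gamma> k) = 1"
          by (simp add: rGamma_inverse_Gamma Gamma_eq_zero_iff)
      qed
      finally show ?thesis unfolding residue_value_def prod.distrib mult.assoc[symmetric] by simp
    qed
    show "?A \<sigma> \<sigma> * (\<Prod>j\<in>?N. 2 * of_real pi * residue_value (\<sigma> j)) = (2 * of_real pi) ^ Suc l * (\<Prod>i\<in>?N. \<Prod>j\<in>{1..l}. Gamma (\<i> * \<delta> j - \<i> * \<gamma> i))"
      by (subst e1, unfold e2 mult.left_commute[of "rGamma_prod (Suc l) \<gamma>"] e3) (rule refl)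
  qed
  also have "\<dots> = of_nat (fact (Suc l)) * ((2 * of_real pi) ^ Suc l * (\<Prod>i\<in>?N. \<Prod>j\<in>{1..l}. Gamma (\<i> * \<delta> j - \<i> * \<gamma> i)))"
    by (simp only: sum_constant card_bijective_selfmaps)
  finally show ?thesis by (simp only: of_nat_fact mult_ac)
qed

lemma kern_integral_generic:
  assumes inj: "inj_on (\<lambda>i. Re (\<gamma> i)) {1..Suc l}"
  shows "lines_integral (Suc l) c (kern l \<gamma> \<delta> y) =
    (2 * of_real pi) ^ Suc l * fact (Suc l) * (\<Prod>i\<in>{1..Suc l}. \<Prod>j\<in>{1..l}. Gamma (\<i> * \<delta> j - \<i> * \<gamma> i)) * of_real (exp (- exp (- y)))"
proof -
  obtain K where K: "\<And>y. lines_integral (Suc l) c (kern l \<gamma> \<delta> y) = K * of_real (exp (- exp (- y)))"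
    using kern_integral_constant by metis
  have "(\<lambda>n. K * of_real (exp (- exp (- real n)))) \<longlonglongrightarrow> K * of_real (exp (- 0))"
    by (intro tendsto_intros filterlim_compose[OF exp_at_bot] filterlim_compose[OF filterlim_uminus_at_bot_at_top filterlim_real_sequentially])
  then have "(\<lambda>n. lines_integral (Suc l) c (kern l \<gamma> \<delta> (real n))) \<longlonglongrightarrow> K" unfolding K by simp
  from LIMSEQ_unique[OF this kern_integral_limit[OF inj]] show ?thesis unfolding K by simp
qed

end

text \<open>Points that coincide are separated by the different shifts, and points that differ stay apart for large \<open>n\<close>.\<close>
lemma generic_perturbation:
  fixes x :: "nat \<Rightarrow> real"
  shows "\<forall>\<^sub>F n in sequentially. inj_on (\<lambda>i. x i + real i / (real n + 1)) {1..N}"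
proof -
  have "\<forall>\<^sub>F n in sequentially. \<forall>i\<in>{1..N}. \<forall>j\<in>{1..N}. i \<noteq> j \<longrightarrow> x i + real i / (real n + 1) \<noteq> x j + real j / (real n + 1)"
  proof (intro eventually_ball_finite finite_atLeastAtMost ballI)
    fix i j
    show "\<forall>\<^sub>F n in sequentially. i \<noteq> j \<longrightarrow> x i + real i / (real n + 1) \<noteq> x j + real j / (real n + 1)"
    proof (cases "i = j \<or> x i = x j")
      case True
      have "i \<noteq> j \<longrightarrow> x i + real i / (real n + 1) \<noteq> x j + real j / (real n + 1)" for n
        using True by (auto simp: divide_cancel_right add_nonneg_eq_0_iff)
      then show ?thesis by simp
    next
      case False
      have "(\<lambda>n. real i / (real n + 1) - real j / (real n + 1)) \<longlonglongrightarrow> real i * 0 - real j * 0"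
        unfolding divide_inverse using LIMSEQ_inverse_real_of_nat
        by (intro tendsto_intros) (simp_all add: add.commute)
      then have "\<forall>\<^sub>F n in sequentially. real i / (real n + 1) - real j / (real n + 1) \<noteq> x j - x i"
        using False by (intro tendsto_imp_eventually_ne[where c = 0]) auto
      then show ?thesis by eventually_elim auto
    qed
  qed
  then show ?thesis by eventually_elim (auto simp: inj_on_def)
qed

context kernel_lines
begin

text \<open>
  Both sides are continuous in \<open>\<gamma>\<close>, and parameters with distinct real parts are dense. Real shifts leave the strip
  unchanged, so the bound of the kernel is uniform along the perturbation.
\<close>
lemma kern_integral:
  "lines_integral (Suc l) c (kern l \<gamma> \<delta> y) =
    (2 * of_real pi) ^ Suc l * fact (Suc l) * (\<Prod>i\<in>{1..Suc l}. \<Prod>j\<in>{1..l}. Gamma (\<i> * \<delta> j - \<i> * \<gamma> i)) * of_real (exp (- exp (- y)))"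
proof -
  let ?M = "\<Pi>\<^sub>M j\<in>{1..Suc l}. lborel :: real measure"
  define g where "g n i = \<gamma> i + of_real (real i / (real n + 1))" for n i
  have Im: "Im (g n i) = Im (\<gamma> i)" for n i by (simp add: g_def)
  have perturbed: "kernel_lines l (g n) \<delta> c P Q" for n
    using below above heights by unfold_locales (auto simp: Im)
  have lim: "(\<lambda>n. g n i) \<longlonglongrightarrow> \<gamma> i" for i
  proof -
    have "(\<lambda>n. \<gamma> i + of_real (real i / (real n + 1))) \<longlonglongrightarrow> \<gamma> i + of_real (real i * 0)"
      unfolding divide_inverse using LIMSEQ_inverse_real_of_nat
      by (intro tendsto_intros) (simp_all add: add.commute)
    then show ?thesis unfolding g_def by simp
  qed
  have Gamma_lim: "(\<lambda>n. Gamma (\<i> * z - \<i> * g n i)) \<longlonglongrightarrow> Gamma (\<i> * z - \<i> * \<gamma> i)" if "Im z < Im (\<gamma> i)" for z i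
    by (intro tendsto_intros lim Re_pos_not_nonpos_Int) (use that in simp)
  obtain C where C: "C > 0" "\<And>\<gamma>' \<beta>. (\<And>i. i \<in> {1..Suc l} \<Longrightarrow> Im (\<gamma>' i) = Im (\<gamma> i) \<and> \<bar>Re (\<gamma>' i)\<bar> \<le> re_size (Suc l) \<gamma> + real (Suc l)) \<Longrightarrow>
       (\<And>j. j \<in> {1..Suc l} \<Longrightarrow> P \<le> Im (\<beta> j) \<and> Im (\<beta> j) \<le> Q) \<Longrightarrow>
       norm (kern l \<gamma>' \<delta> y \<beta>) \<le> C * exp (- (pi/4) * re_size (Suc l) \<beta>)"
    using kern_bound[where l = l and \<delta> = \<delta> and P = P and Q = Q and g = "\<lambda>i. Im (\<gamma> i)" and R = "re_size (Suc l) \<gamma> + real (Suc l)" and y = y, OF below above] by metis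
  have "(\<lambda>n. lines_integral (Suc l) c (kern l (g n) \<delta> y)) \<longlonglongrightarrow> lines_integral (Suc l) c (kern l \<gamma> \<delta> y)"
  proof -
    have meas: "(\<lambda>t. kern l \<gamma>' \<delta> y (on_lines c t)) \<in> borel_measurable ?M" for \<gamma>'
      by (intro kern_measurable measurable_on_lines; assumption)
    have dom: "integrable ?M (\<lambda>t. C * exp (- (pi/4) * re_size (Suc l) (on_lines c t)))"
      by (intro integrable_mult_right integrable_exp_re_size) simp
    have conv: "(\<lambda>n. kern l (g n) \<delta> y (on_lines c t)) \<longlonglongrightarrow> kern l \<gamma> \<delta> y (on_lines c t)" for t
      unfolding kern_def gam_def weight_def
    proof (intro tendsto_mult tendsto_const tendsto_prod tendsto_exp tendsto_diff tendsto_sum lim Gamma_lim)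
      fix j i assume "j \<in> {1..Suc l}" "i \<in> {1..Suc l}"
      then show "Im (on_lines c t j) < Im (\<gamma> i)" using on_lines_range[of j t] above[of i] by linarith
    qed
    have bnd: "norm (kern l (g n) \<delta> y (on_lines c t)) \<le> C * exp (- (pi/4) * re_size (Suc l) (on_lines c t))" for n t
    proof (rule C(2))
      fix i assume i: "i \<in> {1..Suc l}"
      have "real i / (real n + 1) \<le> real i / 1" by (intro divide_left_mono) auto
      then have u: "\<bar>real i / (real n + 1)\<bar> \<le> real (Suc l)" using i by simp
      have "Re (g n i) = Re (\<gamma> i) + real i / (real n + 1)" by (simp add: g_def)
      then have "\<bar>Re (g n i)\<bar> \<le> re_size (Suc l) \<gamma> + real (Suc l)"
        using abs_Re_le_re_size[OF i, of \<gamma>] u by linarith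
      then show "Im (g n i) = Im (\<gamma> i) \<and> \<bar>Re (g n i)\<bar> \<le> re_size (Suc l) \<gamma> + real (Suc l)"
        using Im by simp
    next
      fix i assume i: "i \<in> {1..Suc l}"
      show "P \<le> Im (on_lines c t i) \<and> Im (on_lines c t i) \<le> Q" using on_lines_range[OF i, of t] by simp
    qed
    show ?thesis unfolding lines_integral_def
      by (rule integral_dominated_convergence[OF meas meas dom AE_I2[OF conv] AE_I2[OF bnd]])
  qed
  moreover have "\<forall>\<^sub>F n in sequentially. lines_integral (Suc l) c (kern l (g n) \<delta> y) =
     (2 * of_real pi) ^ Suc l * fact (Suc l) * (\<Prod>i\<in>{1..Suc l}. \<Prod>j\<in>{1..l}. Gamma (\<i> * \<delta> j - \<i> * g n i)) * of_real (exp (- exp (- y)))"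
    using generic_perturbation[of "\<lambda>i. Re (\<gamma> i)" "Suc l"]
  proof eventually_elim
    case (elim n)
    interpret p: kernel_lines l "g n" \<delta> c P Q by (rule perturbed)
    show ?case by (rule p.kern_integral_generic) (use elim in \<open>simp add: g_def\<close>)
  qed
  ultimately have 1: "(\<lambda>n. (2 * of_real pi) ^ Suc l * fact (Suc l) * (\<Prod>i\<in>{1..Suc l}. \<Prod>j\<in>{1..l}. Gamma (\<i> * \<delta> j - \<i> * g n i)) * of_real (exp (- exp (- y))))
     \<longlonglongrightarrow> lines_integral (Suc l) c (kern l \<gamma> \<delta> y)"
    by (rule Lim_transform_eventually)
  have 2: "(\<lambda>n. (2 * of_real pi) ^ Suc l * fact (Suc l) * (\<Prod>i\<in>{1..Suc l}. \<Prod>j\<in>{1..l}. Gamma (\<i> * \<delta> j - \<i> * g n i)) * of_real (exp (- exp (- y))))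
     \<longlonglongrightarrow> (2 * of_real pi) ^ Suc l * fact (Suc l) * (\<Prod>i\<in>{1..Suc l}. \<Prod>j\<in>{1..l}. Gamma (\<i> * \<delta> j - \<i> * \<gamma> i)) * of_real (exp (- exp (- y)))"
  proof (intro tendsto_mult tendsto_const tendsto_prod Gamma_lim)
    fix i j assume "i \<in> {1..Suc l}" "j \<in> {1..l}"
    then show "Im (\<delta> j) < Im (\<gamma> i)" using below[of j] above[of i] heights[of 1] by simp
  qed
  show ?thesis by (rule LIMSEQ_unique[OF 1 2])
qed

end

section \<open>Whittaker functions with fixed heights\<close>

definition recursion_kernel :: "nat \<Rightarrow> (nat \<Rightarrow> real) \<Rightarrow> (nat \<Rightarrow> complex) \<Rightarrow> (nat \<Rightarrow> complex) \<Rightarrow> complex" where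
  "recursion_kernel n x \<gamma> \<delta> =
     exp (- \<i> * ((\<Sum>j\<in>{1..n+1}. \<gamma> j) - (\<Sum>k\<in>{1..n}. \<delta> k)) * of_real (x (n+1))) *
     (\<Prod>k\<in>{1..n}. \<Prod>m\<in>{1..n+1}. Gamma (\<i> * \<delta> k - \<i> * \<gamma> m))"

text \<open>
  The Whittaker function whose \<open>n\<close>-th lines of integration all have the height \<open>H n\<close>, independently of the outer variables.
  The recursion starts with the constant \<open>1\<close> at rank \<open>0\<close>, so that rank \<open>1\<close> is an instance of the recursion, too.
\<close>
primrec level_whittaker :: "(nat \<Rightarrow> real) \<Rightarrow> (nat \<Rightarrow> real) \<Rightarrow> nat \<Rightarrow> (nat \<Rightarrow> complex) \<Rightarrow> complex" where
  "level_whittaker H x 0 = (\<lambda>\<gamma>. 1)"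
| "level_whittaker H x (Suc n) = (\<lambda>\<gamma>. lines_integral n (\<lambda>_. H n)
     (\<lambda>\<delta>. recursion_kernel n x \<gamma> \<delta> * level_whittaker H x n \<delta> * mu n \<delta>))"

lemma lines_integral_0: "lines_integral 0 c f = f (on_lines c (\<lambda>_. undefined))"
  by (simp add: lines_integral_def PiM_empty lebesgue_integral_count_space_finite)

lemma level_whittaker_1: "level_whittaker H x (Suc 0) \<gamma> = exp (- \<i> * \<gamma> 1 * of_real (x 1))"
  by (simp add: lines_integral_0 recursion_kernel_def mu_def)

lemma recursion_kernel_measurable:
  assumes "\<And>j. j \<in> {1..n+1} \<Longrightarrow> (\<lambda>\<omega>. g \<omega> j) \<in> borel_measurable M"
    and "\<And>j. j \<in> {1..n} \<Longrightarrow> (\<lambda>\<omega>. d \<omega> j) \<in> borel_measurable M"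
  shows "(\<lambda>\<omega>. recursion_kernel n x (g \<omega>) (d \<omega>)) \<in> borel_measurable M"
  unfolding recursion_kernel_def
  by (intro borel_measurable_times borel_measurable_exp_complex borel_measurable_diff borel_measurable_sum borel_measurable_prod
      borel_measurable_Gamma borel_measurable_const assms)

lemma mu_measurable:
  assumes "\<And>j. j \<in> {1..n} \<Longrightarrow> (\<lambda>\<omega>. g \<omega> j) \<in> borel_measurable M"
  shows "(\<lambda>\<omega>. mu n (g \<omega>)) \<in> borel_measurable M"
  unfolding mu_eq by (intro borel_measurable_times borel_measurable_const rGamma_prod_measurable assms)

text \<open>A function that depends only on the coordinates \<open>1, ..., n\<close> can be restricted to the product space before it is composed.\<close>
lemma measurable_from_coordinates:
  fixes F :: "(nat \<Rightarrow> complex) \<Rightarrow> complex"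
  assumes F: "F \<in> borel_measurable (\<Pi>\<^sub>M j\<in>{1..n}. borel)"
    and cong: "\<And>\<gamma> \<gamma>'. (\<And>j. j \<in> {1..n} \<Longrightarrow> \<gamma> j = \<gamma>' j) \<Longrightarrow> F \<gamma> = F \<gamma>'"
    and g: "\<And>j. j \<in> {1..n} \<Longrightarrow> (\<lambda>\<omega>. g \<omega> j) \<in> borel_measurable M"
  shows "(\<lambda>\<omega>. F (g \<omega>)) \<in> borel_measurable M"
proof -
  have "(\<lambda>\<omega>. \<lambda>j\<in>{1..n}. g \<omega> j) \<in> measurable M (\<Pi>\<^sub>M j\<in>{1..n}. borel)"
    by (rule measurable_restrict) (rule g)
  from measurable_compose[OF this F] have "(\<lambda>\<omega>. F (\<lambda>j\<in>{1..n}. g \<omega> j)) \<in> borel_measurable M" .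
  moreover have "F (\<lambda>j\<in>{1..n}. g \<omega> j) = F (g \<omega>)" for \<omega> by (rule cong) simp
  ultimately show ?thesis by simp
qed

lemma recursion_kernel_cong:
  assumes "\<And>j. j \<in> {1..n+1} \<Longrightarrow> \<gamma> j = \<gamma>' j" "\<And>j. j \<in> {1..n} \<Longrightarrow> \<delta> j = \<delta>' j"
  shows "recursion_kernel n x \<gamma> \<delta> = recursion_kernel n x \<gamma>' \<delta>'"
proof -
  have "(\<Sum>j\<in>{1..n+1}. \<gamma> j) = (\<Sum>j\<in>{1..n+1}. \<gamma>' j)" "(\<Sum>j\<in>{1..n}. \<delta> j) = (\<Sum>j\<in>{1..n}. \<delta>' j)"
    "(\<Prod>k\<in>{1..n}. \<Prod>m\<in>{1..n+1}. Gamma (\<i> * \<delta> k - \<i> * \<gamma> m)) = (\<Prod>k\<in>{1..n}. \<Prod>m\<in>{1..n+1}. Gamma (\<i> * \<delta>' k - \<i> * \<gamma>' m))"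
    using assms by (auto intro!: sum.cong prod.cong simp del: sum.cl_ivl_Suc prod.cl_ivl_Suc)
  then show ?thesis by (simp only: recursion_kernel_def)
qed

lemma level_whittaker_cong:
  assumes "\<And>j. j \<in> {1..n} \<Longrightarrow> \<gamma> j = \<gamma>' j"
  shows "level_whittaker H x n \<gamma> = level_whittaker H x n \<gamma>'"
proof (cases n)
  case (Suc m)
  then have "recursion_kernel m x \<gamma> \<delta> = recursion_kernel m x \<gamma>' \<delta>" for \<delta>
    using assms by (intro recursion_kernel_cong) auto
  then show ?thesis using Suc by simp
qed simp

lemma mu_cong:
  assumes "\<And>j. j \<in> {1..n} \<Longrightarrow> \<gamma> j = \<gamma>' j"
  shows "mu n \<gamma> = mu n \<gamma>'"
  using assms unfolding mu_def by (auto intro!: prod.cong)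

text \<open>
  Here the fixed heights matter: they make the recursion an integral of a function that is jointly measurable in the
  inner and the outer variables.
\<close>
lemma level_whittaker_borel: "level_whittaker H x n \<in> borel_measurable (\<Pi>\<^sub>M j\<in>{1..n}. borel)"
proof (induction n)
  case (Suc n)
  let ?P = "\<Pi>\<^sub>M j\<in>{1..n}. lborel :: real measure"
  let ?M = "\<Pi>\<^sub>M j\<in>{1..Suc n}. borel :: complex measure"
  interpret P: finite_product_sigma_finite "\<lambda>_. lborel :: real measure" "{1..n}" by standard simp
  have g: "(\<lambda>p. fst p j) \<in> borel_measurable (?M \<Otimes>\<^sub>M ?P)" if "j \<in> {1..n+1}" for j
    using that by (intro measurable_compose[OF measurable_fst measurable_component_singleton]) simp
  have d: "(\<lambda>p. on_lines (\<lambda>_. H n) (snd p) j) \<in> borel_measurable (?M \<Otimes>\<^sub>M ?P)" if "j \<in> {1..n}" for j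
    by (rule measurable_compose[OF measurable_snd measurable_on_lines[OF that]])
  have V: "(\<lambda>p. level_whittaker H x n (on_lines (\<lambda>_. H n) (snd p))) \<in> borel_measurable (?M \<Otimes>\<^sub>M ?P)"
    by (rule measurable_from_coordinates[OF Suc level_whittaker_cong d])
  have "(\<lambda>p. recursion_kernel n x (fst p) (on_lines (\<lambda>_. H n) (snd p)) * level_whittaker H x n (on_lines (\<lambda>_. H n) (snd p)) * mu n (on_lines (\<lambda>_. H n) (snd p)))
     \<in> borel_measurable (?M \<Otimes>\<^sub>M ?P)"
    by (intro borel_measurable_times recursion_kernel_measurable mu_measurable V g d)
  then have "(\<lambda>\<omega>. \<integral>u. recursion_kernel n x \<omega> (on_lines (\<lambda>_. H n) u) * level_whittaker H x n (on_lines (\<lambda>_. H n) u) * mu n (on_lines (\<lambda>_. H n) u) \<partial>?P) \<in> borel_measurable ?M"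
    by (intro P.borel_measurable_lebesgue_integral) (simp add: case_prod_unfold)
  then show ?case unfolding level_whittaker.simps lines_integral_def .
qed simp

lemmas level_whittaker_measurable = measurable_from_coordinates[OF level_whittaker_borel level_whittaker_cong]

lemma norm_exp_im_bound:
  assumes "\<And>j. j \<in> A \<Longrightarrow> \<bar>Im (f j)\<bar> \<le> B" "\<And>k. k \<in> A' \<Longrightarrow> \<bar>Im (g k)\<bar> \<le> B"
  shows "norm (exp (- \<i> * ((\<Sum>j\<in>A. f j) - (\<Sum>k\<in>A'. g k)) * of_real x)) \<le> exp ((real (card A) + real (card A')) * B * \<bar>x\<bar>)"
proof -
  have 1: "\<bar>Im (\<Sum>j\<in>A. f j)\<bar> \<le> real (card A) * B"
    unfolding Im_sum using sum_mono[of A "\<lambda>j. \<bar>Im (f j)\<bar>" "\<lambda>_. B"] assms(1) by (intro order_trans[OF sum_abs]) auto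
  have 2: "\<bar>Im (\<Sum>k\<in>A'. g k)\<bar> \<le> real (card A') * B"
    unfolding Im_sum using sum_mono[of A' "\<lambda>j. \<bar>Im (g j)\<bar>" "\<lambda>_. B"] assms(2) by (intro order_trans[OF sum_abs]) auto
  have "norm (exp (- \<i> * ((\<Sum>j\<in>A. f j) - (\<Sum>k\<in>A'. g k)) * of_real x)) = exp ((Im (\<Sum>j\<in>A. f j) - Im (\<Sum>k\<in>A'. g k)) * x)"
    by (simp add: algebra_simps)
  also have "\<dots> \<le> exp ((real (card A) + real (card A')) * B * \<bar>x\<bar>)"
  proof -
    have "(Im (\<Sum>j\<in>A. f j) - Im (\<Sum>k\<in>A'. g k)) * x \<le> \<bar>Im (\<Sum>j\<in>A. f j) - Im (\<Sum>k\<in>A'. g k)\<bar> * \<bar>x\<bar>"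
      by (metis abs_ge_self abs_mult)
    also have "\<dots> \<le> (real (card A) * B + real (card A') * B) * \<bar>x\<bar>" using 1 2 by (intro mult_right_mono) linarith+
    finally show ?thesis by (simp add: algebra_simps)
  qed
  finally show ?thesis .
qed

lemma recursion_kernel_bound:
  assumes e: "e > 0" and pq: "q' < p"
  obtains C where "C > 0" "\<And>\<gamma> \<delta>. (\<And>j. j \<in> {1..n+1} \<Longrightarrow> p \<le> Im (\<gamma> j) \<and> Im (\<gamma> j) \<le> q) \<Longrightarrow>
     (\<And>k. k \<in> {1..n} \<Longrightarrow> p' \<le> Im (\<delta> k) \<and> Im (\<delta> k) \<le> q') \<Longrightarrow>
     norm (recursion_kernel n x \<gamma> \<delta>) \<le> C * exp (- (pi/2 - e) * re_cross n (n+1) \<delta> \<gamma>)"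
proof -
  obtain C where C: "C > 0" "\<And>\<delta> \<gamma>. (\<And>j k. j \<in> {1..n} \<Longrightarrow> k \<in> {1..n+1} \<Longrightarrow> p - q' \<le> Im (\<gamma> k) - Im (\<delta> j) \<and> Im (\<gamma> k) - Im (\<delta> j) \<le> q - p') \<Longrightarrow>
       norm (\<Prod>j\<in>{1..n}. \<Prod>k\<in>{1..n+1}. Gamma (\<i> * \<delta> j - \<i> * \<gamma> k)) \<le> C * exp (- (pi/2 - e) * re_cross n (n+1) \<delta> \<gamma>)"
    using Gamma_cross_bound[of "p - q'" e n "n+1" "q - p'"] e pq by (metis diff_gt_0_iff_gt)
  define B where "B = \<bar>p\<bar> + \<bar>q\<bar> + \<bar>p'\<bar> + \<bar>q'\<bar>"
  define K where "K = exp ((real (card {1..n+1}) + real (card {1..n})) * B * \<bar>x (n+1)\<bar>)"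
  have "norm (recursion_kernel n x \<gamma> \<delta>) \<le> (K * C) * exp (- (pi/2 - e) * re_cross n (n+1) \<delta> \<gamma>)"
    if g: "\<And>j. j \<in> {1..n+1} \<Longrightarrow> p \<le> Im (\<gamma> j) \<and> Im (\<gamma> j) \<le> q" and d: "\<And>k. k \<in> {1..n} \<Longrightarrow> p' \<le> Im (\<delta> k) \<and> Im (\<delta> k) \<le> q'" for \<gamma> \<delta>
  proof -
    have 1: "norm (exp (- \<i> * ((\<Sum>j\<in>{1..n+1}. \<gamma> j) - (\<Sum>k\<in>{1..n}. \<delta> k)) * of_real (x (n+1)))) \<le> K"
      unfolding K_def
    proof (rule norm_exp_im_bound)
      show "\<bar>Im (\<gamma> j)\<bar> \<le> B" if "j \<in> {1..n+1}" for j using g[OF that] unfolding B_def by linarith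
      show "\<bar>Im (\<delta> k)\<bar> \<le> B" if "k \<in> {1..n}" for k using d[OF that] unfolding B_def by linarith
    qed
    have 2: "norm (\<Prod>j\<in>{1..n}. \<Prod>k\<in>{1..n+1}. Gamma (\<i> * \<delta> j - \<i> * \<gamma> k)) \<le> C * exp (- (pi/2 - e) * re_cross n (n+1) \<delta> \<gamma>)"
    proof (rule C(2))
      fix j k assume "j \<in> {1..n}" "k \<in> {1..n+1}"
      then show "p - q' \<le> Im (\<gamma> k) - Im (\<delta> j) \<and> Im (\<gamma> k) - Im (\<delta> j) \<le> q - p'"
        using g[of k] d[of j] by linarith
    qed
    show ?thesis unfolding recursion_kernel_def norm_mult
      using mult_mono[OF 1 2] by (simp add: K_def mult.assoc)
  qed
  moreover have "K * C > 0" using C by (simp add: K_def)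
  ultimately show ?thesis using that by blast
qed

lemma mu_bound:
  assumes e: "e > 0"
  obtains C where "C > 0" "\<And>\<beta>. (\<forall>j\<in>{1..n}. \<bar>Im (\<beta> j)\<bar> \<le> R) \<Longrightarrow>
     norm (mu n \<beta>) \<le> C * exp (pi/2 * re_spread n \<beta> + e * re_size n \<beta>)"
proof -
  obtain C where C: "C > 0" "\<And>\<beta>. (\<forall>j\<in>{1..n}. \<bar>Im (\<beta> j)\<bar> \<le> R) \<Longrightarrow>
     norm (rGamma_prod n \<beta>) \<le> C * exp (pi/2 * re_spread n \<beta> + e * re_size n \<beta>)"
    using rGamma_prod_bound[OF e] by metis
  define D where "D = norm (1 / ((2 * complex_of_real pi) ^ n * fact n)) * C"
  have "norm (mu n \<beta>) \<le> D * exp (pi/2 * re_spread n \<beta> + e * re_size n \<beta>)" if "\<forall>j\<in>{1..n}. \<bar>Im (\<beta> j)\<bar> \<le> R" for \<beta>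
    unfolding mu_eq norm_mult D_def mult.assoc using C(2)[OF that] by (intro mult_left_mono) auto
  moreover have "D > 0" unfolding D_def using C by (intro mult_pos_pos) auto
  ultimately show ?thesis using that by blast
qed

text \<open>Growth at most \<open>a\<close> per unit of the spread, up to an arbitrarily small exponential in the size.\<close>
definition spread_bounded :: "nat \<Rightarrow> real \<Rightarrow> real \<Rightarrow> real \<Rightarrow> ((nat \<Rightarrow> complex) \<Rightarrow> complex) \<Rightarrow> bool" where
  "spread_bounded n a p q F \<longleftrightarrow> (\<forall>\<epsilon>>0. \<exists>C>0. \<forall>\<gamma>. (\<forall>j\<in>{1..n}. p \<le> Im (\<gamma> j) \<and> Im (\<gamma> j) \<le> q) \<longrightarrow>
     norm (F \<gamma>) \<le> C * exp (a * re_spread n \<gamma> + \<epsilon> * re_size n \<gamma>))"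

lemma spread_boundedD:
  assumes "spread_bounded n a p q F" "\<epsilon> > 0"
  obtains C where "C > 0" "\<And>\<gamma>. (\<And>j. j \<in> {1..n} \<Longrightarrow> p \<le> Im (\<gamma> j) \<and> Im (\<gamma> j) \<le> q) \<Longrightarrow>
     norm (F \<gamma>) \<le> C * exp (a * re_spread n \<gamma> + \<epsilon> * re_size n \<gamma>)"
proof -
  have "\<exists>C>0. \<forall>\<gamma>. (\<forall>j\<in>{1..n}. p \<le> Im (\<gamma> j) \<and> Im (\<gamma> j) \<le> q) \<longrightarrow>
     norm (F \<gamma>) \<le> C * exp (a * re_spread n \<gamma> + \<epsilon> * re_size n \<gamma>)"
    using assms unfolding spread_bounded_def by simp
  then obtain C where C: "C > 0" "\<forall>\<gamma>. (\<forall>j\<in>{1..n}. p \<le> Im (\<gamma> j) \<and> Im (\<gamma> j) \<le> q) \<longrightarrow>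
     norm (F \<gamma>) \<le> C * exp (a * re_spread n \<gamma> + \<epsilon> * re_size n \<gamma>)" by (elim exE conjE)
  show ?thesis by (rule that[OF C(1)]) (rule C(2)[rule_format])
qed

text \<open>
  The exponent of the recursion integrand, with \<open>X\<close>, \<open>D\<close>, \<open>G\<close> the cross term and the two spreads and \<open>S\<close>, \<open>T\<close> the two sizes. The defect
  \<open>Y = 2 X - D - G\<close> is nonnegative by \<open>re_spread_interlace\<close>, which alone would give the spread of \<open>\<gamma>\<close> but no decay in \<open>\<delta>\<close>. Since \<open>Y\<close> is also
  at least \<open>4 S - 4 n T\<close>, a small fraction \<open>\<theta>\<close> of \<open>Y\<close> pays for the decay in \<open>\<delta>\<close> at the price of a small multiple of \<open>T\<close>.
\<close>
lemma recursion_exponent: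
  fixes e \<epsilon> :: real
  assumes e: "e > 0" "e * (real n + 3) \<le> pi" "e * (real n * (real n + 4)) \<le> \<epsilon>"
  shows "- (pi/2 - e) * re_cross n (n+1) \<delta> \<gamma> + (pi/4 * re_spread n \<delta> + e * re_size n \<delta>)
    \<le> (- (pi/4) * re_spread (n+1) \<gamma> + \<epsilon> * re_size (n+1) \<gamma>) + - e * re_size n \<delta>"
proof -
  define X where "X = re_cross n (n+1) \<delta> \<gamma>"
  define S where "S = re_size n \<delta>"
  define T where "T = re_size (n+1) \<gamma>"
  define D where "D = re_spread n \<delta>"
  define G where "G = re_spread (n+1) \<gamma>"
  define Y where "Y = 2 * X - D - G"
  \<comment> \<open>\<open>\<pi> \<theta> = e (n + 3)\<close> covers the losses \<open>e X\<close>, where \<open>X \<le> (n + 1) S + n T\<close>, and \<open>e S\<close>, and leaves \<open>- e S\<close>\<close>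
  define \<theta> where "\<theta> = e * (real n + 3) / pi"
  have \<theta>: "0 \<le> \<theta>" "\<theta> \<le> 1" using e by (auto simp: \<theta>_def)
  have T: "T \<ge> 0" unfolding T_def by (rule re_size_nonneg)
  have S: "S \<ge> 0" unfolding S_def by (rule re_size_nonneg)
  have Y0: "Y \<ge> 0" unfolding Y_def X_def D_def G_def using re_spread_interlace[of n \<delta> \<gamma>] by simp
  have Y1: "Y \<ge> 4 * S - 4 * n * T"
  proof -
    have "X \<ge> (real n + 1) * S - n * T"
      using re_cross_ge[of "n+1" n \<delta> \<gamma>] unfolding X_def S_def T_def by (simp add: algebra_simps)
    moreover have "D \<le> 2 * (real n - 1) * S"
    proof (cases "n = 0")
      case False
      then show ?thesis using re_spread_le[of n \<delta>] unfolding D_def S_def by simp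
    qed (simp add: D_def S_def re_spread_def re_size_def)
    moreover have "G \<le> 2 * n * T" using re_spread_le[of "n+1" \<gamma>] unfolding G_def T_def by simp
    ultimately show ?thesis unfolding Y_def by (simp add: algebra_simps)
  qed
  have "\<theta> * (4 * S - 4 * n * T) \<le> \<theta> * Y" using Y1 \<theta> by (intro mult_left_mono) auto
  also have "\<dots> \<le> 1 * Y" using \<theta> Y0 by (intro mult_right_mono) auto
  finally have "pi/4 * (\<theta> * (4 * S - 4 * n * T)) \<le> pi/4 * Y" by (intro mult_left_mono) auto
  also have "pi/4 * (\<theta> * (4 * S - 4 * n * T)) = e * (real n + 3) * (S - n * T)"
    unfolding \<theta>_def by (simp add: field_simps)
  finally have 1: "e * (real n + 3) * (S - n * T) \<le> pi/4 * Y" .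
  have "X \<le> (real n + 1) * S + n * T"
    using re_cross_le[of n "n+1" \<delta> \<gamma>] unfolding X_def S_def T_def by (simp add: algebra_simps)
  then have 2: "e * X \<le> e * ((real n + 1) * S + n * T)" using e by (intro mult_left_mono) auto
  have 3: "e * (real n * (real n + 4)) * T \<le> \<epsilon> * T" using e T by (intro mult_right_mono) auto
  have "- (pi/2 - e) * X + (pi/4 * D + e * S) = - (pi/4) * G - pi/4 * Y + e * X + e * S"
    unfolding Y_def by (simp add: algebra_simps add_divide_distrib)
  also have "\<dots> \<le> - (pi/4) * G - e * (real n + 3) * (S - n * T) + e * ((real n + 1) * S + n * T) + e * S"
    using 1 2 by linarith
  also have "\<dots> = - (pi/4) * G + e * (real n * (real n + 4)) * T - e * S"
    by (simp add: algebra_simps)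
  also have "\<dots> \<le> - (pi/4) * G + \<epsilon> * T - e * S" using 3 by linarith
  finally show ?thesis unfolding X_def S_def T_def D_def G_def by simp
qed

lemma recursion_integrand_bound:
  assumes F: "spread_bounded n (- (pi/4)) h h F" and hp: "h < p" and \<epsilon>: "\<epsilon> > 0"
  obtains C e where "C > 0" "e > 0" "\<And>\<gamma> \<delta>. (\<And>j. j \<in> {1..n+1} \<Longrightarrow> p \<le> Im (\<gamma> j) \<and> Im (\<gamma> j) \<le> q) \<Longrightarrow>
     (\<And>k. k \<in> {1..n} \<Longrightarrow> Im (\<delta> k) = h) \<Longrightarrow>
     norm (recursion_kernel n x \<gamma> \<delta> * F \<delta> * mu n \<delta>) \<le> C * exp (- (pi/4) * re_spread (n+1) \<gamma> + \<epsilon> * re_size (n+1) \<gamma>) * exp (- e * re_size n \<delta>)"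
proof -
  \<comment> \<open>the two requirements of \<open>recursion_exponent\<close>; the summand \<open>1\<close> avoids a zero denominator for \<open>n = 0\<close>\<close>
  define e where "e = min (pi / (real n + 3)) (\<epsilon> / (real n * (real n + 4) + 1))"
  have e: "e > 0" unfolding e_def using \<epsilon> by (auto intro!: divide_pos_pos add_nonneg_pos)
  have e1: "e * (real n + 3) \<le> pi"
  proof -
    have "e * (real n + 3) \<le> pi / (real n + 3) * (real n + 3)" unfolding e_def by (intro mult_right_mono) auto
    then show ?thesis by simp
  qed
  have e2: "e * (real n * (real n + 4)) \<le> \<epsilon>"
  proof -
    have "e * (real n * (real n + 4)) \<le> e * (real n * (real n + 4) + 1)" using e by (intro mult_left_mono) auto
    also have "\<dots> \<le> \<epsilon> / (real n * (real n + 4) + 1) * (real n * (real n + 4) + 1)"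
      unfolding e_def by (intro mult_right_mono) auto
    also have "\<dots> = \<epsilon>" by (simp add: add_nonneg_eq_0_iff)
    finally show ?thesis .
  qed
  obtain C1 where C1: "C1 > 0" "\<And>\<gamma> \<delta>. (\<And>j. j \<in> {1..n+1} \<Longrightarrow> p \<le> Im (\<gamma> j) \<and> Im (\<gamma> j) \<le> q) \<Longrightarrow>
     (\<And>k. k \<in> {1..n} \<Longrightarrow> h \<le> Im (\<delta> k) \<and> Im (\<delta> k) \<le> h) \<Longrightarrow>
     norm (recursion_kernel n x \<gamma> \<delta>) \<le> C1 * exp (- (pi/2 - e) * re_cross n (n+1) \<delta> \<gamma>)"
    using recursion_kernel_bound[OF e hp] by metis
  have e_half: "e / 2 > 0" using e by simp
  obtain C2 where C2: "C2 > 0" "\<And>\<delta>. (\<And>j. j \<in> {1..n} \<Longrightarrow> h \<le> Im (\<delta> j) \<and> Im (\<delta> j) \<le> h) \<Longrightarrow>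
     norm (F \<delta>) \<le> C2 * exp (- (pi/4) * re_spread n \<delta> + e/2 * re_size n \<delta>)"
    using spread_boundedD[OF F e_half] by metis
  obtain C3 where C3: "C3 > 0" "\<And>\<beta>. (\<forall>j\<in>{1..n}. \<bar>Im (\<beta> j)\<bar> \<le> \<bar>h\<bar>) \<Longrightarrow>
     norm (mu n \<beta>) \<le> C3 * exp (pi/2 * re_spread n \<beta> + e/2 * re_size n \<beta>)"
    using mu_bound[OF e_half] by metis
  have "norm (recursion_kernel n x \<gamma> \<delta> * F \<delta> * mu n \<delta>) \<le> (C1 * C2 * C3) * exp (- (pi/4) * re_spread (n+1) \<gamma> + \<epsilon> * re_size (n+1) \<gamma>) * exp (- e * re_size n \<delta>)"
    if g: "\<And>j. j \<in> {1..n+1} \<Longrightarrow> p \<le> Im (\<gamma> j) \<and> Im (\<gamma> j) \<le> q" and d: "\<And>k. k \<in> {1..n} \<Longrightarrow> Im (\<delta> k) = h" for \<gamma> \<delta>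
  proof -
    have "norm (recursion_kernel n x \<gamma> \<delta>) \<le> C1 * exp (- (pi/2 - e) * re_cross n (n+1) \<delta> \<gamma>)"
      using C1(2)[OF g] d by simp
    moreover have "norm (F \<delta>) \<le> C2 * exp (- (pi/4) * re_spread n \<delta> + e/2 * re_size n \<delta>)"
      using C2(2) d by simp
    moreover have "norm (mu n \<delta>) \<le> C3 * exp (pi/2 * re_spread n \<delta> + e/2 * re_size n \<delta>)"
      using C3(2) d by simp
    ultimately have "norm (recursion_kernel n x \<gamma> \<delta> * F \<delta> * mu n \<delta>) \<le> (C1 * exp (- (pi/2 - e) * re_cross n (n+1) \<delta> \<gamma>)) *
      (C2 * exp (- (pi/4) * re_spread n \<delta> + e/2 * re_size n \<delta>)) * (C3 * exp (pi/2 * re_spread n \<delta> + e/2 * re_size n \<delta>))"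
      unfolding norm_mult using C1 C2 C3 by (intro mult_mono) auto
    also have "\<dots> = (C1 * C2 * C3) * exp (- (pi/2 - e) * re_cross n (n+1) \<delta> \<gamma> + (pi/4 * re_spread n \<delta> + e * re_size n \<delta>))"
    proof -
      have "(C1 * exp a) * (C2 * exp b) * (C3 * exp c) = (C1 * C2 * C3) * exp (a + (b + c))" for a b c
        by (simp add: exp_add)
      moreover have "(- (pi/4) * re_spread n \<delta> + e/2 * re_size n \<delta>) + (pi/2 * re_spread n \<delta> + e/2 * re_size n \<delta>) = pi/4 * re_spread n \<delta> + e * re_size n \<delta>"
        by (simp add: algebra_simps)
      ultimately show ?thesis by (simp only:)
    qed
    also have "\<dots> \<le> (C1 * C2 * C3) * exp ((- (pi/4) * re_spread (n+1) \<gamma> + \<epsilon> * re_size (n+1) \<gamma>) + - e * re_size n \<delta>)"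
      using recursion_exponent[OF e e1 e2, of \<delta> \<gamma>] C1 C2 C3 by (intro mult_left_mono) auto
    also have "\<dots> = (C1 * C2 * C3) * exp (- (pi/4) * re_spread (n+1) \<gamma> + \<epsilon> * re_size (n+1) \<gamma>) * exp (- e * re_size n \<delta>)"
      unfolding exp_add[of _ "- e * re_size n \<delta>"] by (simp only: mult.assoc)
    finally show ?thesis .
  qed
  moreover have "C1 * C2 * C3 > 0" using C1 C2 C3 by simp
  ultimately show ?thesis using that e by blast
qed

text \<open>
  Integration of \<open>recursion_integrand_bound\<close> over \<open>\<delta>\<close>. The rate \<open>- \<pi>/4\<close> reproduces itself: in the integrand the measure and the
  Whittaker function of lower rank together have rate \<open>\<pi>/2 - \<pi>/4 = \<pi>/4\<close> in the spread of \<open>\<delta>\<close>, and the cross term of rate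
  \<open>- \<pi>/2\<close> turns it into rate \<open>- \<pi>/4\<close> in the spread of \<open>\<gamma>\<close>.
\<close>
lemma level_whittaker_bound:
  assumes H: "strict_mono H" and p: "\<And>m. n = Suc m \<Longrightarrow> H m < p"
  shows "spread_bounded n (- (pi/4)) p q (level_whittaker H x n)"
  using p
proof (induction n arbitrary: p q)
  case 0
  have "re_spread 0 \<gamma> = 0" "re_size 0 \<gamma> = 0" for \<gamma> by (simp_all add: re_spread_def re_size_def)
  then show ?case unfolding spread_bounded_def by (intro allI impI exI[of _ 1]) simp
next
  case (Suc n)
  show ?case unfolding spread_bounded_def
  proof (intro allI impI)
    fix \<epsilon> :: real assume \<epsilon>: "\<epsilon> > 0"
    have IH: "spread_bounded n (- (pi/4)) (H n) (H n) (level_whittaker H x n)"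
      by (rule Suc.IH) (auto intro: strict_monoD[OF H])
    have "H n < p" using Suc.prems by simp
    obtain C e where C: "C > 0" "e > 0" "\<And>\<gamma> \<delta>. (\<And>j. j \<in> {1..n+1} \<Longrightarrow> p \<le> Im (\<gamma> j) \<and> Im (\<gamma> j) \<le> q) \<Longrightarrow>
     (\<And>k. k \<in> {1..n} \<Longrightarrow> Im (\<delta> k) = H n) \<Longrightarrow>
     norm (recursion_kernel n x \<gamma> \<delta> * level_whittaker H x n \<delta> * mu n \<delta>) \<le> C * exp (- (pi/4) * re_spread (n+1) \<gamma> + \<epsilon> * re_size (n+1) \<gamma>) * exp (- e * re_size n \<delta>)"
      using recursion_integrand_bound[OF IH \<open>H n < p\<close> \<epsilon>] by metis
    define J where "J = (\<integral>u. exp (- e * re_size n (on_lines (\<lambda>_. H n) u)) \<partial>(\<Pi>\<^sub>M j\<in>{1..n}. lborel))"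
    have J: "J \<ge> 0" unfolding J_def by (intro Bochner_Integration.integral_nonneg) auto
    show "\<exists>C>0. \<forall>\<gamma>. (\<forall>j\<in>{1..Suc n}. p \<le> Im (\<gamma> j) \<and> Im (\<gamma> j) \<le> q) \<longrightarrow>
       norm (level_whittaker H x (Suc n) \<gamma>) \<le> C * exp (- (pi/4) * re_spread (Suc n) \<gamma> + \<epsilon> * re_size (Suc n) \<gamma>)"
    proof (intro exI[of _ "C * (J + 1)"] conjI allI impI)
      show "C * (J + 1) > 0" using C J by simp
      fix \<gamma> assume g: "\<forall>j\<in>{1..Suc n}. p \<le> Im (\<gamma> j) \<and> Im (\<gamma> j) \<le> q"
      let ?E = "exp (- (pi/4) * re_spread (n+1) \<gamma> + \<epsilon> * re_size (n+1) \<gamma>)"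
      have b: "norm (recursion_kernel n x \<gamma> (on_lines (\<lambda>_. H n) u) * level_whittaker H x n (on_lines (\<lambda>_. H n) u) * mu n (on_lines (\<lambda>_. H n) u)) \<le> C * ?E * exp (- e * re_size n (on_lines (\<lambda>_. H n) u))" for u
        by (rule C(3)) (use g in \<open>auto simp: on_lines_def\<close>)
      have "norm (level_whittaker H x (Suc n) \<gamma>) \<le> (\<integral>u. C * ?E * exp (- e * re_size n (on_lines (\<lambda>_. H n) u)) \<partial>(\<Pi>\<^sub>M j\<in>{1..n}. lborel))"
        unfolding level_whittaker.simps lines_integral_def
      proof (rule order_trans[OF integral_norm_bound integral_mono[OF integrable_norm]])
        show "integrable (\<Pi>\<^sub>M j\<in>{1..n}. lborel) (\<lambda>u. C * ?E * exp (- e * re_size n (on_lines (\<lambda>_. H n) u)))"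
          using C by (intro integrable_mult_right integrable_exp_re_size)
        show "integrable (\<Pi>\<^sub>M j\<in>{1..n}. lborel) (\<lambda>u. recursion_kernel n x \<gamma> (on_lines (\<lambda>_. H n) u) * level_whittaker H x n (on_lines (\<lambda>_. H n) u) * mu n (on_lines (\<lambda>_. H n) u))"
        proof (rule lines_integrable[where f = "\<lambda>\<delta>. recursion_kernel n x \<gamma> \<delta> * level_whittaker H x n \<delta> * mu n \<delta>", OF C(2)])
          show "(\<lambda>u. recursion_kernel n x \<gamma> (on_lines (\<lambda>_. H n) u) * level_whittaker H x n (on_lines (\<lambda>_. H n) u) * mu n (on_lines (\<lambda>_. H n) u)) \<in> borel_measurable (\<Pi>\<^sub>M j\<in>{1..n}. lborel)"
            by (intro borel_measurable_times recursion_kernel_measurable level_whittaker_measurable mu_measurable measurable_on_lines borel_measurable_const)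
        qed (rule b)
      qed (rule b)
      also have "\<dots> = C * ?E * J" unfolding J_def by simp
      also have "\<dots> \<le> C * (J + 1) * ?E" using C J by (simp add: algebra_simps)
      finally show "norm (level_whittaker H x (Suc n) \<gamma>) \<le> C * (J + 1) * exp (- (pi/4) * re_spread (Suc n) \<gamma> + \<epsilon> * re_size (Suc n) \<gamma>)" by simp
    qed
  qed
qed

section \<open>Exchange of the integrations\<close>

lemma (in pair_sigma_finite) integrable_pair_mult:
  fixes f g :: "_ \<Rightarrow> real"
  assumes f: "integrable M1 f" and g: "integrable M2 g"
  shows "integrable (M1 \<Otimes>\<^sub>M M2) (\<lambda>p. f (fst p) * g (snd p))"
proof (rule Fubini_integrable)
  have [measurable]: "f \<in> borel_measurable M1" "g \<in> borel_measurable M2" using f g by auto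
  show "(\<lambda>p. f (fst p) * g (snd p)) \<in> borel_measurable (M1 \<Otimes>\<^sub>M M2)" by measurable
  have "(\<integral>y. norm (f (fst (x, y)) * g (snd (x, y))) \<partial>M2) = norm (f x) * (\<integral>y. norm (g y) \<partial>M2)" for x
    by (simp add: abs_mult)
  then show "integrable M1 (\<lambda>x. \<integral>y. norm (f (fst (x, y)) * g (snd (x, y))) \<partial>M2)"
    using f by simp
  show "AE x in M1. integrable M2 (\<lambda>y. f (fst (x, y)) * g (snd (x, y)))"
    using g by simp
qed

text \<open>
  The growth \<open>\<pi>/4\<close> of \<open>A\<close> in the spread is exactly compensated by the recursion integrand, so any decay \<open>\<eta>\<close> in the size makes the double
  integral absolutely convergent.
\<close>
lemma level_whittaker_swap:
  assumes H: "strict_mono H" and c: "\<And>j. j \<in> {1..Suc n} \<Longrightarrow> p \<le> c j \<and> c j \<le> q" and Hp: "H n < p" and \<eta>: "\<eta> > 0"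
    and Ameas: "(\<lambda>t. A (on_lines c t)) \<in> borel_measurable (\<Pi>\<^sub>M j\<in>{1..Suc n}. lborel)"
    and Abound: "\<And>t. norm (A (on_lines c t)) \<le> CA * exp (pi/4 * re_spread (Suc n) (on_lines c t) + - \<eta> * re_size (Suc n) (on_lines c t))"
  shows "lines_integral (Suc n) c (\<lambda>\<beta>. A \<beta> * level_whittaker H x (Suc n) \<beta>) =
    lines_integral n (\<lambda>_. H n) (\<lambda>\<delta>. level_whittaker H x n \<delta> * mu n \<delta> *
       lines_integral (Suc n) c (\<lambda>\<beta>. A \<beta> * recursion_kernel n x \<beta> \<delta>))"
proof -
  let ?M = "\<Pi>\<^sub>M j\<in>{1..Suc n}. lborel :: real measure" and ?P = "\<Pi>\<^sub>M j\<in>{1..n}. lborel :: real measure"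
  interpret M: finite_product_sigma_finite "\<lambda>_. lborel :: real measure" "{1..Suc n}" by standard simp
  interpret P: finite_product_sigma_finite "\<lambda>_. lborel :: real measure" "{1..n}" by standard simp
  interpret pair_sigma_finite ?M ?P by (rule pair_sigma_finite.intro; unfold_locales)
  let ?b = "\<lambda>t. on_lines c t" and ?d = "\<lambda>u. on_lines (\<lambda>_. H n) u"
  define f where "f t u = A (?b t) * (recursion_kernel n x (?b t) (?d u) * level_whittaker H x n (?d u) * mu n (?d u))" for t u
  have V: "spread_bounded n (- (pi/4)) (H n) (H n) (level_whittaker H x n)"
    by (rule level_whittaker_bound[OF H]) (auto intro: strict_monoD[OF H])
  have \<eta>2: "\<eta> / 2 > 0" using \<eta> by simp
  obtain C e where C: "C > 0" "e > 0" "\<And>\<gamma> \<delta>. (\<And>j. j \<in> {1..n+1} \<Longrightarrow> p \<le> Im (\<gamma> j) \<and> Im (\<gamma> j) \<le> q) \<Longrightarrow>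
     (\<And>k. k \<in> {1..n} \<Longrightarrow> Im (\<delta> k) = H n) \<Longrightarrow>
     norm (recursion_kernel n x \<gamma> \<delta> * level_whittaker H x n \<delta> * mu n \<delta>) \<le> C * exp (- (pi/4) * re_spread (n+1) \<gamma> + \<eta>/2 * re_size (n+1) \<gamma>) * exp (- e * re_size n \<delta>)"
    using recursion_integrand_bound[OF V Hp \<eta>2] by metis
  have fb: "norm (f t u) \<le> (CA * C) * (exp (- (\<eta>/2) * re_size (Suc n) (?b t)) * exp (- e * re_size n (?d u)))" for t u
  proof -
    have "norm (recursion_kernel n x (?b t) (?d u) * level_whittaker H x n (?d u) * mu n (?d u)) \<le>
       C * exp (- (pi/4) * re_spread (n+1) (?b t) + \<eta>/2 * re_size (n+1) (?b t)) * exp (- e * re_size n (?d u))"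
      by (rule C(3)) (use c in \<open>auto simp: on_lines_def\<close>)
    then have "norm (f t u) \<le> (CA * exp (pi/4 * re_spread (Suc n) (?b t) + - \<eta> * re_size (Suc n) (?b t))) *
       (C * exp (- (pi/4) * re_spread (Suc n) (?b t) + \<eta>/2 * re_size (Suc n) (?b t)) * exp (- e * re_size n (?d u)))"
      unfolding f_def norm_mult[of "A (?b t)"] Suc_eq_plus1
      using Abound[of t] by (intro mult_mono) (auto intro: order_trans[OF norm_ge_zero])
    also have "\<dots> = (CA * C) * (exp ((pi/4 * re_spread (Suc n) (?b t) + - \<eta> * re_size (Suc n) (?b t)) + (- (pi/4) * re_spread (Suc n) (?b t) + \<eta>/2 * re_size (Suc n) (?b t))) * exp (- e * re_size n (?d u)))"
      unfolding exp_add[of "pi/4 * re_spread (Suc n) (?b t) + - \<eta> * re_size (Suc n) (?b t)"] by (simp only: mult_ac)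
    also have "(pi/4 * re_spread (Suc n) (?b t) + - \<eta> * re_size (Suc n) (?b t)) + (- (pi/4) * re_spread (Suc n) (?b t) + \<eta>/2 * re_size (Suc n) (?b t)) = - (\<eta>/2) * re_size (Suc n) (?b t)"
      by (simp add: algebra_simps)
    finally show ?thesis .
  qed
  have b1: "(\<lambda>p. ?b (fst p) j) \<in> borel_measurable (?M \<Otimes>\<^sub>M ?P)" if "j \<in> {1..n+1}" for j
    using that by (intro measurable_compose[OF measurable_fst measurable_on_lines]) simp
  have d1: "(\<lambda>p. ?d (snd p) j) \<in> borel_measurable (?M \<Otimes>\<^sub>M ?P)" if "j \<in> {1..n}" for j
    by (rule measurable_compose[OF measurable_snd measurable_on_lines[OF that]])
  have fm: "(\<lambda>p. f (fst p) (snd p)) \<in> borel_measurable (?M \<Otimes>\<^sub>M ?P)"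
    unfolding f_def
    by (intro borel_measurable_times measurable_compose[OF measurable_fst Ameas] recursion_kernel_measurable level_whittaker_measurable mu_measurable b1 d1)
  have "integrable (?M \<Otimes>\<^sub>M ?P) (\<lambda>p. f (fst p) (snd p))"
  proof (rule Bochner_Integration.integrable_bound[OF integrable_mult_right[OF integrable_pair_mult] fm])
    show "integrable ?M (\<lambda>t. exp (- (\<eta>/2) * re_size (Suc n) (?b t)))" by (rule integrable_exp_re_size[OF \<eta>2])
    show "integrable ?P (\<lambda>u. exp (- e * re_size n (?d u)))" by (rule integrable_exp_re_size[OF C(2)])
    show "AE p in ?M \<Otimes>\<^sub>M ?P. norm (f (fst p) (snd p)) \<le> norm ((CA * C) * (exp (- (\<eta>/2) * re_size (Suc n) (?b (fst p))) * exp (- e * re_size n (?d (snd p)))))"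
      by (intro AE_I2 order_trans[OF fb]) (simp only: real_norm_def abs_ge_self)
  qed
  then have int: "integrable (?M \<Otimes>\<^sub>M ?P) (case_prod f)" by (simp add: case_prod_unfold)
  have "lines_integral (Suc n) c (\<lambda>\<beta>. A \<beta> * level_whittaker H x (Suc n) \<beta>) = (\<integral>t. \<integral>u. f t u \<partial>?P \<partial>?M)"
    unfolding f_def level_whittaker.simps lines_integral_def by simp
  also have "\<dots> = (\<integral>u. \<integral>t. f t u \<partial>?M \<partial>?P)" by (rule Fubini_integral[OF int, symmetric])
  also have "\<dots> = lines_integral n (\<lambda>_. H n) (\<lambda>\<delta>. level_whittaker H x n \<delta> * mu n \<delta> *
       lines_integral (Suc n) c (\<lambda>\<beta>. A \<beta> * recursion_kernel n x \<beta> \<delta>))"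
    unfolding lines_integral_def
  proof (intro Bochner_Integration.integral_cong refl)
    fix u
    have "f t u = level_whittaker H x n (?d u) * mu n (?d u) * (A (?b t) * recursion_kernel n x (?b t) (?d u))" for t
      unfolding f_def by (simp only: mult_ac)
    then show "(\<integral>t. f t u \<partial>?M) = level_whittaker H x n (?d u) * mu n (?d u) * (\<integral>t. A (?b t) * recursion_kernel n x (?b t) (?d u) \<partial>?M)"
      by (simp only: integral_mult_right_zero)
  qed
  finally show ?thesis .
qed

lemma strip_below:
  fixes \<gamma> :: "nat \<Rightarrow> complex" and m :: nat
  assumes "\<And>i. i \<in> {1..m} \<Longrightarrow> q < Im (\<gamma> i)"
  obtains hi where "q < hi" "\<And>i. i \<in> {1..m} \<Longrightarrow> hi < Im (\<gamma> i)"
proof -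
  \<comment> \<open>the extra element \<open>q + 1\<close> covers \<open>m = 0\<close>\<close>
  define a where "a = Min (insert (q + 1) ((\<lambda>i. Im (\<gamma> i)) ` {1..m}))"
  have "q < a" unfolding a_def using assms by (subst Min_gr_iff) auto
  moreover have "a \<le> Im (\<gamma> i)" if "i \<in> {1..m}" for i unfolding a_def using that by (intro Min_le) auto
  ultimately have "q < (q + a) / 2" "\<And>i. i \<in> {1..m} \<Longrightarrow> (q + a) / 2 < Im (\<gamma> i)" by (auto simp: field_simps) fastforce?
  then show ?thesis by (rule that)
qed

text \<open>
  The cross term \<open>re_cross\<close> is \<open>m S\<close> up to a constant and the spread is at most \<open>2 (m - 1) S\<close>, with \<open>S\<close> the size. Half of the growth
  \<open>\<pi>/2\<close> of the measure in the spread can thus be bounded by \<open>\<pi>/2 (m - 1) S\<close>, which leaves decay \<open>\<pi>/2\<close> in the size, less the losses.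
\<close>
lemma cross_mu_bound:
  assumes above: "\<And>i. i \<in> {1..m} \<Longrightarrow> q < Im (\<gamma> i)" and nm: "n \<le> m"
  obtains C where "C > 0" "\<And>\<beta>. (\<And>j. j \<in> {1..n} \<Longrightarrow> p \<le> Im (\<beta> j) \<and> Im (\<beta> j) \<le> q) \<Longrightarrow>
     norm ((\<Prod>j\<in>{1..n}. \<Prod>i\<in>{1..m}. Gamma (\<i> * \<beta> j - \<i> * \<gamma> i)) * mu n \<beta>) \<le> C * exp (pi/4 * re_spread n \<beta> + - (pi/4) * re_size n \<beta>)"
proof -
  \<comment> \<open>\<open>m + 1\<close> losses of size \<open>e\<close> add up to \<open>\<pi>/4\<close>\<close>
  define e where "e = pi / (4 * (real m + 1))"
  have "pi \<le> pi * (2 * (real m + 1))" by simp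
  then have e: "e > 0" "e \<le> pi/2" by (auto simp: e_def field_simps)
  obtain hi where hi: "q < hi" "\<And>i. i \<in> {1..m} \<Longrightarrow> hi < Im (\<gamma> i)"
    using strip_below[where m = m and q = q and \<gamma> = \<gamma>, OF above] by metis
  define R where "R = Max (insert 0 ((\<lambda>i. Im (\<gamma> i)) ` {1..m})) - p"
  have R: "Im (\<gamma> i) \<le> R + p" if "i \<in> {1..m}" for i
  proof -
    have "Im (\<gamma> i) \<le> Max (insert 0 ((\<lambda>i. Im (\<gamma> i)) ` {1..m}))" using that by (intro Max_ge) auto
    then show ?thesis by (simp add: R_def)
  qed
  have r: "hi - q > 0" using hi by simp
  obtain C1 where C1: "C1 > 0" "\<And>\<beta> \<gamma>. (\<And>j k. j \<in> {1..n} \<Longrightarrow> k \<in> {1..m} \<Longrightarrow> hi - q \<le> Im (\<gamma> k) - Im (\<beta> j) \<and> Im (\<gamma> k) - Im (\<beta> j) \<le> R) \<Longrightarrow>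
       norm (\<Prod>j\<in>{1..n}. \<Prod>k\<in>{1..m}. Gamma (\<i> * \<beta> j - \<i> * \<gamma> k)) \<le> C1 * exp (- (pi/2 - e) * re_cross n m \<beta> \<gamma>)"
    using Gamma_cross_bound[OF r e(1), of n m R] by metis
  obtain C2 where C2: "C2 > 0" "\<And>\<beta>. (\<forall>j\<in>{1..n}. \<bar>Im (\<beta> j)\<bar> \<le> \<bar>p\<bar> + \<bar>q\<bar>) \<Longrightarrow>
     norm (mu n \<beta>) \<le> C2 * exp (pi/2 * re_spread n \<beta> + e * re_size n \<beta>)"
    using mu_bound[OF e(1)] by metis
  define T where "T = (pi/2 - e) * (real n * re_size m \<gamma>)"
  have "norm ((\<Prod>j\<in>{1..n}. \<Prod>i\<in>{1..m}. Gamma (\<i> * \<beta> j - \<i> * \<gamma> i)) * mu n \<beta>) \<le> (C1 * C2 * exp T) * exp (pi/4 * re_spread n \<beta> + - (pi/4) * re_size n \<beta>)"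
    if b: "\<And>j. j \<in> {1..n} \<Longrightarrow> p \<le> Im (\<beta> j) \<and> Im (\<beta> j) \<le> q" for \<beta>
  proof -
    let ?S = "re_size n \<beta>" and ?D = "re_spread n \<beta>"
    have S: "?S \<ge> 0" by (rule re_size_nonneg)
    have 1: "norm (\<Prod>j\<in>{1..n}. \<Prod>k\<in>{1..m}. Gamma (\<i> * \<beta> j - \<i> * \<gamma> k)) \<le> C1 * exp (- (pi/2 - e) * re_cross n m \<beta> \<gamma>)"
    proof (rule C1(2))
      fix j k assume "j \<in> {1..n}" "k \<in> {1..m}"
      then show "hi - q \<le> Im (\<gamma> k) - Im (\<beta> j) \<and> Im (\<gamma> k) - Im (\<beta> j) \<le> R" using b[of j] hi(2)[of k] R[of k] by linarith
    qed
    have "\<bar>Im (\<beta> j)\<bar> \<le> \<bar>p\<bar> + \<bar>q\<bar>" if "j \<in> {1..n}" for j using b[OF that] by linarith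
    then have 2: "norm (mu n \<beta>) \<le> C2 * exp (pi/2 * ?D + e * ?S)" by (intro C2) auto
    have "norm ((\<Prod>j\<in>{1..n}. \<Prod>i\<in>{1..m}. Gamma (\<i> * \<beta> j - \<i> * \<gamma> i)) * mu n \<beta>) \<le> (C1 * exp (- (pi/2 - e) * re_cross n m \<beta> \<gamma>)) * (C2 * exp (pi/2 * ?D + e * ?S))"
      unfolding norm_mult using 1 2 C1 by (intro mult_mono) auto
    also have "\<dots> = (C1 * C2) * exp (- (pi/2 - e) * re_cross n m \<beta> \<gamma> + (pi/2 * ?D + e * ?S))"
      by (simp add: exp_add mult_ac)
    also have "\<dots> \<le> (C1 * C2) * exp (T + (pi/4 * ?D + - (pi/4) * ?S))"
    proof -
      have "(pi/2 - e) * (m * ?S - n * re_size m \<gamma>) \<le> (pi/2 - e) * re_cross n m \<beta> \<gamma>"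
        using re_cross_ge[of m n \<beta> \<gamma>] e by (intro mult_left_mono) auto
      then have x: "- (pi/2 - e) * re_cross n m \<beta> \<gamma> \<le> T - (pi/2 - e) * (m * ?S)" by (simp add: T_def algebra_simps)
      have "?D \<le> 2 * (real m - 1) * ?S"
      proof (cases "n = 0")
        case False
        have "?D \<le> 2 * (real n - 1) * ?S" using False re_spread_le[of n \<beta>] by simp
        also have "\<dots> \<le> 2 * (real m - 1) * ?S" using nm S by (intro mult_right_mono) auto
        finally show ?thesis .
      qed (simp add: re_spread_def re_size_def)
      then have "pi/4 * ?D \<le> pi/4 * (2 * (real m - 1) * ?S)" by (intro mult_left_mono) auto
      moreover have "pi/4 * (2 * (real m - 1) * ?S) = pi/2 * (real m - 1) * ?S" by simp
      ultimately have y: "pi/2 * ?D \<le> pi/4 * ?D + pi/2 * (real m - 1) * ?S" by linarith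
      have "e * (real m + 1) = pi/4" by (simp add: e_def field_simps)
      then have z: "e * (real m + 1) * ?S = pi/4 * ?S" by (simp only:)
      have "- (pi/2 - e) * re_cross n m \<beta> \<gamma> + (pi/2 * ?D + e * ?S) \<le> T - (pi/2 - e) * (m * ?S) + (pi/4 * ?D + pi/2 * (real m - 1) * ?S + e * ?S)"
        using x y by linarith
      also have "\<dots> = T + pi/4 * ?D - pi/2 * ?S + e * (real m + 1) * ?S" by (simp add: algebra_simps add_divide_distrib diff_divide_distrib)
      also have "\<dots> = T + (pi/4 * ?D + - (pi/4) * ?S)" unfolding z by (simp add: algebra_simps)
      finally show ?thesis using C1 C2 by (intro mult_left_mono) auto
    qed
    also have "\<dots> = (C1 * C2 * exp T) * exp (pi/4 * ?D + - (pi/4) * ?S)" unfolding exp_add[of T] by (simp only: mult_ac)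
    finally show ?thesis .
  qed
  moreover have "C1 * C2 * exp T > 0" using C1 C2 by simp
  ultimately show ?thesis using that by blast
qed

lemma recursion_kernel_mu_bound:
  assumes above: "\<And>i. i \<in> {1..n+1} \<Longrightarrow> q < Im (\<gamma> i)"
  obtains C where "C > 0" "\<And>\<delta>. (\<And>j. j \<in> {1..n} \<Longrightarrow> p \<le> Im (\<delta> j) \<and> Im (\<delta> j) \<le> q) \<Longrightarrow>
     norm (recursion_kernel n x \<gamma> \<delta> * mu n \<delta>) \<le> C * exp (pi/4 * re_spread n \<delta> + - (pi/4) * re_size n \<delta>)"
proof -
  obtain C where C: "C > 0" "\<And>\<beta>. (\<And>j. j \<in> {1..n} \<Longrightarrow> p \<le> Im (\<beta> j) \<and> Im (\<beta> j) \<le> q) \<Longrightarrow>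
     norm ((\<Prod>j\<in>{1..n}. \<Prod>i\<in>{1..n+1}. Gamma (\<i> * \<beta> j - \<i> * \<gamma> i)) * mu n \<beta>) \<le> C * exp (pi/4 * re_spread n \<beta> + - (pi/4) * re_size n \<beta>)"
    using cross_mu_bound[where m = "n+1" and n = n and q = q and \<gamma> = \<gamma> and p = p, OF above] by (metis le_add1)
  define B where "B = \<bar>p\<bar> + \<bar>q\<bar> + (\<Sum>i\<in>{1..n+1}. \<bar>Im (\<gamma> i)\<bar>)"
  have gB: "\<bar>Im (\<gamma> i)\<bar> \<le> B" if "i \<in> {1..n+1}" for i
    using member_le_sum[OF that, of "\<lambda>i. \<bar>Im (\<gamma> i)\<bar>"] unfolding B_def by (intro add_increasing) auto
  have "(\<Sum>i\<in>{1..n+1}. \<bar>Im (\<gamma> i)\<bar>) \<ge> 0" by (intro sum_nonneg) auto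
  then have PB: "\<bar>p\<bar> + \<bar>q\<bar> \<le> B" by (simp add: B_def)
  define K where "K = exp ((real (card {1..n+1}) + real (card {1..n})) * B * \<bar>x (n+1)\<bar>)"
  have "norm (recursion_kernel n x \<gamma> \<delta> * mu n \<delta>) \<le> (K * C) * exp (pi/4 * re_spread n \<delta> + - (pi/4) * re_size n \<delta>)"
    if d: "\<And>j. j \<in> {1..n} \<Longrightarrow> p \<le> Im (\<delta> j) \<and> Im (\<delta> j) \<le> q" for \<delta>
  proof -
    have dB: "\<bar>Im (\<delta> k)\<bar> \<le> B" if "k \<in> {1..n}" for k using d[OF that] PB by linarith
    have 1: "norm (exp (- \<i> * ((\<Sum>j\<in>{1..n+1}. \<gamma> j) - (\<Sum>k\<in>{1..n}. \<delta> k)) * of_real (x (n+1)))) \<le> K"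
      unfolding K_def by (rule norm_exp_im_bound) (use gB dB in auto)
    show ?thesis unfolding recursion_kernel_def mult.assoc[of "exp _"] norm_mult[of "exp _"]
      using mult_mono[OF 1 C(2)[OF d]] by (simp add: K_def mult.assoc)
  qed
  moreover have "K * C > 0" using C by (simp add: K_def)
  ultimately show ?thesis using that by blast
qed

section \<open>Independence of the contours\<close>

lemma Gamma_coordinate_holomorphic:
  assumes "\<And>z. z \<in> S \<Longrightarrow> a z \<notin> \<int>\<^sub>\<le>\<^sub>0" "a holomorphic_on S"
  shows "(\<lambda>z. Gamma (a z)) holomorphic_on S"
  using assms by (intro holomorphic_Gamma') auto

lemma recursion_kernel_holomorphic_lower:
  assumes d: "\<And>k i. k \<in> {1..n} \<Longrightarrow> i \<in> {1..n+1} \<Longrightarrow> Im (\<delta> k) < Im (\<gamma> i)" and hi: "\<And>i. i \<in> {1..n+1} \<Longrightarrow> hi \<le> Im (\<gamma> i)"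
  shows "(\<lambda>z. recursion_kernel n x \<gamma> (\<delta>(j := z))) holomorphic_on {z. lo < Im z \<and> Im z < hi}"
  unfolding recursion_kernel_def
proof (intro holomorphic_intros holomorphic_coordinate holomorphic_on_prod Gamma_coordinate_holomorphic)
  fix k i z assume "k \<in> {1..n}" "i \<in> {1..n+1}" "z \<in> {z. lo < Im z \<and> Im z < hi}"
  then have "Re (\<i> * (\<delta>(j := z)) k - \<i> * \<gamma> i) > 0"
    using d[of k i] hi[of i] by (cases "k = j") auto
  then show "\<i> * (\<delta>(j := z)) k - \<i> * \<gamma> i \<notin> \<int>\<^sub>\<le>\<^sub>0" by (rule Re_pos_not_nonpos_Int)
qed

lemma recursion_kernel_holomorphic_upper:
  assumes d: "\<And>k i. k \<in> {1..n} \<Longrightarrow> i \<in> {1..n+1} \<Longrightarrow> Im (\<delta> k) < Im (\<gamma> i)" and lo: "\<And>k. k \<in> {1..n} \<Longrightarrow> Im (\<delta> k) \<le> lo"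
  shows "(\<lambda>z. recursion_kernel n x (\<gamma>(j := z)) \<delta>) holomorphic_on {z. lo < Im z \<and> Im z < hi}"
  unfolding recursion_kernel_def
proof (intro holomorphic_intros holomorphic_coordinate holomorphic_on_prod Gamma_coordinate_holomorphic)
  fix k i z assume "k \<in> {1..n}" "i \<in> {1..n+1}" "z \<in> {z. lo < Im z \<and> Im z < hi}"
  then have "Re (\<i> * \<delta> k - \<i> * (\<gamma>(j := z)) i) > 0"
    using d[of k i] lo[of k] by (cases "i = j") auto
  then show "\<i> * \<delta> k - \<i> * (\<gamma>(j := z)) i \<notin> \<int>\<^sub>\<le>\<^sub>0" by (rule Re_pos_not_nonpos_Int)
qed

lemma lines_integral_cong:
  assumes "\<And>\<beta>. (\<And>j. j \<in> {1..n} \<Longrightarrow> Im (\<beta> j) = c j) \<Longrightarrow> f \<beta> = g \<beta>"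
  shows "lines_integral n c f = lines_integral n c g"
  unfolding lines_integral_def by (intro Bochner_Integration.integral_cong refl assms) (simp add: on_lines_def)

text \<open>
  After the exchange of integrations the shifted variables occur only in the two recursion kernels and the
  measure, all explicit. In this way neither holomorphy nor uniform decay of the Whittaker function in its
  parameters is needed.
\<close>
lemma recursion_integral_shift:
  assumes H: "strict_mono H" and e: "\<And>j. j \<in> {1..N} \<Longrightarrow> p \<le> e j \<and> e j \<le> q" "\<And>j. j \<in> {1..N} \<Longrightarrow> p \<le> e' j \<and> e' j \<le> q"
    and Hp: "\<And>m. N = Suc m \<Longrightarrow> H m < p" and above: "\<And>i. i \<in> {1..N+1} \<Longrightarrow> q < Im (\<gamma> i)"
  shows "lines_integral N e (\<lambda>\<delta>. recursion_kernel N x \<gamma> \<delta> * level_whittaker H x N \<delta> * mu N \<delta>) =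
    lines_integral N e' (\<lambda>\<delta>. recursion_kernel N x \<gamma> \<delta> * level_whittaker H x N \<delta> * mu N \<delta>)"
proof (cases N)
  case 0
  then show ?thesis by (simp add: lines_integral_0 recursion_kernel_def mu_def)
next
  case (Suc n)
  define A where "A \<delta> = recursion_kernel N x \<gamma> \<delta> * mu N \<delta>" for \<delta>
  obtain CA where CA: "CA > 0" "\<And>\<delta>. (\<And>j. j \<in> {1..N} \<Longrightarrow> p \<le> Im (\<delta> j) \<and> Im (\<delta> j) \<le> q) \<Longrightarrow>
     norm (A \<delta>) \<le> CA * exp (pi/4 * re_spread N \<delta> + - (pi/4) * re_size N \<delta>)"
    unfolding A_def using recursion_kernel_mu_bound[where n = N and q = q and \<gamma> = \<gamma> and p = p and x = x, OF above] by metis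
  have Hn: "H n < p" using Hp Suc by simp
  have Ameas: "(\<lambda>t. A (on_lines c t)) \<in> borel_measurable (\<Pi>\<^sub>M j\<in>{1..N}. lborel)" for c
    unfolding A_def by (intro borel_measurable_times recursion_kernel_measurable mu_measurable measurable_on_lines borel_measurable_const)
  have swap: "lines_integral N c (\<lambda>\<delta>. recursion_kernel N x \<gamma> \<delta> * level_whittaker H x N \<delta> * mu N \<delta>) =
     lines_integral n (\<lambda>_. H n) (\<lambda>\<epsilon>. level_whittaker H x n \<epsilon> * mu n \<epsilon> * lines_integral N c (\<lambda>\<delta>. A \<delta> * recursion_kernel n x \<delta> \<epsilon>))"
    if c: "\<And>j. j \<in> {1..N} \<Longrightarrow> p \<le> c j \<and> c j \<le> q" for c
  proof -
    have "lines_integral N c (\<lambda>\<delta>. recursion_kernel N x \<gamma> \<delta> * level_whittaker H x N \<delta> * mu N \<delta>) = lines_integral N c (\<lambda>\<delta>. A \<delta> * level_whittaker H x N \<delta>)"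
      unfolding A_def by (simp only: mult_ac)
    also have "\<dots> = lines_integral n (\<lambda>_. H n) (\<lambda>\<epsilon>. level_whittaker H x n \<epsilon> * mu n \<epsilon> * lines_integral N c (\<lambda>\<delta>. A \<delta> * recursion_kernel n x \<delta> \<epsilon>))"
      unfolding Suc
    proof (rule level_whittaker_swap[OF H _ Hn, where \<eta> = "pi/4" and CA = CA and q = q])
      show "norm (A (on_lines c t)) \<le> CA * exp (pi/4 * re_spread (Suc n) (on_lines c t) + - (pi/4) * re_size (Suc n) (on_lines c t))" for t
        unfolding Suc[symmetric] by (rule CA(2)) (use c in \<open>simp add: on_lines_def\<close>)
    qed (use c Suc Ameas in auto)
    finally show ?thesis .
  qed
  obtain hi where hi: "q < hi" "\<And>i. i \<in> {1..N+1} \<Longrightarrow> hi < Im (\<gamma> i)"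
    using strip_below[where m = "N+1" and q = q and \<gamma> = \<gamma>, OF above] by metis
  define lo where "lo = (H n + p) / 2"
  have lo: "H n < lo" "lo < p" using Hn by (auto simp: lo_def field_simps)
  have inner: "lines_integral N e (\<lambda>\<delta>. A \<delta> * recursion_kernel n x \<delta> \<epsilon>) = lines_integral N e' (\<lambda>\<delta>. A \<delta> * recursion_kernel n x \<delta> \<epsilon>)"
    if \<epsilon>: "\<And>k. k \<in> {1..n} \<Longrightarrow> Im (\<epsilon> k) = H n" for \<epsilon>
  proof -
    \<comment> \<open>\<open>n\<close> losses of size \<open>\<kappa>\<close> cost at most half of the decay \<open>\<pi>/4\<close> of \<open>A\<close>\<close>
    define \<kappa> where "\<kappa> = pi / (8 * (real n + 1))"
    have "pi \<le> pi * (4 * (real n + 1))" by simp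
    then have \<kappa>: "\<kappa> > 0" "\<kappa> \<le> pi/2" by (auto simp: \<kappa>_def field_simps)
    obtain C where C: "C > 0" "\<And>\<delta> \<epsilon>. (\<And>j. j \<in> {1..n+1} \<Longrightarrow> p \<le> Im (\<delta> j) \<and> Im (\<delta> j) \<le> q) \<Longrightarrow>
     (\<And>k. k \<in> {1..n} \<Longrightarrow> H n \<le> Im (\<epsilon> k) \<and> Im (\<epsilon> k) \<le> H n) \<Longrightarrow>
     norm (recursion_kernel n x \<delta> \<epsilon>) \<le> C * exp (- (pi/2 - \<kappa>) * re_cross n (n+1) \<epsilon> \<delta>)"
      using recursion_kernel_bound[OF \<kappa>(1) Hn] by metis
    define T where "T = (pi/2 - \<kappa>) * (real (n+1) * re_size n \<epsilon>)"
    show ?thesis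
    proof (rule lines_integral_shift[where \<eta> = "pi/8" and lo = lo and hi = hi and p = p and q = q and C = "CA * C * exp T"])
      show "(\<lambda>t. A (on_lines c t) * recursion_kernel n x (on_lines c t) \<epsilon>) \<in> borel_measurable (\<Pi>\<^sub>M j\<in>{1..N}. lborel)" for c
        using Suc by (intro borel_measurable_times Ameas recursion_kernel_measurable measurable_on_lines borel_measurable_const) auto
      fix \<beta> :: "nat \<Rightarrow> complex" assume b: "\<And>k. k \<in> {1..N} \<Longrightarrow> p \<le> Im (\<beta> k) \<and> Im (\<beta> k) \<le> q"
      show "(\<lambda>z. A (\<beta>(j := z)) * recursion_kernel n x (\<beta>(j := z)) \<epsilon>) holomorphic_on {z. lo < Im z \<and> Im z < hi}" for j
        unfolding A_def mu_eq
      proof (intro holomorphic_on_mult holomorphic_on_const rGamma_prod_holomorphic recursion_kernel_holomorphic_lower recursion_kernel_holomorphic_upper)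
        show "Im (\<beta> k) < Im (\<gamma> i)" if "k \<in> {1..N}" "i \<in> {1..N+1}" for k i using b[OF that(1)] above[OF that(2)] by linarith
        show "hi \<le> Im (\<gamma> i)" if "i \<in> {1..N+1}" for i using hi(2)[OF that] by simp
        show "Im (\<epsilon> k) < Im (\<beta> i)" if "k \<in> {1..n}" "i \<in> {1..n+1}" for k i using \<epsilon>[OF that(1)] b[of i] that(2) Hn Suc by auto
        show "Im (\<epsilon> k) \<le> lo" if "k \<in> {1..n}" for k using \<epsilon>[OF that] lo by simp
      qed
      let ?S = "re_size N \<beta>" and ?D = "re_spread N \<beta>"
      have 1: "norm (A \<beta>) \<le> CA * exp (pi/4 * ?D + - (pi/4) * ?S)" by (rule CA(2)) (rule b)
      have 2: "norm (recursion_kernel n x \<beta> \<epsilon>) \<le> C * exp (- (pi/2 - \<kappa>) * re_cross n (n+1) \<epsilon> \<beta>)"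
        by (rule C(2)) (use b \<epsilon> Suc in auto)
      have "norm (A \<beta> * recursion_kernel n x \<beta> \<epsilon>) \<le> (CA * exp (pi/4 * ?D + - (pi/4) * ?S)) * (C * exp (- (pi/2 - \<kappa>) * re_cross n (n+1) \<epsilon> \<beta>))"
        unfolding norm_mult using 1 2 CA by (intro mult_mono) auto
      also have "\<dots> = (CA * C) * exp ((pi/4 * ?D + - (pi/4) * ?S) + - (pi/2 - \<kappa>) * re_cross n (n+1) \<epsilon> \<beta>)"
        unfolding exp_add[of "pi/4 * ?D + - (pi/4) * ?S"] by (simp only: mult_ac)
      also have "\<dots> \<le> (CA * C) * exp (T + - (pi/8) * ?S)"
      proof -
        have S: "?S \<ge> 0" by (rule re_size_nonneg)
        have "re_cross n (n+1) \<epsilon> \<beta> \<ge> n * ?S - real (n+1) * re_size n \<epsilon>"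
          using re_cross_ge[of n "n+1" \<beta> \<epsilon>] Suc by (simp add: re_cross_commute[of n])
        then have "(pi/2 - \<kappa>) * (n * ?S - real (n+1) * re_size n \<epsilon>) \<le> (pi/2 - \<kappa>) * re_cross n (n+1) \<epsilon> \<beta>"
          using \<kappa> by (intro mult_left_mono) auto
        then have x: "- (pi/2 - \<kappa>) * re_cross n (n+1) \<epsilon> \<beta> \<le> T - (pi/2 - \<kappa>) * (n * ?S)" by (simp add: T_def algebra_simps)
        have "?D \<le> 2 * real n * ?S" using re_spread_le[of N \<beta>] Suc by simp
        then have "pi/4 * ?D \<le> pi/4 * (2 * real n * ?S)" by (intro mult_left_mono) auto
        then have y: "pi/4 * ?D \<le> pi/2 * (n * ?S)" by (simp add: algebra_simps)
        have "\<kappa> * n \<le> \<kappa> * (real n + 1)" using \<kappa> by simp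
        also have "\<dots> = pi/8" by (simp add: \<kappa>_def field_simps)
        finally have z: "\<kappa> * n * ?S \<le> pi/8 * ?S" using S by (intro mult_right_mono)
        have "(pi/4 * ?D + - (pi/4) * ?S) + - (pi/2 - \<kappa>) * re_cross n (n+1) \<epsilon> \<beta> \<le> pi/2 * (n * ?S) + - (pi/4) * ?S + (T - (pi/2 - \<kappa>) * (n * ?S))"
          using x y by linarith
        also have "\<dots> = T - pi/4 * ?S + \<kappa> * n * ?S" by (simp add: algebra_simps)
        also have "\<dots> \<le> T + - (pi/8) * ?S" using z by (simp add: algebra_simps)
        finally show ?thesis using CA C by (intro mult_left_mono) auto
      qed
      also have "\<dots> = CA * C * exp T * exp (- (pi/8) * ?S)" unfolding exp_add by (simp only: mult_ac)
      finally show "norm (A \<beta> * recursion_kernel n x \<beta> \<epsilon>) \<le> CA * C * exp T * exp (- (pi/8) * ?S)" .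
    next
      fix \<beta> \<beta>' :: "nat \<Rightarrow> complex" assume "\<And>k. k \<in> {1..N} \<Longrightarrow> \<beta> k = \<beta>' k"
      then have "A \<beta> = A \<beta>'" "recursion_kernel n x \<beta> \<epsilon> = recursion_kernel n x \<beta>' \<epsilon>"
        unfolding A_def using Suc by (auto intro!: arg_cong2[where f = "(*)"] recursion_kernel_cong mu_cong)
      then show "A \<beta> * recursion_kernel n x \<beta> \<epsilon> = A \<beta>' * recursion_kernel n x \<beta>' \<epsilon>" by simp
    qed (use lo hi e in auto)
  qed
  let ?V = "\<lambda>\<epsilon>. level_whittaker H x n \<epsilon> * mu n \<epsilon>"
  have "lines_integral N e (\<lambda>\<delta>. recursion_kernel N x \<gamma> \<delta> * level_whittaker H x N \<delta> * mu N \<delta>) =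
     lines_integral n (\<lambda>_. H n) (\<lambda>\<epsilon>. ?V \<epsilon> * lines_integral N e (\<lambda>\<delta>. A \<delta> * recursion_kernel n x \<delta> \<epsilon>))"
    using e(1) by (rule swap)
  also have "\<dots> = lines_integral n (\<lambda>_. H n) (\<lambda>\<epsilon>. ?V \<epsilon> * lines_integral N e' (\<lambda>\<delta>. A \<delta> * recursion_kernel n x \<delta> \<epsilon>))"
    by (rule lines_integral_cong) (simp only: inner)
  also have "\<dots> = lines_integral N e' (\<lambda>\<delta>. recursion_kernel N x \<gamma> \<delta> * level_whittaker H x N \<delta> * mu N \<delta>)"
    using e(2) by (rule swap[symmetric])
  finally show ?thesis .
qed

lemma whittaker_Suc:
  "whittaker h (Suc l) \<gamma> x = lines_integral (Suc l) (h (Suc l) \<gamma>) (\<lambda>\<delta>. recursion_kernel (Suc l) x \<gamma> \<delta> * whittaker h l \<delta> x * mu (Suc l) \<delta>)"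
  by (simp only: whittaker.simps Let_def recursion_kernel_def)

text \<open>
  Induction on the rank. The heights \<open>h\<close> of the outermost integral may lie below \<open>H l\<close>. Hence the
  inner Whittaker function is first written with heights \<open>H'\<close> below everything, then the outer lines
  are moved to \<open>H n\<close>, and there the induction hypothesis permits to return to \<open>H\<close>.
\<close>
lemma whittaker_eq_level_whittaker:
  assumes h: "\<And>n. n \<ge> 1 \<Longrightarrow> admissible n (n+1) (h n)"
    and H: "strict_mono H" and below: "\<And>i. i \<in> {1..l+1} \<Longrightarrow> H l < Im (\<gamma> i)"
  shows "whittaker h l \<gamma> x = level_whittaker H x (Suc l) \<gamma>"
  using H below
proof (induction l arbitrary: \<gamma> H)
  case 0
  show ?case by (simp only: level_whittaker_1 whittaker.simps)
next
  case (Suc l)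
  define n where "n = Suc l"
  define e where "e = h n \<gamma>"
  have e: "e j < Im (\<gamma> i)" if "j \<in> {1..n}" "i \<in> {1..n+1}" for i j
    using h[of n] that unfolding admissible_def e_def n_def by auto
  define p where "p = Min (insert (H n) (e ` {1..n}))"
  define q where "q = Max (insert (H n) (e ` {1..n}))"
  have pq: "p \<le> e j \<and> e j \<le> q" if "j \<in> {1..n}" for j
    unfolding p_def q_def using that by (intro conjI Min_le Max_ge) auto
  have pH: "p \<le> H n" "H n \<le> q" unfolding p_def q_def by (intro Min_le Max_ge; simp)+
  have q: "q < Im (\<gamma> i)" if "i \<in> {1..n+1}" for i
    unfolding q_def using e that Suc.prems(2)[of i] by (subst Max_less_iff) (auto simp: n_def)
  define H' where "H' m = H m - (\<bar>H l\<bar> + \<bar>p\<bar> + 1)" for m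
  have H': "strict_mono H'" using Suc.prems(1) unfolding strict_mono_def H'_def by auto
  have H'p: "H' l < p" unfolding H'_def by linarith
  have Hl: "H l < H n" unfolding n_def by (rule strict_monoD[OF Suc.prems(1)]) simp
  have "whittaker h n \<gamma> x = lines_integral n e (\<lambda>\<delta>. recursion_kernel n x \<gamma> \<delta> * whittaker h l \<delta> x * mu n \<delta>)"
    unfolding n_def e_def by (rule whittaker_Suc)
  also have "\<dots> = lines_integral n e (\<lambda>\<delta>. recursion_kernel n x \<gamma> \<delta> * level_whittaker H' x n \<delta> * mu n \<delta>)"
  proof (rule lines_integral_cong)
    fix \<delta> assume "\<And>j. j \<in> {1..n} \<Longrightarrow> Im (\<delta> j) = e j"
    then have "H' l < Im (\<delta> i)" if "i \<in> {1..l+1}" for i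
      using pq[of i] that H'p by (simp add: n_def)
    then show "recursion_kernel n x \<gamma> \<delta> * whittaker h l \<delta> x * mu n \<delta> = recursion_kernel n x \<gamma> \<delta> * level_whittaker H' x n \<delta> * mu n \<delta>"
      using Suc.IH[OF H'] by (simp add: n_def)
  qed
  also have "\<dots> = lines_integral n (\<lambda>_. H n) (\<lambda>\<delta>. recursion_kernel n x \<gamma> \<delta> * level_whittaker H' x n \<delta> * mu n \<delta>)"
    by (rule recursion_integral_shift[OF H' pq _ _ q]) (use pH H'p in \<open>auto simp: n_def\<close>)
  also have "\<dots> = lines_integral n (\<lambda>_. H n) (\<lambda>\<delta>. recursion_kernel n x \<gamma> \<delta> * level_whittaker H x n \<delta> * mu n \<delta>)"
  proof (rule lines_integral_cong)
    fix \<delta> assume d: "\<And>j. j \<in> {1..n} \<Longrightarrow> Im (\<delta> j) = H n"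
    have low: "H' l < Im (\<delta> i)" "H l < Im (\<delta> i)" if "i \<in> {1..l+1}" for i
      using d[of i] that H'p pH Hl by (auto simp: n_def)
    have "whittaker h l \<delta> x = level_whittaker H' x n \<delta>"
      unfolding n_def by (rule Suc.IH[OF H' low(1)])
    moreover have "whittaker h l \<delta> x = level_whittaker H x n \<delta>"
      unfolding n_def by (rule Suc.IH[OF Suc.prems(1) low(2)])
    ultimately have "level_whittaker H' x n \<delta> = level_whittaker H x n \<delta>" by (simp only:)
    then show "recursion_kernel n x \<gamma> \<delta> * level_whittaker H' x n \<delta> * mu n \<delta> = recursion_kernel n x \<gamma> \<delta> * level_whittaker H x n \<delta> * mu n \<delta>" by simp
  qed
  finally show ?case unfolding n_def by simp
qed

section \<open>The action of the dual Baxter operator\<close>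

text \<open>This is \<open>kern_integral\<close> with all constant factors restored.\<close>
lemma kernel_recursion_integral:
  assumes below: "\<And>k. k \<in> {1..l} \<Longrightarrow> Im (\<delta> k) = b" and c: "\<And>j. j \<in> {1..l+1} \<Longrightarrow> b < c j"
    and above: "\<And>j i. j \<in> {1..l+1} \<Longrightarrow> i \<in> {1..l+1} \<Longrightarrow> c j < Im (\<gamma> i)"
  shows "lines_integral (Suc l) c (\<lambda>\<beta>. dual_baxter_kernel l z \<gamma> \<beta> * mu (l+1) \<beta> * recursion_kernel l x \<beta> \<delta>) =
    of_real (exp (- exp (x (l+1) - z))) * recursion_kernel l x \<gamma> \<delta>"
proof -
  define p where "p = (b + Min (c ` {1..l+1})) / 2"
  have "b < Min (c ` {1..l+1})" using c by (subst Min_gr_iff) auto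
  then have p: "b < p" "p < Min (c ` {1..l+1})" by (auto simp: p_def field_simps)
  have "Max (c ` {1..l+1}) < Im (\<gamma> i)" if "i \<in> {1..l+1}" for i
    using above that by (subst Max_less_iff) auto
  from strip_below[where m = "l+1" and q = "Max (c ` {1..l+1})" and \<gamma> = \<gamma>, OF this]
  obtain q where q: "Max (c ` {1..l+1}) < q" "\<And>i. i \<in> {1..l+1} \<Longrightarrow> q < Im (\<gamma> i)" by metis
  interpret k: kernel_lines l \<gamma> \<delta> c p q
  proof
    show "Im (\<delta> k) < p" if "k \<in> {1..l}" for k using below[OF that] p by simp
    show "q < Im (\<gamma> i)" if "i \<in> {1..Suc l}" for i using q(2) that by simp
    fix j assume j: "j \<in> {1..Suc l}"
    have "Min (c ` {1..l+1}) \<le> c j" "c j \<le> Max (c ` {1..l+1})" using j by (intro Min_le Max_ge; simp)+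
    then show "p < c j \<and> c j < q" using p q by linarith
  qed
  define y where "y = z - x (l+1)"
  define G where "G = (\<Sum>i\<in>{1..Suc l}. \<gamma> i)"
  define D where "D = (\<Sum>k\<in>{1..l}. \<delta> k)"
  define GAMMAS where "GAMMAS = (\<Prod>i\<in>{1..Suc l}. \<Prod>j\<in>{1..l}. Gamma (\<i> * \<delta> j - \<i> * \<gamma> i))"
  define N where "N = (2 * complex_of_real pi) ^ Suc l * fact (Suc l)"
  have N: "N \<noteq> 0" unfolding N_def by (simp del: fact_Suc)
  define K where "K = exp (- \<i> * (G - D) * of_real (x (l+1))) / N"
  have "dual_baxter_kernel l z \<gamma> \<beta> * mu (l+1) \<beta> * recursion_kernel l x \<beta> \<delta> = K * kern l \<gamma> \<delta> y \<beta>" for \<beta>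
  proof -
    define B where "B = (\<Sum>j\<in>{1..Suc l}. \<beta> j)"
    define X where "X = (\<Prod>i\<in>{1..Suc l}. \<Prod>j\<in>{1..Suc l}. Gamma (\<i> * \<beta> j - \<i> * \<gamma> i))"
    define Y where "Y = (\<Prod>k\<in>{1..l}. \<Prod>m\<in>{1..Suc l}. Gamma (\<i> * \<delta> k - \<i> * \<beta> m))"
    have "exp (- \<i> * of_real z * (G - B)) * exp (- \<i> * (B - D) * of_real (x (l+1))) = exp (- \<i> * (G - D) * of_real (x (l+1))) * exp (of_real y * (\<i> * B - \<i> * G))"
      unfolding exp_add[symmetric] y_def by (simp add: algebra_simps)
    moreover have "weight l \<gamma> \<beta> = \<i> * B - \<i> * G" unfolding weight_def B_def G_def by (simp only: sum_distrib_left)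
    ultimately have E: "exp (- \<i> * of_real z * (G - B)) * exp (- \<i> * (B - D) * of_real (x (l+1))) = exp (- \<i> * (G - D) * of_real (x (l+1))) * exp (of_real y * weight l \<gamma> \<beta>)" by simp
    have "(\<Prod>j\<in>{1..Suc l}. gam (Suc l) l \<gamma> \<delta> (\<beta> j)) = X * Y"
      unfolding gam_def prod.distrib X_def Y_def by (subst prod.swap, subst (2) prod.swap) (rule refl)
    then have k: "kern l \<gamma> \<delta> y \<beta> = rGamma_prod (Suc l) \<beta> * (X * Y) * exp (of_real y * weight l \<gamma> \<beta>)" unfolding kern_def by (simp only:)
    have "dual_baxter_kernel l z \<gamma> \<beta> * mu (l+1) \<beta> * recursion_kernel l x \<beta> \<delta> =
      (exp (- \<i> * of_real z * (G - B)) * X) * (1 / N * rGamma_prod (Suc l) \<beta>) * (exp (- \<i> * (B - D) * of_real (x (l+1))) * Y)"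
      unfolding dual_baxter_kernel_def recursion_kernel_def mu_eq Suc_eq_plus1[symmetric] G_def B_def D_def X_def Y_def N_def ..
    also have "\<dots> = (exp (- \<i> * of_real z * (G - B)) * exp (- \<i> * (B - D) * of_real (x (l+1)))) * (1 / N * (rGamma_prod (Suc l) \<beta> * (X * Y)))"
      by (simp only: mult_ac)
    also have "\<dots> = K * kern l \<gamma> \<delta> y \<beta>"
      unfolding E k K_def by simp
    finally show ?thesis .
  qed
  then have "lines_integral (Suc l) c (\<lambda>\<beta>. dual_baxter_kernel l z \<gamma> \<beta> * mu (l+1) \<beta> * recursion_kernel l x \<beta> \<delta>) = K * lines_integral (Suc l) c (kern l \<gamma> \<delta> y)"
    unfolding lines_integral_def by simp
  also have "\<dots> = K * (N * GAMMAS * of_real (exp (- exp (- y))))"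
    unfolding k.kern_integral N_def GAMMAS_def ..
  also have "\<dots> = of_real (exp (- exp (x (l+1) - z))) * (exp (- \<i> * (G - D) * of_real (x (l+1))) * GAMMAS)"
    using N by (simp add: K_def y_def)
  also have "exp (- \<i> * (G - D) * of_real (x (l+1))) * GAMMAS = recursion_kernel l x \<gamma> \<delta>"
    unfolding recursion_kernel_def GAMMAS_def G_def D_def Suc_eq_plus1[symmetric] by (subst prod.swap) (rule refl)
  finally show ?thesis .
qed

theorem proposition3p2:
  fixes l :: nat and z :: real and x :: "nat \<Rightarrow> real" and \<gamma> :: "nat \<Rightarrow> complex"
    and h :: "nat \<Rightarrow> (nat \<Rightarrow> complex) \<Rightarrow> nat \<Rightarrow> real"
    and c :: "(nat \<Rightarrow> complex) \<Rightarrow> nat \<Rightarrow> real"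
  assumes "\<And>n. n \<ge> 1 \<Longrightarrow> admissible n (n+1) (h n)"
    and "admissible (l+1) (l+1) c"
  shows "dual_baxter c l z (\<lambda>\<beta>. whittaker h l \<beta> x) \<gamma> =
    of_real (exp (- exp (x (l+1) - z))) * whittaker h l \<gamma> x"
proof -
  let ?c = "c \<gamma>"
  have c: "?c j < Im (\<gamma> i)" if "j \<in> {1..l+1}" "i \<in> {1..l+1}" for i j
    using assms(2) that unfolding admissible_def by auto
  define p where "p = Min (?c ` {1..l+1})"
  define q where "q = Max (?c ` {1..l+1})"
  have pq: "p \<le> ?c j \<and> ?c j \<le> q" if "j \<in> {1..l+1}" for j
    unfolding p_def q_def using that by (intro conjI Min_le Max_ge) auto
  have q: "q < Im (\<gamma> i)" if "i \<in> {1..l+1}" for i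
    unfolding q_def using c that by (subst Max_less_iff) auto
  \<comment> \<open>increasing heights which on the levels \<open>m \<le> l\<close> lie below the lines of the dual Baxter operator\<close>
  define H where "H m = p - 1 + (real m - real l)" for m
  have H: "strict_mono H" by (simp add: strict_mono_def H_def)
  have Hp: "H l < p" by (simp add: H_def)
  have Hc: "H l < ?c j" if "j \<in> {1..l+1}" for j using Hp pq[OF that] by linarith
  have H\<gamma>: "H l < Im (\<gamma> i)" if "i \<in> {1..l+1}" for i using Hc[OF that] c[OF that that] by linarith
  define A where "A \<beta> = dual_baxter_kernel l z \<gamma> \<beta> * mu (l+1) \<beta>" for \<beta>
  have swapped: "(\<Prod>i\<in>{1..l+1}. \<Prod>j\<in>{1..l+1}. Gamma (\<i> * \<beta> j - \<i> * \<gamma> i)) = (\<Prod>j\<in>{1..l+1}. \<Prod>i\<in>{1..l+1}. Gamma (\<i> * \<beta> j - \<i> * \<gamma> i))" for \<beta> :: "nat \<Rightarrow> complex"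
    by (rule prod.swap)
  obtain C where C: "C > 0" "\<And>\<beta>. (\<And>j. j \<in> {1..l+1} \<Longrightarrow> p \<le> Im (\<beta> j) \<and> Im (\<beta> j) \<le> q) \<Longrightarrow>
     norm ((\<Prod>j\<in>{1..l+1}. \<Prod>i\<in>{1..l+1}. Gamma (\<i> * \<beta> j - \<i> * \<gamma> i)) * mu (l+1) \<beta>) \<le> C * exp (pi/4 * re_spread (l+1) \<beta> + - (pi/4) * re_size (l+1) \<beta>)"
    using cross_mu_bound[where m = "l+1" and n = "l+1" and q = q and \<gamma> = \<gamma> and p = p, OF q] by (metis order_refl)
  define B where "B = \<bar>p\<bar> + \<bar>q\<bar> + (\<Sum>i\<in>{1..l+1}. \<bar>Im (\<gamma> i)\<bar>)"
  have gB: "\<bar>Im (\<gamma> i)\<bar> \<le> B" if "i \<in> {1..l+1}" for i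
    using member_le_sum[OF that, of "\<lambda>i. \<bar>Im (\<gamma> i)\<bar>"] unfolding B_def by (intro add_increasing) auto
  have "(\<Sum>i\<in>{1..l+1}. \<bar>Im (\<gamma> i)\<bar>) \<ge> 0" by (intro sum_nonneg) auto
  then have PB: "\<bar>p\<bar> + \<bar>q\<bar> \<le> B" by (simp add: B_def)
  define K where "K = exp ((real (card {1..l+1}) + real (card {1..l+1})) * B * \<bar>z\<bar>)"
  have Abound: "norm (A (on_lines ?c t)) \<le> (K * C) * exp (pi/4 * re_spread (Suc l) (on_lines ?c t) + - (pi/4) * re_size (Suc l) (on_lines ?c t))" for t
  proof -
    let ?\<beta> = "on_lines ?c t"
    have b: "p \<le> Im (?\<beta> j) \<and> Im (?\<beta> j) \<le> q" if "j \<in> {1..l+1}" for j using pq[OF that] by (simp add: on_lines_def)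
    have bB: "\<bar>Im (?\<beta> j)\<bar> \<le> B" if "j \<in> {1..l+1}" for j using b[OF that] PB by linarith
    have 1: "norm (exp (- \<i> * ((\<Sum>i\<in>{1..l+1}. \<gamma> i) - (\<Sum>j\<in>{1..l+1}. ?\<beta> j)) * of_real z)) \<le> K"
      unfolding K_def by (rule norm_exp_im_bound) (use gB bB in auto)
    have "A ?\<beta> = exp (- \<i> * ((\<Sum>i\<in>{1..l+1}. \<gamma> i) - (\<Sum>j\<in>{1..l+1}. ?\<beta> j)) * of_real z) *
       ((\<Prod>j\<in>{1..l+1}. \<Prod>i\<in>{1..l+1}. Gamma (\<i> * ?\<beta> j - \<i> * \<gamma> i)) * mu (l+1) ?\<beta>)"
      unfolding A_def dual_baxter_kernel_def swapped by (simp only: mult_ac)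
    then show ?thesis
      using mult_mono[OF 1 C(2)[OF b]] by (simp add: norm_mult K_def mult.assoc)
  qed
  have Ameas: "(\<lambda>t. A (on_lines ?c t)) \<in> borel_measurable (\<Pi>\<^sub>M j\<in>{1..Suc l}. lborel)"
    unfolding A_def dual_baxter_kernel_def Suc_eq_plus1
    by (intro borel_measurable_times borel_measurable_exp_complex borel_measurable_diff borel_measurable_sum borel_measurable_prod
      borel_measurable_Gamma borel_measurable_const mu_measurable measurable_on_lines)
  have "dual_baxter c l z (\<lambda>\<beta>. whittaker h l \<beta> x) \<gamma> = lines_integral (Suc l) ?c (\<lambda>\<beta>. A \<beta> * level_whittaker H x (Suc l) \<beta>)"
    unfolding dual_baxter_def Suc_eq_plus1[symmetric]
  proof (rule lines_integral_cong)
    fix \<beta> assume b: "\<And>j. j \<in> {1..Suc l} \<Longrightarrow> Im (\<beta> j) = ?c j"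
    have "whittaker h l \<beta> x = level_whittaker H x (Suc l) \<beta>"
      by (rule whittaker_eq_level_whittaker[OF assms(1) H]) (use b Hc in auto)
    then show "dual_baxter_kernel l z \<gamma> \<beta> * whittaker h l \<beta> x * mu (Suc l) \<beta> = A \<beta> * level_whittaker H x (Suc l) \<beta>"
      unfolding A_def Suc_eq_plus1[symmetric] by (simp only: mult_ac)
  qed
  also have "\<dots> = lines_integral l (\<lambda>_. H l) (\<lambda>\<delta>. level_whittaker H x l \<delta> * mu l \<delta> * lines_integral (Suc l) ?c (\<lambda>\<beta>. A \<beta> * recursion_kernel l x \<beta> \<delta>))"
    by (rule level_whittaker_swap[OF H _ Hp _ Ameas Abound, where q = q]) (use pq in auto)
  also have "\<dots> = lines_integral l (\<lambda>_. H l) (\<lambda>\<delta>. of_real (exp (- exp (x (l+1) - z))) * (recursion_kernel l x \<gamma> \<delta> * level_whittaker H x l \<delta> * mu l \<delta>))"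
  proof (rule lines_integral_cong)
    fix \<delta> assume "\<And>k. k \<in> {1..l} \<Longrightarrow> Im (\<delta> k) = H l"
    then have "lines_integral (Suc l) ?c (\<lambda>\<beta>. A \<beta> * recursion_kernel l x \<beta> \<delta>) = of_real (exp (- exp (x (l+1) - z))) * recursion_kernel l x \<gamma> \<delta>"
      unfolding A_def using Hc c by (intro kernel_recursion_integral) auto
    then show "level_whittaker H x l \<delta> * mu l \<delta> * lines_integral (Suc l) ?c (\<lambda>\<beta>. A \<beta> * recursion_kernel l x \<beta> \<delta>) =
       of_real (exp (- exp (x (l+1) - z))) * (recursion_kernel l x \<gamma> \<delta> * level_whittaker H x l \<delta> * mu l \<delta>)"
      by (simp only: mult_ac)
  qed
  also have "\<dots> = of_real (exp (- exp (x (l+1) - z))) * level_whittaker H x (Suc l) \<gamma>"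
    unfolding level_whittaker.simps lines_integral_def by (rule integral_mult_right_zero)
  also have "level_whittaker H x (Suc l) \<gamma> = whittaker h l \<gamma> x"
    by (rule whittaker_eq_level_whittaker[OF assms(1) H H\<gamma>, symmetric])
  finally show ?thesis .
qed

end
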